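(* Let $n\ge2$, $p\in(1,\infty)$, $s\in(0,1)$, $\Lambda\ge1$ and $q_*:=\max\{1,p-1\}$. There exist constants $\alpha\in(0,sp/q_* )$ and $c\ge 1$, both depending only on $n,s,p,\Lambda$, such that the following holds. Let $\Phi,K$ satisfy the structure assumptions listed in the context, let $\Omega\subset\mathbb{R}^n$ be open, and let $v\in W^{s,p}(\mathbb{R}^n)$ be a weak solution of $$-\mathcal L_\Phi v=0\ \text{ in }\Omega,\qquad v=g\ \text{ on }\mathbb{R}^n\setminus\Omega,$$ for some $g\in W^{s,p}(\mathbb{R}^n)$. Let $B_R(x_0)\subset\Omega$. Then, whenever $0<\varrho\le r\le R$, $$E(v;x_0,\varrho)\le c\Big(\frac{\varrho}{r}\Big)^{\alpha}\Big(\frac rR\Big)^{sp/q_*}E(v;x_0,R)+c\Big(\frac\varrho r\Big)^\alpha\int_r^R\Big(\frac rt\Big)^{sp/q_*}E(v;x_0,t)\,\frac{dt}{t}.$$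
   Context: **Structure assumptions.** $\Phi:\mathbb{R}\to\mathbb{R}$ is continuous, $\Phi(0)=0$, and $\Lambda^{-1}|t|^p\le\Phi(t)t\le\Lambda|t|^p$ for all $t\in\mathbb{R}$. $K:\mathbb{R}^n\times\mathbb{R}^n\to\mathbb{R}$ is measurable and $\Lambda^{-1}|x-y|^{-n-sp}\le K(x,y)\le\Lambda|x-y|^{-n-sp}$ for all $x\ne y$. **Weak solution.** $W^{s,p}(\mathbb{R}^n)$ is the space of $v\in L^p(\mathbb{R}^n)$ with $\int_{\mathbb{R}^n}\int_{\mathbb{R}^n}\frac{|v(x)-v(y)|^p}{|x-y|^{n+sp}}dxdy<\infty$. $v\in W^{s,p}(\mathbb{R}^n)$ is a weak solution of the problem $-\mathcal L_\Phi v=0$ in $\Omega$, $v=g$ on $\mathbb{R}^n\setminus\Omega$, if $v=g$ a.e. in $\mathbb{R}^n\setminus\Omega$ and $$\int_{\mathbb{R}^n}\int_{\mathbb{R}^n}\Phi(v(x)-v(y))(\varphi(x)-\varphi(y))K(x,y)\,dx\,dy=0\quad\text{for all }\varphi\in C_0^\infty(\Omega).$$ **Tail and global excess.** With $(f)_B=\frac1{|B|}\int_Bf\,dx$, $$\mathrm{Tail}(f;x_0,r)=\Big[r^{sp}\int_{\mathbb{R}^n\setminus B_r(x_0)}\frac{|f(x)|^{p-1}}{|x-x_0|^{n+sp}}dx\Big]^{1/(p-1)},$$ $$E(f;x_0,r)=\Big(\frac1{|B_r(x_0)|}\int_{B_r(x_0)}|f-(f)_{B_r(x_0)}|^{q_*}dx\Big)^{1/q_*}+\mathrm{Tail}(f-(f)_{B_r(x_0)};x_0,r).$$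 *)

theory Defs
  imports "HOL-Analysis.Analysis"
begin

text \<open>
  Conventions. The space R^n is \<open>real ^ 'n\<close>. Measurability and integrals are with respect to
  Lebesgue measure. A double integral over R^n x R^n is taken with respect to
  Lebesgue measure on the product space. For functions in the fractional Sobolev space, all
  integrands below are absolutely integrable, so by Fubini this is the iterated integral, and
  the Bochner integral never takes its default value.
\<close>

definition structure_nonlinearity :: "real \<Rightarrow> real \<Rightarrow> (real \<Rightarrow> real) \<Rightarrow> bool" where
  "structure_nonlinearity p \<Lambda> \<Phi> \<longleftrightarrow>
     continuous_on UNIV \<Phi> \<and> \<Phi> 0 = 0 \<and>
     (\<forall>t. inverse \<Lambda> * \<bar>t\<bar> powr p \<le> \<Phi> t * t \<and> \<Phi> t * t \<le> \<Lambda> * \<bar>t\<bar> powr p)"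

definition structure_kernel ::
    "real \<Rightarrow> real \<Rightarrow> real \<Rightarrow> (real ^ 'n \<Rightarrow> real ^ 'n \<Rightarrow> real) \<Rightarrow> bool" where
  "structure_kernel s p \<Lambda> K \<longleftrightarrow>
     (\<lambda>(x, y). K x y) \<in> borel_measurable lebesgue \<and>
     (\<forall>x y. x \<noteq> y \<longrightarrow>
        inverse \<Lambda> * norm (x - y) powr (- real CARD('n) - s * p) \<le> K x y \<and>
        K x y \<le> \<Lambda> * norm (x - y) powr (- real CARD('n) - s * p))"

text \<open>The diagonal, where the quotient below evaluates to 0, is a null set.\<close>

definition frac_sobolev :: "real \<Rightarrow> real \<Rightarrow> (real ^ 'n \<Rightarrow> real) set" where
  "frac_sobolev s p = {v.
     v \<in> borel_measurable lebesgue \<and>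
     integrable lebesgue (\<lambda>x. \<bar>v x\<bar> powr p) \<and>
     integrable lebesgue
       (\<lambda>(x, y). \<bar>v x - v y\<bar> powr p / norm (x - y) powr (real CARD('n) + s * p))}"

definition partial_deriv :: "'n \<Rightarrow> (real ^ 'n \<Rightarrow> real) \<Rightarrow> real ^ 'n \<Rightarrow> real" where
  "partial_deriv i f x = frechet_derivative f (at x) (axis i 1)"

text \<open>\<open>C_k k f\<close>: \<open>f\<close> is k times continuously differentiable on the whole space.\<close>

primrec C_k :: "nat \<Rightarrow> (real ^ 'n \<Rightarrow> real) \<Rightarrow> bool" where
  "C_k 0 f \<longleftrightarrow> continuous_on UNIV f"
| "C_k (Suc k) f \<longleftrightarrow> (\<forall>x. f differentiable at x) \<and> (\<forall>i. C_k k (partial_deriv i f))"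

text \<open>Test functions on \<open>\<Omega>\<close> are extended by zero to the whole space.\<close>

definition test_functions :: "(real ^ 'n) set \<Rightarrow> (real ^ 'n \<Rightarrow> real) set" where
  "test_functions \<Omega> = {\<phi>.
     (\<forall>k. C_k k \<phi>) \<and> compact (closure {x. \<phi> x \<noteq> 0}) \<and> closure {x. \<phi> x \<noteq> 0} \<subseteq> \<Omega>}"

definition weak_solution ::
    "real \<Rightarrow> real \<Rightarrow> (real \<Rightarrow> real) \<Rightarrow> (real ^ 'n \<Rightarrow> real ^ 'n \<Rightarrow> real) \<Rightarrow> (real ^ 'n) set \<Rightarrow>
     (real ^ 'n \<Rightarrow> real) \<Rightarrow> (real ^ 'n \<Rightarrow> real) \<Rightarrow> bool" where
  "weak_solution s p \<Phi> K \<Omega> g v \<longleftrightarrow>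
     v \<in> frac_sobolev s p \<and>
     (AE x in lebesgue. x \<notin> \<Omega> \<longrightarrow> v x = g x) \<and>
     (\<forall>\<phi> \<in> test_functions \<Omega>.
        (LINT (x, y)|lebesgue. \<Phi> (v x - v y) * (\<phi> x - \<phi> y) * K x y) = 0)"

definition average :: "(real ^ 'n \<Rightarrow> real) \<Rightarrow> (real ^ 'n) set \<Rightarrow> real" where
  "average f B = (LINT x:B|lebesgue. f x) / measure lebesgue B"

definition q_star :: "real \<Rightarrow> real" where
  "q_star p = max 1 (p - 1)"

definition Tail :: "real \<Rightarrow> real \<Rightarrow> (real ^ 'n \<Rightarrow> real) \<Rightarrow> real ^ 'n \<Rightarrow> real \<Rightarrow> real" where
  "Tail s p f x0 r =
     (r powr (s * p) *
      (LINT x:- ball x0 r|lebesgue.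
         \<bar>f x\<bar> powr (p - 1) / norm (x - x0) powr (real CARD('n) + s * p)))
     powr (1 / (p - 1))"

definition excess :: "real \<Rightarrow> real \<Rightarrow> (real ^ 'n \<Rightarrow> real) \<Rightarrow> real ^ 'n \<Rightarrow> real \<Rightarrow> real" where
  "excess s p f x0 r =
     (let m = average f (ball x0 r) in
       average (\<lambda>x. \<bar>f x - m\<bar> powr q_star p) (ball x0 r) powr (1 / q_star p) +
       Tail s p (\<lambda>x. f x - m) x0 r)"

end

theory Submission
  imports Defs "HOL-Computational_Algebra.Polynomial"
begin

text \<open>
  The proof is De Giorgi's method. Testing with (v - k)_+ \<eta>^p and keeping only the pairs of
  points that lie on different sides of the level k gives a Caccioppoli inequality whose left side
  is the integral of (v(x) - v(y))^(p-1) (v(x) - k) |x-y|^(-n-sp) over v(x) > k \<ge> v(y). Nonlocality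
  makes this term do the work of two standard tools: integrating in y over the complement of
  a small superlevel set replaces the Sobolev inequality, and integrating over a set of positive density
  where v is much smaller than k replaces the logarithmic or isoperimetric lemma. The
  first gives local boundedness by iteration; together they reduce the oscillation by a fixed factor
  from a ball to a smaller concentric one while controlling the tail. This yields
  E(\<rho>) \<le> c (\<rho>/r)^\<alpha> E(r). Finally E(r) \<le> c E(t) for r \<le> t \<le> 2r, so E(r) is
  bounded by the integral over [r, R] when 2r \<le> R and by E(R) otherwise.
\<close>

section \<open>Smooth mollifiers\<close>

text \<open>Only the size and the sign of \<Phi> are prescribed, so two solutions cannot be compared
  with each other, and every estimate has to come from the energy of truncations of a single
  solution. The estimates used on that energy depend only on volumes of balls and on the size of the
  kernel, which is why all s and p are handled together. Three obstacles shape the argument. Test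
  functions are smooth, truncations of v are not, so the weak form must first be extended to
  functions of finite seminorm. The excess measures v in L^q with q = max 1 (p - 1) < p, whereas the
  Caccioppoli inequality speaks of p-th moments; an interpolation against a sup bound closes this
  gap. Finally, values of v far away are not improved by any local estimate: what makes the tail
  small is only the passage to a smaller ball, which multiplies its scaled size by a power
  \<sigma>^\<beta> of the ratio. Hence \<sigma> has to be fixed before the gain \<theta> in the
  oscillation, and the decay exponent is the one for which \<sigma>^\<alpha> = 1 - \<theta>. All
  constants are obtained before the solution is fixed, so that they depend on n, s, p and \<Lambda>
  alone.\<close>

lemma C_k_Suc_imp_C_k: "C_k (Suc k) f \<Longrightarrow> C_k k f"
proof (induction k arbitrary: f)
  case 0
  then show ?case
    by (auto intro!: continuous_at_imp_continuous_on differentiable_imp_continuous_within)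
next
  case (Suc k)
  then show ?case by (metis C_k.simps(2))
qed

lemma partial_deriv_eq:
  "(f has_derivative f') (at x) \<Longrightarrow> partial_deriv i f x = f' (axis i 1)"
  unfolding partial_deriv_def by (metis frechet_derivative_at)

lemma differentiable_has_derivative:
  "f differentiable at x \<Longrightarrow> (f has_derivative frechet_derivative f (at x)) (at x)"
  using frechet_derivative_works by blast

lemma C_k_const: "C_k k (\<lambda>x::real^'n. c)"
proof (induction k arbitrary: c)
  case (Suc k)
  have "partial_deriv i (\<lambda>x::real^'n. c) = (\<lambda>x. 0)" for i
    by (rule ext, subst partial_deriv_eq[OF has_derivative_const]) simp
  then show ?case using Suc by simp
qed simp

lemma C_k_add: "C_k k f \<Longrightarrow> C_k k g \<Longrightarrow> C_k k (\<lambda>x::real^'n. f x + g x)"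
proof (induction k arbitrary: f g)
  case 0 then show ?case by (auto intro: continuous_intros)
next
  case (Suc k)
  have df: "f differentiable at x" "g differentiable at x" for x using Suc.prems by auto
  have "partial_deriv i (\<lambda>x. f x + g x) = (\<lambda>x. partial_deriv i f x + partial_deriv i g x)" for i
    by (rule ext, subst partial_deriv_eq[OF has_derivative_add[OF
          df[THEN differentiable_has_derivative]]]) (simp add: partial_deriv_def)
  then show ?case using Suc df by auto
qed

lemma C_k_mult: "C_k k f \<Longrightarrow> C_k k g \<Longrightarrow> C_k k (\<lambda>x::real^'n. f x * g x)"
proof (induction k arbitrary: f g)
  case 0 then show ?case by (auto intro: continuous_intros)
next
  case (Suc k)
  have df: "f differentiable at x" "g differentiable at x" for x using Suc.prems by auto
  have "partial_deriv i (\<lambda>x. f x * g x) =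
      (\<lambda>x. f x * partial_deriv i g x + partial_deriv i f x * g x)" for i
    by (rule ext, subst partial_deriv_eq[OF has_derivative_mult[OF
          df[THEN differentiable_has_derivative]]]) (simp add: partial_deriv_def)
  then show ?case
    using Suc.IH Suc.prems C_k_Suc_imp_C_k[OF Suc.prems(1)] C_k_Suc_imp_C_k[OF Suc.prems(2)] df
    by (auto intro!: C_k_add)
qed

lemma C_k_prod:
  "finite I \<Longrightarrow> (\<And>i. i \<in> I \<Longrightarrow> C_k k (f i)) \<Longrightarrow> C_k k (\<lambda>x::real^'n. \<Prod>i\<in>I. f i x)"
  by (induction I rule: finite_induct) (auto intro: C_k_mult C_k_const)

text \<open>The standard flat function is the case P = 1. Carrying a polynomial in 1/t along makes
  the family closed under differentiation, so smoothness follows by one induction over the order,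
  for all P at once.\<close>

definition exp_cutoff :: "real poly \<Rightarrow> real \<Rightarrow> real" where
  "exp_cutoff P t = (if t > 0 then poly P (inverse t) * exp (- inverse t) else 0)"

lemma poly_div_exp_tendsto_0: "((\<lambda>u::real. poly P u * exp (- u)) \<longlongrightarrow> 0) at_top"
proof -
  have "((\<lambda>u. \<Sum>i\<le>degree P. coeff P i * (u ^ i / exp u)) \<longlongrightarrow> 0) at_top"
    by (intro tendsto_null_sum tendsto_mult_right_zero tendsto_power_div_exp_0)
  then show ?thesis
    by (simp add: poly_altdef sum_distrib_right exp_minus divide_inverse mult.assoc)
qed

text \<open>With u = 1/t the chain rule gives d/dt = - u^2 d/du, and the derivative of P(u) e^(-u)
  in u is (P' - P)(u) e^(-u); \<open>[:0, 0, 1:]\<close> is the factor u^2.\<close>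

lemma exp_cutoff_has_derivative:
  "(exp_cutoff P has_real_derivative exp_cutoff ([:0, 0, 1:] * (P - pderiv P)) t) (at t)"
proof -
  consider "t > 0" | "t < 0" | "t = 0" by linarith
  then show ?thesis
  proof cases
    case 1
    have "((\<lambda>t. poly P (inverse t) * exp (- inverse t)) has_real_derivative
        exp_cutoff ([:0, 0, 1:] * (P - pderiv P)) t) (at t)"
      using 1
      by (auto intro!: derivative_eq_intros DERIV_chain2[OF poly_DERIV]
          simp: exp_cutoff_def power2_eq_square algebra_simps)
    then show ?thesis
      by (rule has_field_derivative_transform_within_open[OF _ open_greaterThan[of 0]])
         (use 1 in \<open>auto simp: exp_cutoff_def\<close>)
  next
    case 2
    have "((\<lambda>t. 0) has_real_derivative exp_cutoff ([:0, 0, 1:] * (P - pderiv P)) t) (at t)"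
      using 2 by (simp add: exp_cutoff_def)
    then show ?thesis
      by (rule has_field_derivative_transform_within_open[OF _ open_lessThan[of 0]])
         (use 2 in \<open>auto simp: exp_cutoff_def\<close>)
  next
    case 3
    \<comment> \<open>From the right the difference quotient at 0 is u P(u) e^(-u) with u = 1/h, and
      \<open>pCons 0 P\<close> is the polynomial u P(u).\<close>
    have "((\<lambda>h. poly (pCons 0 P) (inverse h) * exp (- inverse h)) \<longlongrightarrow> 0) (at_right 0)"
      by (rule filterlim_compose[OF poly_div_exp_tendsto_0 filterlim_inverse_at_top_right])
    then have r: "((\<lambda>h. (exp_cutoff P (0 + h) - exp_cutoff P 0) / h) \<longlongrightarrow> 0) (at_right 0)"
      by (rule Lim_transform_eventually)
         (auto simp: eventually_at_right_less exp_cutoff_def divide_inverse mult_ac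
            intro!: eventually_mono[OF eventually_at_right_less])
    have l: "((\<lambda>h. (exp_cutoff P (0 + h) - exp_cutoff P 0) / h) \<longlongrightarrow> 0) (at_left 0)"
      by (rule Lim_transform_eventually[OF tendsto_const])
         (auto simp: exp_cutoff_def eventually_at_filter)
    have z: "exp_cutoff Q 0 = 0" for Q by (simp add: exp_cutoff_def)
    show ?thesis
      using r l 3 unfolding DERIV_def by (simp add: filterlim_at_split z)
  qed
qed

text \<open>The factor \<open>\<tau>\<close> is there for the induction: a derivative in direction i
  brings out \<sigma>, in any other direction 0, and either is absorbed in \<tau>.\<close>

lemma C_k_exp_cutoff: "C_k k (\<lambda>x::real^'n. \<tau> * exp_cutoff P (c + \<sigma> * x $ i))"
proof (induction k arbitrary: P \<tau>)
  case 0
  have "continuous_on UNIV (exp_cutoff P)"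
    using exp_cutoff_has_derivative by (meson DERIV_isCont continuous_at_imp_continuous_on)
  then show ?case
    by (auto intro!: continuous_intros continuous_on_compose2[of UNIV "exp_cutoff P"])
next
  case (Suc k)
  let ?Q = "[:0, 0, 1:] * (P - pderiv P)"
  have d: "((\<lambda>x::real^'n. \<tau> * exp_cutoff P (c + \<sigma> * x $ i)) has_derivative
      (\<lambda>h. \<tau> * (exp_cutoff ?Q (c + \<sigma> * x $ i) * (\<sigma> * h $ i)))) (at x)" for x
  proof -
    have "((\<lambda>x::real^'n. c + \<sigma> * x $ i) has_derivative (\<lambda>h. \<sigma> * h $ i)) (at x)"
      by (auto intro!: derivative_eq_intros bounded_linear_imp_has_derivative bounded_linear_vec_nth)
    moreover have "(exp_cutoff P has_derivative (*) (exp_cutoff ?Q (c + \<sigma> * x $ i)))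
        (at (c + \<sigma> * x $ i))"
      using exp_cutoff_has_derivative by (simp add: has_field_derivative_def)
    ultimately have "((\<lambda>x::real^'n. exp_cutoff P (c + \<sigma> * x $ i)) has_derivative
        (\<lambda>h. exp_cutoff ?Q (c + \<sigma> * x $ i) * (\<sigma> * h $ i))) (at x)"
      by (rule has_derivative_compose)
    then show ?thesis by (rule has_derivative_mult_right)
  qed
  have "partial_deriv j (\<lambda>x::real^'n. \<tau> * exp_cutoff P (c + \<sigma> * x $ i)) =
      (\<lambda>x. (if j = i then \<tau> * \<sigma> else 0) * exp_cutoff ?Q (c + \<sigma> * x $ i))" for j
    by (rule ext, subst partial_deriv_eq[OF d]) (simp add: axis_def)
  moreover have "(\<lambda>x::real^'n. \<tau> * exp_cutoff P (c + \<sigma> * x $ i)) differentiable at x" for x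
    using d unfolding differentiable_def by blast
  ultimately show ?case using Suc unfolding C_k.simps by auto
qed

text \<open>A product of one-dimensional bumps avoids differentiating a norm. It lives on the cube
  |x_i| < \<epsilon>, hence inside the ball of radius n \<epsilon>. It is left unnormalised; the
  later argument divides by its positive integral.\<close>

definition mollifier :: "real \<Rightarrow> real ^ 'n \<Rightarrow> real" where
  "mollifier \<epsilon> x = (\<Prod>i\<in>UNIV. exp_cutoff 1 (\<epsilon> + x $ i) * exp_cutoff 1 (\<epsilon> - x $ i))"

lemma C_k_mollifier: "C_k k (mollifier \<epsilon> :: real^'n \<Rightarrow> real)"
proof -
  have "C_k k (\<lambda>x::real^'n. \<Prod>i\<in>UNIV. exp_cutoff 1 (\<epsilon> + x $ i) * exp_cutoff 1 (\<epsilon> - x $ i))"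
    using C_k_exp_cutoff[where \<tau> = 1 and P = 1 and c = \<epsilon> and \<sigma> = 1]
      C_k_exp_cutoff[where \<tau> = 1 and P = 1 and c = \<epsilon> and \<sigma> = "-1"]
    by (intro C_k_prod C_k_mult) auto
  then show ?thesis by (simp add: mollifier_def[abs_def])
qed

lemma mollifier_nonneg: "mollifier \<epsilon> x \<ge> 0"
  unfolding mollifier_def by (intro prod_nonneg) (auto simp: exp_cutoff_def)

lemma mollifier_pos: "\<epsilon> > 0 \<Longrightarrow> norm x < \<epsilon> \<Longrightarrow> mollifier \<epsilon> x > 0"
proof -
  assume "\<epsilon> > 0" "norm x < \<epsilon>"
  then have "\<bar>x $ i\<bar> < \<epsilon>" for i using component_le_norm_cart[of x i] by linarith
  then have "\<epsilon> + x $ i > 0 \<and> \<epsilon> - x $ i > 0" for i by (smt (verit))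
  then show ?thesis unfolding mollifier_def by (intro prod_pos) (auto simp: exp_cutoff_def)
qed

lemma mollifier_eq_0:
  fixes x :: "real^'n"
  assumes "norm x > real CARD('n) * \<epsilon>"
  shows "mollifier \<epsilon> x = 0"
proof -
  have "\<exists>i. \<bar>x $ i\<bar> > \<epsilon>"
  proof (rule ccontr)
    assume "\<not> ?thesis"
    then have "(\<Sum>i\<in>UNIV. \<bar>x $ i\<bar>) \<le> (\<Sum>i\<in>(UNIV::'n set). \<epsilon>)" by (intro sum_mono) (auto simp: not_less)
    then show False using assms norm_le_l1_cart[of x] by simp
  qed
  then obtain i where "\<epsilon> + x $ i < 0 \<or> \<epsilon> - x $ i < 0" by (smt (verit))
  then have "exp_cutoff 1 (\<epsilon> + x $ i) * exp_cutoff 1 (\<epsilon> - x $ i) = 0"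
    by (auto simp: exp_cutoff_def)
  then show ?thesis unfolding mollifier_def by (intro prod_zero) auto
qed

section \<open>Convolution with a smooth function of bounded support\<close>

lemma uniformly_continuous_bounded_support:
  fixes g :: "'a::euclidean_space \<Rightarrow> real"
  assumes c: "continuous_on UNIV g" and z: "\<And>x. norm x > R \<Longrightarrow> g x = 0" and "e > 0"
  obtains d where "d > 0" "\<And>x y. norm (x - y) < d \<Longrightarrow> \<bar>g x - g y\<bar> < e"
proof -
  have "uniformly_continuous_on (cball 0 (R + 1)) g"
    by (intro compact_uniformly_continuous continuous_on_subset[OF c]) auto
  then obtain d where d: "d > 0"
    "\<And>x y. x \<in> cball 0 (R + 1) \<Longrightarrow> y \<in> cball 0 (R + 1) \<Longrightarrow> dist y x < d \<Longrightarrow> dist (g y) (g x) < e"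
    using \<open>e > 0\<close> unfolding uniformly_continuous_on_def by metis
  show ?thesis
  proof (rule that[of "min d 1"])
    fix x y :: 'a assume *: "norm (x - y) < min d 1"
    show "\<bar>g x - g y\<bar> < e"
    proof (cases "norm x \<le> R + 1 \<and> norm y \<le> R + 1")
      case True
      then show ?thesis using d(2)[of y x] * by (auto simp: dist_norm)
    next
      case False
      then have "norm x > R" "norm y > R"
        using * norm_triangle_ineq2[of x y] norm_triangle_ineq3[of x y] by auto
      then show ?thesis using z \<open>e > 0\<close> by auto
    qed
  qed (use d in auto)
qed

lemma bounded_support_bounded:
  fixes g :: "'a::euclidean_space \<Rightarrow> real"
  assumes c: "continuous_on UNIV g" and z: "\<And>x. norm x > R \<Longrightarrow> g x = 0"
  obtains B where "\<And>x. \<bar>g x\<bar> \<le> B"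
proof -
  have "bounded (g ` cball 0 R)"
    by (intro compact_imp_bounded compact_continuous_image continuous_on_subset[OF c]) auto
  then obtain B where B: "B > 0" "\<And>x. x \<in> cball 0 R \<Longrightarrow> \<bar>g x\<bar> \<le> B"
    by (auto simp: bounded_pos)
  show ?thesis using B z by (intro that[of B]) (metis abs_zero less_imp_le mem_cball_0 not_le)
qed

lemma integrable_conv:
  fixes f g :: "'a::euclidean_space \<Rightarrow> real"
  assumes f: "integrable lborel f" and c: "continuous_on UNIV g"
    and z: "\<And>x. norm x > R \<Longrightarrow> g x = 0"
  shows "integrable lborel (\<lambda>y. f y * g (x - y))"
proof -
  obtain B where B: "\<And>x. \<bar>g x\<bar> \<le> B" using bounded_support_bounded[OF c z] by blast
  have [measurable]: "g \<in> borel_measurable borel" using c by (rule borel_measurable_continuous_onI)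
  have [measurable]: "f \<in> borel_measurable borel" using f by auto
  show ?thesis
    by (rule Bochner_Integration.integrable_bound[of _ "\<lambda>y. B * f y"])
       (use f B in \<open>auto simp: abs_mult mult.commute[of B] intro!: mult_left_mono AE_I2
          order_trans[OF B abs_ge_self]\<close>)
qed

text \<open>Differentiation under the integral. The partial derivatives of g are continuous with
  bounded support, hence uniformly continuous, so the linearisation error of g is o(|h|) uniformly
  in the base point; integrating it against f costs only the L^1 norm of f.\<close>

lemma has_derivative_conv:
  fixes f g :: "real^'n \<Rightarrow> real"
  assumes f: "integrable lborel f" and g: "C_k (Suc 0) g"
    and z: "\<And>x. norm x > R \<Longrightarrow> g x = 0"
    and z': "\<And>i x. norm x > R \<Longrightarrow> partial_deriv i g x = 0"
  shows "((\<lambda>x. \<integral>y. f y * g (x - y) \<partial>lborel) has_derivative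
      (\<lambda>h. \<Sum>i\<in>UNIV. h $ i * (\<integral>y. f y * partial_deriv i g (x - y) \<partial>lborel))) (at x)"
proof -
  have cont: "continuous_on UNIV (partial_deriv i g)" for i using g by simp
  have contg: "continuous_on UNIV g" using C_k_Suc_imp_C_k[OF g] by simp
  define D where "D z h = (\<Sum>i\<in>UNIV. h $ i * partial_deriv i g z)" for z h :: "real^'n"
  have D: "(g has_derivative D z) (at z)" for z
  proof -
    have 1: "(g has_derivative frechet_derivative g (at z)) (at z)"
      using g by (intro differentiable_has_derivative) simp
    have lin: "linear (frechet_derivative g (at z))" using has_derivative_linear[OF 1] .
    have "frechet_derivative g (at z) h = D z h" for h
    proof -
      have "frechet_derivative g (at z) (\<Sum>i\<in>UNIV. (h $ i) *s axis i 1) = D z h"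
        by (simp add: linear_sum[OF lin] scalar_mult_eq_scaleR linear_scale[OF lin] D_def
            partial_deriv_def)
      then show ?thesis by (simp only: basis_expansion)
    qed
    then have "frechet_derivative g (at z) = D z" by auto
    with 1 show ?thesis by simp
  qed
  have ig: "integrable lborel (\<lambda>y. f y * g (x - y))" for x
    by (rule integrable_conv[OF f contg z])
  have ip: "integrable lborel (\<lambda>y. f y * partial_deriv i g (x - y))" for i x
    by (rule integrable_conv[OF f cont z'])
  let ?F = "\<integral>y. \<bar>f y\<bar> \<partial>lborel"
  have est: "\<exists>d>0. \<forall>y. norm (y - x) < d \<longrightarrow>
      norm ((\<integral>w. f w * g (y - w) \<partial>lborel) - (\<integral>w. f w * g (x - w) \<partial>lborel) -
        (\<Sum>i\<in>UNIV. (y - x) $ i * (\<integral>w. f w * partial_deriv i g (x - w) \<partial>lborel))) \<le> e * norm (y - x)"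
    if "e > 0" for e
  proof -
    \<comment> \<open>Each of the n partial derivatives contributes an error e', and the L^1 norm of
      f multiplies the sum; the added 1 covers f = 0.\<close>
    define e' where "e' = e / (real CARD('n) * (?F + 1))"
    have F: "?F \<ge> 0" by simp
    then have "?F + 1 > 0" by linarith
    then have e': "e' > 0" using \<open>e > 0\<close> unfolding e'_def by (intro divide_pos_pos mult_pos_pos) auto
    have "\<exists>d. d > 0 \<and> (\<forall>x y. norm (x - y) < d \<longrightarrow> \<bar>partial_deriv i g x - partial_deriv i g y\<bar> < e')" for i
      using uniformly_continuous_bounded_support[OF cont z' e'] by metis
    then obtain dd where dd: "\<And>i. dd i > 0"
      "\<And>i x y. norm (x - y) < dd i \<Longrightarrow> \<bar>partial_deriv i g x - partial_deriv i g y\<bar> < e'"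
      by metis
    define d where "d = Min (range dd)"
    have d: "d > 0" "\<And>i. d \<le> dd i" using dd(1) by (auto simp: d_def)
    have lin: "\<bar>g (z + h) - g z - D z h\<bar> \<le> norm h * (real CARD('n) * e')" if h: "norm h < d" for z h
    proof -
      \<comment> \<open>Mean value inequality on the ball around z, where the derivative differs
        from \<open>D z\<close> by at most n e' in operator norm.\<close>
      have "norm (g (z + h) - g z - D z ((z + h) - z)) \<le> norm ((z + h) - z) * (real CARD('n) * e')"
      proof (rule differentiable_bound_linearization[where S = "ball z d" and f' = D])
        fix t :: real assume "t \<in> {0..1}"
        then have "\<bar>t\<bar> * norm h \<le> norm h" by (intro mult_left_le_one_le) auto
        then show "z + t *\<^sub>R (z + h - z) \<in> ball z d" using h by (simp add: dist_norm)
      next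
        fix x assume x: "x \<in> ball z d"
        show "onorm (D x - D z) \<le> real CARD('n) * e'"
        proof (rule onorm_le)
          fix h :: "real^'n"
          have "\<bar>(D x - D z) h\<bar> = \<bar>\<Sum>i\<in>UNIV. h $ i * (partial_deriv i g x - partial_deriv i g z)\<bar>"
            by (simp add: D_def sum_subtractf algebra_simps)
          also have "\<dots> \<le> (\<Sum>i\<in>(UNIV::'n set). norm h * e')"
          proof (rule order_trans[OF sum_abs], rule sum_mono)
            fix i
            have "norm (x - z) < dd i" using x d(2)[of i] by (auto simp: dist_norm norm_minus_commute)
            then have "\<bar>partial_deriv i g x - partial_deriv i g z\<bar> \<le> e'" using dd(2) by (meson less_imp_le)
            then show "\<bar>h $ i * (partial_deriv i g x - partial_deriv i g z)\<bar> \<le> norm h * e'"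
              unfolding abs_mult by (intro mult_mono component_le_norm_cart) auto
          qed
          finally show "norm ((D x - D z) h) \<le> real CARD('n) * e' * norm h" by (simp add: mult_ac)
        qed
      qed (use D d in \<open>auto intro: has_derivative_at_withinI\<close>)
      then show ?thesis by simp
    qed
    show ?thesis
    proof (intro exI conjI allI impI)
      fix y assume y: "norm (y - x) < d"
      let ?h = "y - x"
      have "(\<integral>w. f w * g (y - w) \<partial>lborel) - (\<integral>w. f w * g (x - w) \<partial>lborel) -
        (\<Sum>i\<in>UNIV. ?h $ i * (\<integral>w. f w * partial_deriv i g (x - w) \<partial>lborel)) =
        (\<integral>w. f w * g (y - w) - f w * g (x - w) - (\<Sum>i\<in>UNIV. ?h $ i * (f w * partial_deriv i g (x - w))) \<partial>lborel)"
        using ig ip by (simp add: Bochner_Integration.integral_sum)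
      also have "\<bar>\<dots>\<bar> \<le> (\<integral>w. \<bar>f w\<bar> * (norm ?h * (real CARD('n) * e')) \<partial>lborel)"
      proof (rule integral_abs_bound_integral)
        fix w
        have "\<bar>f w * g (y - w) - f w * g (x - w) - (\<Sum>i\<in>UNIV. ?h $ i * (f w * partial_deriv i g (x - w)))\<bar>
          = \<bar>f w\<bar> * \<bar>g ((x - w) + ?h) - g (x - w) - D (x - w) ?h\<bar>"
          unfolding abs_mult[symmetric] D_def
          by (rule arg_cong[where f = abs]) (simp add: algebra_simps sum_distrib_left sum_subtractf)
        also have "\<dots> \<le> \<bar>f w\<bar> * (norm ?h * (real CARD('n) * e'))"
          by (intro mult_left_mono lin y) auto
        finally show "\<bar>f w * g (y - w) - f w * g (x - w) - (\<Sum>i\<in>UNIV. ?h $ i * (f w * partial_deriv i g (x - w)))\<bar>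
          \<le> \<bar>f w\<bar> * (norm ?h * (real CARD('n) * e'))" .
      qed (use f ig ip in auto)
      also have "\<dots> = ?F * (norm ?h * (real CARD('n) * e'))" by simp
      also have "\<dots> = norm ?h * (e * (?F / (?F + 1)))"
        by (simp add: e'_def)
      also have "\<dots> \<le> e * norm ?h"
      proof -
        have "?F / (?F + 1) \<le> 1" using F by (subst divide_le_eq_1_pos) linarith+
        from mult_left_mono[OF this, of e] have "e * (?F / (?F + 1)) \<le> e" using \<open>e > 0\<close> by simp
        then show ?thesis by (metis mult.commute mult_left_mono norm_ge_zero)
      qed
      finally show "norm ((\<integral>w. f w * g (y - w) \<partial>lborel) - (\<integral>w. f w * g (x - w) \<partial>lborel) -
        (\<Sum>i\<in>UNIV. ?h $ i * (\<integral>w. f w * partial_deriv i g (x - w) \<partial>lborel))) \<le> e * norm ?h" by simp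
    qed (rule d(1))
  qed
  show ?thesis
    unfolding has_derivative_at_alt
  proof (intro conjI allI impI est)
    show "bounded_linear (\<lambda>h. \<Sum>i\<in>UNIV. h $ i * (\<integral>y. f y * partial_deriv i g (x - y) \<partial>lborel))"
      by (intro bounded_linear_sum bounded_linear_mult_const bounded_linear_vec_nth)
  qed auto
qed

lemma partial_deriv_eq_0_outside:
  fixes g :: "real^'n \<Rightarrow> real"
  assumes z: "\<And>x. norm x > R \<Longrightarrow> g x = 0" and "norm x > R"
  shows "partial_deriv i g x = 0"
proof -
  have "((\<lambda>x::real^'n. 0::real) has_derivative (\<lambda>h. 0)) (at x)" by simp
  then have "(g has_derivative (\<lambda>h. 0)) (at x)"
    by (rule has_derivative_transform_within_open[where s = "{x. norm x > R}"])
       (use assms in \<open>auto intro!: open_Collect_less continuous_intros\<close>)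
  then show ?thesis by (simp add: partial_deriv_eq)
qed

text \<open>All derivatives fall on g, so integrability of f suffices. The induction runs over all
  smooth g vanishing outside the ball of radius R, a class closed under
  \<open>partial_deriv\<close>.\<close>

lemma C_k_conv:
  fixes f g :: "real^'n \<Rightarrow> real"
  assumes f: "integrable lborel f" and g: "\<And>k. C_k k g"
    and z: "\<And>x. norm x > R \<Longrightarrow> g x = 0"
  shows "C_k k (\<lambda>x. \<integral>y. f y * g (x - y) \<partial>lborel)"
  using g z
proof (induction k arbitrary: g)
  case 0
  have contg: "continuous_on UNIV g" using 0(1)[of 0] by simp
  have "C_k (Suc 0) g" by (rule 0(1))
  then have "isCont (\<lambda>x. \<integral>y. f y * g (x - y) \<partial>lborel) x" for x
    by (intro has_derivative_continuous[OF has_derivative_conv[OF f, where R = R]]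
        0(2) partial_deriv_eq_0_outside[OF 0(2)])
  then show ?case by (simp add: continuous_at_imp_continuous_on)
next
  case (Suc k)
  have 1: "C_k (Suc 0) g" by (rule Suc.prems)
  have d: "((\<lambda>x. \<integral>y. f y * g (x - y) \<partial>lborel) has_derivative
      (\<lambda>h. \<Sum>i\<in>UNIV. h $ i * (\<integral>y. f y * partial_deriv i g (x - y) \<partial>lborel))) (at x)" for x
    by (intro has_derivative_conv[OF f 1, where R = R] Suc.prems(2)
        partial_deriv_eq_0_outside[OF Suc.prems(2)])
  have "partial_deriv i (\<lambda>x. \<integral>y. f y * g (x - y) \<partial>lborel) =
      (\<lambda>x. \<integral>y. f y * partial_deriv i g (x - y) \<partial>lborel)" for i
  proof
    fix x
    have "(\<Sum>j\<in>UNIV. axis i 1 $ j * c j) = c i" for c :: "'n \<Rightarrow> real"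
      by (subst sum.remove[of _ i]) (auto simp: axis_def)
    then show "partial_deriv i (\<lambda>x. \<integral>y. f y * g (x - y) \<partial>lborel) x =
        (\<integral>y. f y * partial_deriv i g (x - y) \<partial>lborel)"
      by (simp only: partial_deriv_eq[OF d])
  qed
  moreover have "C_k k (\<lambda>x. \<integral>y. f y * partial_deriv i g (x - y) \<partial>lborel)" for i
  proof (rule Suc.IH)
    show "C_k k (partial_deriv i g)" for k using Suc.prems(1)[of "Suc k"] by simp
    show "norm x > R \<Longrightarrow> partial_deriv i g x = 0" for x
      by (rule partial_deriv_eq_0_outside[OF Suc.prems(2)])
  qed
  moreover have "(\<lambda>x. \<integral>y. f y * g (x - y) \<partial>lborel) differentiable at x" for x
    using d unfolding differentiable_def by blast
  ultimately show ?case unfolding C_k.simps by auto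
qed

section \<open>Continuity of translations\<close>

lemma powr_add_le:
  fixes a b e :: real
  assumes "a \<ge> 0" "b \<ge> 0" "e \<ge> 0"
  shows "(a + b) powr e \<le> 2 powr e * (a powr e + b powr e)"
proof -
  have "(a + b) powr e \<le> (2 * max a b) powr e" using assms by (intro powr_mono2) auto
  also have "\<dots> = 2 powr e * (max a b) powr e" using assms by (simp add: powr_mult)
  also have "(max a b) powr e \<le> a powr e + b powr e" by (simp add: max_def)
  finally show ?thesis by simp
qed

lemma abs_add_powr_le:
  fixes a b e :: real
  assumes "e \<ge> 0"
  shows "\<bar>a + b\<bar> powr e \<le> 2 powr e * (\<bar>a\<bar> powr e + \<bar>b\<bar> powr e)"
  by (rule order_trans[OF powr_mono2 powr_add_le]) (use assms in auto)

text \<open>Young's inequality without the sharp constant: compare Y with e X, and whichever is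
  larger absorbs the whole product. The explicit dependence on e is what later allows terms to
  cancel exactly.\<close>

lemma powr_young:
  fixes X Y e p :: real
  assumes "X \<ge> 0" "Y \<ge> 0" "e > 0" "p > 1"
  shows "X powr (p - 1) * Y \<le> e * X powr p + e powr (1 - p) * Y powr p"
proof (cases "Y \<le> e * X")
  case True
  then have "X powr (p - 1) * Y \<le> X powr (p - 1) * (e * X)" by (intro mult_left_mono) auto
  also have "\<dots> = e * X powr p"
    using assms by (cases "X = 0") (auto simp: powr_diff)
  finally show ?thesis by (smt (verit) mult_nonneg_nonneg powr_ge_zero)
next
  case False
  then have Y: "Y > 0" "X \<le> Y / e" using assms by (auto simp: field_simps) (smt (verit) mult_nonneg_nonneg)
  then have "X powr (p - 1) * Y \<le> (Y / e) powr (p - 1) * Y"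
    using assms by (intro mult_right_mono powr_mono2) auto
  also have "\<dots> = e powr (1 - p) * Y powr p"
    using assms Y by (simp add: powr_divide powr_diff field_simps)
  finally show ?thesis using assms by (smt (verit) mult_nonneg_nonneg powr_ge_zero)
qed

lemma nn_integral_lborel_shift:
  fixes f :: "'a::euclidean_space \<Rightarrow> ennreal"
  assumes [measurable]: "f \<in> borel_measurable borel"
  shows "(\<integral>\<^sup>+x. f (x + c) \<partial>lborel) = (\<integral>\<^sup>+x. f x \<partial>lborel)"
proof -
  have "(\<integral>\<^sup>+x. f x \<partial>lborel) = (\<integral>\<^sup>+x. f x \<partial>distr lborel borel ((+) c))"
    by (simp add: lborel_distr_plus)
  also have "\<dots> = (\<integral>\<^sup>+x. f (c + x) \<partial>lborel)" by (subst nn_integral_distr) auto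
  finally show ?thesis by (simp add: add.commute)
qed

lemma inner_compact_lborel:
  fixes A :: "'a::euclidean_space set"
  assumes A: "A \<in> sets lborel" "emeasure lborel A < \<infinity>" and "e > 0"
  obtains K where "compact K" "K \<subseteq> A" "emeasure lborel (A - K) \<le> ennreal e"
proof -
  have lim: "(\<lambda>k. emeasure lborel (A - cball 0 (real k))) \<longlonglongrightarrow> emeasure lborel (\<Inter>k. A - cball 0 (real k))"
  proof (rule Lim_emeasure_decseq)
    show "range (\<lambda>k. A - cball 0 (real k)) \<subseteq> sets lborel" using A by auto
    show "decseq (\<lambda>k. A - cball 0 (real k))" by (auto simp: decseq_def)
    show "emeasure lborel (A - cball 0 (real k)) \<noteq> \<infinity>" for k
      using emeasure_mono[of "A - cball 0 (real k)" A lborel] A by (auto simp: top_unique)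
  qed
  have eq: "(\<Inter>k. A - cball 0 (real k)) = {}"
  proof -
    have "\<exists>k. norm x \<le> real k" for x :: 'a using real_arch_simple by blast
    then show ?thesis by (auto simp: dist_norm)
  qed
  have "(\<lambda>k. emeasure lborel (A - cball 0 (real k))) \<longlonglongrightarrow> 0"
    using lim unfolding eq by simp
  then have "eventually (\<lambda>k. emeasure lborel (A - cball 0 (real k)) < ennreal (e/2)) sequentially"
    using \<open>e > 0\<close> by (intro order_tendstoD) auto
  then obtain k where k: "emeasure lborel (A - cball 0 (real k)) < ennreal (e/2)"
    by (auto simp: eventually_sequentially)
  let ?B = "A \<inter> cball 0 (real k)"
  have B: "?B \<in> sets lebesgue" using A by auto
  obtain K where K: "closed K" "K \<subseteq> ?B" "emeasure lebesgue (?B - K) < ennreal (e/2)"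
    using sets_lebesgue_inner_closed[OF B half_gt_zero[OF \<open>e > 0\<close>]] by metis
  have Kb: "K \<in> sets lborel" using K by auto
  have "A - K \<subseteq> (A - cball 0 (real k)) \<union> (?B - K)" by auto
  then have "emeasure lborel (A - K) \<le> emeasure lborel ((A - cball 0 (real k)) \<union> (?B - K))"
    using A Kb by (intro emeasure_mono) auto
  also have "\<dots> \<le> emeasure lborel (A - cball 0 (real k)) + emeasure lborel (?B - K)"
    using A Kb by (intro emeasure_subadditive) auto
  also have "\<dots> \<le> ennreal (e/2) + ennreal (e/2)"
    using k K A Kb by (intro add_mono) (auto simp: less_imp_le)
  also have "\<dots> = ennreal e" using \<open>e > 0\<close> by (simp add: ennreal_plus[symmetric] del: ennreal_plus)
  finally have AK: "emeasure lborel (A - K) \<le> ennreal e" .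
  show ?thesis
  proof (rule that[OF _ _ AK])
    show "compact K"
      using K(1,2) bounded_subset[OF bounded_cball, of K 0 "real k"] by (auto simp: compact_eq_bounded_closed)
  qed (use K in auto)
qed

text \<open>Squeeze A between a compact K and an open U with U - K small. A shift shorter than the
  distance from K to the complement of U keeps K inside U, so A and its translate can differ only on
  U - K and its translate.\<close>

lemma translation_continuous_indicator:
  fixes A :: "'a::euclidean_space set"
  assumes A: "A \<in> sets lborel" "emeasure lborel A < \<infinity>" and "e > 0"
  obtains d where "d > 0" "\<And>h. norm h < d \<Longrightarrow>
    (\<integral>\<^sup>+x. ennreal \<bar>indicator A (x + h) - indicator A x\<bar> \<partial>lborel) \<le> ennreal e"
proof -
  obtain K where K: "compact K" "K \<subseteq> A" "emeasure lborel (A - K) \<le> ennreal (e/4)"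
    using inner_compact_lborel[OF A, of "e/4"] \<open>e > 0\<close> by auto
  obtain U where U: "open U" "A \<subseteq> U" "emeasure lborel (U - A) < ennreal (e/4)"
    using outer_regular_lborel[of A "e/4"] A \<open>e > 0\<close> by auto
  have [measurable]: "K \<in> sets borel" "U \<in> sets borel" "A \<in> sets borel"
    using K U A by (auto simp: compact_imp_closed)
  have "emeasure lborel (U - K) \<le> emeasure lborel ((U - A) \<union> (A - K))"
    using U K by (intro emeasure_mono) auto
  also have "\<dots> \<le> emeasure lborel (U - A) + emeasure lborel (A - K)"
    by (intro emeasure_subadditive) auto
  also have "\<dots> \<le> ennreal (e/4) + ennreal (e/4)" using U K by (intro add_mono) auto
  also have "\<dots> = ennreal (e/2)" using \<open>e > 0\<close> by (simp add: ennreal_plus[symmetric] del: ennreal_plus)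
  finally have UK: "emeasure lborel (U - K) \<le> ennreal (e/2)" .
  obtain d where d: "d > 0" "(\<Union>x\<in>K. ball x d) \<subseteq> U"
    using compact_subset_open_imp_ball_epsilon_subset[of K U] K U by auto
  show ?thesis
  proof (rule that[OF d(1)])
    fix h :: 'a assume h: "norm h < d"
    have KU: "x + h \<in> U" "x - h \<in> U" if "x \<in> K" for x
    proof -
      have "x + h \<in> (\<Union>x\<in>K. ball x d)" "x - h \<in> (\<Union>x\<in>K. ball x d)"
        using h that by (auto simp: dist_norm intro!: bexI[of _ x])
      then show "x + h \<in> U" "x - h \<in> U" using d(2) by blast+
    qed
    have pt: "\<bar>indicator A (x + h) - indicator A x :: real\<bar> \<le> indicator (U - K) (x + h) + indicator (U - K) x" for x
      using KU[of x] KU[of "x + h"] K(2) U(2) by (auto simp: indicator_def)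
    have "(\<integral>\<^sup>+x. ennreal \<bar>indicator A (x + h) - indicator A x\<bar> \<partial>lborel) \<le>
      (\<integral>\<^sup>+x. ennreal (indicator (U - K) (x + h)) + ennreal (indicator (U - K) x) \<partial>lborel)"
      by (intro nn_integral_mono) (use pt in \<open>auto simp: ennreal_plus[symmetric] simp del: ennreal_plus intro!: ennreal_leI\<close>)
    also have "\<dots> = (\<integral>\<^sup>+x. ennreal (indicator (U - K) (x + h)) \<partial>lborel) + (\<integral>\<^sup>+x. ennreal (indicator (U - K) x) \<partial>lborel)"
      by (intro nn_integral_add) auto
    also have "(\<integral>\<^sup>+x. ennreal (indicator (U - K) (x + h)) \<partial>lborel) = (\<integral>\<^sup>+x. ennreal (indicator (U - K) x) \<partial>lborel)"
      by (rule nn_integral_lborel_shift[where f = "\<lambda>x. ennreal (indicator (U - K) x)"]) auto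
    also have "(\<integral>\<^sup>+x. ennreal (indicator (U - K) x) \<partial>lborel) = emeasure lborel (U - K)"
      by (simp add: ennreal_indicator)
    also have "emeasure lborel (U - K) + emeasure lborel (U - K) \<le> ennreal (e/2) + ennreal (e/2)"
      by (intro add_mono UK)
    also have "\<dots> = ennreal e" using \<open>e > 0\<close> by (simp add: ennreal_plus[symmetric] del: ennreal_plus)
    finally show "(\<integral>\<^sup>+x. ennreal \<bar>indicator A (x + h) - indicator A x\<bar> \<partial>lborel) \<le> ennreal e" .
  qed
qed

lemma translation_continuous_L1:
  fixes f :: "'a::euclidean_space \<Rightarrow> real"
  assumes "integrable lborel f"
  shows "\<forall>e>0. \<exists>d>0. \<forall>h. norm h < d \<longrightarrow> (\<integral>\<^sup>+x. ennreal \<bar>f (x + h) - f x\<bar> \<partial>lborel) \<le> ennreal e"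
  using assms
proof (induction rule: integrable_induct)
  case (base A c)
  show ?case
  proof (intro allI impI)
    fix e :: real assume "e > 0"
    then have "e / (\<bar>c\<bar> + 1) > 0" by simp
    then obtain d where d: "d > 0" "\<And>h. norm h < d \<Longrightarrow>
      (\<integral>\<^sup>+x. ennreal \<bar>indicator A (x + h) - indicator A x\<bar> \<partial>lborel) \<le> ennreal (e / (\<bar>c\<bar> + 1))"
      using translation_continuous_indicator[OF base] by blast
    have [measurable]: "A \<in> sets borel" using base by auto
    have "(\<integral>\<^sup>+x. ennreal \<bar>indicator A (x + h) *\<^sub>R c - indicator A x *\<^sub>R c\<bar> \<partial>lborel) \<le> ennreal e" if "norm h < d" for h
    proof -
      have "(\<integral>\<^sup>+x. ennreal \<bar>indicator A (x + h) *\<^sub>R c - indicator A x *\<^sub>R c\<bar> \<partial>lborel) =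
        (\<integral>\<^sup>+x. ennreal \<bar>c\<bar> * ennreal \<bar>indicator A (x + h) - indicator A x\<bar> \<partial>lborel)"
        by (intro nn_integral_cong) (simp add: ennreal_mult[symmetric] abs_mult[symmetric] algebra_simps)
      also have "\<dots> = ennreal \<bar>c\<bar> * (\<integral>\<^sup>+x. ennreal \<bar>indicator A (x + h) - indicator A x\<bar> \<partial>lborel)"
        by (intro nn_integral_cmult) auto
      also have "\<dots> \<le> ennreal \<bar>c\<bar> * ennreal (e / (\<bar>c\<bar> + 1))" by (intro mult_left_mono d that) auto
      also have "\<dots> = ennreal (\<bar>c\<bar> * (e / (\<bar>c\<bar> + 1)))" using \<open>e > 0\<close> by (simp add: ennreal_mult[symmetric])
      also have "\<dots> \<le> ennreal e" using \<open>e > 0\<close> by (intro ennreal_leI) (simp add: field_simps)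
      finally show ?thesis .
    qed
    then show "\<exists>d>0. \<forall>h. norm h < d \<longrightarrow>
      (\<integral>\<^sup>+x. ennreal \<bar>indicator A (x + h) *\<^sub>R c - indicator A x *\<^sub>R c\<bar> \<partial>lborel) \<le> ennreal e"
      using d(1) by blast
  qed
next
  case (add f g)
  have [measurable]: "f \<in> borel_measurable borel" "g \<in> borel_measurable borel" using add by auto
  show ?case
  proof (intro allI impI)
    fix e :: real assume e: "e > 0"
    obtain d1 where d1: "d1 > 0" "\<And>h. norm h < d1 \<Longrightarrow> (\<integral>\<^sup>+x. ennreal \<bar>f (x + h) - f x\<bar> \<partial>lborel) \<le> ennreal (e/2)"
      using add.IH(1) e by (meson half_gt_zero)
    obtain d2 where d2: "d2 > 0" "\<And>h. norm h < d2 \<Longrightarrow> (\<integral>\<^sup>+x. ennreal \<bar>g (x + h) - g x\<bar> \<partial>lborel) \<le> ennreal (e/2)"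
      using add.IH(2) e by (metis half_gt_zero)
    have "(\<integral>\<^sup>+x. ennreal \<bar>f (x + h) + g (x + h) - (f x + g x)\<bar> \<partial>lborel) \<le> ennreal e" if "norm h < min d1 d2" for h
    proof -
      have "(\<integral>\<^sup>+x. ennreal \<bar>f (x + h) + g (x + h) - (f x + g x)\<bar> \<partial>lborel) \<le>
        (\<integral>\<^sup>+x. ennreal \<bar>f (x + h) - f x\<bar> + ennreal \<bar>g (x + h) - g x\<bar> \<partial>lborel)"
        by (intro nn_integral_mono) (auto simp: ennreal_plus[symmetric] simp del: ennreal_plus intro!: ennreal_leI)
      also have "\<dots> = (\<integral>\<^sup>+x. ennreal \<bar>f (x + h) - f x\<bar> \<partial>lborel) + (\<integral>\<^sup>+x. ennreal \<bar>g (x + h) - g x\<bar> \<partial>lborel)"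
        by (intro nn_integral_add) auto
      also have "\<dots> \<le> ennreal (e/2) + ennreal (e/2)" using that by (intro add_mono d1 d2) auto
      also have "\<dots> = ennreal e" using e by (simp add: ennreal_plus[symmetric] del: ennreal_plus)
      finally show ?thesis .
    qed
    then show "\<exists>d>0. \<forall>h. norm h < d \<longrightarrow>
      (\<integral>\<^sup>+x. ennreal \<bar>f (x + h) + g (x + h) - (f x + g x)\<bar> \<partial>lborel) \<le> ennreal e"
      using d1(1) d2(1) by (intro exI[of _ "min d1 d2"]) auto
  qed
next
  case (lim f s)
  have [measurable]: "f \<in> borel_measurable borel" "\<And>i. s i \<in> borel_measurable borel" using lim by auto
  have "(\<lambda>i. \<integral>\<^sup>+x. ennreal (norm (f x - s i x)) \<partial>lborel) \<longlonglongrightarrow> 0"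
  proof (rule tendsto_0_if_Limsup_eq_0_ennreal)
    have "(\<lambda>i. \<integral>\<^sup>+x. ennreal \<bar>f x - s i x\<bar> \<partial>lborel) \<longlonglongrightarrow> (\<integral>\<^sup>+x. 0 \<partial>(lborel :: 'a measure))"
    \<comment> \<open>The approximants supplied by \<open>integrable_induct\<close> satisfy |s i x|
      \<le> 2 |f x|, hence the factor 3.\<close>
    proof (rule nn_integral_dominated_convergence[where w = "\<lambda>x. ennreal (3 * \<bar>f x\<bar>)"])
      have "integrable lborel (\<lambda>x. 3 * \<bar>f x\<bar>)" using lim by auto
      then show "(\<integral>\<^sup>+x. ennreal (3 * \<bar>f x\<bar>) \<partial>lborel) < \<infinity>"
        by (subst nn_integral_eq_integral) auto
      show "AE x in lborel. ennreal \<bar>f x - s i x\<bar> \<le> ennreal (3 * \<bar>f x\<bar>)" for i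
      proof (intro AE_I2 ennreal_leI)
        fix x show "\<bar>f x - s i x\<bar> \<le> 3 * \<bar>f x\<bar>" using lim.hyps(3)[of x i] by simp
      qed
      show "AE x in lborel. (\<lambda>i. ennreal \<bar>f x - s i x\<bar>) \<longlonglongrightarrow> 0"
      proof (intro AE_I2)
        fix x
        have "(\<lambda>i. \<bar>f x - s i x\<bar>) \<longlonglongrightarrow> \<bar>f x - f x\<bar>" using lim.hyps(2)[of x] by (intro tendsto_intros) auto
        then show "(\<lambda>i. ennreal \<bar>f x - s i x\<bar>) \<longlonglongrightarrow> 0" using tendsto_ennrealI by fastforce
      qed
    qed auto
    then show "limsup (\<lambda>i. \<integral>\<^sup>+x. ennreal (norm (f x - s i x)) \<partial>lborel) = 0"
      by (simp add: lim_imp_Limsup)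
  qed
  then have conv: "(\<lambda>i. \<integral>\<^sup>+x. ennreal \<bar>f x - s i x\<bar> \<partial>lborel) \<longlonglongrightarrow> 0" by simp
  show ?case
  proof (intro allI impI)
    fix e :: real assume e: "e > 0"
    have "eventually (\<lambda>i. (\<integral>\<^sup>+x. ennreal \<bar>f x - s i x\<bar> \<partial>lborel) < ennreal (e/3)) sequentially"
      using conv e by (intro order_tendstoD) auto
    then obtain i where i: "(\<integral>\<^sup>+x. ennreal \<bar>f x - s i x\<bar> \<partial>lborel) < ennreal (e/3)"
      by (auto simp: eventually_sequentially)
    obtain d where d: "d > 0" "\<And>h. norm h < d \<Longrightarrow> (\<integral>\<^sup>+x. ennreal \<bar>s i (x + h) - s i x\<bar> \<partial>lborel) \<le> ennreal (e/3)"
      using lim.IH[of i, rule_format, of "e/3"] e by auto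
    have "(\<integral>\<^sup>+x. ennreal \<bar>f (x + h) - f x\<bar> \<partial>lborel) \<le> ennreal e" if "norm h < d" for h
    proof -
      have "(\<integral>\<^sup>+x. ennreal \<bar>f (x + h) - f x\<bar> \<partial>lborel) \<le>
        (\<integral>\<^sup>+x. ennreal \<bar>f (x + h) - s i (x + h)\<bar> + ennreal \<bar>s i (x + h) - s i x\<bar> + ennreal \<bar>f x - s i x\<bar> \<partial>lborel)"
        by (intro nn_integral_mono) (auto simp: ennreal_plus[symmetric] simp del: ennreal_plus intro!: ennreal_leI)
      also have "\<dots> = (\<integral>\<^sup>+x. ennreal \<bar>f (x + h) - s i (x + h)\<bar> \<partial>lborel) +
          (\<integral>\<^sup>+x. ennreal \<bar>s i (x + h) - s i x\<bar> \<partial>lborel) + (\<integral>\<^sup>+x. ennreal \<bar>f x - s i x\<bar> \<partial>lborel)"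
        by (simp add: nn_integral_add)
      also have "(\<integral>\<^sup>+x. ennreal \<bar>f (x + h) - s i (x + h)\<bar> \<partial>lborel) = (\<integral>\<^sup>+x. ennreal \<bar>f x - s i x\<bar> \<partial>lborel)"
        by (rule nn_integral_lborel_shift[where f = "\<lambda>x. ennreal \<bar>f x - s i x\<bar>"]) auto
      also have "(\<integral>\<^sup>+x. ennreal \<bar>f x - s i x\<bar> \<partial>lborel) + (\<integral>\<^sup>+x. ennreal \<bar>s i (x + h) - s i x\<bar> \<partial>lborel)
          + (\<integral>\<^sup>+x. ennreal \<bar>f x - s i x\<bar> \<partial>lborel) \<le> ennreal (e/3) + ennreal (e/3) + ennreal (e/3)"
        using i by (intro add_mono d that) auto
      also have "\<dots> = ennreal e" using e by (simp add: ennreal_plus[symmetric] del: ennreal_plus)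
      finally show ?thesis .
    qed
    then show "\<exists>d>0. \<forall>h. norm h < d \<longrightarrow> (\<integral>\<^sup>+x. ennreal \<bar>f (x + h) - f x\<bar> \<partial>lborel) \<le> ennreal e"
      using d(1) by blast
  qed
qed

text \<open>Reduction to L^1. Keeping f only where 1/m \<le> |f| \<le> m gives a function g that is
  bounded, so p-th powers of its differences are controlled by the differences themselves, and
  integrable, because |f| \<le> m^(p-1) |f|^p where |f| \<ge> 1/m.\<close>

lemma translation_continuous_Lp:
  fixes f :: "'a::euclidean_space \<Rightarrow> real"
  assumes [measurable]: "f \<in> borel_measurable borel" and i: "integrable lborel (\<lambda>x. \<bar>f x\<bar> powr p)"
    and p: "p > 1" and e: "e > 0"
  obtains d where "d > 0" "\<And>h. norm h < d \<Longrightarrow>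
    (\<integral>\<^sup>+x. ennreal (\<bar>f (x + h) - f x\<bar> powr p) \<partial>lborel) \<le> ennreal e"
proof -
  define g where "g M x = (if 1 / real (Suc M) \<le> \<bar>f x\<bar> \<and> \<bar>f x\<bar> \<le> real (Suc M) then f x else 0)" for M x
  have [measurable]: "g M \<in> borel_measurable borel" for M unfolding g_def by measurable
  have gf: "\<bar>f x - g M x\<bar> \<le> \<bar>f x\<bar>" for x M by (auto simp: g_def)
  have "(\<lambda>M. \<integral>\<^sup>+x. ennreal (\<bar>f x - g M x\<bar> powr p) \<partial>lborel) \<longlonglongrightarrow> (\<integral>\<^sup>+x. 0 \<partial>(lborel :: 'a measure))"
  proof (rule nn_integral_dominated_convergence[where w = "\<lambda>x. ennreal (\<bar>f x\<bar> powr p)"])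
    show "(\<integral>\<^sup>+x. ennreal (\<bar>f x\<bar> powr p) \<partial>lborel) < \<infinity>"
      using i by (subst nn_integral_eq_integral) auto
    show "AE x in lborel. ennreal (\<bar>f x - g i x\<bar> powr p) \<le> ennreal (\<bar>f x\<bar> powr p)" for i
      using gf p by (intro AE_I2 ennreal_leI powr_mono2) auto
    show "AE x in lborel. (\<lambda>i. ennreal (\<bar>f x - g i x\<bar> powr p)) \<longlonglongrightarrow> 0"
    proof (intro AE_I2)
      fix x
      have "eventually (\<lambda>M. g M x = f x) sequentially"
      proof (cases "f x = 0")
        case True then show ?thesis by (simp add: g_def)
      next
        case False
        obtain N where N: "max (1 / \<bar>f x\<bar>) \<bar>f x\<bar> \<le> real N" using real_arch_simple by blast
        have "g M x = f x" if "M \<ge> N" for M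
        proof -
          have "1 / \<bar>f x\<bar> \<le> real (Suc M)" "\<bar>f x\<bar> \<le> real (Suc M)" using N that by auto
          then have "1 / real (Suc M) \<le> \<bar>f x\<bar>"
            using False by (simp add: divide_le_eq mult.commute del: of_nat_Suc)
          then show ?thesis using \<open>\<bar>f x\<bar> \<le> real (Suc M)\<close> unfolding g_def by simp
        qed
        then show ?thesis by (auto simp: eventually_sequentially)
      qed
      then have "eventually (\<lambda>i. ennreal (\<bar>f x - g i x\<bar> powr p) = 0) sequentially"
        by eventually_elim auto
      then show "(\<lambda>i. ennreal (\<bar>f x - g i x\<bar> powr p)) \<longlonglongrightarrow> 0" by (rule tendsto_eventually)
    qed
  qed auto
  then have conv: "(\<lambda>M. \<integral>\<^sup>+x. ennreal (\<bar>f x - g M x\<bar> powr p) \<partial>lborel) \<longlonglongrightarrow> 0" by simp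
  \<comment> \<open>One factor 2^p for each of the two splittings needed to separate three
    summands.\<close>
  define c :: real where "c = 2 powr p * 2 powr p"
  have c: "c > 0" by (simp add: c_def)
  have "eventually (\<lambda>M. (\<integral>\<^sup>+x. ennreal (\<bar>f x - g M x\<bar> powr p) \<partial>lborel) < ennreal (e / (3 * c))) sequentially"
    using conv e c by (intro order_tendstoD) auto
  then obtain M where M: "(\<integral>\<^sup>+x. ennreal (\<bar>f x - g M x\<bar> powr p) \<partial>lborel) < ennreal (e / (3 * c))"
    by (auto simp: eventually_sequentially)
  define m where "m = real (Suc M)"
  have m: "m > 0" by (simp add: m_def)
  have gm: "\<bar>g M x\<bar> \<le> m" for x using m by (auto simp: g_def m_def)
  have "integrable lborel (g M)"
  proof (rule Bochner_Integration.integrable_bound)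
    show "integrable lborel (\<lambda>x. m powr (p - 1) * \<bar>f x\<bar> powr p)" using i by simp
    show "AE x in lborel. norm (g M x) \<le> norm (m powr (p - 1) * \<bar>f x\<bar> powr p)"
    proof (intro AE_I2)
      fix x show "norm (g M x) \<le> norm (m powr (p - 1) * \<bar>f x\<bar> powr p)"
      proof (cases "1 / m \<le> \<bar>f x\<bar> \<and> \<bar>f x\<bar> \<le> m")
        case True
        then have "\<bar>f x\<bar> > 0" using m by (smt (verit) divide_pos_pos)
        have "1 \<le> m * \<bar>f x\<bar>" using True m by (simp add: field_simps)
        then have "1 \<le> (m * \<bar>f x\<bar>) powr (p - 1)" using p by (intro ge_one_powr_ge_zero) auto
        then have "\<bar>f x\<bar> * 1 \<le> \<bar>f x\<bar> * (m * \<bar>f x\<bar>) powr (p - 1)" by (intro mult_left_mono) auto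
        also have "\<dots> = m powr (p - 1) * \<bar>f x\<bar> powr p"
          using m \<open>\<bar>f x\<bar> > 0\<close> by (simp add: powr_mult powr_diff)
        finally show ?thesis using True by (simp add: g_def m_def)
      qed (auto simp: g_def m_def)
    qed
  qed auto
  \<comment> \<open>A difference of values of g is at most 2 m, so its p-th power is at most (2
    m)^(p-1) times the difference. With this accuracy in L^1 each of the three summands contributes
    e/3.\<close>
  define e1 where "e1 = e / (3 * c * (2 * m) powr (p - 1))"
  have e1: "e1 > 0" using e c m by (simp add: e1_def)
  obtain d where d: "d > 0" "\<And>h. norm h < d \<Longrightarrow> (\<integral>\<^sup>+x. ennreal \<bar>g M (x + h) - g M x\<bar> \<partial>lborel) \<le> ennreal e1"
    using translation_continuous_L1[OF \<open>integrable lborel (g M)\<close>] e1 by blast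
  show ?thesis
  proof (rule that[OF d(1)])
    fix h :: 'a assume h: "norm h < d"
    let ?a = "\<lambda>x. \<bar>f x - g M x\<bar> powr p"
    let ?b = "\<lambda>x. (2 * m) powr (p - 1) * \<bar>g M (x + h) - g M x\<bar>"
    have pt: "\<bar>f (x + h) - f x\<bar> powr p \<le> c * (?a (x + h) + ?a x + ?b x)" for x
    proof -
      have "\<bar>f (x + h) - f x\<bar> powr p = \<bar>(f (x + h) - g M (x + h)) + ((g M x - f x) + (g M (x + h) - g M x))\<bar> powr p"
        by simp
      also have "\<dots> \<le> 2 powr p * (?a (x + h) + \<bar>(g M x - f x) + (g M (x + h) - g M x)\<bar> powr p)"
        using p by (intro abs_add_powr_le) auto
      also have "\<dots> \<le> 2 powr p * (2 powr p * ?a (x + h) + 2 powr p * (\<bar>g M x - f x\<bar> powr p + \<bar>g M (x + h) - g M x\<bar> powr p))"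
      proof (intro mult_left_mono add_mono abs_add_powr_le)
        have "1 \<le> 2 powr p" using p by (intro ge_one_powr_ge_zero) auto
        from mult_right_mono[OF this, of "?a (x + h)"] show "?a (x + h) \<le> 2 powr p * ?a (x + h)" by simp
      qed (use p in auto)
      also have "\<dots> = c * (?a (x + h) + ?a x + \<bar>g M (x + h) - g M x\<bar> powr p)"
        by (simp add: c_def algebra_simps abs_minus_commute)
      also have "\<bar>g M (x + h) - g M x\<bar> powr p \<le> ?b x"
      proof -
        have "\<bar>g M (x + h) - g M x\<bar> powr p = \<bar>g M (x + h) - g M x\<bar> powr (p - 1) * \<bar>g M (x + h) - g M x\<bar>"
          by (cases "g M (x + h) - g M x = 0") (auto simp: powr_diff)
        also have "\<dots> \<le> (2 * m) powr (p - 1) * \<bar>g M (x + h) - g M x\<bar>"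
          using p gm[of x] gm[of "x + h"] by (intro mult_right_mono powr_mono2) (auto simp: abs_le_iff)
        finally show ?thesis .
      qed
      finally show ?thesis using c by simp
    qed
    have "(\<integral>\<^sup>+x. ennreal (\<bar>f (x + h) - f x\<bar> powr p) \<partial>lborel) \<le>
      (\<integral>\<^sup>+x. ennreal c * (ennreal (?a (x + h)) + ennreal (?a x) + ennreal ((2 * m) powr (p - 1)) * ennreal \<bar>g M (x + h) - g M x\<bar>) \<partial>lborel)"
    proof (intro nn_integral_mono)
      fix x
      have "ennreal (\<bar>f (x + h) - f x\<bar> powr p) \<le> ennreal (c * (?a (x + h) + ?a x + ?b x))" using pt by (rule ennreal_leI)
      also have "\<dots> = ennreal c * (ennreal (?a (x + h)) + ennreal (?a x) + ennreal ((2 * m) powr (p - 1)) * ennreal \<bar>g M (x + h) - g M x\<bar>)"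
        using c m by (simp add: ennreal_mult)
      finally show "ennreal (\<bar>f (x + h) - f x\<bar> powr p) \<le> \<dots>" .
    qed
    also have "\<dots> = ennreal c * ((\<integral>\<^sup>+x. ennreal (?a (x + h)) \<partial>lborel) + (\<integral>\<^sup>+x. ennreal (?a x) \<partial>lborel) +
        ennreal ((2 * m) powr (p - 1)) * (\<integral>\<^sup>+x. ennreal \<bar>g M (x + h) - g M x\<bar> \<partial>lborel))"
      by (simp add: nn_integral_cmult nn_integral_add)
    also have "(\<integral>\<^sup>+x. ennreal (?a (x + h)) \<partial>lborel) = (\<integral>\<^sup>+x. ennreal (?a x) \<partial>lborel)"
      by (rule nn_integral_lborel_shift[where f = "\<lambda>x. ennreal (?a x)"]) auto
    also have "ennreal c * ((\<integral>\<^sup>+x. ennreal (?a x) \<partial>lborel) + (\<integral>\<^sup>+x. ennreal (?a x) \<partial>lborel) +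
        ennreal ((2 * m) powr (p - 1)) * (\<integral>\<^sup>+x. ennreal \<bar>g M (x + h) - g M x\<bar> \<partial>lborel)) \<le>
        ennreal c * (ennreal (e / (3 * c)) + ennreal (e / (3 * c)) + ennreal ((2 * m) powr (p - 1)) * ennreal e1)"
      using M by (intro mult_left_mono add_mono d h) auto
    also have "\<dots> = ennreal (c * (e / (3 * c) + e / (3 * c) + (2 * m) powr (p - 1) * e1))"
      using c e e1 by (simp add: ennreal_mult[symmetric] ennreal_plus[symmetric] del: ennreal_plus)
    also have "c * (e / (3 * c) + e / (3 * c) + (2 * m) powr (p - 1) * e1) = e"
      using c m by (simp add: e1_def field_simps)
    finally show "(\<integral>\<^sup>+x. ennreal (\<bar>f (x + h) - f x\<bar> powr p) \<partial>lborel) \<le> ennreal e" .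
  qed
qed

section \<open>Admissible test functions\<close>

text \<open>For \<beta> = s p this is the model kernel. Negative \<beta> occurs too: |z|^p times the
  kernel is again of this form, with exponent parameter \<beta> - p. Since \<open>0 powr a\<close>
  is 0 the function vanishes at the origin, so the diagonal never has to be treated apart.\<close>

definition sing_kernel :: "real \<Rightarrow> 'a::euclidean_space \<Rightarrow> real" where
  "sing_kernel \<beta> z = norm z powr (- (real DIM('a) + \<beta>))"

lemma sing_kernel_nonneg [simp]: "sing_kernel \<beta> z \<ge> 0"
  by (simp add: sing_kernel_def)

lemma sing_kernel_0 [simp]: "sing_kernel \<beta> 0 = 0"
  by (simp add: sing_kernel_def)

lemma borel_measurable_sing_kernel [measurable]: "sing_kernel \<beta> \<in> borel_measurable borel"
  unfolding sing_kernel_def[abs_def] by measurable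

lemma sing_kernel_minus [simp]: "sing_kernel \<beta> (- z) = sing_kernel \<beta> z"
  by (simp add: sing_kernel_def)

lemma borel_measurable_fst_prod [measurable]:
  "(fst :: 'a::second_countable_topology \<times> 'b::second_countable_topology \<Rightarrow> 'a) \<in> borel_measurable borel"
  by (subst borel_prod[symmetric]) simp

lemma borel_measurable_snd_prod [measurable]:
  "(snd :: 'a::second_countable_topology \<times> 'b::second_countable_topology \<Rightarrow> 'b) \<in> borel_measurable borel"
  by (subst borel_prod[symmetric]) simp

lemma lborel_integral_reflect_shift:
  fixes f :: "'a::euclidean_space \<Rightarrow> real"
  assumes [measurable]: "f \<in> borel_measurable borel"
  shows "(\<integral>y. f y \<partial>lborel) = (\<integral>w. f (x - w) \<partial>lborel)"
    and "integrable lborel f \<longleftrightarrow> integrable lborel (\<lambda>w. f (x - w))"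
proof -
  have d: "(lborel :: 'a measure) = distr lborel borel (\<lambda>w. x - w)"
    using lborel_affine[of "-1" x] by (simp add: density_1)
  show "(\<integral>y. f y \<partial>lborel) = (\<integral>w. f (x - w) \<partial>lborel)"
    by (subst d, subst integral_distr) auto
  show "integrable lborel f \<longleftrightarrow> integrable lborel (\<lambda>w. f (x - w))"
    by (subst d, subst integrable_distr_eq) auto
qed

text \<open>The function D(w), the weak form tested with the translate of \<phi> by w, is continuous at 0, and its
  average against a mollifier vanishes because the mollified \<phi> is a test function.\<close>

lemma test_extension:
  fixes v \<phi> :: "real^'n \<Rightarrow> real" and b :: "(real^'n) \<times> (real^'n) \<Rightarrow> real"
  assumes p: "p > 1" and L: "L \<ge> 0"
    and [measurable]: "v \<in> borel_measurable borel" "b \<in> borel_measurable borel" "\<phi> \<in> borel_measurable borel"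
    and b: "AE z in lborel. \<bar>b z\<bar> \<le> L * \<bar>v (fst z) - v (snd z)\<bar> powr (p - 1) * sing_kernel \<beta> (fst z - snd z)"
    and v: "integrable lborel (\<lambda>z. \<bar>v (fst z) - v (snd z)\<bar> powr p * sing_kernel \<beta> (fst z - snd z))"
    and weak: "\<And>\<psi>. \<psi> \<in> test_functions \<Omega> \<Longrightarrow> (\<integral>z. b z * (\<psi> (fst z) - \<psi> (snd z)) \<partial>lborel) = 0"
    and \<phi>1: "integrable lborel \<phi>"
    and \<phi>: "integrable lborel (\<lambda>z. \<bar>\<phi> (fst z) - \<phi> (snd z)\<bar> powr p * sing_kernel \<beta> (fst z - snd z))"
    and supp: "\<And>x. norm (x - x0) > \<rho> \<Longrightarrow> \<phi> x = 0" and \<rho>: "\<rho> < \<rho>'" "ball x0 \<rho>' \<subseteq> \<Omega>"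
  shows "integrable lborel (\<lambda>z. b z * (\<phi> (fst z) - \<phi> (snd z)))"
    and "(\<integral>z. b z * (\<phi> (fst z) - \<phi> (snd z)) \<partial>lborel) = 0"
proof -
  define J where "J z = sing_kernel \<beta> (fst z - snd z)" for z :: "(real^'n) \<times> (real^'n)"
  define dv where "dv z = \<bar>v (fst z) - v (snd z)\<bar>" for z
  define dp where "dp w z = \<phi> (fst z - w) - \<phi> (snd z - w)" for w :: "real^'n" and z
  have [measurable]: "J \<in> borel_measurable borel" "dv \<in> borel_measurable borel"
    "dp w \<in> borel_measurable borel" for w unfolding J_def dv_def dp_def by measurable
  have J0: "J z \<ge> 0" and dv0: "dv z \<ge> 0" for z by (auto simp: J_def dv_def)
  have vI: "integrable lborel (\<lambda>z. dv z powr p * J z)" using v by (simp add: dv_def J_def)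
  \<comment> \<open>The kernel J is invariant under the diagonal shift (w, w). Multiplying its p-th
    root into the difference of \<phi> therefore turns a translation of \<phi> by w into a
    translation of F on the product space, where continuity of translations in L^p applies.\<close>
  define F where "F z = dp 0 z * J z powr (1 / p)" for z
  have [measurable]: "F \<in> borel_measurable borel" unfolding F_def by measurable
  have Fp: "\<bar>F z\<bar> powr p = \<bar>dp 0 z\<bar> powr p * J z" for z
    using p J0 by (simp add: F_def abs_mult powr_mult powr_powr)
  have shiftF: "F (z + (- w, - w)) = dp w z * J z powr (1 / p)" for z w
    by (simp add: F_def dp_def J_def)
  have shiftFp: "\<bar>F (z + (- w, - w))\<bar> powr p = \<bar>dp w z\<bar> powr p * J z" for z w
    using p J0 by (simp add: shiftF abs_mult powr_mult powr_powr)
  have FI: "integrable lborel (\<lambda>z. \<bar>F z\<bar> powr p)"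
    using \<phi> by (simp add: Fp dp_def J_def)
  define W where "W = (\<integral>z. \<bar>F z\<bar> powr p \<partial>lborel)"
  define V where "V = (\<integral>z. dv z powr p * J z \<partial>lborel)"
  have V0: "V \<ge> 0" unfolding V_def using J0 by (intro integral_nonneg_AE) auto
  have dpI: "integrable lborel (\<lambda>z. \<bar>dp w z\<bar> powr p * J z)"
    and dpW: "(\<integral>z. \<bar>dp w z\<bar> powr p * J z \<partial>lborel) = W" for w
  proof -
    have n: "(\<integral>\<^sup>+z. ennreal (\<bar>dp w z\<bar> powr p * J z) \<partial>lborel) = ennreal W"
    proof -
      have "(\<integral>\<^sup>+z. ennreal (\<bar>dp w z\<bar> powr p * J z) \<partial>lborel) =
          (\<integral>\<^sup>+z. ennreal (\<bar>F (z + (- w, - w))\<bar> powr p) \<partial>lborel)" by (simp add: shiftFp)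
      also have "\<dots> = (\<integral>\<^sup>+z. ennreal (\<bar>F z\<bar> powr p) \<partial>lborel)"
        by (rule nn_integral_lborel_shift[where f = "\<lambda>z. ennreal (\<bar>F z\<bar> powr p)"]) measurable
      also have "\<dots> = ennreal W" unfolding W_def using FI by (intro nn_integral_eq_integral) auto
      finally show ?thesis .
    qed
    then show "integrable lborel (\<lambda>z. \<bar>dp w z\<bar> powr p * J z)"
      using J0 by (intro integrableI_nn_integral_finite) auto
    have "W \<ge> 0" unfolding W_def by (intro integral_nonneg_AE) auto
    then show "(\<integral>z. \<bar>dp w z\<bar> powr p * J z \<partial>lborel) = W"
      using n J0 by (subst integral_eq_nn_integral) auto
  qed
  \<comment> \<open>Young's inequality with a free e stands in for Holder's: a small e makes the
    part with v small, and the part with Y can then be made small by continuity of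
    translations.\<close>
  have young: "AE z in lborel. \<bar>b z * Y z\<bar> \<le> L * e * (dv z powr p * J z) + L * e powr (1 - p) * (\<bar>Y z\<bar> powr p * J z)"
    if "e > 0" for e Y
    using b
  proof eventually_elim
    fix z assume *: "\<bar>b z\<bar> \<le> L * \<bar>v (fst z) - v (snd z)\<bar> powr (p - 1) * sing_kernel \<beta> (fst z - snd z)"
    have "\<bar>b z * Y z\<bar> \<le> (L * dv z powr (p - 1) * J z) * \<bar>Y z\<bar>"
      unfolding abs_mult using * by (intro mult_right_mono) (auto simp: dv_def J_def)
    also have "\<dots> = L * J z * (dv z powr (p - 1) * \<bar>Y z\<bar>)" by simp
    also have "\<dots> \<le> L * J z * (e * dv z powr p + e powr (1 - p) * \<bar>Y z\<bar> powr p)"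
      using L J0 dv0 that p by (intro mult_left_mono powr_young) auto
    finally show "\<bar>b z * Y z\<bar> \<le> L * e * (dv z powr p * J z) + L * e powr (1 - p) * (\<bar>Y z\<bar> powr p * J z)"
      by (simp add: algebra_simps)
  qed
  have bI: "integrable lborel (\<lambda>z. b z * Y z)" and bW: "(\<integral>z. \<bar>b z * Y z\<bar> \<partial>lborel) \<le>
      L * e * V + L * e powr (1 - p) * (\<integral>z. \<bar>Y z\<bar> powr p * J z \<partial>lborel)"
    if [measurable]: "Y \<in> borel_measurable borel" and Y: "integrable lborel (\<lambda>z. \<bar>Y z\<bar> powr p * J z)"
      and e: "e > 0" for Y e
  proof -
    show I: "integrable lborel (\<lambda>z. b z * Y z)"
    proof (rule Bochner_Integration.integrable_bound)
      show "integrable lborel (\<lambda>z. L * e * (dv z powr p * J z) + L * e powr (1 - p) * (\<bar>Y z\<bar> powr p * J z))"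
        using vI Y by simp
      show "AE z in lborel. norm (b z * Y z) \<le>
          norm (L * e * (dv z powr p * J z) + L * e powr (1 - p) * (\<bar>Y z\<bar> powr p * J z))"
        using young[OF e, of Y] by eventually_elim auto
    qed measurable
    have "(\<integral>z. \<bar>b z * Y z\<bar> \<partial>lborel) \<le>
      (\<integral>z. L * e * (dv z powr p * J z) + L * e powr (1 - p) * (\<bar>Y z\<bar> powr p * J z) \<partial>lborel)"
      using vI Y I young[OF e, of Y] by (intro integral_mono_AE) auto
    also have "\<dots> = L * e * V + L * e powr (1 - p) * (\<integral>z. \<bar>Y z\<bar> powr p * J z \<partial>lborel)"
      using vI Y by (simp add: V_def)
    finally show "(\<integral>z. \<bar>b z * Y z\<bar> \<partial>lborel) \<le> \<dots>" .
  qed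
  define D where "D w = (\<integral>z. b z * dp w z \<partial>lborel)" for w
  have DI: "integrable lborel (\<lambda>z. b z * dp w z)" for w by (intro bI[where e = 1] dpI) auto
  show "integrable lborel (\<lambda>z. b z * (\<phi> (fst z) - \<phi> (snd z)))"
    using DI[of 0] by (simp add: dp_def)
  have Dcont: "\<exists>d>0. \<forall>w. norm w < d \<longrightarrow> \<bar>D w - D 0\<bar> \<le> e" if "e > 0" for e
  proof -
    \<comment> \<open>The two terms of \<open>bW\<close> are to be at most e/2 each: \<epsilon>
      settles the one with V, and then \<open>e1\<close> the one with \<epsilon>^(1-p). The summands
      1 allow L or V to be 0.\<close>
    define \<epsilon> where "\<epsilon> = e / (2 * (L + 1) * (V + 1))"
    have \<epsilon>: "\<epsilon> > 0" using that L V0 by (simp add: \<epsilon>_def)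
    define e1 where "e1 = e / (2 * (L + 1) * \<epsilon> powr (1 - p))"
    have e1: "e1 > 0" using that L \<epsilon> by (simp add: e1_def)
    obtain d where d: "d > 0" "\<And>h. norm h < d \<Longrightarrow>
      (\<integral>\<^sup>+z. ennreal (\<bar>F (z + h) - F z\<bar> powr p) \<partial>lborel) \<le> ennreal e1"
      using translation_continuous_Lp[of F p e1] FI p e1 by auto
    have "\<bar>D w - D 0\<bar> \<le> e" if w: "norm w < d / 2" for w
    proof -
      have "norm (- w, - w) \<le> norm w + norm w" using norm_Pair_le[of "-w" "-w"] by simp
      then have "norm (- w, - w) < d" using w by simp
      note d2 = d(2)[OF this]
      have eq: "\<bar>F (z + (- w, - w)) - F z\<bar> powr p = \<bar>dp w z - dp 0 z\<bar> powr p * J z" for z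
      proof -
        have "F (z + (- w, - w)) - F z = (dp w z - dp 0 z) * J z powr (1 / p)"
          unfolding shiftF by (simp add: F_def algebra_simps)
        then show ?thesis using p J0 by (simp add: abs_mult powr_mult powr_powr)
      qed
      have n: "(\<integral>\<^sup>+z. ennreal (\<bar>dp w z - dp 0 z\<bar> powr p * J z) \<partial>lborel) \<le> ennreal e1"
        using d2 by (simp add: eq)
      have I: "integrable lborel (\<lambda>z. \<bar>dp w z - dp 0 z\<bar> powr p * J z)"
        using n J0 by (intro integrableI_nonneg) (auto simp: less_top[symmetric] top_unique)
      have le: "(\<integral>z. \<bar>dp w z - dp 0 z\<bar> powr p * J z \<partial>lborel) \<le> e1"
        using n e1 J0 by (subst (asm) nn_integral_eq_integral[OF I]) (auto simp: ennreal_le_iff)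
      have "\<bar>D w - D 0\<bar> = \<bar>\<integral>z. b z * (dp w z - dp 0 z) \<partial>lborel\<bar>"
        unfolding D_def using DI by (subst Bochner_Integration.integral_diff[symmetric]) (auto simp: algebra_simps)
      also have "\<dots> \<le> (\<integral>z. \<bar>b z * (dp w z - dp 0 z)\<bar> \<partial>lborel)" by (rule integral_abs_bound)
      also have "\<dots> \<le> L * \<epsilon> * V + L * \<epsilon> powr (1 - p) * (\<integral>z. \<bar>dp w z - dp 0 z\<bar> powr p * J z \<partial>lborel)"
        by (intro bW I \<epsilon>) measurable
      also have "\<dots> \<le> (L + 1) * \<epsilon> * (V + 1) + (L + 1) * \<epsilon> powr (1 - p) * e1"
        using L \<epsilon> V0 le e1 J0 by (intro add_mono mult_mono) auto
      also have "\<dots> = e"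
      proof -
        have half: "(L + 1) * x * y = e / 2" if "x = e / (2 * (L + 1) * y)" "y > 0" for x y
          using that L by (simp add: divide_simps) (simp add: algebra_simps)
        from half[OF \<epsilon>_def] have "(L + 1) * \<epsilon> * (V + 1) = e / 2" using V0 by simp
        moreover have "(L + 1) * \<epsilon> powr (1 - p) * e1 = e / 2"
          using half[OF e1_def] \<epsilon> by (simp add: mult_ac)
        ultimately show ?thesis by simp
      qed
      finally show ?thesis .
    qed
    then show ?thesis using d(1) by (intro exI[of _ "d / 2"]) auto
  qed
  have "\<bar>D 0\<bar> \<le> e" if e: "e > 0" for e
  proof -
    obtain d where d: "d > 0" "\<And>w. norm w < d \<Longrightarrow> \<bar>D w - D 0\<bar> \<le> e" using Dcont[OF e] by blast
    \<comment> \<open>N enters because the mollifier with parameter \<epsilon> reaches as far as N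
      \<epsilon>. This distance must stay below d, so that D hardly changes, and below the gap
      between \<rho> and \<rho>', so that the mollified \<phi> is still supported in
      \<Omega>.\<close>
    define N where "N = real CARD('n)"
    have N: "N > 0" by (simp add: N_def)
    define \<epsilon> where "\<epsilon> = min d (\<rho>' - \<rho>) / (2 * N)"
    have \<epsilon>: "\<epsilon> > 0" "N * \<epsilon> < d" "N * \<epsilon> < \<rho>' - \<rho>"
      using d(1) \<rho> N by (auto simp: \<epsilon>_def min_def field_simps)
    define m :: "real^'n \<Rightarrow> real" where "m = mollifier \<epsilon>"
    have m0: "m w \<ge> 0" for w by (simp add: m_def mollifier_nonneg)
    have mz: "m w = 0" if "norm w > N * \<epsilon>" for w using that by (simp add: m_def N_def mollifier_eq_0)
    have mc: "continuous_on UNIV m" using C_k_mollifier[of 0 \<epsilon>] by (simp add: m_def)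
    have [measurable]: "m \<in> borel_measurable borel" using mc by (rule borel_measurable_continuous_onI)
    obtain B where B: "\<And>w. \<bar>m w\<bar> \<le> B" using bounded_support_bounded[OF mc mz] by blast
    have mI: "integrable lborel m"
    proof (rule Bochner_Integration.integrable_bound)
      show "integrable lborel (\<lambda>w::real^'n. B * indicator (cball 0 (N * \<epsilon>)) w)"
        by (intro integrable_mult_right integrable_real_indicator) (use emeasure_bounded_finite[OF bounded_cball] in auto)
      show "AE w in lborel. norm (m w) \<le> norm (B * indicator (cball 0 (N * \<epsilon>)) w)"
      proof (intro AE_I2)
        fix w show "norm (m w) \<le> norm (B * indicator (cball 0 (N * \<epsilon>)) w)"
          using B[of w] mz[of w] by (cases "norm w \<le> N * \<epsilon>") (auto simp: indicator_def)
      qed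
    qed measurable
    define M where "M = (\<integral>w. m w \<partial>lborel)"
    have M0: "M > 0"
    proof -
      have "M \<ge> 0" unfolding M_def using m0 by (intro integral_nonneg_AE) auto
      moreover have "M \<noteq> 0"
      proof
        assume "M = 0"
        then have "AE w in lborel. m w = 0"
          using integral_nonneg_eq_0_iff_AE[OF mI] m0 by (auto simp: M_def)
        moreover have "w \<notin> ball 0 \<epsilon>" if "m w = 0" for w
          using mollifier_pos[OF \<epsilon>(1), of w] that by (auto simp: m_def)
        ultimately have "AE w::real^'n in lborel. w \<notin> ball 0 \<epsilon>"
          by (auto elim: eventually_mono)
        then have "emeasure lborel (ball (0::real^'n) \<epsilon>) = 0"
          by (subst (asm) AE_iff_measurable[where N = "ball 0 \<epsilon>"]) auto
        then show False using emeasure_bounded_finite[OF bounded_ball, of "0::real^'n" \<epsilon>] content_ball_pos[OF \<epsilon>(1), of "0::real^'n"]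
          by (simp add: measure_def)
      qed
      ultimately show ?thesis by simp
    qed
    define \<psi> where "\<psi> x = (\<integral>y. \<phi> y * m (x - y) \<partial>lborel)" for x
    have \<phi>mI: "integrable lborel (\<lambda>y. \<phi> y * m (x - y))" for x
      by (rule integrable_conv[OF \<phi>1 mc mz])
    have \<psi>eq: "\<psi> x = (\<integral>w. \<phi> (x - w) * m w \<partial>lborel)"
      and \<phi>mI': "integrable lborel (\<lambda>w. \<phi> (x - w) * m w)" for x
      using lborel_integral_reflect_shift[of "\<lambda>y. \<phi> y * m (x - y)" x] \<phi>mI[of x] by (auto simp: \<psi>_def)
    have "\<psi> \<in> test_functions \<Omega>"
    proof -
      have "C_k k \<psi>" for k
        unfolding \<psi>_def using mz by (intro C_k_conv[OF \<phi>1]) (auto simp: m_def C_k_mollifier)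
      moreover have "{x. \<psi> x \<noteq> 0} \<subseteq> cball x0 (\<rho> + N * \<epsilon>)"
      proof
        fix x assume "x \<in> {x. \<psi> x \<noteq> 0}"
        show "x \<in> cball x0 (\<rho> + N * \<epsilon>)"
        proof (rule ccontr)
          assume *: "x \<notin> cball x0 (\<rho> + N * \<epsilon>)"
          have "\<phi> y * m (x - y) = 0" for y
          proof (cases "norm (x - y) > N * \<epsilon>")
            case False
            have "norm (x - x0) \<le> norm (x - y) + norm (y - x0)" by norm
            then have "norm (y - x0) > \<rho>" using * False by (auto simp: dist_norm norm_minus_commute)
            then show ?thesis using supp by simp
          qed (use mz in auto)
          then have "(\<lambda>y. \<phi> y * m (x - y)) = (\<lambda>y. 0)" by (intro ext)
          then have "\<psi> x = 0" by (simp only: \<psi>_def Bochner_Integration.integral_zero)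
          then show False using \<open>x \<in> _\<close> by simp
        qed
      qed
      then have c: "closure {x. \<psi> x \<noteq> 0} \<subseteq> cball x0 (\<rho> + N * \<epsilon>)" by (intro closure_minimal) auto
      moreover have "cball x0 (\<rho> + N * \<epsilon>) \<subseteq> ball x0 \<rho>'" using \<epsilon> by (auto simp: dist_norm)
      moreover have "compact (closure {x. \<psi> x \<noteq> 0})"
        using c by (metis bounded_cball bounded_subset closed_closure compact_eq_bounded_closed)
      ultimately show ?thesis using \<rho>(2) unfolding test_functions_def by auto
    qed
    then have "0 = (\<integral>z. b z * (\<psi> (fst z) - \<psi> (snd z)) \<partial>lborel)" using weak by simp
    \<comment> \<open>The difference of mollified values is the mollifier average of the differences
      \<open>dp w\<close>. Fubini then moves this average outside the weak form; it applies since
      the bound \<open>dpW\<close> on the seminorm of a translate is the same for every w.\<close>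
    also have "\<dots> = (\<integral>z. (\<integral>w. m w * (b z * dp w z) \<partial>lborel) \<partial>lborel)"
    proof (rule Bochner_Integration.integral_cong[OF refl])
      fix z :: "(real^'n) \<times> (real^'n)"
      have "b z * (\<psi> (fst z) - \<psi> (snd z)) = b z * (\<integral>w. \<phi> (fst z - w) * m w - \<phi> (snd z - w) * m w \<partial>lborel)"
        unfolding \<psi>eq using \<phi>mI' by simp
      also have "\<dots> = (\<integral>w. b z * (\<phi> (fst z - w) * m w - \<phi> (snd z - w) * m w) \<partial>lborel)" by simp
      also have "\<dots> = (\<integral>w. m w * (b z * dp w z) \<partial>lborel)"
        by (intro Bochner_Integration.integral_cong refl) (simp add: dp_def algebra_simps)
      finally show "b z * (\<psi> (fst z) - \<psi> (snd z)) = (\<integral>w. m w * (b z * dp w z) \<partial>lborel)" .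
    qed
    also have "\<dots> = (\<integral>w. (\<integral>z. m w * (b z * dp w z) \<partial>lborel) \<partial>lborel)"
    proof (rule lborel_pair.Fubini_integral)
      have [measurable]: "(\<lambda>(w, z). m w * (b z * dp w z)) \<in> borel_measurable (lborel \<Otimes>\<^sub>M lborel)"
        unfolding dp_def by measurable
      show "integrable (lborel \<Otimes>\<^sub>M lborel) (\<lambda>(w, z). m w * (b z * dp w z))"
      proof (rule lborel_pair.Fubini_integrable)
        show "AE w in lborel. integrable lborel (\<lambda>z. case (w, z) of (w, z) \<Rightarrow> m w * (b z * dp w z))"
          using DI by simp
        have "integrable lborel (\<lambda>w. \<integral>z. norm (m w * (b z * dp w z)) \<partial>lborel)"
        proof (rule Bochner_Integration.integrable_bound)
          show "integrable lborel (\<lambda>w. m w * (L * V + L * W))" using mI by simp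
          show "(\<lambda>w. \<integral>z. norm (m w * (b z * dp w z)) \<partial>lborel) \<in> borel_measurable lborel"
            unfolding dp_def by measurable
          show "AE w in lborel. norm (\<integral>z. norm (m w * (b z * dp w z)) \<partial>lborel) \<le> norm (m w * (L * V + L * W))"
          proof (intro AE_I2)
            fix w
            have "(\<integral>z. norm (m w * (b z * dp w z)) \<partial>lborel) = m w * (\<integral>z. \<bar>b z * dp w z\<bar> \<partial>lborel)"
              using m0 by (simp add: abs_mult)
            also have "\<dots> \<le> m w * (L * V + L * W)"
              using bW[of "dp w" 1] dpI dpW m0 by (intro mult_left_mono) auto
            finally have 1: "(\<integral>z. norm (m w * (b z * dp w z)) \<partial>lborel) \<le> m w * (L * V + L * W)" .
            have 2: "(\<integral>z. norm (m w * (b z * dp w z)) \<partial>lborel) \<ge> 0" by (intro integral_nonneg_AE) auto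
            show "norm (\<integral>z. norm (m w * (b z * dp w z)) \<partial>lborel) \<le> norm (m w * (L * V + L * W))"
              using 1 2 by simp
          qed
        qed
        then show "integrable lborel (\<lambda>w. \<integral>z. norm (case (w, z) of (w, z) \<Rightarrow> m w * (b z * dp w z)) \<partial>lborel)"
          by simp
      qed measurable
    qed
    also have "\<dots> = (\<integral>w. m w * D w \<partial>lborel)" by (simp add: D_def)
    finally have z: "(\<integral>w. m w * D w \<partial>lborel) = 0" by simp
    have [measurable]: "D \<in> borel_measurable borel"
      unfolding D_def[abs_def] dp_def by measurable
    have bd: "\<bar>m w * D w - m w * D 0\<bar> \<le> m w * e" for w
    proof (cases "norm w > N * \<epsilon>")
      case False
      then have "\<bar>D w - D 0\<bar> \<le> e" using \<epsilon> by (intro d(2)) auto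
      then have "m w * \<bar>D w - D 0\<bar> \<le> m w * e" using m0 by (intro mult_left_mono) auto
      moreover have "m w * D w - m w * D 0 = m w * (D w - D 0)" by (simp add: algebra_simps)
      ultimately show ?thesis using m0[of w] by (simp only: abs_mult abs_of_nonneg)
    qed (simp add: mz)
    have dI: "integrable lborel (\<lambda>w. m w * D w - m w * D 0)"
    proof (rule Bochner_Integration.integrable_bound)
      show "integrable lborel (\<lambda>w. m w * e)" using mI by simp
      show "AE w in lborel. norm (m w * D w - m w * D 0) \<le> norm (m w * e)"
        using bd by (intro AE_I2) (metis abs_ge_self order_trans real_norm_def)
    qed measurable
    have "integrable lborel (\<lambda>w. (m w * D w - m w * D 0) + m w * D 0)"
      using dI mI by (intro Bochner_Integration.integrable_add) auto
    then have mDI: "integrable lborel (\<lambda>w. m w * D w)" by simp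
    \<comment> \<open>Because the average of D vanishes, that of D - D 0 is - M D 0, while its
      integrand is at most e times the mollifier.\<close>
    have "M * \<bar>D 0\<bar> = \<bar>\<integral>w. m w * D w - m w * D 0 \<partial>lborel\<bar>"
      using mDI mI z M0 by (simp add: M_def abs_mult)
    also have "\<dots> \<le> (\<integral>w. m w * e \<partial>lborel)"
      using mI dI bd by (intro integral_abs_bound_integral) auto
    also have "\<dots> = M * e" by (simp add: M_def)
    finally show ?thesis using M0 by simp
  qed
  then have "\<bar>D 0\<bar> \<le> 0 + e" if "e > 0" for e using that by simp
  then have "\<bar>D 0\<bar> \<le> 0" by (rule field_le_epsilon)
  then show "(\<integral>z. b z * (\<phi> (fst z) - \<phi> (snd z)) \<partial>lborel) = 0" by (simp add: D_def dp_def)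
qed

section \<open>Kernel integrals and the pointwise Caccioppoli inequality\<close>

lemma emeasure_lborel_ball:
  fixes x :: "'a::euclidean_space"
  assumes "r \<ge> 0"
  shows "emeasure lborel (ball x r) = ennreal (unit_ball_vol (real DIM('a)) * r ^ DIM('a))"
  using emeasure_ball[of r x] assms by simp

lemma sets_borel_ball [measurable]: "ball (x::'a::euclidean_space) r \<in> sets borel" by simp

text \<open>Takes the place of polar coordinates. By hypothesis f is pointwise at most the sum of
  \<open>c i\<close> over those balls that contain z, and the masses of the summands decay
  geometrically.\<close>

lemma nn_integral_le_geometric:
  fixes f :: "'a::euclidean_space \<Rightarrow> real" and r :: "nat \<Rightarrow> real"
  assumes [measurable]: "f \<in> borel_measurable borel"
    and c: "\<And>i. c i \<ge> 0" and r: "\<And>i. r i > 0"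
    and f: "\<And>z. f z > 0 \<Longrightarrow> \<exists>i. norm z < r i \<and> f z \<le> c i"
    and q: "0 \<le> q" "q < 1" and A: "A \<ge> 0"
    and cr: "\<And>i. c i * r i ^ DIM('a) \<le> A * q ^ i"
  shows "(\<integral>\<^sup>+z. ennreal (f z) \<partial>lborel) \<le> ennreal (unit_ball_vol (real DIM('a)) * A / (1 - q))"
proof -
  let ?w = "unit_ball_vol (real DIM('a))"
  have "(\<integral>\<^sup>+z. ennreal (f z) \<partial>lborel) \<le> (\<integral>\<^sup>+z. (\<Sum>i. ennreal (c i) * indicator (ball 0 (r i)) z) \<partial>(lborel :: 'a measure))"
  proof (intro nn_integral_mono)
    fix z
    show "ennreal (f z) \<le> (\<Sum>i. ennreal (c i) * indicator (ball 0 (r i)) z)"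
    proof (cases "f z > 0")
      case True
      then obtain i where i: "norm z < r i" "f z \<le> c i" using f by blast
      let ?g = "\<lambda>i. ennreal (c i) * indicator (ball 0 (r i)) z :: ennreal"
      have "ennreal (f z) \<le> ?g i"
        using i by (simp add: ennreal_leI)
      also have "?g i \<le> suminf ?g"
      proof -
        have "sum ?g {i} \<le> suminf ?g" by (rule sum_le_suminf) auto
        moreover have "sum g {i} = g i" for g :: "nat \<Rightarrow> ennreal" by simp
        ultimately show ?thesis by metis
      qed
      finally show ?thesis .
    qed (simp add: ennreal_neg)
  qed
  also have "\<dots> = (\<Sum>i. ennreal (c i) * emeasure lborel (ball (0::'a) (r i)))"
    by (subst nn_integral_suminf) (measurable, auto simp: nn_integral_cmult_indicator)
  also have "\<dots> \<le> (\<Sum>i. ennreal (?w * A * q ^ i))"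
  proof (rule suminf_le)
    fix i
    have "ennreal (c i) * emeasure lborel (ball (0::'a) (r i)) = ennreal (?w * (c i * r i ^ DIM('a)))"
      using c[of i] r[of i] by (simp add: emeasure_lborel_ball ennreal_mult[symmetric] mult_ac)
    also have "\<dots> \<le> ennreal (?w * A * q ^ i)"
      using mult_left_mono[OF cr[of i], of ?w] by (intro ennreal_leI) (simp add: mult_ac)
    finally show "ennreal (c i) * emeasure lborel (ball (0::'a) (r i)) \<le> ennreal (?w * A * q ^ i)" .
  qed auto
  also have "\<dots> = ennreal (?w * A / (1 - q))"
  proof (rule suminf_ennreal_eq)
    have "(\<lambda>i. ?w * A * q ^ i) sums (?w * A * (1 / (1 - q)))"
      using q by (intro sums_mult geometric_sums) auto
    then show "(\<lambda>i. ?w * A * q ^ i) sums (?w * A / (1 - q))" by simp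
  qed (use q A in auto)
  finally show ?thesis .
qed

lemma dyadic_shell:
  fixes t :: real
  assumes "0 < t" "t < 1"
  obtains i :: nat where "(1/2) ^ Suc i \<le> t" "t < (1/2) ^ i"
proof -
  obtain n where n: "(1/2) ^ n < t" using real_arch_pow_inv[of t "1/2"] assms by auto
  define m where "m = (LEAST n. (1/2) ^ n \<le> t)"
  have m: "(1/2) ^ m \<le> t" unfolding m_def by (rule LeastI[of _ n]) (use n in simp)
  have "m \<noteq> 0" using m assms by (intro notI) simp
  then obtain i where i: "m = Suc i" by (cases m) auto
  have "\<not> (1/2) ^ i \<le> t" using not_less_Least[of i "\<lambda>n. (1/2) ^ n \<le> t"] i by (simp add: m_def)
  then show ?thesis using m i by (intro that[of i]) auto
qed

lemma nn_integral_sing_kernel_near: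
  fixes \<gamma> :: real
  assumes "\<gamma> > 0"
  obtains c where "c > 0" "\<And>R. R > 0 \<Longrightarrow>
    (\<integral>\<^sup>+z. ennreal (indicator (ball 0 R) z * sing_kernel (- \<gamma>) z) \<partial>(lborel :: 'a::euclidean_space measure)) \<le> ennreal (c * R powr \<gamma>)"
proof -
  let ?n = "real DIM('a)" and ?w = "unit_ball_vol (real DIM('a))"
  define q :: real where "q = (1/2) powr \<gamma>"
  have q: "0 \<le> q" "q < 1" using assms powr_less_mono2[of _ "1/2" 1] by (auto simp: q_def)
  show ?thesis
  proof (rule that)
    show "?w * 2 powr ?n / (1 - q) > 0" using q by simp
    fix R :: real assume R: "R > 0"
    \<comment> \<open>On the shell between 2^(-i-1) R and 2^(-i) R the decreasing factor |z|^(-n) is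
      bounded by its value at the inner radius, the increasing factor |z|^\<gamma> by its value at
      the outer one.\<close>
    define c where "c i = ((1/2) ^ Suc i * R) powr (- ?n) * ((1/2) ^ i * R) powr \<gamma>" for i
    have "(\<integral>\<^sup>+z. ennreal (indicator (ball 0 R) z * sing_kernel (- \<gamma>) z) \<partial>(lborel :: 'a measure)) \<le>
      ennreal (?w * (2 powr ?n * R powr \<gamma>) / (1 - q))"
    proof (rule nn_integral_le_geometric[where c = c and r = "\<lambda>i. (1/2) ^ i * R"])
      show "(\<lambda>z::'a. indicator (ball 0 R) z * sing_kernel (- \<gamma>) z :: real) \<in> borel_measurable borel" by measurable
      show "c i \<ge> 0" "(1/2) ^ i * R > 0" for i using R by (auto simp: c_def)
      fix z :: 'a assume z: "indicator (ball 0 R) z * sing_kernel (- \<gamma>) z > 0"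
      then have "z \<noteq> 0" by auto
      have zR: "norm z < R" using z by (cases "norm z < R") auto
      obtain i where i: "(1/2) ^ Suc i \<le> norm z / R" "norm z / R < (1/2) ^ i"
        using dyadic_shell[of "norm z / R"] \<open>z \<noteq> 0\<close> zR R by (auto simp: field_simps)
      have i': "(1/2) ^ Suc i * R \<le> norm z" "norm z < (1/2) ^ i * R"
        using i R by (simp_all only: pos_le_divide_eq pos_divide_less_eq)
      have pos: "(1/2) ^ Suc i * R > 0" using R by simp
      have "sing_kernel (- \<gamma>) z = norm z powr (- ?n) * norm z powr \<gamma>"
        by (simp add: sing_kernel_def powr_add[symmetric])
      also have "\<dots> \<le> c i" unfolding c_def
        using i' pos assms R by (intro mult_mono powr_mono2 powr_mono2') auto
      finally show "\<exists>i. norm z < (1/2) ^ i * R \<and> indicator (ball 0 R) z * sing_kernel (- \<gamma>) z \<le> c i"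
        using i' zR by (intro exI[of _ i]) simp
    next
      fix i
      have e: "(1/2 :: real) ^ i = (1/2) powr i" for i by (simp add: powr_realpow)
      have "c i * ((1/2) ^ i * R) ^ DIM('a) = (((1/2) ^ Suc i * R) powr (- ?n) * ((1/2) ^ i * R) powr ?n) * ((1/2) ^ i * R) powr \<gamma>"
        using R by (simp add: c_def powr_realpow)
      also have "((1/2) ^ Suc i * R) powr (- ?n) * ((1/2) ^ i * R) powr ?n = 2 powr ?n"
      proof -
        have "((1/2) ^ Suc i * R) powr (- ?n) = 2 powr ?n * ((1/2) ^ i * R) powr (- ?n)"
        proof -
          have "((1/2) ^ Suc i * R) = (1/2) * ((1/2) ^ i * R)" by simp
          then have "((1/2) ^ Suc i * R) powr (- ?n) = (1/2) powr (- ?n) * ((1/2) ^ i * R) powr (- ?n)"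
            using R by (simp only: powr_mult)
          also have "(1/2 :: real) powr (- ?n) = 2 powr ?n" by (simp add: powr_minus powr_divide)
          finally show ?thesis .
        qed
        then show ?thesis using R by (simp add: powr_minus)
      qed
      also have "((1/2) ^ i * R) powr \<gamma> = q ^ i * R powr \<gamma>"
        using R by (simp add: powr_mult q_def e powr_powr powr_realpow[symmetric] mult.commute)
      finally show "c i * ((1/2) ^ i * R) ^ DIM('a) \<le> (2 powr ?n * R powr \<gamma>) * q ^ i" by simp
    qed (use q in auto)
    then show "(\<integral>\<^sup>+z. ennreal (indicator (ball 0 R) z * sing_kernel (- \<gamma>) z) \<partial>(lborel :: 'a measure)) \<le>
      ennreal (?w * 2 powr ?n / (1 - q) * R powr \<gamma>)" by (simp add: mult_ac)
  qed
qed

lemma nn_integral_sing_kernel_far: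
  fixes \<beta> :: real
  assumes "\<beta> > 0"
  obtains c where "c > 0" "\<And>R. R > 0 \<Longrightarrow>
    (\<integral>\<^sup>+z. ennreal (indicator (- ball 0 R) z * sing_kernel \<beta> z) \<partial>(lborel :: 'a::euclidean_space measure)) \<le> ennreal (c * R powr (- \<beta>))"
proof -
  let ?n = "real DIM('a)" and ?w = "unit_ball_vol (real DIM('a))"
  define q :: real where "q = (1/2) powr \<beta>"
  have q: "0 \<le> q" "q < 1" using assms powr_less_mono2[of _ "1/2" 1] by (auto simp: q_def)
  show ?thesis
  proof (rule that)
    show "?w * 2 powr ?n / (1 - q) > 0" using q by simp
    fix R :: real assume R: "R > 0"
    define c where "c i = (2 ^ i * R) powr (- (?n + \<beta>))" for i
    have "(\<integral>\<^sup>+z. ennreal (indicator (- ball 0 R) z * sing_kernel \<beta> z) \<partial>(lborel :: 'a measure)) \<le>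
      ennreal (?w * (2 powr ?n * R powr (- \<beta>)) / (1 - q))"
    proof (rule nn_integral_le_geometric[where c = c and r = "\<lambda>i. 2 ^ Suc i * R"])
      show "(\<lambda>z::'a. indicator (- ball 0 R) z * sing_kernel \<beta> z :: real) \<in> borel_measurable borel" by measurable
      show "c i \<ge> 0" "2 ^ Suc i * R > 0" for i using R by (auto simp: c_def)
      fix z :: 'a assume z: "indicator (- ball 0 R) z * sing_kernel \<beta> z > 0"
      then have zR: "norm z \<ge> R" by (cases "norm z < R") auto
      have z0: "norm z > 0" using zR R by linarith
      \<comment> \<open>Half of the ratio, because R / |z| may equal 1 and
        \<open>dyadic_shell\<close> wants a number strictly below 1. The index comes out one too
        large, so for i = Suc j the shell j is used, except on the outer sphere of that shell, which
        its open ball misses and the ball of index i contains.\<close>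
      obtain i where i: "(1/2) ^ Suc i \<le> R / norm z / 2" "R / norm z / 2 < (1/2) ^ i"
        using dyadic_shell[of "R / norm z / 2"] z0 zR R by (auto simp: field_simps)
      have i': "norm z \<le> 2 ^ i * R" "2 ^ i * R < 2 * norm z"
        using i z0 by (auto simp: field_simps power_divide)
      show "\<exists>i. norm z < 2 ^ Suc i * R \<and> indicator (- ball 0 R) z * sing_kernel \<beta> z \<le> c i"
      proof (cases i)
        case 0
        then have "norm z = R" using i' zR by auto
        then show ?thesis using R zR by (intro exI[of _ 0]) (auto simp: sing_kernel_def c_def)
      next
        case (Suc j)
        have "sing_kernel \<beta> z \<le> c j" unfolding c_def sing_kernel_def
          using i'(2) Suc R assms by (intro powr_mono2') auto
        moreover have "norm z < 2 ^ Suc i * R" 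
          using i'(1) R by (auto simp: field_simps intro: order.strict_trans1)
        moreover have "norm z < 2 ^ Suc j * R \<or> norm z = 2 ^ Suc j * R" using i'(1) Suc by auto
        ultimately show ?thesis
        proof (elim disjE)
          assume "norm z = 2 ^ Suc j * R"
          then show ?thesis using zR R by (intro exI[of _ i]) (auto simp: Suc c_def sing_kernel_def)
        qed (use zR in \<open>auto intro!: exI[of _ j]\<close>)
      qed
    next
      fix i
      have e: "(2 :: real) ^ i = 2 powr i" for i by (simp add: powr_realpow)
      have "c i * (2 ^ Suc i * R) ^ DIM('a) = ((2 ^ i * R) powr (- (?n + \<beta>)) * (2 * (2 ^ i * R)) powr ?n)"
        using R by (simp add: c_def powr_realpow mult_ac)
      also have "(2 * (2 ^ i * R)) powr ?n = 2 powr ?n * (2 ^ i * R) powr ?n"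
        using R by (simp only: powr_mult)
      also have "(2 ^ i * R) powr (- (?n + \<beta>)) * (2 powr ?n * (2 ^ i * R) powr ?n) =
          2 powr ?n * ((2 ^ i * R) powr (- (?n + \<beta>)) * (2 ^ i * R) powr ?n)" by simp
      also have "(2 ^ i * R) powr (- (?n + \<beta>)) * (2 ^ i * R) powr ?n = (2 ^ i * R) powr (- \<beta>)"
        by (simp add: powr_add[symmetric])
      also have "(2 ^ i * R) powr (- \<beta>) = q ^ i * R powr (- \<beta>)"
      proof -
        have "(2 ^ i) powr (- \<beta>) = q ^ i"
          by (simp add: q_def e powr_powr powr_realpow[symmetric] powr_divide powr_minus inverse_eq_divide mult.commute)
        then show ?thesis using R by (simp add: powr_mult)
      qed
      finally show "c i * (2 ^ Suc i * R) ^ DIM('a) \<le> (2 powr ?n * R powr (- \<beta>)) * q ^ i" by simp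
    qed (use q in auto)
    then show "(\<integral>\<^sup>+z. ennreal (indicator (- ball 0 R) z * sing_kernel \<beta> z) \<partial>(lborel :: 'a measure)) \<le>
      ennreal (?w * 2 powr ?n / (1 - q) * R powr (- \<beta>))" by (simp add: mult_ac)
  qed
qed

section \<open>Pointwise inequalities behind the energy estimate\<close>

lemma powr_diff_le:
  fixes x y p :: real
  assumes "0 \<le> x" "x < y" "p > 1"
  shows "y powr p - x powr p \<le> p * y powr (p - 1) * (y - x)"
proof (cases "x = 0")
  case True
  have "y powr (p - 1) * y = y powr p" using assms by (simp add: powr_diff)
  moreover have "1 * y powr p \<le> p * y powr p" using assms by (intro mult_right_mono) auto
  ultimately show ?thesis using True by (simp add: mult.assoc)
next
  case False
  have "\<exists>z. x < z \<and> z < y \<and> y powr p - x powr p = (y - x) * (p * z powr (p - 1))"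
  proof (rule MVT2[where f' = "\<lambda>z. p * z powr (p - 1)", of x y "\<lambda>z. z powr p"])
    fix z assume z: "x \<le> z" "z \<le> y"
    show "((\<lambda>z. z powr p) has_real_derivative p * z powr (p - 1)) (at z)"
      using z False assms by (intro has_real_derivative_powr) auto
  qed fact
  then obtain z where z: "x < z" "z < y" "y powr p - x powr p = (y - x) * (p * z powr (p - 1))" by blast
  have "z powr (p - 1) \<le> y powr (p - 1)" using z assms by (intro powr_mono2) auto
  then have "(y - x) * (p * z powr (p - 1)) \<le> (y - x) * (p * y powr (p - 1))"
    using assms by (intro mult_left_mono) auto
  then show ?thesis using z by (simp add: mult_ac)
qed

text \<open>Here x and y stand for two values of v - k, a and c for the values of the cutoff, b for
  the density of the weak form and J for the kernel. For pairs across the level, b and T have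
  matching signs and nothing is lost. For two values above the level the only harmful part comes
  from a \<noteq> c; Young's inequality pays for it out of the energy of the pair, which is given up
  entirely. The last two bounds serve pairs with one point outside the support of the cutoff: there
  the error should carry the power p - 1 of the outer value, so that after integration it becomes a
  tail times a first moment.\<close>

lemma caccioppoli_pointwise:
  fixes x y a c b J L p :: real
  assumes p: "p > 1" and L: "L \<ge> 1" and J: "J \<ge> 0"
    and a: "0 \<le> a" "a \<le> 1" and c: "0 \<le> c" "c \<le> 1"
    and lo: "\<bar>x - y\<bar> powr p * J / L \<le> b * (x - y)" and up: "\<bar>b\<bar> \<le> L * \<bar>x - y\<bar> powr (p - 1) * J"
  defines "T \<equiv> max 0 x * a powr p - max 0 y * c powr p"
    and "G \<equiv> (if x > 0 \<and> y \<le> 0 then (x - y) powr (p - 1) * x * a powr p * J / L else 0)"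
  shows "b * T \<ge> G - L * p * (L\<^sup>2 * p) powr (p - 1) *
      (max 0 x powr p + max 0 y powr p) * \<bar>a - c\<bar> powr p * J" (is "_ \<ge> G - ?C * _ * _ * J")
    and "c = 0 \<Longrightarrow> b * T \<ge> G - L * (max 0 y powr (p - 1) * max 0 x * a powr p * J)"
    and "a = 0 \<Longrightarrow> b * T \<ge> G - L * (max 0 x powr (p - 1) * max 0 y * c powr p * J)"
proof -
  have C: "?C \<ge> 0" using L p by simp
  have near: "b * T \<ge> -(?C * (x powr p * \<bar>a - c\<bar> powr p) * J)"
    if xy: "y \<le> x" "y > 0" and a: "0 \<le> a" and c: "0 \<le> c"
      and lo: "\<bar>x - y\<bar> powr p * J / L \<le> b * (x - y)" and up: "\<bar>b\<bar> \<le> L * \<bar>x - y\<bar> powr (p - 1) * J"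
      and T: "T = x * a powr p - y * c powr p"
    for x y a c b T
  proof -
    have b0: "b \<ge> 0"
    proof (cases "x = y")
      case True then show ?thesis using up by simp
    next
      case False
      have "0 \<le> \<bar>x - y\<bar> powr p * J / L" using J L by simp
      then have "0 \<le> b * (x - y)" using lo by linarith
      then show ?thesis using False xy by (simp add: zero_le_mult_iff)
    qed
    have neg: "-(?C * (x powr p * \<bar>a - c\<bar> powr p) * J) \<le> 0" using C J by simp
    show ?thesis
    proof (cases "a \<ge> c")
      case True
      have "y * c powr p \<le> x * a powr p" using xy c True p by (intro mult_mono powr_mono2) auto
      then have "b * T \<ge> 0" using T b0 by simp
      then show ?thesis using neg by linarith
    next
      case False
      \<comment> \<open>The cutoff is smaller at the larger value. Then b T splits into an energy
        part, which dominates X^p J / L, and a cutoff part, which is of the form X^(p-1) Y.\<close>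
      define X where "X = (x - y) * c"
      define Y where "Y = x * (c - a)"
      have X0: "X \<ge> 0" and Y0: "Y \<ge> 0" using xy c False by (auto simp: X_def Y_def)
      have d: "c powr p - a powr p \<le> p * c powr (p - 1) * (c - a)"
        using powr_diff_le[of a c p] a False p by simp
      have "b * T = b * (x - y) * c powr p - b * (x * (c powr p - a powr p))"
        by (simp add: T algebra_simps)
      moreover have "b * (x - y) * c powr p \<ge> X powr p * J / L"
      proof -
        have "X powr p * J / L = (\<bar>x - y\<bar> powr p * J / L) * c powr p"
          using xy c by (simp add: X_def powr_mult)
        also have "\<dots> \<le> b * (x - y) * c powr p" using lo by (intro mult_right_mono) auto
        finally show ?thesis .
      qed
      moreover have "b * (x * (c powr p - a powr p)) \<le> X powr p * J / L + ?C * Y powr p * J"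
      proof -
        have "b * (x * (c powr p - a powr p)) \<le> (L * \<bar>x - y\<bar> powr (p - 1) * J) * (x * (p * c powr (p - 1) * (c - a)))"
          using up xy d False a p L J by (intro mult_mono mult_nonneg_nonneg) (auto intro: powr_mono2)
        also have "\<dots> = L * p * J * (X powr (p - 1) * Y)"
          using xy c by (simp add: X_def Y_def powr_mult)
        \<comment> \<open>The parameter \<open>1 / (L\<^sup>2 * p)\<close> is chosen so that the
          X-term produced here is exactly X^p J / L, the energy available.\<close>
        also have "\<dots> \<le> L * p * J * (1 / (L\<^sup>2 * p) * X powr p + (1 / (L\<^sup>2 * p)) powr (1 - p) * Y powr p)"
          using L p J X0 Y0 by (intro mult_left_mono powr_young) auto
        also have "(1 / (L\<^sup>2 * p)) powr (1 - p) = (L\<^sup>2 * p) powr (p - 1)"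
        proof -
          have "(1 / (L\<^sup>2 * p)) powr (1 - p) = 1 / (L\<^sup>2 * p) powr (1 - p)" using L p by (simp add: powr_divide)
          also have "\<dots> = (L\<^sup>2 * p) powr (- (1 - p))" by (simp only: powr_minus inverse_eq_divide)
          finally show ?thesis by simp
        qed
        also have "L * p * J * (1 / (L\<^sup>2 * p) * X powr p + (L\<^sup>2 * p) powr (p - 1) * Y powr p) =
            X powr p * J / L + ?C * Y powr p * J"
          using L p by (simp add: field_simps power2_eq_square)
        finally show ?thesis .
      qed
      ultimately have "b * T \<ge> - (?C * Y powr p * J)" by linarith
      moreover have "Y powr p = x powr p * \<bar>a - c\<bar> powr p"
        using xy False by (simp add: Y_def powr_mult)
      ultimately show ?thesis by (simp only: mult.assoc)
    qed
  qed
  \<comment> \<open>Exchanging the two points turns b and T into their negatives, so half of the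
    cases follow by symmetry.\<close>
  have lo': "\<bar>y - x\<bar> powr p * J / L \<le> (- b) * (y - x)" and up': "\<bar>- b\<bar> \<le> L * \<bar>y - x\<bar> powr (p - 1) * J"
    using lo up by (auto simp: abs_minus_commute algebra_simps)
  have cross: "b * T \<ge> G" if "x > 0" "y \<le> 0"
  proof -
    have "x - y > 0" using that by simp
    have "(x - y) powr (p - 1) * J / L \<le> b"
    proof -
      have "(x - y) powr p = (x - y) powr (p - 1) * (x - y)" using \<open>x - y > 0\<close> by (simp add: powr_diff)
      then have "((x - y) powr (p - 1) * J / L) * (x - y) \<le> b * (x - y)" using lo \<open>x - y > 0\<close> by (simp add: mult_ac)
      then show ?thesis using \<open>x - y > 0\<close> by (rule mult_right_le_imp_le)
    qed
    then have "((x - y) powr (p - 1) * J / L) * (x * a powr p) \<le> b * (x * a powr p)"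
      using that by (intro mult_right_mono) auto
    then show ?thesis using that by (simp add: T_def G_def mult_ac)
  qed
  have cross': "b * T \<ge> 0" if "y > 0" "x \<le> 0"
  proof -
    have "y - x > 0" using that by simp
    have "0 \<le> \<bar>x - y\<bar> powr p * J / L" using J L by simp
    then have "b * (x - y) \<ge> 0" using lo by linarith
    then have "b \<le> 0" using that by (simp add: zero_le_mult_iff)
    then show ?thesis using that by (simp add: T_def mult_nonpos_nonneg)
  qed
  have zero: "b * T = 0" if "x \<le> 0" "y \<le> 0" using that by (simp add: T_def)
  have G0: "G = 0" if "\<not> (x > 0 \<and> y \<le> 0)" unfolding G_def by (rule if_not_P[OF that])
  show "b * T \<ge> G - ?C * (max 0 x powr p + max 0 y powr p) * \<bar>a - c\<bar> powr p * J"
  proof -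
    have nn: "?C * (max 0 x powr p + max 0 y powr p) * \<bar>a - c\<bar> powr p * J \<ge> 0" using C J by simp
    consider "x > 0" "y \<le> 0" | "y > 0" "x \<le> 0" | "x \<le> 0" "y \<le> 0" | "y > 0" "y \<le> x" | "x > 0" "x \<le> y" by linarith
    then show ?thesis
    proof cases
      case 1 then show ?thesis using cross nn by linarith
    next
      case 2 then show ?thesis using cross' G0 nn by linarith
    next
      case 3 then show ?thesis using zero G0 nn by linarith
    next
      case 4
      then have "b * T \<ge> -(?C * (x powr p * \<bar>a - c\<bar> powr p) * J)"
        using a c lo up by (intro near[of y x]) (auto simp: T_def)
      moreover have "?C * (x powr p * \<bar>a - c\<bar> powr p) * J \<le> ?C * (max 0 x powr p + max 0 y powr p) * \<bar>a - c\<bar> powr p * J"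
        unfolding mult.assoc[of ?C] using C J 4
        by (intro mult_right_mono mult_left_mono) auto
      ultimately show ?thesis using 4 G0 by linarith
    next
      case 5
      then have "(- b) * (- T) \<ge> -(?C * (y powr p * \<bar>c - a\<bar> powr p) * J)"
        using a c lo' up' by (intro near[of x y]) (auto simp: T_def)
      moreover have "?C * (y powr p * \<bar>c - a\<bar> powr p) * J \<le> ?C * (max 0 x powr p + max 0 y powr p) * \<bar>a - c\<bar> powr p * J"
        unfolding mult.assoc[of ?C] abs_minus_commute[of c a] using C J 5
        by (intro mult_right_mono mult_left_mono) auto
      ultimately show ?thesis using 5 G0 by simp
    qed
  qed
  \<comment> \<open>Since 0 < x < y, the difference is at most y, and so b is bounded by the power p
    - 1 of the outer value alone.\<close>
  have far: "b * T \<ge> - (L * (y powr (p - 1) * x * a powr p * J))"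
    if xy: "x > 0" "x < y" and a: "a \<ge> 0" and up: "\<bar>b\<bar> \<le> L * \<bar>x - y\<bar> powr (p - 1) * J" and T: "T = x * a powr p"
    for x y a b T
  proof -
    have "\<bar>b\<bar> * (x * a powr p) \<le> (L * y powr (p - 1) * J) * (x * a powr p)"
    proof (intro mult_right_mono order_trans[OF up] mult_left_mono powr_mono2)
    qed (use xy L J p in auto)
    moreover have "b * T \<ge> - (\<bar>b\<bar> * (x * a powr p))"
      unfolding T using xy by (smt (verit) mult_minus_left mult_nonneg_nonneg mult_right_mono powr_ge_zero)
    ultimately show ?thesis by (simp add: mult_ac)
  qed
  show "b * T \<ge> G - L * (max 0 y powr (p - 1) * max 0 x * a powr p * J)" if "c = 0"
  proof -
    have nn: "L * (max 0 y powr (p - 1) * max 0 x * a powr p * J) \<ge> 0" using L J by simp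
    have T: "T = max 0 x * a powr p" using that p by (simp add: T_def)
    consider "x > 0" "y \<le> 0" | "x \<le> 0" | "y > 0" "y \<le> x" | "x > 0" "x < y" by linarith
    then show ?thesis
    proof cases
      case 1 then show ?thesis using cross nn by linarith
    next
      case 2
      then have "b * T = 0" by (simp add: T)
      then show ?thesis using G0 nn 2 by linarith
    next
      case 3
      have "0 \<le> \<bar>x - y\<bar> powr p * J / L" using J L by simp
      then have "b * (x - y) \<ge> 0" using lo by linarith
      then have "b \<ge> 0 \<or> x = y" using 3 by (auto simp: zero_le_mult_iff)
      then have "b \<ge> 0" using up by auto
      then have "b * T \<ge> 0" by (simp add: T)
      then show ?thesis using G0 nn 3 by linarith
    next
      case 4
      then have "b * T \<ge> - (L * (y powr (p - 1) * x * a powr p * J))"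
        using a up by (intro far) (auto simp: T)
      then show ?thesis using 4 G0 by simp
    qed
  qed
  show "b * T \<ge> G - L * (max 0 x powr (p - 1) * max 0 y * c powr p * J)" if "a = 0"
  proof -
    have nn: "L * (max 0 x powr (p - 1) * max 0 y * c powr p * J) \<ge> 0" using L J by simp
    have T: "- T = max 0 y * c powr p" using that p by (simp add: T_def)
    have G: "G = 0" using that p by (simp add: G_def)
    consider "y > 0" "x \<le> 0" | "y \<le> 0" | "x > 0" "x \<le> y" "y > 0" | "y > 0" "y < x" by linarith
    then show ?thesis
    proof cases
      case 1 then show ?thesis using cross' nn G by linarith
    next
      case 2
      then have "b * T = 0" using T by simp
      then show ?thesis using G nn 2 by linarith
    next
      case 3
      have "0 \<le> \<bar>x - y\<bar> powr p * J / L" using J L by simp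
      then have "b * (x - y) \<ge> 0" using lo by linarith
      then have "b \<le> 0 \<or> x = y" using 3 by (auto simp: zero_le_mult_iff)
      then have "- b \<ge> 0" using up by auto
      then have "(- b) * (- T) \<ge> 0" unfolding T by (intro mult_nonneg_nonneg) auto
      then show ?thesis using G nn by simp
    next
      case 4
      then have "(- b) * (- T) \<ge> - (L * (x powr (p - 1) * y * c powr p * J))"
        using c up' by (intro far) (auto simp: T)
      then show ?thesis using 4 G by simp
    qed
  qed
qed

section \<open>Level sets and tails\<close>

lemma powr_le_1_plus: "0 \<le> t \<Longrightarrow> 0 \<le> e \<Longrightarrow> e \<le> p \<Longrightarrow> t powr e \<le> 1 + (t::real) powr p"
proof (cases "t \<le> 1")
  case True
  moreover assume "0 \<le> t" "0 \<le> e"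
  ultimately have "t powr e \<le> 1" by (simp add: powr_le1)
  then show ?thesis by (smt (verit) powr_ge_zero)
next
  case False
  moreover assume "0 \<le> t" "e \<le> p"
  ultimately show ?thesis by (intro order_trans[OF powr_mono[of e p t]]) auto
qed

lemma moment_bound:
  fixes u v K e p :: real
  assumes "\<bar>u\<bar> \<le> \<bar>v\<bar> + K" "0 \<le> K" "0 \<le> e" "e \<le> p"
  shows "\<bar>u\<bar> powr e \<le> (1 + 2 powr p * K powr p) + 2 powr p * \<bar>v\<bar> powr p"
proof -
  have "\<bar>u\<bar> powr e \<le> (\<bar>v\<bar> + K) powr e" using assms by (intro powr_mono2) auto
  also have "\<dots> \<le> 1 + (\<bar>v\<bar> + K) powr p" using assms by (intro powr_le_1_plus) auto
  also have "\<dots> \<le> 1 + 2 powr p * (\<bar>v\<bar> powr p + K powr p)"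
    using assms by (intro add_left_mono powr_add_le) auto
  finally show ?thesis by (simp add: algebra_simps)
qed

lemma integrable_moment:
  fixes u v :: "'a::euclidean_space \<Rightarrow> real"
  assumes v: "integrable lborel (\<lambda>x. \<bar>v x\<bar> powr p)"
    and [measurable]: "u \<in> borel_measurable borel" "A \<in> sets borel"
    and u: "\<And>x. \<bar>u x\<bar> \<le> \<bar>v x\<bar> + K" and K: "0 \<le> K" and e: "0 \<le> e" "e \<le> p"
    and A: "emeasure lborel A < \<infinity>"
  shows "integrable lborel (\<lambda>x. indicator A x * \<bar>u x\<bar> powr e)"
proof (rule Bochner_Integration.integrable_bound)
  show "integrable lborel (\<lambda>x. (1 + 2 powr p * K powr p) * indicator A x + 2 powr p * \<bar>v x\<bar> powr p)"
    using v A by (intro Bochner_Integration.integrable_add integrable_mult_right integrable_real_indicator) auto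
  show "AE x in lborel. norm (indicator A x * \<bar>u x\<bar> powr e) \<le>
      norm ((1 + 2 powr p * K powr p) * indicator A x + 2 powr p * \<bar>v x\<bar> powr p)"
    using moment_bound[OF u K e] by (intro AE_I2) (auto simp: indicator_def)
qed measurable

lemma integrable_sing_kernel_far:
  fixes x0 :: "'a::euclidean_space"
  assumes "\<beta> > 0" "\<rho> > 0"
  shows "integrable lborel (\<lambda>x. indicator (- ball x0 \<rho>) x * sing_kernel \<beta> (x - x0))"
    and "\<exists>c>0. \<forall>\<rho>>0. \<forall>x0::'a. (\<integral>x. indicator (- ball x0 \<rho>) x * sing_kernel \<beta> (x - x0) \<partial>lborel) \<le> c * \<rho> powr (- \<beta>)"
proof -
  obtain c where c: "c > 0" "\<And>R. R > 0 \<Longrightarrow>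
    (\<integral>\<^sup>+z. ennreal (indicator (- ball 0 R) z * sing_kernel \<beta> z) \<partial>(lborel :: 'a measure)) \<le> ennreal (c * R powr (- \<beta>))"
    using nn_integral_sing_kernel_far[OF assms(1)] by blast
  have n: "(\<integral>\<^sup>+x. ennreal (indicator (- ball x0 \<rho>) x * sing_kernel \<beta> (x - x0)) \<partial>lborel) \<le> ennreal (c * \<rho> powr (- \<beta>))"
    if "\<rho> > 0" for \<rho> and x0 :: 'a
  proof -
    let ?f = "\<lambda>z::'a. ennreal (indicator (- ball 0 \<rho>) z * sing_kernel \<beta> z)"
    have "(\<integral>\<^sup>+x. ennreal (indicator (- ball x0 \<rho>) x * sing_kernel \<beta> (x - x0)) \<partial>lborel) = (\<integral>\<^sup>+x. ?f (x + - x0) \<partial>lborel)"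
      by (intro nn_integral_cong) (auto simp: indicator_def dist_norm norm_minus_commute)
    also have "\<dots> = (\<integral>\<^sup>+x. ?f x \<partial>lborel)" by (rule nn_integral_lborel_shift) measurable
    finally show ?thesis using c(2)[OF that] by simp
  qed
  have i: "integrable lborel (\<lambda>x. indicator (- ball x0 \<rho>) x * sing_kernel \<beta> (x - x0))" if "\<rho> > 0" for \<rho> and x0 :: 'a
    using order.strict_trans1[OF n[OF that] ennreal_less_top] by (intro integrableI_nonneg) auto
  show "integrable lborel (\<lambda>x. indicator (- ball x0 \<rho>) x * sing_kernel \<beta> (x - x0))" by (rule i[OF assms(2)])
  have "(\<integral>x. indicator (- ball x0 \<rho>) x * sing_kernel \<beta> (x - x0) \<partial>lborel) \<le> c * \<rho> powr (- \<beta>)"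
    if "\<rho> > 0" for \<rho> and x0 :: 'a
    using n[OF that, of x0] c(1) by (subst (asm) nn_integral_eq_integral[OF i[OF that]]) (auto simp: ennreal_le_iff)
  then show "\<exists>c>0. \<forall>\<rho>>0. \<forall>x0::'a. (\<integral>x. indicator (- ball x0 \<rho>) x * sing_kernel \<beta> (x - x0) \<partial>lborel) \<le> c * \<rho> powr (- \<beta>)"
    using c(1) by blast
qed

lemma sing_kernel_le:
  fixes z :: "'a::euclidean_space"
  assumes "\<rho> > 0" "norm z \<ge> \<rho>" "\<beta> > 0"
  shows "sing_kernel \<beta> z \<le> \<rho> powr (- (real DIM('a) + \<beta>))"
  unfolding sing_kernel_def using assms by (intro powr_mono2') auto

lemma sing_kernel_ge:
  fixes z :: "'a::euclidean_space"
  assumes "z \<noteq> 0" "norm z \<le> \<rho>" "\<beta> > 0"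
  shows "\<rho> powr (- (real DIM('a) + \<beta>)) \<le> sing_kernel \<beta> z"
  unfolding sing_kernel_def using assms by (intro powr_mono2') auto

text \<open>Away from x0 the kernel is both bounded and integrable: its boundedness is used against
  |v|^p, its integrability against the constants that arise when lower powers are dominated by the
  p-th.\<close>

lemma integrable_tail:
  fixes u v :: "'a::euclidean_space \<Rightarrow> real"
  assumes v: "integrable lborel (\<lambda>x. \<bar>v x\<bar> powr p)"
    and [measurable]: "u \<in> borel_measurable borel"
    and u: "\<And>x. \<bar>u x\<bar> \<le> \<bar>v x\<bar> + K" and K: "0 \<le> K" and e: "0 \<le> e" "e \<le> p"
    and \<beta>: "\<beta> > 0" and \<rho>: "\<rho> > 0"
  shows "integrable lborel (\<lambda>x. indicator (- ball x0 \<rho>) x * \<bar>u x\<bar> powr e * sing_kernel \<beta> (x - x0))"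
proof (rule Bochner_Integration.integrable_bound)
  let ?D = "real DIM('a)"
  show "integrable lborel (\<lambda>x. (1 + 2 powr p * K powr p) * (indicator (- ball x0 \<rho>) x * sing_kernel \<beta> (x - x0)) +
      2 powr p * \<rho> powr (- (?D + \<beta>)) * \<bar>v x\<bar> powr p)"
    using v integrable_sing_kernel_far(1)[OF \<beta> \<rho>]
    by (intro Bochner_Integration.integrable_add integrable_mult_right) auto
  show "AE x in lborel. norm (indicator (- ball x0 \<rho>) x * \<bar>u x\<bar> powr e * sing_kernel \<beta> (x - x0)) \<le>
      norm ((1 + 2 powr p * K powr p) * (indicator (- ball x0 \<rho>) x * sing_kernel \<beta> (x - x0)) +
      2 powr p * \<rho> powr (- (?D + \<beta>)) * \<bar>v x\<bar> powr p)"
  proof (intro AE_I2)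
    fix x
    show "norm (indicator (- ball x0 \<rho>) x * \<bar>u x\<bar> powr e * sing_kernel \<beta> (x - x0)) \<le>
      norm ((1 + 2 powr p * K powr p) * (indicator (- ball x0 \<rho>) x * sing_kernel \<beta> (x - x0)) +
      2 powr p * \<rho> powr (- (?D + \<beta>)) * \<bar>v x\<bar> powr p)"
    proof (cases "x \<in> ball x0 \<rho>")
      case False
      then have s: "sing_kernel \<beta> (x - x0) \<le> \<rho> powr (- (?D + \<beta>))"
        using \<rho> \<beta> by (intro sing_kernel_le) (auto simp: dist_norm norm_minus_commute)
      have "\<bar>u x\<bar> powr e * sing_kernel \<beta> (x - x0) \<le>
          ((1 + 2 powr p * K powr p) + 2 powr p * \<bar>v x\<bar> powr p) * sing_kernel \<beta> (x - x0)"
        by (intro mult_right_mono moment_bound[OF u K e]) auto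
      also have "\<dots> \<le> (1 + 2 powr p * K powr p) * sing_kernel \<beta> (x - x0) + 2 powr p * \<rho> powr (- (?D + \<beta>)) * \<bar>v x\<bar> powr p"
        using mult_left_mono[OF s, of "2 powr p * \<bar>v x\<bar> powr p"] by (simp add: algebra_simps)
      finally show ?thesis using False by simp
    qed simp
  qed
qed measurable

definition level_moment :: "('a::euclidean_space \<Rightarrow> real) \<Rightarrow> 'a \<Rightarrow> real \<Rightarrow> real \<Rightarrow> real \<Rightarrow> real" where
  "level_moment v x0 k e \<rho> = (\<integral>x. indicator (ball x0 \<rho>) x * max 0 (v x - k) powr e \<partial>lborel)"

text \<open>In contrast to \<open>Tail\<close> there is neither the factor \<rho>^\<beta> nor an
  outer root, so this is a plain integral that decreases in both k and \<rho>.\<close>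

definition level_tail :: "real \<Rightarrow> real \<Rightarrow> ('a::euclidean_space \<Rightarrow> real) \<Rightarrow> 'a \<Rightarrow> real \<Rightarrow> real \<Rightarrow> real" where
  "level_tail p \<beta> v x0 k \<rho> =
    (\<integral>x. indicator (- ball x0 \<rho>) x * max 0 (v x - k) powr (p - 1) * sing_kernel \<beta> (x - x0) \<partial>lborel)"

lemma level_integrable:
  fixes v :: "'a::euclidean_space \<Rightarrow> real"
  assumes v: "integrable lborel (\<lambda>x. \<bar>v x\<bar> powr p)" and [measurable]: "v \<in> borel_measurable borel"
    and p: "p > 1"
  shows "0 \<le> e \<Longrightarrow> e \<le> p \<Longrightarrow> integrable lborel (\<lambda>x. indicator (ball x0 \<rho>) x * max 0 (v x - k) powr e)"
    and "\<beta> > 0 \<Longrightarrow> \<rho> > 0 \<Longrightarrow>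
      integrable lborel (\<lambda>x. indicator (- ball x0 \<rho>) x * max 0 (v x - k) powr (p - 1) * sing_kernel \<beta> (x - x0))"
proof -
  have a: "\<bar>max 0 (v x - k)\<bar> = max 0 (v x - k)" for x by simp
  show "0 \<le> e \<Longrightarrow> e \<le> p \<Longrightarrow> integrable lborel (\<lambda>x. indicator (ball x0 \<rho>) x * max 0 (v x - k) powr e)"
    using integrable_moment[OF v, of "\<lambda>x. max 0 (v x - k)" "ball x0 \<rho>" "\<bar>k\<bar>" e] emeasure_bounded_finite[OF bounded_ball]
    unfolding a by force
  show "\<beta> > 0 \<Longrightarrow> \<rho> > 0 \<Longrightarrow>
      integrable lborel (\<lambda>x. indicator (- ball x0 \<rho>) x * max 0 (v x - k) powr (p - 1) * sing_kernel \<beta> (x - x0))"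
    using integrable_tail[OF v, of "\<lambda>x. max 0 (v x - k)" "\<bar>k\<bar>" "p - 1" \<beta> \<rho> x0] p
    unfolding a by force
qed

lemma level_moment_nonneg [simp]: "level_moment v x0 k e \<rho> \<ge> 0"
  unfolding level_moment_def by (intro integral_nonneg_AE) auto

lemma level_tail_nonneg [simp]: "level_tail p \<beta> v x0 k \<rho> \<ge> 0"
  unfolding level_tail_def by (intro integral_nonneg_AE) auto

section \<open>Double integrals of products and convolutions\<close>

lemma nn_integral_prod_mult:
  fixes f g :: "'a::euclidean_space \<Rightarrow> ennreal"
  assumes [measurable]: "f \<in> borel_measurable borel" "g \<in> borel_measurable borel"
  shows "(\<integral>\<^sup>+z. f (fst z) * g (snd z) \<partial>lborel) = (\<integral>\<^sup>+x. f x \<partial>lborel) * (\<integral>\<^sup>+y. g y \<partial>lborel)"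
proof -
  have "(\<integral>\<^sup>+z. f (fst z) * g (snd z) \<partial>lborel) = (\<integral>\<^sup>+z. f (fst z) * g (snd z) \<partial>(lborel \<Otimes>\<^sub>M lborel))"
    by (simp only: lborel_prod)
  also have "\<dots> = (\<integral>\<^sup>+x. \<integral>\<^sup>+y. f x * g y \<partial>lborel \<partial>lborel)"
    by (subst lborel.nn_integral_fst[symmetric]) auto
  also have "\<dots> = (\<integral>\<^sup>+x. f x * (\<integral>\<^sup>+y. g y \<partial>lborel) \<partial>lborel)"
    by (intro nn_integral_cong nn_integral_cmult) auto
  also have "\<dots> = (\<integral>\<^sup>+x. f x \<partial>lborel) * (\<integral>\<^sup>+y. g y \<partial>lborel)"
    by (intro nn_integral_multc) auto
  finally show ?thesis .
qed

lemma nn_integral_lborel_reflect: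
  fixes f :: "'a::euclidean_space \<Rightarrow> ennreal"
  assumes [measurable]: "f \<in> borel_measurable borel"
  shows "(\<integral>\<^sup>+w. f (x - w) \<partial>lborel) = (\<integral>\<^sup>+y. f y \<partial>lborel)"
proof -
  have d: "(lborel :: 'a measure) = distr lborel borel (\<lambda>w. x - w)"
    using lborel_affine[of "-1" x] by (simp add: density_1)
  show ?thesis by (subst (2) d, subst nn_integral_distr) auto
qed

lemma nn_integral_prod_conv:
  fixes f g :: "'a::euclidean_space \<Rightarrow> ennreal"
  assumes [measurable]: "f \<in> borel_measurable borel" "g \<in> borel_measurable borel"
  shows "(\<integral>\<^sup>+z. f (fst z) * g (fst z - snd z) \<partial>lborel) = (\<integral>\<^sup>+x. f x \<partial>lborel) * (\<integral>\<^sup>+y. g y \<partial>lborel)"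
    and "(\<integral>\<^sup>+z. f (snd z) * g (fst z - snd z) \<partial>lborel) = (\<integral>\<^sup>+x. f x \<partial>lborel) * (\<integral>\<^sup>+y. g y \<partial>lborel)"
proof -
  have "(\<integral>\<^sup>+z. f (fst z) * g (fst z - snd z) \<partial>lborel) = (\<integral>\<^sup>+z. f (fst z) * g (fst z - snd z) \<partial>(lborel \<Otimes>\<^sub>M lborel))"
    by (simp only: lborel_prod)
  also have "\<dots> = (\<integral>\<^sup>+x. \<integral>\<^sup>+y. f x * g (x - y) \<partial>lborel \<partial>lborel)"
    by (subst lborel.nn_integral_fst[symmetric]) auto
  also have "\<dots> = (\<integral>\<^sup>+x. f x * (\<integral>\<^sup>+y. g (x - y) \<partial>lborel) \<partial>lborel)"
    by (intro nn_integral_cong nn_integral_cmult) auto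
  also have "\<dots> = (\<integral>\<^sup>+x. f x \<partial>lborel) * (\<integral>\<^sup>+y. g y \<partial>lborel)"
    by (subst nn_integral_lborel_reflect) (auto intro!: nn_integral_multc)
  finally show "(\<integral>\<^sup>+z. f (fst z) * g (fst z - snd z) \<partial>lborel) = (\<integral>\<^sup>+x. f x \<partial>lborel) * (\<integral>\<^sup>+y. g y \<partial>lborel)" .
  have "(\<integral>\<^sup>+z. f (snd z) * g (fst z - snd z) \<partial>lborel) = (\<integral>\<^sup>+z. f (snd z) * g (fst z - snd z) \<partial>(lborel \<Otimes>\<^sub>M lborel))"
    by (simp only: lborel_prod)
  also have "\<dots> = (\<integral>\<^sup>+y. \<integral>\<^sup>+x. f y * g (x + - y) \<partial>lborel \<partial>lborel)"
    by (subst lborel_pair.nn_integral_snd[symmetric]) auto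
  also have "\<dots> = (\<integral>\<^sup>+y. f y * (\<integral>\<^sup>+x. g (x + - y) \<partial>lborel) \<partial>lborel)"
    by (intro nn_integral_cong nn_integral_cmult) auto
  also have "\<dots> = (\<integral>\<^sup>+x. f x \<partial>lborel) * (\<integral>\<^sup>+y. g y \<partial>lborel)"
    by (subst nn_integral_lborel_shift) (auto intro!: nn_integral_multc)
  finally show "(\<integral>\<^sup>+z. f (snd z) * g (fst z - snd z) \<partial>lborel) = (\<integral>\<^sup>+x. f x \<partial>lborel) * (\<integral>\<^sup>+y. g y \<partial>lborel)" .
qed

section \<open>Cutoffs and truncated test functions\<close>

lemma norm_powr_sing_kernel: "norm z powr p * sing_kernel \<beta> z = sing_kernel (- (p - \<beta>)) z"
  by (simp add: sing_kernel_def powr_add[symmetric] algebra_simps)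

text \<open>The function vanishes already beyond the middle radius. The remaining gap up to \<rho>2
  leaves room for mollification and keeps its support at a distance from the complement of the
  larger ball, where the kernel must be comparable to the kernel centred at x0.\<close>

definition cutoff :: "'a::euclidean_space \<Rightarrow> real \<Rightarrow> real \<Rightarrow> 'a \<Rightarrow> real" where
  "cutoff x0 \<rho>1 \<rho>2 x = max 0 (min 1 (((\<rho>1 + \<rho>2) / 2 - norm (x - x0)) * (2 / (\<rho>2 - \<rho>1))))"

lemma cutoff_bounds: "0 \<le> cutoff x0 \<rho>1 \<rho>2 x" "cutoff x0 \<rho>1 \<rho>2 x \<le> 1"
  by (auto simp: cutoff_def)

lemma cutoff_eq_1: "\<rho>1 < \<rho>2 \<Longrightarrow> norm (x - x0) \<le> \<rho>1 \<Longrightarrow> cutoff x0 \<rho>1 \<rho>2 x = 1"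
  by (auto simp: cutoff_def field_simps)

lemma cutoff_eq_0: "\<rho>1 < \<rho>2 \<Longrightarrow> norm (x - x0) \<ge> (\<rho>1 + \<rho>2) / 2 \<Longrightarrow> cutoff x0 \<rho>1 \<rho>2 x = 0"
  using mult_nonpos_nonneg[of "(\<rho>1 + \<rho>2) / 2 - norm (x - x0)" "2 / (\<rho>2 - \<rho>1)"]
  by (simp add: cutoff_def)

lemma cutoff_lipschitz:
  assumes "\<rho>1 < \<rho>2"
  shows "\<bar>cutoff x0 \<rho>1 \<rho>2 x - cutoff x0 \<rho>1 \<rho>2 y\<bar> \<le> 2 / (\<rho>2 - \<rho>1) * norm (x - y)"
proof -
  have c: "2 / (\<rho>2 - \<rho>1) > 0" using assms by simp
  have "\<bar>max 0 (min 1 s) - max 0 (min 1 t)\<bar> \<le> \<bar>s - t\<bar>" for s t :: real by (auto simp: max_def min_def)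
  then have "\<bar>cutoff x0 \<rho>1 \<rho>2 x - cutoff x0 \<rho>1 \<rho>2 y\<bar> \<le>
    \<bar>((\<rho>1 + \<rho>2) / 2 - norm (x - x0)) * (2 / (\<rho>2 - \<rho>1)) - ((\<rho>1 + \<rho>2) / 2 - norm (y - x0)) * (2 / (\<rho>2 - \<rho>1))\<bar>"
    unfolding cutoff_def .
  also have "\<dots> = 2 / (\<rho>2 - \<rho>1) * \<bar>norm (y - x0) - norm (x - x0)\<bar>"
    unfolding left_diff_distrib[symmetric] abs_mult using c by (simp add: mult.commute)
  also have "\<dots> \<le> 2 / (\<rho>2 - \<rho>1) * norm (x - y)"
    using c norm_triangle_ineq3[of "y - x0" "x - x0"] by (intro mult_left_mono) (auto simp: norm_minus_commute)
  finally show ?thesis .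
qed

lemma borel_measurable_cutoff [measurable]: "cutoff x0 \<rho>1 \<rho>2 \<in> borel_measurable borel"
  unfolding cutoff_def[abs_def] by measurable

text \<open>The right-hand side of the Caccioppoli inequality up to a constant. The gap between the
  radii enters with power p through the slope of the cutoff and with power n + \<beta> through the
  comparison of kernels in the tail; n + p dominates both, as \<beta> < p.\<close>

definition dg_energy :: "real \<Rightarrow> real \<Rightarrow> ('a::euclidean_space \<Rightarrow> real) \<Rightarrow> 'a \<Rightarrow> real \<Rightarrow> real \<Rightarrow> real \<Rightarrow> real" where
  "dg_energy p \<beta> v x0 k \<rho>1 \<rho>2 = (\<rho>2 / (\<rho>2 - \<rho>1)) powr (real DIM('a) + p) *
    (\<rho>2 powr (- \<beta>) * level_moment v x0 k p \<rho>2 + level_tail p \<beta> v x0 k \<rho>2 * level_moment v x0 k 1 \<rho>2)"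

text \<open>Here b is a Borel representative of \<Phi>(v(x) - v(y)) K(x,y), which enters only through its size and its
  sign; so (-b, -v) is again a solution.\<close>

locale nonlocal_solution =
  fixes p \<beta> L :: real and \<Omega> :: "(real^'n) set" and b :: "(real^'n) \<times> (real^'n) \<Rightarrow> real"
    and v :: "real^'n \<Rightarrow> real"
  assumes p: "p > 1" and \<beta>: "0 < \<beta>" "\<beta> < p" and L: "L \<ge> 1"
    and v_meas [measurable]: "v \<in> borel_measurable borel"
    and b_meas [measurable]: "b \<in> borel_measurable borel"
    and v_Lp: "integrable lborel (\<lambda>x. \<bar>v x\<bar> powr p)"
    and v_seminorm: "integrable lborel (\<lambda>z. \<bar>v (fst z) - v (snd z)\<bar> powr p * sing_kernel \<beta> (fst z - snd z))"
    and b_lower: "AE z in lborel. \<bar>v (fst z) - v (snd z)\<bar> powr p * sing_kernel \<beta> (fst z - snd z) / L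
      \<le> b z * (v (fst z) - v (snd z))"
    and b_upper: "AE z in lborel. \<bar>b z\<bar> \<le> L * \<bar>v (fst z) - v (snd z)\<bar> powr (p - 1) * sing_kernel \<beta> (fst z - snd z)"
    and weak: "\<And>\<psi>. \<psi> \<in> test_functions \<Omega> \<Longrightarrow> (\<integral>z. b z * (\<psi> (fst z) - \<psi> (snd z)) \<partial>lborel) = 0"
begin

text \<open>Truncation does not increase differences of v, and what the cutoff adds is a function in
  L^p times min 1 (c |x - y|). The p-th power of this minimum is integrable against the kernel: near
  the diagonal because \<beta> < p, far from it because \<beta> > 0.\<close>

lemma truncated_test_seminorm:
  fixes x0 :: "real^'n" and k \<rho>1 \<rho>2 :: real
  assumes \<rho>: "0 < \<rho>1" "\<rho>1 < \<rho>2"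
  defines "\<phi> \<equiv> (\<lambda>x. max 0 (v x - k) * cutoff x0 \<rho>1 \<rho>2 x powr p)"
  shows "integrable lborel (\<lambda>z. \<bar>\<phi> (fst z) - \<phi> (snd z)\<bar> powr p * sing_kernel \<beta> (fst z - snd z))"
proof -
  define w where "w x = max 0 (v x - k)" for x
  define \<eta> where "\<eta> = cutoff x0 \<rho>1 \<rho>2"
  define c where "c = p * (2 / (\<rho>2 - \<rho>1))"
  have c0: "c > 0" using p \<rho> by (simp add: c_def)
  have w0: "w x \<ge> 0" for x by (simp add: w_def)
  have \<eta>: "0 \<le> \<eta> x" "\<eta> x \<le> 1" for x by (auto simp: \<eta>_def cutoff_bounds)
  have \<eta>0: "\<eta> x = 0" if "x \<notin> ball x0 \<rho>2" for x
    unfolding \<eta>_def using that \<rho> by (intro cutoff_eq_0) (auto simp: dist_norm norm_minus_commute)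
  have [measurable]: "w \<in> borel_measurable borel" "\<eta> \<in> borel_measurable borel" "\<phi> \<in> borel_measurable borel"
    unfolding w_def \<eta>_def \<phi>_def by measurable
  have \<phi>: "\<phi> x = w x * \<eta> x powr p" for x by (simp add: \<phi>_def w_def \<eta>_def)
  \<comment> \<open>The Lipschitz bound is needed for small z, the trivial bound 1 for large
    z.\<close>
  define m where "m z = min 1 (c * norm z)" for z :: "real^'n"
  have m0: "m z \<ge> 0" for z using c0 by (simp add: m_def)
  have [measurable]: "m \<in> borel_measurable borel" unfolding m_def by measurable
  have \<eta>p: "\<bar>\<eta> x powr p - \<eta> y powr p\<bar> \<le> m (x - y)" for x y
  proof -
    have 1: "\<bar>\<eta> x powr p - \<eta> y powr p\<bar> \<le> 1"
    proof -
      have "\<eta> x powr p \<le> 1" "\<eta> y powr p \<le> 1" using \<eta> p by (auto intro!: powr_le1)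
      moreover have "\<eta> x powr p \<ge> 0" "\<eta> y powr p \<ge> 0" by auto
      ultimately show ?thesis by linarith
    qed
    have aux: "s powr p - t powr p \<le> p * (s - t)" if st: "0 \<le> t" "t < s" "s \<le> 1" for s t :: real
    proof -
      have "s powr p - t powr p \<le> p * s powr (p - 1) * (s - t)" using st p by (intro powr_diff_le) auto
      also have "\<dots> \<le> p * 1 * (s - t)" using st p by (intro mult_right_mono mult_left_mono powr_le1) auto
      finally show ?thesis by simp
    qed
    have "\<bar>\<eta> x powr p - \<eta> y powr p\<bar> \<le> p * \<bar>\<eta> x - \<eta> y\<bar>"
    proof (cases "\<eta> x" "\<eta> y" rule: linorder_cases)
      case less
      then have "\<eta> x powr p \<le> \<eta> y powr p" using \<eta> p by (intro powr_mono2) auto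
      then show ?thesis using aux[of "\<eta> x" "\<eta> y"] \<eta> less by simp
    next
      case greater
      then have "\<eta> y powr p \<le> \<eta> x powr p" using \<eta> p by (intro powr_mono2) auto
      then show ?thesis using aux[of "\<eta> y" "\<eta> x"] \<eta> greater by simp
    qed simp
    also have "\<dots> \<le> p * (2 / (\<rho>2 - \<rho>1) * norm (x - y))"
      unfolding \<eta>_def using p \<rho> by (intro mult_left_mono cutoff_lipschitz) auto
    finally show ?thesis using 1 by (simp add: m_def c_def)
  qed
  define W where "W x = indicator (ball x0 \<rho>2) x * w x" for x
  have W0: "W x \<ge> 0" for x using w0 by (simp add: W_def)
  have [measurable]: "W \<in> borel_measurable borel" unfolding W_def by measurable
  \<comment> \<open>A product rule for differences in which the increment of the cutoff is
    multiplied by w at a point of the ball: at y if y lies in it, otherwise at x, because then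
    \<eta> vanishes at y.\<close>
  have pt: "\<bar>\<phi> x - \<phi> y\<bar> \<le> \<bar>v x - v y\<bar> + (W x + W y) * m (x - y)" for x y
  proof (cases "y \<in> ball x0 \<rho>2")
    case True
    have "\<phi> x - \<phi> y = (w x - w y) * \<eta> x powr p + w y * (\<eta> x powr p - \<eta> y powr p)" by (simp add: \<phi> algebra_simps)
    also have "\<bar>\<dots>\<bar> \<le> \<bar>w x - w y\<bar> * \<eta> x powr p + w y * \<bar>\<eta> x powr p - \<eta> y powr p\<bar>"
      by (rule order_trans[OF abs_triangle_ineq]) (use w0 in \<open>simp add: abs_mult\<close>)
    also have "\<dots> \<le> \<bar>v x - v y\<bar> * 1 + W y * m (x - y)"
      using \<eta> p w0 \<eta>p True by (intro add_mono mult_mono powr_le1) (auto simp: w_def W_def max_def)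
    also have "\<dots> \<le> \<bar>v x - v y\<bar> + (W x + W y) * m (x - y)"
      using W0[of x] m0[of "x - y"] by (simp add: distrib_right)
    finally show ?thesis .
  next
    case False
    have "\<phi> x - \<phi> y = w x * (\<eta> x powr p - \<eta> y powr p)" using \<eta>0[OF False] p by (simp add: \<phi>)
    then have "\<bar>\<phi> x - \<phi> y\<bar> = w x * \<bar>\<eta> x powr p - \<eta> y powr p\<bar>" using w0 by (simp add: abs_mult)
    also have "\<dots> \<le> W x * m (x - y)"
    proof (cases "x \<in> ball x0 \<rho>2")
      case True
      then show ?thesis using \<eta>p w0 by (auto simp: W_def intro!: mult_left_mono)
    next
      case F: False
      then show ?thesis using \<eta>0[OF F] \<eta>0[OF False] W0 m0 by simp
    qed
    also have "\<dots> \<le> \<bar>v x - v y\<bar> + (W x + W y) * m (x - y)"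
      using W0[of y] m0[of "x - y"] by (simp add: distrib_right)
    finally show ?thesis .
  qed
  define J where "J z = sing_kernel \<beta> (fst z - snd z)" for z :: "(real^'n) \<times> (real^'n)"
  have J0: "J z \<ge> 0" for z by (simp add: J_def)
  have [measurable]: "J \<in> borel_measurable borel" unfolding J_def by measurable
  define g where "g z = m z powr p * sing_kernel \<beta> z" for z
  have g0: "g z \<ge> 0" for z by (simp add: g_def)
  have [measurable]: "g \<in> borel_measurable borel" unfolding g_def by measurable
  have gfin: "(\<integral>\<^sup>+z. ennreal (g z) \<partial>lborel) < \<infinity>"
  proof -
    obtain c1 where c1: "c1 > 0" "\<And>R. R > 0 \<Longrightarrow>
      (\<integral>\<^sup>+z. ennreal (indicator (ball 0 R) z * sing_kernel (- (p - \<beta>)) z) \<partial>(lborel :: (real^'n) measure)) \<le> ennreal (c1 * R powr (p - \<beta>))"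
      using nn_integral_sing_kernel_near[of "p - \<beta>"] \<beta> by auto
    obtain c2 where c2: "c2 > 0" "\<And>R. R > 0 \<Longrightarrow>
      (\<integral>\<^sup>+z. ennreal (indicator (- ball 0 R) z * sing_kernel \<beta> z) \<partial>(lborel :: (real^'n) measure)) \<le> ennreal (c2 * R powr (- \<beta>))"
      using nn_integral_sing_kernel_far[of \<beta>] \<beta> by auto
    have "(\<integral>\<^sup>+z. ennreal (g z) \<partial>lborel) \<le>
      (\<integral>\<^sup>+z. ennreal (c powr p) * ennreal (indicator (ball 0 1) z * sing_kernel (- (p - \<beta>)) z) +
        ennreal (indicator (- ball 0 1) z * sing_kernel \<beta> z) \<partial>(lborel :: (real^'n) measure))"
    proof (intro nn_integral_mono)
      fix z :: "real^'n"
      have "g z \<le> c powr p * (indicator (ball 0 1) z * sing_kernel (- (p - \<beta>)) z) + indicator (- ball 0 1) z * sing_kernel \<beta> z"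
      proof (cases "z \<in> ball 0 1")
        case True
        have "m z powr p \<le> (c * norm z) powr p" using m0 p by (intro powr_mono2) (auto simp: m_def)
        also have "\<dots> = c powr p * norm z powr p" using c0 by (simp add: powr_mult)
        finally have "g z \<le> c powr p * norm z powr p * sing_kernel \<beta> z"
          unfolding g_def by (intro mult_right_mono) auto
        then show ?thesis using True by (simp add: norm_powr_sing_kernel mult.assoc)
      next
        case False
        have "m z powr p \<le> 1" using m0 p by (intro powr_le1) (auto simp: m_def)
        from mult_right_mono[OF this, of "sing_kernel \<beta> z"] show ?thesis using False by (simp add: g_def)
      qed
      then show "ennreal (g z) \<le> ennreal (c powr p) * ennreal (indicator (ball 0 1) z * sing_kernel (- (p - \<beta>)) z) +
        ennreal (indicator (- ball 0 1) z * sing_kernel \<beta> z)"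
        by (simp add: ennreal_mult[symmetric] ennreal_plus[symmetric] ennreal_leI del: ennreal_plus)
    qed
    also have "\<dots> = ennreal (c powr p) * (\<integral>\<^sup>+z. ennreal (indicator (ball 0 1) z * sing_kernel (- (p - \<beta>)) z) \<partial>(lborel :: (real^'n) measure)) +
        (\<integral>\<^sup>+z. ennreal (indicator (- ball 0 1) z * sing_kernel \<beta> z) \<partial>(lborel :: (real^'n) measure))"
      by (subst nn_integral_add) (measurable, simp add: nn_integral_cmult)
    also have "\<dots> \<le> ennreal (c powr p) * ennreal (c1 * 1 powr (p - \<beta>)) + ennreal (c2 * 1 powr (- \<beta>))"
      by (intro add_mono mult_left_mono c1 c2) auto
    also have "\<dots> < \<infinity>" by (simp add: ennreal_mult_less_top)
    finally show ?thesis .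
  qed
  have Wfin: "(\<integral>\<^sup>+x. ennreal (W x powr p) \<partial>lborel) < \<infinity>"
  proof -
    have "W x powr p = indicator (ball x0 \<rho>2) x * max 0 (v x - k) powr p" for x
      by (simp add: W_def w_def indicator_def)
    then have "integrable lborel (\<lambda>x. W x powr p)"
      using level_integrable(1)[OF v_Lp v_meas p, of p x0 \<rho>2 k] p by simp
    then show ?thesis by (subst nn_integral_eq_integral) auto
  qed
  have Wg: "integrable lborel (\<lambda>z. W (fst z) powr p * g (fst z - snd z))"
    "integrable lborel (\<lambda>z. W (snd z) powr p * g (fst z - snd z))"
  proof -
    have "(\<integral>\<^sup>+z. ennreal (W (fst z) powr p * g (fst z - snd z)) \<partial>lborel) < \<infinity>"
      using nn_integral_prod_conv(1)[of "\<lambda>x. ennreal (W x powr p)" "\<lambda>z. ennreal (g z)"] Wfin gfin g0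
      by (simp add: ennreal_mult ennreal_mult_less_top)
    then show "integrable lborel (\<lambda>z. W (fst z) powr p * g (fst z - snd z))"
      using g0 by (intro integrableI_nonneg) auto
    have "(\<integral>\<^sup>+z. ennreal (W (snd z) powr p * g (fst z - snd z)) \<partial>lborel) < \<infinity>"
      using nn_integral_prod_conv(2)[of "\<lambda>x. ennreal (W x powr p)" "\<lambda>z. ennreal (g z)"] Wfin gfin g0
      by (simp add: ennreal_mult ennreal_mult_less_top)
    then show "integrable lborel (\<lambda>z. W (snd z) powr p * g (fst z - snd z))"
      using g0 by (intro integrableI_nonneg) auto
  qed
  show ?thesis
  proof (rule Bochner_Integration.integrable_bound)
    show "integrable lborel (\<lambda>z. 2 powr p * (\<bar>v (fst z) - v (snd z)\<bar> powr p * J z) +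
        2 powr p * 2 powr p * (W (fst z) powr p * g (fst z - snd z) + W (snd z) powr p * g (fst z - snd z)))"
      using v_seminorm Wg unfolding J_def by (intro Bochner_Integration.integrable_add integrable_mult_right) auto
    show "AE z in lborel. norm (\<bar>\<phi> (fst z) - \<phi> (snd z)\<bar> powr p * sing_kernel \<beta> (fst z - snd z)) \<le>
      norm (2 powr p * (\<bar>v (fst z) - v (snd z)\<bar> powr p * J z) +
        2 powr p * 2 powr p * (W (fst z) powr p * g (fst z - snd z) + W (snd z) powr p * g (fst z - snd z)))"
    proof (intro AE_I2)
      fix z :: "(real^'n) \<times> (real^'n)"
      obtain x y where z: "z = (x, y)" by (cases z)
      have "\<bar>\<phi> x - \<phi> y\<bar> powr p \<le> (\<bar>v x - v y\<bar> + (W x + W y) * m (x - y)) powr p"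
        using pt p by (intro powr_mono2) auto
      also have "\<dots> \<le> 2 powr p * (\<bar>v x - v y\<bar> powr p + ((W x + W y) * m (x - y)) powr p)"
        using W0 m0 p by (intro powr_add_le) auto
      also have "((W x + W y) * m (x - y)) powr p \<le> 2 powr p * (W x powr p + W y powr p) * m (x - y) powr p"
        using W0 m0 p by (simp add: powr_mult mult_right_mono powr_add_le)
      finally have "\<bar>\<phi> x - \<phi> y\<bar> powr p * J z \<le>
        (2 powr p * (\<bar>v x - v y\<bar> powr p + 2 powr p * (W x powr p + W y powr p) * m (x - y) powr p)) * J z"
        using J0 by (intro mult_right_mono) auto
      also have "\<dots> = 2 powr p * (\<bar>v x - v y\<bar> powr p * J z) +
        2 powr p * 2 powr p * (W x powr p * g (x - y) + W y powr p * g (x - y))"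
        by (simp add: g_def J_def z algebra_simps)
      finally show "norm (\<bar>\<phi> (fst z) - \<phi> (snd z)\<bar> powr p * sing_kernel \<beta> (fst z - snd z)) \<le>
        norm (2 powr p * (\<bar>v (fst z) - v (snd z)\<bar> powr p * J z) +
        2 powr p * 2 powr p * (W (fst z) powr p * g (fst z - snd z) + W (snd z) powr p * g (fst z - snd z)))"
        using J0 g0 by (simp add: z J_def)
    qed
  qed measurable
qed

end

section \<open>The Caccioppoli inequality\<close>

text \<open>The part of the energy density of the truncation that survives in the Caccioppoli inequality.\<close>

definition good_density :: "real \<Rightarrow> real \<Rightarrow> ('a::euclidean_space \<Rightarrow> real) \<Rightarrow> 'a \<Rightarrow> real \<Rightarrow> real \<Rightarrow> real \<Rightarrow> 'a \<times> 'a \<Rightarrow> real" where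
  "good_density p \<beta> v x0 k \<rho>1 \<rho>2 z =
    (if fst z \<in> ball x0 \<rho>1 \<and> snd z \<in> ball x0 \<rho>2 \<and> v (snd z) \<le> k \<and> k < v (fst z)
     then (v (fst z) - v (snd z)) powr (p - 1) * (v (fst z) - k) * sing_kernel \<beta> (fst z - snd z) else 0)"

lemma nn_integral_level:
  fixes v :: "'a::euclidean_space \<Rightarrow> real"
  assumes v: "integrable lborel (\<lambda>x. \<bar>v x\<bar> powr p)" and [measurable]: "v \<in> borel_measurable borel"
    and p: "p > 1"
  shows "0 \<le> e \<Longrightarrow> e \<le> p \<Longrightarrow> (\<integral>\<^sup>+x. ennreal (indicator (ball x0 \<rho>) x * max 0 (v x - k) powr e) \<partial>lborel) =
      ennreal (level_moment v x0 k e \<rho>)"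
    and "\<beta> > 0 \<Longrightarrow> \<rho> > 0 \<Longrightarrow>
      (\<integral>\<^sup>+x. ennreal (indicator (- ball x0 \<rho>) x * max 0 (v x - k) powr (p - 1) * sing_kernel \<beta> (x - x0)) \<partial>lborel) =
      ennreal (level_tail p \<beta> v x0 k \<rho>)"
  unfolding level_moment_def level_tail_def using level_integrable[OF assms]
  by (intro nn_integral_eq_integral; simp)+

context nonlocal_solution
begin

text \<open>The weak form tested with \<phi> is 0, so integrating the pointwise inequality bounds
  the surviving density by the errors: both points in the ball give the local p-th moment, one point
  outside gives tail times first moment, and two points outside give nothing. The constant
  \<open>c1\<close> is a parameter, so that the bound is visibly uniform in v, x0, k and the
  radii.\<close>

lemma caccioppoli:
  fixes x0 :: "real^'n" and k \<rho>1 \<rho>2 c1 :: real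
  assumes \<rho>: "0 < \<rho>1" "\<rho>1 < \<rho>2" and ball: "ball x0 \<rho>2 \<subseteq> \<Omega>"
    and c1: "c1 > 0" "\<And>R. R > 0 \<Longrightarrow>
      (\<integral>\<^sup>+z. ennreal (indicator (ball 0 R) z * sing_kernel (- (p - \<beta>)) z) \<partial>(lborel :: (real^'n) measure)) \<le> ennreal (c1 * R powr (p - \<beta>))"
  shows "(\<integral>\<^sup>+z. ennreal (good_density p \<beta> v x0 k \<rho>1 \<rho>2 z) \<partial>lborel) \<le>
    ennreal (L * (2 * (L * p * (L\<^sup>2 * p) powr (p - 1)) * c1 * 2 powr (2 * p) + 2 * L * 2 powr (real CARD('n) + p)) *
      dg_energy p \<beta> v x0 k \<rho>1 \<rho>2)"
proof -
  define w where "w x = max 0 (v x - k)" for x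
  define \<eta> where "\<eta> = cutoff x0 \<rho>1 \<rho>2"
  define \<phi> where "\<phi> x = w x * \<eta> x powr p" for x
  define h where "h = \<rho>2 - \<rho>1"
  define C1 where "C1 = L * p * (L\<^sup>2 * p) powr (p - 1)"
  define N where "N = real CARD('n)"
  \<comment> \<open>The cost of replacing |x - y| by |y - x0| in the kernel when x is in the support
    of the cutoff and y is outside the \<rho>2-ball; there |x - y| is at least h / (2 \<rho>2) times
    |y - x0|.\<close>
  define c3 where "c3 = (2 * \<rho>2 / h) powr (N + \<beta>)"
  define B where "B = ball x0 \<rho>2"
  have h: "h > 0" and \<rho>2: "\<rho>2 > 0" using \<rho> by (auto simp: h_def)
  have C1: "C1 \<ge> 0" using L p by (simp add: C1_def)
  have c3: "c3 \<ge> 0" by (simp add: c3_def)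
  have w0: "w x \<ge> 0" for x by (simp add: w_def)
  have \<eta>: "0 \<le> \<eta> x" "\<eta> x \<le> 1" for x by (auto simp: \<eta>_def cutoff_bounds)
  have \<eta>0: "\<eta> x = 0" if "norm (x - x0) \<ge> (\<rho>1 + \<rho>2) / 2" for x
    unfolding \<eta>_def using that \<rho> by (intro cutoff_eq_0) auto
  have \<eta>B: "\<eta> x = 0" if "x \<notin> B" for x
    using that \<rho> by (intro \<eta>0) (auto simp: B_def dist_norm norm_minus_commute)
  have \<eta>1: "\<eta> x = 1" if "x \<in> ball x0 \<rho>1" for x
    unfolding \<eta>_def using that \<rho> by (intro cutoff_eq_1) (auto simp: dist_norm norm_minus_commute)
  have [measurable]: "w \<in> borel_measurable borel" "\<eta> \<in> borel_measurable borel" "B \<in> sets borel"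
    unfolding w_def \<eta>_def B_def by measurable
  have [measurable]: "\<phi> \<in> borel_measurable borel" unfolding \<phi>_def by measurable
  have Bfin: "emeasure lborel B < \<infinity>" unfolding B_def by (rule emeasure_bounded_finite[OF bounded_ball])

  define J where "J z = sing_kernel \<beta> (fst z - snd z)" for z :: "(real^'n) \<times> (real^'n)"
  have J0: "J z \<ge> 0" for z by (simp add: J_def)
  define near where "near z = indicator (ball 0 (2 * \<rho>2)) z * sing_kernel (- (p - \<beta>)) z" for z :: "real^'n"
  define far where "far x = indicator (- B) x * w x powr (p - 1) * sing_kernel \<beta> (x - x0)" for x
  define mp where "mp x = indicator B x * w x powr p" for x
  define m1 where "m1 x = indicator B x * w x" for x
  have nn: "near z \<ge> 0" "far x \<ge> 0" "mp x \<ge> 0" "m1 x \<ge> 0" for z x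
    using w0 by (auto simp: near_def far_def mp_def m1_def)
  have [measurable]: "near \<in> borel_measurable borel" "far \<in> borel_measurable borel"
    "mp \<in> borel_measurable borel" "m1 \<in> borel_measurable borel" "J \<in> borel_measurable borel"
    unfolding near_def far_def mp_def m1_def J_def by measurable
  \<comment> \<open>The error terms are written as products of a function of one point with a
    function of the other point or of the difference, so that their double integrals factor.\<close>
  define H where "H z = C1 * (2 / h) powr p * (mp (fst z) * near (fst z - snd z) + mp (snd z) * near (fst z - snd z))
    + L * c3 * (m1 (fst z) * far (snd z) + far (fst z) * m1 (snd z))" for z
  have [measurable]: "H \<in> borel_measurable borel" unfolding H_def by measurable
  have H0: "H z \<ge> 0" for z unfolding H_def using nn C1 L c3 by simp
  define G where "G = good_density p \<beta> v x0 k \<rho>1 \<rho>2"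
  have G0: "G z \<ge> 0" for z unfolding G_def good_density_def by simp
  have [measurable]: "G \<in> borel_measurable borel" unfolding G_def good_density_def by measurable

  have pt: "b z * (\<phi> (fst z) - \<phi> (snd z)) \<ge> G z / L - H z"
    if lo: "\<bar>v (fst z) - v (snd z)\<bar> powr p * sing_kernel \<beta> (fst z - snd z) / L \<le> b z * (v (fst z) - v (snd z))"
      and up: "\<bar>b z\<bar> \<le> L * \<bar>v (fst z) - v (snd z)\<bar> powr (p - 1) * sing_kernel \<beta> (fst z - snd z)" for z
  proof -
    obtain x y where z: "z = (x, y)" by (cases z)
    define X where "X = v x - k"
    define Y where "Y = v y - k"
    have lo': "\<bar>X - Y\<bar> powr p * J z / L \<le> b z * (X - Y)" and up': "\<bar>b z\<bar> \<le> L * \<bar>X - Y\<bar> powr (p - 1) * J z"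
      using lo up by (auto simp: z X_def Y_def J_def)
    define T where "T = max 0 X * \<eta> x powr p - max 0 Y * \<eta> y powr p"
    have T: "\<phi> (fst z) - \<phi> (snd z) = T" by (simp add: T_def \<phi>_def w_def z X_def Y_def)
    define G' where "G' = (if X > 0 \<and> Y \<le> 0 then (X - Y) powr (p - 1) * X * \<eta> x powr p * J z / L else 0)"
    note pw = caccioppoli_pointwise[OF p L J0 \<eta>(1)[of x] \<eta>(2)[of x] \<eta>(1)[of y] \<eta>(2)[of y] lo' up',
        folded T_def G'_def]
    have G'0: "G' \<ge> 0" using L J0 by (simp add: G'_def)
    have GG: "G z / L \<le> G'"
    proof (cases "x \<in> ball x0 \<rho>1 \<and> y \<in> B \<and> v y \<le> k \<and> k < v x")
      case True
      then show ?thesis using \<eta>1[of x] by (simp add: G_def good_density_def G'_def z X_def Y_def J_def B_def)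
    next
      case False
      then have "G z = 0" unfolding G_def good_density_def z B_def by auto
      then show ?thesis using G'0 by simp
    qed
    have Gout: "G z = 0" if "\<not> (x \<in> B \<and> y \<in> B)"
    proof -
      have "ball x0 \<rho>1 \<subseteq> B" unfolding B_def using \<rho> by (intro subset_ball) auto
      then show ?thesis using that unfolding G_def good_density_def z B_def by auto
    qed
    have J3: "J (x', y') \<le> c3 * sing_kernel \<beta> (y' - x0)"
      if "norm (x' - x0) < (\<rho>1 + \<rho>2) / 2" "y' \<notin> B" for x' y'
    proof -
      have y': "norm (y' - x0) \<ge> \<rho>2" using that(2) by (simp add: B_def dist_norm norm_minus_commute)
      have "norm (y' - x0) \<le> norm (x' - y') + norm (x' - x0)" by norm
      then have 1: "norm (x' - y') \<ge> norm (y' - x0) - (\<rho>1 + \<rho>2) / 2" using that(1) by linarith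
      \<comment> \<open>Of the distance |y' - x0| \<ge> \<rho>2 at most the fraction (\<rho>1 +
        \<rho>2) / (2 \<rho>2) is lost to the middle radius; the fraction that remains is h / (2
        \<rho>2).\<close>
      have "h / (2 * \<rho>2) * norm (y' - x0) \<le> norm (y' - x0) - (\<rho>1 + \<rho>2) / 2"
      proof -
        have "(\<rho>1 + \<rho>2) / 2 = (\<rho>1 + \<rho>2) / (2 * \<rho>2) * \<rho>2" using \<rho>2 by simp
        also have "\<dots> \<le> (\<rho>1 + \<rho>2) / (2 * \<rho>2) * norm (y' - x0)" using y' \<rho> by (intro mult_left_mono) auto
        finally have "(\<rho>1 + \<rho>2) / 2 \<le> (\<rho>1 + \<rho>2) / (2 * \<rho>2) * norm (y' - x0)" .
        moreover have "h / (2 * \<rho>2) + (\<rho>1 + \<rho>2) / (2 * \<rho>2) = 1"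
          using \<rho>2 by (simp add: h_def add_divide_distrib[symmetric])
        then have "h / (2 * \<rho>2) * norm (y' - x0) + (\<rho>1 + \<rho>2) / (2 * \<rho>2) * norm (y' - x0) = norm (y' - x0)"
          by (metis distrib_right mult_1)
        ultimately show ?thesis by linarith
      qed
      then have 2: "h / (2 * \<rho>2) * norm (y' - x0) \<le> norm (x' - y')" using 1 by linarith
      have "norm (y' - x0) > 0" using y' \<rho>2 by linarith
      then have "J (x', y') \<le> (h / (2 * \<rho>2) * norm (y' - x0)) powr (- (N + \<beta>))"
        unfolding J_def sing_kernel_def using 2 h \<rho>2 \<beta> by (simp add: N_def) (intro powr_mono2', auto)
      also have "\<dots> = (h / (2 * \<rho>2)) powr (- (N + \<beta>)) * sing_kernel \<beta> (y' - x0)"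
        using h \<rho>2 by (simp only: powr_mult) (simp add: sing_kernel_def N_def)
      also have "(h / (2 * \<rho>2)) powr (- (N + \<beta>)) = c3"
      proof -
        have "(h / (2 * \<rho>2)) powr (- (N + \<beta>)) = (inverse (h / (2 * \<rho>2))) powr (N + \<beta>)"
          unfolding powr_minus using h \<rho>2 by (subst inverse_powr) auto
        then show ?thesis by (simp add: c3_def)
      qed
      finally show ?thesis .
    qed
    have farx: "max 0 Y powr (p - 1) * max 0 X * \<eta> x powr p * J z \<le> c3 * (m1 x * far y)" if "x \<in> B" "y \<notin> B"
    proof (cases "norm (x - x0) < (\<rho>1 + \<rho>2) / 2")
      case True
      have "max 0 Y powr (p - 1) * max 0 X * \<eta> x powr p * J z \<le>
          max 0 Y powr (p - 1) * max 0 X * 1 * (c3 * sing_kernel \<beta> (y - x0))"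
        using \<eta>[of x] p J3[OF True that(2)] J0 by (intro mult_mono powr_le1 mult_nonneg_nonneg) (auto simp: z)
      then show ?thesis using that by (simp add: m1_def far_def w_def X_def Y_def mult_ac)
    next
      case False
      then have "\<eta> x = 0" by (intro \<eta>0) simp
      then show ?thesis using nn c3 by simp
    qed
    have fary: "max 0 X powr (p - 1) * max 0 Y * \<eta> y powr p * J z \<le> c3 * (far x * m1 y)" if "x \<notin> B" "y \<in> B"
    proof (cases "norm (y - x0) < (\<rho>1 + \<rho>2) / 2")
      case True
      have "J z = J (y, x)" using sing_kernel_minus[of \<beta> "x - y"] by (simp add: J_def z)
      then have "max 0 X powr (p - 1) * max 0 Y * \<eta> y powr p * J z \<le>
          max 0 X powr (p - 1) * max 0 Y * 1 * (c3 * sing_kernel \<beta> (x - x0))"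
        using \<eta>[of y] p J3[OF True that(1)] J0 by (intro mult_mono powr_le1 mult_nonneg_nonneg) auto
      then show ?thesis using that by (simp add: m1_def far_def w_def X_def Y_def mult_ac)
    next
      case False
      then have "\<eta> y = 0" by (intro \<eta>0) simp
      then show ?thesis using nn c3 by simp
    qed
    have Hge: "C1 * (2 / h) powr p * (mp x * near (x - y) + mp y * near (x - y)) \<le> H z"
      "L * (c3 * (m1 x * far y)) \<le> H z" "L * (c3 * (far x * m1 y)) \<le> H z"
    proof -
      have a: "C1 * (2 / h) powr p * (mp x * near (x - y) + mp y * near (x - y)) \<ge> 0"
        using nn C1 by simp
      have b: "L * (c3 * (m1 x * far y)) \<ge> 0" "L * (c3 * (far x * m1 y)) \<ge> 0"
        using nn L c3 by simp_all
      have "H z = C1 * (2 / h) powr p * (mp x * near (x - y) + mp y * near (x - y)) +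
        (L * (c3 * (m1 x * far y)) + L * (c3 * (far x * m1 y)))"
        by (simp add: H_def z distrib_left mult.assoc)
      then show "C1 * (2 / h) powr p * (mp x * near (x - y) + mp y * near (x - y)) \<le> H z"
        "L * (c3 * (m1 x * far y)) \<le> H z" "L * (c3 * (far x * m1 y)) \<le> H z"
        using a b by linarith+
    qed
    consider "x \<in> B" "y \<in> B" | "x \<in> B" "y \<notin> B" | "x \<notin> B" "y \<in> B" | "x \<notin> B" "y \<notin> B" by blast
    then have "b z * T \<ge> G z / L - H z"
    proof cases
      case 1
      have xy: "norm (x - y) < 2 * \<rho>2"
      proof -
        have "norm (x - y) \<le> norm (x - x0) + norm (y - x0)" by norm
        then show ?thesis using 1 by (auto simp: B_def dist_norm norm_minus_commute)
      qed
      have "\<bar>\<eta> x - \<eta> y\<bar> powr p \<le> (2 / h * norm (x - y)) powr p"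
        unfolding \<eta>_def h_def using \<rho> p by (intro powr_mono2 cutoff_lipschitz) auto
      also have "\<dots> = (2 / h) powr p * norm (x - y) powr p" using h by (simp only: powr_mult)
      finally have "\<bar>\<eta> x - \<eta> y\<bar> powr p * J z \<le> (2 / h) powr p * norm (x - y) powr p * J z"
        using J0 by (intro mult_right_mono) auto
      also have "\<dots> = (2 / h) powr p * near (x - y)"
        using xy by (simp add: J_def z near_def norm_powr_sing_kernel mult.assoc)
      finally have "C1 * (max 0 X powr p + max 0 Y powr p) * (\<bar>\<eta> x - \<eta> y\<bar> powr p * J z) \<le>
          C1 * (max 0 X powr p + max 0 Y powr p) * ((2 / h) powr p * near (x - y))"
        using C1 by (intro mult_left_mono) auto
      also have "\<dots> = C1 * (2 / h) powr p * (mp x * near (x - y) + mp y * near (x - y))"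
        using 1 by (simp add: mp_def w_def X_def Y_def algebra_simps)
      finally show ?thesis using pw(1) GG Hge(1) unfolding C1_def[symmetric] by (simp only: mult.assoc)
    next
      case 2
      have "b z * T \<ge> G' - L * (max 0 Y powr (p - 1) * max 0 X * \<eta> x powr p * J z)"
        by (rule pw(2)[OF \<eta>B[OF 2(2)]])
      moreover have "L * (max 0 Y powr (p - 1) * max 0 X * \<eta> x powr p * J z) \<le> L * (c3 * (m1 x * far y))"
        using farx[OF 2] L by (intro mult_left_mono) auto
      ultimately show ?thesis using GG Hge(2) by linarith
    next
      case 3
      have "b z * T \<ge> G' - L * (max 0 X powr (p - 1) * max 0 Y * \<eta> y powr p * J z)"
        by (rule pw(3)[OF \<eta>B[OF 3(1)]])
      moreover have "L * (max 0 X powr (p - 1) * max 0 Y * \<eta> y powr p * J z) \<le> L * (c3 * (far x * m1 y))"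
        using fary[OF 3] L by (intro mult_left_mono) auto
      ultimately show ?thesis using GG Hge(3) by linarith
    next
      case 4
      then have "T = 0" using \<eta>B p by (simp add: T_def)
      then show ?thesis using Gout 4 H0[of z] by simp
    qed
    then show ?thesis by (simp only: T)
  qed

  have mp_nn: "(\<integral>\<^sup>+x. ennreal (mp x) \<partial>lborel) = ennreal (level_moment v x0 k p \<rho>2)"
    unfolding mp_def w_def B_def using p by (intro nn_integral_level[OF v_Lp v_meas p]) auto
  have m1_nn: "(\<integral>\<^sup>+x. ennreal (m1 x) \<partial>lborel) = ennreal (level_moment v x0 k 1 \<rho>2)"
    using nn_integral_level(1)[OF v_Lp v_meas p, of 1 x0 \<rho>2 k] p by (simp add: m1_def w_def B_def)
  have far_nn: "(\<integral>\<^sup>+x. ennreal (far x) \<partial>lborel) = ennreal (level_tail p \<beta> v x0 k \<rho>2)"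
    unfolding far_def w_def B_def by (intro nn_integral_level[OF v_Lp v_meas p] \<beta> \<rho>2)
  have near_nn: "(\<integral>\<^sup>+z. ennreal (near z) \<partial>lborel) \<le> ennreal (c1 * (2 * \<rho>2) powr (p - \<beta>))"
    unfolding near_def using \<rho>2 by (intro c1) simp
  define E where "E = C1 * (2 / h) powr p * (2 * (level_moment v x0 k p \<rho>2 * (c1 * (2 * \<rho>2) powr (p - \<beta>)))) +
    L * c3 * (2 * (level_moment v x0 k 1 \<rho>2 * level_tail p \<beta> v x0 k \<rho>2))"
  have H_nn: "(\<integral>\<^sup>+z. ennreal (H z) \<partial>lborel) \<le> ennreal E"
  proof -
    have "ennreal (H z) = ennreal (C1 * (2 / h) powr p) *
        (ennreal (mp (fst z)) * ennreal (near (fst z - snd z)) + ennreal (mp (snd z)) * ennreal (near (fst z - snd z))) +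
        ennreal (L * c3) * (ennreal (m1 (fst z)) * ennreal (far (snd z)) + ennreal (far (fst z)) * ennreal (m1 (snd z)))" for z
      unfolding H_def using nn C1 L c3 by (simp add: ennreal_mult ennreal_plus)
    then have "(\<integral>\<^sup>+z. ennreal (H z) \<partial>lborel) = ennreal (C1 * (2 / h) powr p) *
        ((\<integral>\<^sup>+z. ennreal (mp (fst z)) * ennreal (near (fst z - snd z)) \<partial>lborel) +
         (\<integral>\<^sup>+z. ennreal (mp (snd z)) * ennreal (near (fst z - snd z)) \<partial>lborel)) +
        ennreal (L * c3) * ((\<integral>\<^sup>+z. ennreal (m1 (fst z)) * ennreal (far (snd z)) \<partial>lborel) +
         (\<integral>\<^sup>+z. ennreal (far (fst z)) * ennreal (m1 (snd z)) \<partial>lborel))"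
      by (simp add: nn_integral_add nn_integral_cmult)
    also have "(\<integral>\<^sup>+z. ennreal (mp (fst z)) * ennreal (near (fst z - snd z)) \<partial>lborel) =
        ennreal (level_moment v x0 k p \<rho>2) * (\<integral>\<^sup>+z. ennreal (near z) \<partial>lborel)"
      using nn_integral_prod_conv(1)[of "\<lambda>x. ennreal (mp x)" "\<lambda>z. ennreal (near z)"] mp_nn by simp
    also have "(\<integral>\<^sup>+z. ennreal (mp (snd z)) * ennreal (near (fst z - snd z)) \<partial>lborel) =
        ennreal (level_moment v x0 k p \<rho>2) * (\<integral>\<^sup>+z. ennreal (near z) \<partial>lborel)"
      using nn_integral_prod_conv(2)[of "\<lambda>x. ennreal (mp x)" "\<lambda>z. ennreal (near z)"] mp_nn by simp
    also have "(\<integral>\<^sup>+z. ennreal (m1 (fst z)) * ennreal (far (snd z)) \<partial>lborel) =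
        ennreal (level_moment v x0 k 1 \<rho>2) * ennreal (level_tail p \<beta> v x0 k \<rho>2)"
      using nn_integral_prod_mult[of "\<lambda>x. ennreal (m1 x)" "\<lambda>x. ennreal (far x)"] m1_nn far_nn by simp
    also have "(\<integral>\<^sup>+z. ennreal (far (fst z)) * ennreal (m1 (snd z)) \<partial>lborel) =
        ennreal (level_tail p \<beta> v x0 k \<rho>2) * ennreal (level_moment v x0 k 1 \<rho>2)"
      using nn_integral_prod_mult[of "\<lambda>x. ennreal (far x)" "\<lambda>x. ennreal (m1 x)"] m1_nn far_nn by simp
    also have "ennreal (C1 * (2 / h) powr p) *
        (ennreal (level_moment v x0 k p \<rho>2) * (\<integral>\<^sup>+z. ennreal (near z) \<partial>lborel) +
         ennreal (level_moment v x0 k p \<rho>2) * (\<integral>\<^sup>+z. ennreal (near z) \<partial>lborel)) +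
        ennreal (L * c3) * (ennreal (level_moment v x0 k 1 \<rho>2) * ennreal (level_tail p \<beta> v x0 k \<rho>2) +
         ennreal (level_tail p \<beta> v x0 k \<rho>2) * ennreal (level_moment v x0 k 1 \<rho>2)) \<le>
        ennreal (C1 * (2 / h) powr p) *
        (ennreal (level_moment v x0 k p \<rho>2) * ennreal (c1 * (2 * \<rho>2) powr (p - \<beta>)) +
         ennreal (level_moment v x0 k p \<rho>2) * ennreal (c1 * (2 * \<rho>2) powr (p - \<beta>))) +
        ennreal (L * c3) * (ennreal (level_moment v x0 k 1 \<rho>2) * ennreal (level_tail p \<beta> v x0 k \<rho>2) +
         ennreal (level_tail p \<beta> v x0 k \<rho>2) * ennreal (level_moment v x0 k 1 \<rho>2))"
      by (intro add_mono mult_left_mono near_nn) auto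
    also have "\<dots> = ennreal E"
    proof -
      have E: "E = C1 * (2 / h) powr p * (level_moment v x0 k p \<rho>2 * (c1 * (2 * \<rho>2) powr (p - \<beta>)) +
          level_moment v x0 k p \<rho>2 * (c1 * (2 * \<rho>2) powr (p - \<beta>))) +
        L * c3 * (level_moment v x0 k 1 \<rho>2 * level_tail p \<beta> v x0 k \<rho>2 +
          level_tail p \<beta> v x0 k \<rho>2 * level_moment v x0 k 1 \<rho>2)"
        by (simp add: E_def)
      show ?thesis unfolding E using C1 c1(1) L c3
        by (simp only: ennreal_mult ennreal_plus mult_nonneg_nonneg add_nonneg_nonneg level_moment_nonneg
            level_tail_nonneg powr_ge_zero less_imp_le order_trans[OF zero_le_one])
    qed
    finally show ?thesis .
  qed
  have HI: "integrable lborel H"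
    using order.strict_trans1[OF H_nn ennreal_less_top] H0 by (intro integrableI_nonneg) auto
  have E0: "E \<ge> 0" unfolding E_def using C1 c1(1) L c3 by simp
  have Hint: "(\<integral>z. H z \<partial>lborel) \<le> E"
    using H_nn H0 E0 by (subst (asm) nn_integral_eq_integral[OF HI]) (auto simp: ennreal_le_iff)

  have \<phi>I: "integrable lborel \<phi>"
  proof (rule Bochner_Integration.integrable_bound)
    show "integrable lborel m1"
      using m1_nn nn by (intro integrableI_nonneg) auto
    show "AE x in lborel. norm (\<phi> x) \<le> norm (m1 x)"
    proof (intro AE_I2)
      fix x show "norm (\<phi> x) \<le> norm (m1 x)"
      proof (cases "x \<in> B")
        case True
        have "\<eta> x powr p \<le> 1" using \<eta> p by (intro powr_le1) auto
        from mult_left_mono[OF this w0[of x]] show ?thesis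
          using True w0[of x] by (simp add: \<phi>_def m1_def abs_mult)
      next
        case False
        then show ?thesis using \<eta>B by (simp add: \<phi>_def)
      qed
    qed
  qed measurable
  have \<phi>S: "integrable lborel (\<lambda>z. \<bar>\<phi> (fst z) - \<phi> (snd z)\<bar> powr p * sing_kernel \<beta> (fst z - snd z))"
    unfolding \<phi>_def w_def \<eta>_def by (rule truncated_test_seminorm[OF \<rho>])
  have supp: "\<phi> x = 0" if "norm (x - x0) > (\<rho>1 + \<rho>2) / 2" for x
    using that \<eta>0[of x] p by (simp add: \<phi>_def)
  have mid: "(\<rho>1 + \<rho>2) / 2 < \<rho>2" using \<rho> by simp
  have L0: "L \<ge> 0" using L by simp
  have \<phi>m: "\<phi> \<in> borel_measurable borel" by measurable
  note te = test_extension[OF p L0 v_meas b_meas \<phi>m b_upper v_seminorm weak \<phi>I \<phi>S supp mid ball]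
  have bI: "integrable lborel (\<lambda>z. b z * (\<phi> (fst z) - \<phi> (snd z)))" by (rule te(1))
  have bz: "(\<integral>z. b z * (\<phi> (fst z) - \<phi> (snd z)) \<partial>lborel) = 0" by (rule te(2))
  have ae: "AE z in lborel. G z \<le> L * (b z * (\<phi> (fst z) - \<phi> (snd z)) + H z)"
    using b_lower b_upper
  proof eventually_elim
    fix z
    assume "\<bar>v (fst z) - v (snd z)\<bar> powr p * sing_kernel \<beta> (fst z - snd z) / L \<le> b z * (v (fst z) - v (snd z))"
      "\<bar>b z\<bar> \<le> L * \<bar>v (fst z) - v (snd z)\<bar> powr (p - 1) * sing_kernel \<beta> (fst z - snd z)"
    from pt[OF this] have "G z / L \<le> b z * (\<phi> (fst z) - \<phi> (snd z)) + H z" by linarith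
    then show "G z \<le> L * (b z * (\<phi> (fst z) - \<phi> (snd z)) + H z)" using L by (simp add: divide_le_eq mult.commute)
  qed
  let ?K = "\<lambda>z. L * (b z * (\<phi> (fst z) - \<phi> (snd z)) + H z)"
  have KI: "integrable lborel ?K" using bI HI by (intro integrable_mult_right Bochner_Integration.integrable_add)
  have "(\<integral>\<^sup>+z. ennreal (G z) \<partial>lborel) \<le> (\<integral>\<^sup>+z. ennreal (?K z) \<partial>lborel)"
    using ae by (intro nn_integral_mono_AE) (auto elim!: eventually_mono intro: ennreal_leI)
  also have "\<dots> = ennreal (\<integral>z. ?K z \<partial>lborel)"
  proof (rule nn_integral_eq_integral[OF KI])
    show "AE z in lborel. 0 \<le> ?K z" using ae by eventually_elim (use G0 in \<open>meson order_trans\<close>)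
  qed
  also have "(\<integral>z. ?K z \<partial>lborel) = L * (\<integral>z. H z \<partial>lborel)" using bI HI bz by simp
  also have "ennreal (L * (\<integral>z. H z \<partial>lborel)) \<le> ennreal (L * E)"
    using Hint L by (intro ennreal_leI mult_left_mono) auto
  finally have GE: "(\<integral>\<^sup>+z. ennreal (G z) \<partial>lborel) \<le> ennreal (L * E)" .
  have "L * E \<le> L * (2 * C1 * c1 * 2 powr (2 * p) + 2 * L * 2 powr (N + p)) * dg_energy p \<beta> v x0 k \<rho>1 \<rho>2"
  proof -
    \<comment> \<open>As u \<ge> 1, all powers of u that occur can be raised to the common exponent
      n + p of \<open>dg_energy\<close>.\<close>
    define u where "u = \<rho>2 / h"
    have u: "u \<ge> 1" using \<rho> h by (simp add: u_def h_def)
    define P where "P = level_moment v x0 k p \<rho>2"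
    define Q where "Q = level_moment v x0 k 1 \<rho>2 * level_tail p \<beta> v x0 k \<rho>2"
    have PQ: "P \<ge> 0" "Q \<ge> 0" by (auto simp: P_def Q_def)
    have e1: "(2 / h) powr p * (2 * \<rho>2) powr (p - \<beta>) \<le> 2 powr (2 * p) * (u powr (N + p) * \<rho>2 powr (- \<beta>))"
    proof -
      have "(2 / h) powr p * (2 * \<rho>2) powr (p - \<beta>) = 2 powr p * 2 powr (p - \<beta>) * (u powr p * \<rho>2 powr (- \<beta>))"
        using h \<rho>2 by (simp add: u_def powr_divide powr_mult powr_diff powr_minus field_simps)
      also have "\<dots> \<le> 2 powr p * 2 powr p * (u powr (N + p) * \<rho>2 powr (- \<beta>))"
      proof -
        have "2 powr (p - \<beta>) \<le> (2::real) powr p" "u powr p \<le> u powr (N + p)"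
          using u \<beta> by (auto intro!: powr_mono simp: N_def)
        then show ?thesis by (intro mult_mono mult_right_mono mult_left_mono) auto
      qed
      also have "2 powr p * 2 powr p = (2::real) powr (2 * p)" by (simp add: powr_add[symmetric])
      finally show ?thesis .
    qed
    have e2: "c3 \<le> 2 powr (N + p) * u powr (N + p)"
    proof -
      have "c3 = 2 powr (N + \<beta>) * u powr (N + \<beta>)" using h \<rho>2 by (simp add: c3_def u_def powr_mult[symmetric])
      also have "\<dots> \<le> 2 powr (N + p) * u powr (N + p)"
        using u \<beta> by (intro mult_mono powr_mono) auto
      finally show ?thesis .
    qed
    have "E = 2 * C1 * c1 * ((2 / h) powr p * (2 * \<rho>2) powr (p - \<beta>)) * P + 2 * L * c3 * Q"
      by (simp add: E_def P_def Q_def)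
    also have "\<dots> \<le> 2 * C1 * c1 * (2 powr (2 * p) * (u powr (N + p) * \<rho>2 powr (- \<beta>))) * P +
        2 * L * (2 powr (N + p) * u powr (N + p)) * Q"
      using e1 e2 C1 c1(1) L PQ by (intro add_mono mult_right_mono mult_left_mono) auto
    also have "\<dots> \<le> (2 * C1 * c1 * 2 powr (2 * p) + 2 * L * 2 powr (N + p)) * (u powr (N + p) * (\<rho>2 powr (- \<beta>) * P + Q))"
    proof -
      let ?A = "2 * C1 * c1 * 2 powr (2 * p)" and ?B = "2 * L * 2 powr (N + p)"
      have "?A * (u powr (N + p) * Q) \<ge> 0" "?B * (u powr (N + p) * (\<rho>2 powr (- \<beta>) * P)) \<ge> 0"
        using C1 c1(1) L PQ by simp_all
      then show ?thesis by (simp add: algebra_simps)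
    qed
    also have "u powr (N + p) * (\<rho>2 powr (- \<beta>) * P + Q) = dg_energy p \<beta> v x0 k \<rho>1 \<rho>2"
      by (simp add: dg_energy_def u_def h_def N_def P_def Q_def mult.commute)
    finally show ?thesis using L by (simp add: mult.assoc mult_left_mono)
  qed
  from order_trans[OF GE ennreal_leI[OF this]] show ?thesis unfolding G_def C1_def N_def .
qed

end

text \<open>The first inequality plays the role of the Sobolev inequality, the second that of an
  isoperimetric inequality.\<close>

definition de_giorgi :: "real \<Rightarrow> real \<Rightarrow> real \<Rightarrow> ('a::euclidean_space \<Rightarrow> real) \<Rightarrow> 'a \<Rightarrow> real \<Rightarrow> bool" where
  "de_giorgi p \<beta> C v x0 R \<longleftrightarrow>
    v \<in> borel_measurable borel \<and> integrable lborel (\<lambda>x. \<bar>v x\<bar> powr p) \<and>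
    (\<forall>k \<rho>1 \<rho>2. 0 < \<rho>1 \<longrightarrow> \<rho>1 < \<rho>2 \<longrightarrow> \<rho>2 \<le> R \<longrightarrow>
      (\<forall>d. 0 < d \<longrightarrow> d \<le> \<rho>2 - \<rho>1 \<longrightarrow>
        measure lborel {x \<in> ball x0 \<rho>2. k < v x} \<le> measure lborel (ball x0 d) / 2 \<longrightarrow>
        level_moment v x0 k p \<rho>1 \<le> C * d powr \<beta> * dg_energy p \<beta> v x0 k \<rho>1 \<rho>2) \<and>
      (\<forall>l\<le>k. measure lborel (ball x0 \<rho>1) / 2 \<le> measure lborel {x \<in> ball x0 \<rho>1. v x \<le> l} \<longrightarrow>
        (k - l) powr (p - 1) * \<rho>1 powr real DIM('a) * \<rho>2 powr (- (real DIM('a) + \<beta>)) * level_moment v x0 k 1 \<rho>1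
        \<le> C * dg_energy p \<beta> v x0 k \<rho>1 \<rho>2))"

section \<open>Lower bounds for the surviving energy\<close>

lemma dg_energy_nonneg: "dg_energy p \<beta> v x0 k \<rho>1 \<rho>2 \<ge> 0"
  unfolding dg_energy_def by simp

lemma measure_lborel_ball:
  fixes x :: "'a::euclidean_space"
  assumes "r \<ge> 0"
  shows "measure lborel (ball x r) = unit_ball_vol (real DIM('a)) * r ^ DIM('a)"
  using content_ball[OF assms, of x] by simp

lemma fmeasurable_ball_inter:
  fixes x0 :: "'a::euclidean_space"
  assumes "A \<subseteq> ball x0 r" "A \<in> sets borel"
  shows "A \<in> fmeasurable lborel"
  using assms emeasure_bounded_finite[OF bounded_subset[OF bounded_ball assms(1)]]
  by (auto simp: fmeasurable_def)

text \<open>The superlevel set covers at most half the volume of a d-ball, so around each x at least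
  half of the d-ball lies in {v \<le> k}. For such y the difference v(x) - v(y) is at least v(x) - k
  and the kernel at least d^(-n-\<beta>); integrating in y leaves d^(-\<beta>) times the p-th
  moment. The condition d \<le> \<rho>2 - \<rho>1 keeps these balls inside the larger one.\<close>

lemma faber_krahn_lower:
  fixes v :: "'a::euclidean_space \<Rightarrow> real"
  assumes [measurable]: "v \<in> borel_measurable borel" and p: "p > 1" and \<beta>: "\<beta> > 0"
    and \<rho>: "0 < \<rho>1" "\<rho>1 < \<rho>2" and d: "0 < d" "d \<le> \<rho>2 - \<rho>1"
    and A: "measure lborel {x \<in> ball x0 \<rho>2. k < v x} \<le> measure lborel (ball x0 d) / 2"
    and v: "integrable lborel (\<lambda>x. \<bar>v x\<bar> powr p)"
  shows "ennreal (unit_ball_vol (real DIM('a)) / 2 * d powr (- \<beta>) * level_moment v x0 k p \<rho>1) \<le>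
    (\<integral>\<^sup>+z. ennreal (good_density p \<beta> v x0 k \<rho>1 \<rho>2 z) \<partial>lborel)"
proof -
  let ?w = "unit_ball_vol (real DIM('a))"
  define A' where "A' = {x \<in> ball x0 \<rho>2. k < v x}"
  have [measurable]: "A' \<in> sets borel" unfolding A'_def by measurable
  have A'f: "A' \<in> fmeasurable lborel" by (rule fmeasurable_ball_inter[of _ x0 \<rho>2]) (auto simp: A'_def)
  define f where "f x = indicator (ball x0 \<rho>1) x * max 0 (v x - k) powr p" for x
  have f0: "f x \<ge> 0" for x by (simp add: f_def)
  have [measurable]: "f \<in> borel_measurable borel" unfolding f_def by measurable
  define c where "c = d powr (- (real DIM('a) + \<beta>))"
  define S where "S = {z. dist (fst z) (snd z) < d \<and> snd z \<notin> A'}"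
  have Sb: "S \<in> sets borel"
  proof -
    have "S = {z \<in> space borel. dist (fst z) (snd z) < d \<and> snd z \<notin> A'}" by (simp add: S_def)
    also have "\<dots> \<in> sets borel" by measurable
    finally show ?thesis .
  qed
  then have [measurable]: "S \<in> sets borel" "S \<in> sets (lborel \<Otimes>\<^sub>M lborel)"
    by (simp_all only: lborel_prod sets_lborel)
  \<comment> \<open>The hypothesis concerns the d-ball around x0, but its volume is the same around
    every x.\<close>
  have vol: "ennreal (?w / 2 * d ^ DIM('a)) \<le> emeasure lborel (ball x d - A')" for x
  proof -
    have 1: "ball x d - A' \<in> fmeasurable lborel" by (rule fmeasurable_ball_inter[of _ x d]) auto
    have "measure lborel (ball x d) \<le> measure lborel ((ball x d - A') \<union> A')"
    proof (rule measure_mono_fmeasurable)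
      show "(ball x d - A') \<union> A' \<in> fmeasurable lborel" using 1 A'f by (rule fmeasurable.Un)
    qed auto
    also have "\<dots> \<le> measure lborel (ball x d - A') + measure lborel A'"
      by (intro measure_Un_le) auto
    finally have "measure lborel (ball x d) \<le> measure lborel (ball x d - A') + measure lborel A'" .
    moreover have "measure lborel (ball x d) = ?w * d ^ DIM('a)" "measure lborel (ball x0 d) = ?w * d ^ DIM('a)"
      using d by (simp_all only: measure_lborel_ball less_imp_le)
    ultimately have "?w / 2 * d ^ DIM('a) \<le> measure lborel (ball x d - A')"
      using A unfolding A'_def by simp
    then have "ennreal (?w / 2 * d ^ DIM('a)) \<le> ennreal (measure lborel (ball x d - A'))" by (rule ennreal_leI)
    also have "\<dots> = emeasure lborel (ball x d - A')" using 1 by (simp add: emeasure_eq_measure2)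
    finally show ?thesis .
  qed
  have "ennreal (?w / 2 * d powr (- \<beta>) * level_moment v x0 k p \<rho>1) =
      ennreal (level_moment v x0 k p \<rho>1) * ennreal (c * (?w / 2 * d ^ DIM('a)))"
  proof -
    have "c * d ^ DIM('a) = d powr (- \<beta>)"
    proof -
      have "d ^ DIM('a) = d powr real DIM('a)" using d by (simp add: powr_realpow)
      then show ?thesis by (simp add: c_def powr_add[symmetric])
    qed
    then have "?w / 2 * d powr (- \<beta>) = c * (?w / 2 * d ^ DIM('a))" by (simp add: mult_ac)
    then show ?thesis by (simp only:) (simp add: ennreal_mult[symmetric] c_def d less_imp_le mult_ac)
  qed
  also have "\<dots> = (\<integral>\<^sup>+x. ennreal (f x) \<partial>lborel) * ennreal (c * (?w / 2 * d ^ DIM('a)))"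
    unfolding f_def using p by (subst nn_integral_level[OF v _ p]) auto
  also have "\<dots> = (\<integral>\<^sup>+x. ennreal (f x) * ennreal (c * (?w / 2 * d ^ DIM('a))) \<partial>lborel)"
    by (intro nn_integral_multc[symmetric]) auto
  also have "\<dots> \<le> (\<integral>\<^sup>+x. \<integral>\<^sup>+y. ennreal (f x) * (ennreal c * indicator S (x, y)) \<partial>lborel \<partial>lborel)"
  proof (intro nn_integral_mono)
    fix x
    have "ennreal (c * (?w / 2 * d ^ DIM('a))) = ennreal c * ennreal (?w / 2 * d ^ DIM('a))"
      by (rule ennreal_mult) (use d in \<open>auto simp: c_def\<close>)
    also have "\<dots> \<le> ennreal c * emeasure lborel (ball x d - A')" by (intro mult_left_mono vol) auto
    also have "\<dots> = (\<integral>\<^sup>+y. ennreal c * indicator (ball x d - A') y \<partial>lborel)"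
      by (subst nn_integral_cmult_indicator) auto
    also have "\<dots> = (\<integral>\<^sup>+y. ennreal c * indicator S (x, y) \<partial>lborel)"
      by (intro nn_integral_cong) (auto simp: S_def indicator_def)
    finally have "ennreal (f x) * ennreal (c * (?w / 2 * d ^ DIM('a))) \<le>
      ennreal (f x) * (\<integral>\<^sup>+y. ennreal c * indicator S (x, y) \<partial>lborel)" by (rule mult_left_mono) auto
    also have "\<dots> = (\<integral>\<^sup>+y. ennreal (f x) * (ennreal c * indicator S (x, y)) \<partial>lborel)"
      by (intro nn_integral_cmult[symmetric]) measurable
    finally show "ennreal (f x) * ennreal (c * (?w / 2 * d ^ DIM('a))) \<le>
      (\<integral>\<^sup>+y. ennreal (f x) * (ennreal c * indicator S (x, y)) \<partial>lborel)" .
  qed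
  also have "\<dots> = (\<integral>\<^sup>+z. ennreal (f (fst z)) * (ennreal c * indicator S z) \<partial>(lborel \<Otimes>\<^sub>M lborel))"
    by (subst lborel.nn_integral_fst[symmetric]) auto
  also have "\<dots> = (\<integral>\<^sup>+z. ennreal (f (fst z)) * (ennreal c * indicator S z) \<partial>lborel)"
    by (simp only: lborel_prod)
  also have "\<dots> \<le> (\<integral>\<^sup>+z. ennreal (good_density p \<beta> v x0 k \<rho>1 \<rho>2 z) \<partial>lborel)"
  proof (intro nn_integral_mono)
    fix z :: "'a \<times> 'a"
    obtain x y where z: "z = (x, y)" by (cases z)
    show "ennreal (f (fst z)) * (ennreal c * indicator S z) \<le> ennreal (good_density p \<beta> v x0 k \<rho>1 \<rho>2 z)"
    proof (cases "x \<in> ball x0 \<rho>1 \<and> k < v x \<and> z \<in> S")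
      case True
      have y: "y \<in> ball x0 \<rho>2"
        using True d(2) dist_triangle[of x0 y x] by (auto simp: S_def z)
      then have vy: "v y \<le> k" using True by (auto simp: S_def z A'_def)
      have ne: "x - y \<noteq> 0" using vy True by auto
      have sk: "c \<le> sing_kernel \<beta> (x - y)"
        unfolding c_def using ne True \<beta> by (intro sing_kernel_ge) (auto simp: S_def z dist_norm)
      have "f x * c = (v x - k) powr (p - 1) * (v x - k) * c"
        using True by (simp add: f_def powr_diff)
      also have "\<dots> \<le> (v x - v y) powr (p - 1) * (v x - k) * sing_kernel \<beta> (x - y)"
        using True vy sk p by (intro mult_mono powr_mono2) (auto simp: c_def)
      also have "\<dots> = good_density p \<beta> v x0 k \<rho>1 \<rho>2 z"
        using True y vy by (simp add: good_density_def z)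
      finally have "ennreal (f x * c) \<le> ennreal (good_density p \<beta> v x0 k \<rho>1 \<rho>2 z)" by (rule ennreal_leI)
      moreover have "ennreal (f x * c) = ennreal (f x) * ennreal c"
        using f0 by (intro ennreal_mult) (auto simp: c_def)
      ultimately show ?thesis using True by (simp add: z)
    next
      case False
      then have "f x = 0 \<or> z \<notin> S" by (auto simp: f_def)
      then show ?thesis by (auto simp: z)
    qed
  qed
  finally show ?thesis .
qed

text \<open>For y with v(y) \<le> l the difference v(x) - v(y) is at least k - l, whatever x is
  above the level, and the kernel is at least its value at distance 2 \<rho>2. The two integrations
  decouple into a first moment and the measure of {v \<le> l}.\<close>

lemma shrinking_lower:
  fixes v :: "'a::euclidean_space \<Rightarrow> real"
  assumes [measurable]: "v \<in> borel_measurable borel" and p: "p > 1" and \<beta>: "\<beta> > 0"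
    and \<rho>: "0 < \<rho>1" "\<rho>1 < \<rho>2" and l: "l \<le> k"
    and A: "measure lborel (ball x0 \<rho>1) / 2 \<le> measure lborel {x \<in> ball x0 \<rho>1. v x \<le> l}"
    and v: "integrable lborel (\<lambda>x. \<bar>v x\<bar> powr p)"
  shows "ennreal (unit_ball_vol (real DIM('a)) / 2 * 2 powr (- (real DIM('a) + \<beta>)) *
      ((k - l) powr (p - 1) * \<rho>1 powr real DIM('a) * \<rho>2 powr (- (real DIM('a) + \<beta>)) * level_moment v x0 k 1 \<rho>1)) \<le>
    (\<integral>\<^sup>+z. ennreal (good_density p \<beta> v x0 k \<rho>1 \<rho>2 z) \<partial>lborel)"
proof -
  let ?w = "unit_ball_vol (real DIM('a))"
  define S where "S = {x \<in> ball x0 \<rho>1. v x \<le> l}"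
  have [measurable]: "S \<in> sets borel" unfolding S_def by measurable
  have Sf: "S \<in> fmeasurable lborel" by (rule fmeasurable_ball_inter[of _ x0 \<rho>1]) (auto simp: S_def)
  define f where "f x = indicator (ball x0 \<rho>1) x * max 0 (v x - k)" for x
  have f0: "f x \<ge> 0" for x by (simp add: f_def)
  have [measurable]: "f \<in> borel_measurable borel" unfolding f_def by measurable
  define c where "c = (k - l) powr (p - 1) * (2 * \<rho>2) powr (- (real DIM('a) + \<beta>))"
  have c0: "c \<ge> 0" by (simp add: c_def)
  have I: "(\<integral>\<^sup>+x. ennreal (f x) \<partial>lborel) = ennreal (level_moment v x0 k 1 \<rho>1)"
    using nn_integral_level(1)[OF v _ p, of 1 x0 \<rho>1 k] p by (simp add: f_def)
  have m: "?w / 2 * \<rho>1 powr real DIM('a) \<le> measure lborel S"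
    using A \<rho> by (simp add: S_def measure_lborel_ball powr_realpow)
  have "?w / 2 * 2 powr (- (real DIM('a) + \<beta>)) *
      ((k - l) powr (p - 1) * \<rho>1 powr real DIM('a) * \<rho>2 powr (- (real DIM('a) + \<beta>)) * level_moment v x0 k 1 \<rho>1)
      = level_moment v x0 k 1 \<rho>1 * (c * (?w / 2 * \<rho>1 powr real DIM('a)))"
    using \<rho> by (simp add: c_def powr_mult)
  also have "\<dots> \<le> level_moment v x0 k 1 \<rho>1 * (c * measure lborel S)"
    by (intro mult_left_mono m c0) auto
  finally have "ennreal (?w / 2 * 2 powr (- (real DIM('a) + \<beta>)) *
      ((k - l) powr (p - 1) * \<rho>1 powr real DIM('a) * \<rho>2 powr (- (real DIM('a) + \<beta>)) * level_moment v x0 k 1 \<rho>1))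
      \<le> ennreal (level_moment v x0 k 1 \<rho>1 * (c * measure lborel S))" by (rule ennreal_leI)
  also have "\<dots> = ennreal (level_moment v x0 k 1 \<rho>1) * (ennreal c * emeasure lborel S)"
    using c0 Sf by (simp add: ennreal_mult emeasure_eq_measure2)
  also have "\<dots> = (\<integral>\<^sup>+x. ennreal (f x) \<partial>lborel) * (\<integral>\<^sup>+y. ennreal c * indicator S y \<partial>lborel)"
    using I by (simp add: nn_integral_cmult_indicator)
  also have "\<dots> = (\<integral>\<^sup>+z. ennreal (f (fst z)) * (ennreal c * indicator S (snd z)) \<partial>lborel)"
    by (rule nn_integral_prod_mult[symmetric]) auto
  also have "\<dots> \<le> (\<integral>\<^sup>+z. ennreal (good_density p \<beta> v x0 k \<rho>1 \<rho>2 z) \<partial>lborel)"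
  proof (intro nn_integral_mono)
    fix z :: "'a \<times> 'a"
    obtain x y where z: "z = (x, y)" by (cases z)
    show "ennreal (f (fst z)) * (ennreal c * indicator S (snd z)) \<le> ennreal (good_density p \<beta> v x0 k \<rho>1 \<rho>2 z)"
    proof (cases "x \<in> ball x0 \<rho>1 \<and> k < v x \<and> y \<in> S")
      case True
      have y: "y \<in> ball x0 \<rho>2" using True \<rho> by (auto simp: S_def)
      have vy: "v y \<le> l" "v y \<le> k" using True l by (auto simp: S_def)
      have ne: "x - y \<noteq> 0" using vy True by auto
      have "dist x y \<le> dist x x0 + dist x0 y" by (rule dist_triangle)
      then have "norm (x - y) \<le> 2 * \<rho>2" using True y \<rho> by (auto simp: dist_norm norm_minus_commute)
      then have sk: "(2 * \<rho>2) powr (- (real DIM('a) + \<beta>)) \<le> sing_kernel \<beta> (x - y)"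
        using ne \<beta> by (intro sing_kernel_ge) auto
      have "f x * c = (k - l) powr (p - 1) * (v x - k) * (2 * \<rho>2) powr (- (real DIM('a) + \<beta>))"
        using True by (simp add: f_def c_def)
      also have "\<dots> \<le> (v x - v y) powr (p - 1) * (v x - k) * sing_kernel \<beta> (x - y)"
        using True vy sk p l by (intro mult_mono powr_mono2) auto
      also have "\<dots> = good_density p \<beta> v x0 k \<rho>1 \<rho>2 z"
        using True y vy by (simp add: good_density_def z)
      finally have "ennreal (f x * c) \<le> ennreal (good_density p \<beta> v x0 k \<rho>1 \<rho>2 z)" by (rule ennreal_leI)
      moreover have "ennreal (f x * c) = ennreal (f x) * ennreal c"
        using f0 c0 by (intro ennreal_mult) auto
      ultimately show ?thesis using True by (simp add: z)
    next
      case False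
      then have "f x = 0 \<or> y \<notin> S" by (auto simp: f_def)
      then show ?thesis by (auto simp: z)
    qed
  qed
  finally show ?thesis .
qed

lemma nonlocal_solution_de_giorgi:
  fixes p \<beta> L :: real
  assumes p: "p > 1" and \<beta>: "0 < \<beta>" "\<beta> < p" and L: "L \<ge> 1"
  obtains C where "C > 0"
    "\<And>\<Omega> b (v :: real^'n \<Rightarrow> real) x0 R. nonlocal_solution p \<beta> L \<Omega> b v \<Longrightarrow> ball x0 R \<subseteq> \<Omega> \<Longrightarrow> de_giorgi p \<beta> C v x0 R"
proof -
  obtain c1 where c1: "c1 > 0" "\<And>R. R > 0 \<Longrightarrow>
      (\<integral>\<^sup>+z. ennreal (indicator (ball 0 R) z * sing_kernel (- (p - \<beta>)) z) \<partial>(lborel :: (real^'n) measure)) \<le> ennreal (c1 * R powr (p - \<beta>))"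
    using nn_integral_sing_kernel_near[of "p - \<beta>"] \<beta> by auto
  let ?n = "real DIM(real^'n)"
  define C0 where "C0 = L * (2 * (L * p * (L\<^sup>2 * p) powr (p - 1)) * c1 * 2 powr (2 * p) + 2 * L * 2 powr (real CARD('n) + p))"
  have C0: "C0 > 0" using L p c1(1) unfolding C0_def by (intro mult_pos_pos add_pos_pos) auto
  \<comment> \<open>The two lower bounds come with different constants; a is the smaller one and
    serves both.\<close>
  define a where "a = unit_ball_vol ?n / 2 * 2 powr (- (?n + \<beta>))"
  have a: "a > 0" "a \<le> unit_ball_vol ?n / 2"
  proof -
    show "a > 0" by (simp add: a_def)
    have "2 powr (- (?n + \<beta>)) \<le> (2::real) powr 0" using \<beta> by (intro powr_mono) auto
    then show "a \<le> unit_ball_vol ?n / 2" unfolding a_def by (simp add: mult_left_le)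
  qed
  show ?thesis
  proof (rule that)
    show "C0 / a > 0" using C0 a by simp
    fix \<Omega> b and v :: "real^'n \<Rightarrow> real" and x0 R
    assume "nonlocal_solution p \<beta> L \<Omega> b v" and ball: "ball x0 R \<subseteq> \<Omega>"
    then interpret nonlocal_solution p \<beta> L \<Omega> b v by simp
    show "de_giorgi p \<beta> (C0 / a) v x0 R"
      unfolding de_giorgi_def
    proof (intro conjI allI impI v_meas v_Lp)
      fix k \<rho>1 \<rho>2 d :: real
      assume \<rho>: "0 < \<rho>1" "\<rho>1 < \<rho>2" "\<rho>2 \<le> R" and d: "0 < d" "d \<le> \<rho>2 - \<rho>1"
        and A: "measure lborel {x \<in> ball x0 \<rho>2. k < v x} \<le> measure lborel (ball x0 d) / 2"
      let ?E = "dg_energy p \<beta> v x0 k \<rho>1 \<rho>2"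
      have "ball x0 \<rho>2 \<subseteq> \<Omega>" using ball \<rho> by auto
      then have "(\<integral>\<^sup>+z. ennreal (good_density p \<beta> v x0 k \<rho>1 \<rho>2 z) \<partial>lborel) \<le> ennreal (C0 * ?E)"
        unfolding C0_def using \<rho> c1 by (intro caccioppoli) auto
      from order_trans[OF faber_krahn_lower[OF v_meas p \<beta>(1) \<rho>(1,2) d A v_Lp] this]
      have "unit_ball_vol ?n / 2 * d powr (- \<beta>) * level_moment v x0 k p \<rho>1 \<le> C0 * ?E"
        using C0 by (subst (asm) ennreal_le_iff) (auto simp: dg_energy_nonneg)
      moreover have "a * (d powr (- \<beta>) * level_moment v x0 k p \<rho>1) \<le>
          unit_ball_vol ?n / 2 * (d powr (- \<beta>) * level_moment v x0 k p \<rho>1)"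
        using a by (intro mult_right_mono) auto
      ultimately have "a * (d powr (- \<beta>) * level_moment v x0 k p \<rho>1) \<le> C0 * ?E" by (simp add: mult.assoc)
      then have "d powr (- \<beta>) * level_moment v x0 k p \<rho>1 \<le> C0 / a * ?E" using a by (simp add: field_simps)
      from mult_left_mono[OF this, of "d powr \<beta>"]
      have "(d powr \<beta> * d powr (- \<beta>)) * level_moment v x0 k p \<rho>1 \<le> C0 / a * d powr \<beta> * ?E"
        by (simp add: mult_ac)
      moreover have "d powr \<beta> * d powr (- \<beta>) = 1" using d by (simp add: powr_minus)
      ultimately show "level_moment v x0 k p \<rho>1 \<le> C0 / a * d powr \<beta> * ?E" by simp
    next
      fix k \<rho>1 \<rho>2 l :: real
      assume \<rho>: "0 < \<rho>1" "\<rho>1 < \<rho>2" "\<rho>2 \<le> R" and l: "l \<le> k"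
        and A: "measure lborel (ball x0 \<rho>1) / 2 \<le> measure lborel {x \<in> ball x0 \<rho>1. v x \<le> l}"
      let ?E = "dg_energy p \<beta> v x0 k \<rho>1 \<rho>2"
      have "ball x0 \<rho>2 \<subseteq> \<Omega>" using ball \<rho> by auto
      then have "(\<integral>\<^sup>+z. ennreal (good_density p \<beta> v x0 k \<rho>1 \<rho>2 z) \<partial>lborel) \<le> ennreal (C0 * ?E)"
        unfolding C0_def using \<rho> c1 by (intro caccioppoli) auto
      from order_trans[OF shrinking_lower[OF v_meas p \<beta>(1) \<rho>(1,2) l A v_Lp] this]
      have "a * ((k - l) powr (p - 1) * \<rho>1 powr ?n * \<rho>2 powr (- (?n + \<beta>)) * level_moment v x0 k 1 \<rho>1) \<le> C0 * ?E"
        using C0 by (subst (asm) ennreal_le_iff) (auto simp: dg_energy_nonneg a_def)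
      then show "(k - l) powr (p - 1) * \<rho>1 powr ?n * \<rho>2 powr (- (?n + \<beta>)) * level_moment v x0 k 1 \<rho>1 \<le> C0 / a * ?E"
        using a by (simp add: field_simps)
    qed
  qed
qed

lemma nonlocal_solution_uminus:
  assumes "nonlocal_solution p \<beta> L \<Omega> b v"
  shows "nonlocal_solution p \<beta> L \<Omega> (\<lambda>z. - b z) (\<lambda>x. - v x)"
proof -
  interpret nonlocal_solution p \<beta> L \<Omega> b v by fact
  have a: "\<bar>- v (fst z) - - v (snd z)\<bar> = \<bar>v (fst z) - v (snd z)\<bar>" for z by simp
  show ?thesis
  proof (unfold_locales, unfold a)
    show "AE z in lborel. \<bar>v (fst z) - v (snd z)\<bar> powr p * sing_kernel \<beta> (fst z - snd z) / L \<le>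
        - b z * (- v (fst z) - - v (snd z))"
      using b_lower by eventually_elim (simp add: algebra_simps)
    fix \<psi> assume "\<psi> \<in> test_functions \<Omega>"
    from weak[OF this] show "(\<integral>z. - b z * (\<psi> (fst z) - \<psi> (snd z)) \<partial>lborel) = 0" by simp
  qed (use p \<beta> L v_Lp v_seminorm b_upper in auto)
qed

section \<open>De Giorgi iteration\<close>

lemma power_powr_swap: "x > 0 \<Longrightarrow> (x ^ j) powr e = (x powr e) ^ j" for x e :: real
  by (induction j) (auto simp: powr_mult)

context
  fixes v :: "'a::euclidean_space \<Rightarrow> real" and p :: real
  assumes v_Lp: "integrable lborel (\<lambda>x. \<bar>v x\<bar> powr p)"
    and v_meas [measurable]: "v \<in> borel_measurable borel" and p: "p > 1"
begin

lemma level_moment_mono: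
  assumes "0 \<le> e" "e \<le> p" "k \<le> k'" "r' \<le> r"
  shows "level_moment v x0 k' e r' \<le> level_moment v x0 k e r"
  unfolding level_moment_def
proof (rule integral_mono)
  fix x
  have "ball x0 r' \<subseteq> ball x0 r" using assms by auto
  then show "indicator (ball x0 r') x * max 0 (v x - k') powr e \<le> indicator (ball x0 r) x * max 0 (v x - k) powr e"
    using assms by (intro mult_mono powr_mono2) (auto simp: indicator_def)
qed (use level_integrable(1)[OF v_Lp v_meas p] assms in auto)

lemma level_tail_mono:
  assumes "\<beta> > 0" "k \<le> k'" "0 < r" "r \<le> r'"
  shows "level_tail p \<beta> v x0 k' r' \<le> level_tail p \<beta> v x0 k r"
  unfolding level_tail_def
proof (rule integral_mono)
  fix x
  have "ball x0 r \<subseteq> ball x0 r'" using assms by auto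
  then show "indicator (- ball x0 r') x * max 0 (v x - k') powr (p - 1) * sing_kernel \<beta> (x - x0) \<le>
      indicator (- ball x0 r) x * max 0 (v x - k) powr (p - 1) * sing_kernel \<beta> (x - x0)"
    using assms p by (intro mult_right_mono mult_mono powr_mono2) (auto simp: indicator_def)
qed (use level_integrable(2)[OF v_Lp v_meas p] assms in auto)

lemma level_chebyshev:
  assumes "k < k'"
  shows "measure lborel {x \<in> ball x0 r. k' < v x} * (k' - k) powr p \<le> level_moment v x0 k p r"
proof -
  have A: "{x \<in> ball x0 r. k' < v x} \<in> fmeasurable lborel"
    by (rule fmeasurable_ball_inter[of _ x0 r]) auto
  then have "measure lborel {x \<in> ball x0 r. k' < v x} * (k' - k) powr p =
      (\<integral>x. indicator {x \<in> ball x0 r. k' < v x} x * (k' - k) powr p \<partial>lborel)" by simp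
  also have "\<dots> \<le> level_moment v x0 k p r"
    unfolding level_moment_def
  proof (rule integral_mono)
    show "integrable lborel (\<lambda>x. indicator {x \<in> ball x0 r. k' < v x} x * (k' - k) powr p)"
      using A by (intro integrable_mult_left integrable_real_indicator) (auto simp: fmeasurable_def)
    show "integrable lborel (\<lambda>x. indicator (ball x0 r) x * max 0 (v x - k) powr p)"
      using level_integrable(1)[OF v_Lp v_meas p] p by simp
    fix x
    show "indicator {x \<in> ball x0 r. k' < v x} x * (k' - k) powr p \<le> indicator (ball x0 r) x * max 0 (v x - k) powr p"
      using assms p by (auto simp: indicator_def intro!: powr_mono2)
  qed
  finally show ?thesis .
qed

text \<open>Raising the level trades powers: where v > k', both v - k' and k' - k are at most v - k,
  so p - 1 factors of v - k may be replaced by the gap between the levels. The iteration needs this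
  because its tail term comes with a first moment.\<close>

lemma level_moment_1_le:
  assumes "k < k'"
  shows "level_moment v x0 k' 1 r * (k' - k) powr (p - 1) \<le> level_moment v x0 k p r"
proof -
  have i1: "integrable lborel (\<lambda>x. indicator (ball x0 r) x * max 0 (v x - k') powr 1)"
    by (rule level_integrable(1)[OF v_Lp v_meas p]) (use p in auto)
  have "level_moment v x0 k' 1 r * (k' - k) powr (p - 1) =
      (\<integral>x. (indicator (ball x0 r) x * max 0 (v x - k') powr 1) * (k' - k) powr (p - 1) \<partial>lborel)"
    unfolding level_moment_def by simp
  also have "\<dots> \<le> level_moment v x0 k p r"
    unfolding level_moment_def
  proof (rule integral_mono)
    show "integrable lborel (\<lambda>x. (indicator (ball x0 r) x * max 0 (v x - k') powr 1) * (k' - k) powr (p - 1))"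
      using i1 by (rule integrable_mult_left)
    show "integrable lborel (\<lambda>x. indicator (ball x0 r) x * max 0 (v x - k) powr p)"
      using level_integrable(1)[OF v_Lp v_meas p] p by simp
    fix x
    have "max 0 (v x - k') * (k' - k) powr (p - 1) \<le> max 0 (v x - k) powr p"
    proof (cases "v x > k'")
      case True
      have "(v x - k') * (k' - k) powr (p - 1) \<le> (v x - k) * (v x - k) powr (p - 1)"
        using True assms p by (intro mult_mono powr_mono2) auto
      also have "\<dots> = (v x - k) powr p" using True assms by (simp add: powr_diff)
      finally show ?thesis using True assms by simp
    qed simp
    then show "(indicator (ball x0 r) x * max 0 (v x - k') powr 1) * (k' - k) powr (p - 1) \<le>
        indicator (ball x0 r) x * max 0 (v x - k) powr p"
      by (simp add: indicator_def)
  qed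
  finally show ?thesis .
qed

lemma level_moment_0_imp_AE:
  assumes "level_moment v x0 k p r \<le> 0"
  shows "AE x in lborel. x \<in> ball x0 r \<longrightarrow> v x \<le> k"
proof -
  have "level_moment v x0 k p r = 0" using assms by (intro antisym) auto
  then have "AE x in lborel. indicator (ball x0 r) x * max 0 (v x - k) powr p = 0"
    unfolding level_moment_def using level_integrable(1)[OF v_Lp v_meas p, of p] p
    by (subst (asm) integral_nonneg_eq_0_iff_AE) auto
  then show ?thesis by eventually_elim (auto simp: max_def split: if_splits)
qed

end

text \<open>The radii decrease from \<rho>2 to \<rho>1 and the levels increase from k0 to k0 + \<kappa>. At step j the first
  De Giorgi inequality is applied with a geometrically decreasing d, chosen so that the induction
  hypothesis and Chebyshev's inequality give exactly its density condition.\<close>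

lemma de_giorgi_iteration:
  fixes p \<beta> C T :: real
  assumes p: "p > 1" and \<beta>: "\<beta> > 0" and C: "C > 0" and T: "T \<ge> 0"
  obtains \<nu> \<gamma> where "\<nu> > 0" "\<gamma> > 0"
    "\<And>v (x0::'a::euclidean_space) R \<rho>1 \<rho>2 k0 \<kappa>. de_giorgi p \<beta> C v x0 R \<Longrightarrow> 0 < \<rho>1 \<Longrightarrow> \<rho>1 < \<rho>2 \<Longrightarrow> \<rho>2 \<le> 2 * \<rho>1 \<Longrightarrow> \<rho>2 \<le> R \<Longrightarrow> \<kappa> > 0 \<Longrightarrow>
      level_moment v x0 k0 p \<rho>2 \<le> \<nu> * ((\<rho>2 - \<rho>1) / \<rho>2) powr \<gamma> * \<kappa> powr p * \<rho>2 powr real DIM('a) \<Longrightarrow>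
      level_tail p \<beta> v x0 k0 \<rho>1 \<le> T * \<kappa> powr (p - 1) * \<rho>2 powr (- \<beta>) \<Longrightarrow>
      AE x in lborel. x \<in> ball x0 \<rho>1 \<longrightarrow> v x \<le> k0 + \<kappa>"
proof -
  define n where "n = real DIM('a)"
  define w where "w = unit_ball_vol n"
  define N where "N = n + p"
  \<comment> \<open>In step j the radius d will be h u^a \<delta>0 \<delta>^j, with h the gap
    between the radii and u = h / \<rho>2. In d^\<beta> the factor u^(a \<beta>) = u^N cancels the
    loss u^(-N) of the Caccioppoli inequality, \<delta>^\<beta> beats the growth 2^((N+p) j) caused
    by the shrinking gaps, and \<delta>0 brings the remaining constant below \<mu>. The values of
    \<mu>, \<nu> and \<gamma> are then forced by matching Chebyshev's bound with half the volume of
    the d-ball.\<close>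
  define a where "a = N / \<beta>"
  define \<delta> :: real where "\<delta> = (1/2) powr ((N + p) / \<beta> + 1)"
  define \<mu> where "\<mu> = \<delta> powr n * 2 powr (- p)"
  define C' where "C' = C * (2 powr \<beta> + T)"
  define \<delta>0 where "\<delta>0 = min (1/2) ((\<mu> / (C' * 2 powr (N + p))) powr (1 / \<beta>))"
  define \<nu> where "\<nu> = w / 2 * \<delta>0 powr n * 2 powr (- p)"
  define \<gamma> where "\<gamma> = n * (1 + a)"
  have n: "n \<ge> 1" using DIM_positive[where 'a='a] unfolding n_def by linarith
  have N: "N > 0" "N + p > 0" using n p by (auto simp: N_def)
  have a: "a > 0" using N \<beta> by (simp add: a_def)
  have w: "w > 0" by (simp add: w_def n_def)
  have \<delta>: "\<delta> > 0" "\<delta> \<le> 1/2"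
  proof -
    have "(1/2) powr ((N + p) / \<beta> + 1) \<le> (1/2 :: real) powr 1"
      using N \<beta> by (intro powr_mono') auto
    then show "\<delta> \<le> 1/2" by (simp add: \<delta>_def)
  qed (simp add: \<delta>_def)
  have \<delta>\<beta>: "\<delta> powr \<beta> * 2 powr (N + p) \<le> 1"
  proof -
    have "\<delta> powr \<beta> = (1/2) powr (((N + p) / \<beta> + 1) * \<beta>)" by (simp add: \<delta>_def powr_powr)
    also have "((N + p) / \<beta> + 1) * \<beta> = N + p + \<beta>" using \<beta> by (simp add: field_simps)
    also have "(1/2 :: real) powr (N + p + \<beta>) \<le> (1/2) powr (N + p)" using \<beta> by (intro powr_mono') auto
    also have "(1/2 :: real) powr (N + p) = 1 / 2 powr (N + p)" by (simp add: powr_divide)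
    finally show ?thesis by (simp add: field_simps)
  qed
  have \<mu>: "\<mu> > 0" "\<mu> < 1"
  proof -
    show "\<mu> > 0" using \<delta> by (simp add: \<mu>_def)
    have "\<delta> powr n \<le> 1" using \<delta> n by (intro powr_le1) auto
    moreover have "2 powr (- p) < (2::real) powr 0" using p by (intro powr_less_mono) auto
    ultimately have "\<delta> powr n * 2 powr (- p) < 1 * 1" by (intro mult_le_less_imp_less) (use \<delta> in auto)
    then show "\<mu> < 1" by (simp add: \<mu>_def)
  qed
  have C': "C' > 0" using C T by (simp add: C'_def add_pos_nonneg)
  have \<delta>0: "\<delta>0 > 0" "\<delta>0 \<le> 1/2" using \<mu> C' by (auto simp: \<delta>0_def)
  have \<delta>0\<beta>: "C' * \<delta>0 powr \<beta> * 2 powr (N + p) \<le> \<mu>"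
  proof -
    have "\<delta>0 powr \<beta> \<le> ((\<mu> / (C' * 2 powr (N + p))) powr (1 / \<beta>)) powr \<beta>"
      using \<delta>0 \<beta> by (intro powr_mono2) (auto simp: \<delta>0_def)
    also have "\<dots> = \<mu> / (C' * 2 powr (N + p))" using \<mu> C' \<beta> by (simp add: powr_powr)
    finally show ?thesis using C' by (simp add: field_simps)
  qed
  have \<nu>: "\<nu> > 0" using w \<delta>0 by (simp add: \<nu>_def)
  have \<gamma>: "\<gamma> > 0" using n a by (simp add: \<gamma>_def)
  show ?thesis
  proof (rule that[OF \<nu> \<gamma>])
    fix v :: "'a \<Rightarrow> real" and x0 R \<rho>1 \<rho>2 k0 \<kappa>
    assume dg: "de_giorgi p \<beta> C v x0 R" and \<rho>: "0 < \<rho>1" "\<rho>1 < \<rho>2" "\<rho>2 \<le> 2 * \<rho>1" "\<rho>2 \<le> R" and \<kappa>: "\<kappa> > 0"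
      and Y0: "level_moment v x0 k0 p \<rho>2 \<le> \<nu> * ((\<rho>2 - \<rho>1) / \<rho>2) powr \<gamma> * \<kappa> powr p * \<rho>2 powr real DIM('a)"
      and tail: "level_tail p \<beta> v x0 k0 \<rho>1 \<le> T * \<kappa> powr (p - 1) * \<rho>2 powr (- \<beta>)"
    have v_meas [measurable]: "v \<in> borel_measurable borel" and v: "integrable lborel (\<lambda>x. \<bar>v x\<bar> powr p)"
      using dg by (auto simp: de_giorgi_def)
    define h where "h = \<rho>2 - \<rho>1"
    define u where "u = h / \<rho>2"
    have h: "h > 0" and \<rho>2: "\<rho>2 > 0" using \<rho> by (auto simp: h_def)
    have u: "0 < u" "u \<le> 1" using h \<rho> by (auto simp: u_def h_def)
    have hu: "h = u * \<rho>2" using \<rho>2 by (simp add: u_def)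
    define r where "r j = \<rho>1 + h * (1/2) ^ j" for j :: nat
    define k where "k j = k0 + \<kappa> * (1 - (1/2) ^ j)" for j :: nat
    define Y where "Y j = level_moment v x0 (k j) p (r j)" for j
    define M0 where "M0 = \<nu> * u powr \<gamma> * \<kappa> powr p * \<rho>2 powr n"
    have M0: "M0 \<ge> 0" using \<nu> by (simp add: M0_def)
    have Ynn: "Y j \<ge> 0" for j by (simp add: Y_def)
    have step: "Y (Suc j) \<le> M0 * \<mu> ^ Suc j" if IH: "Y j \<le> M0 * \<mu> ^ j" for j
    proof -
      \<comment> \<open>The exponent is Suc j because both gaps, that of the radii and that of the
        levels, are halves of what is left after step j: they equal h t and \<kappa> t.\<close>
      define t :: real where "t = (1/2) ^ Suc j"
      have t: "0 < t" "t \<le> 1" unfolding t_def by (simp, intro power_le_one) auto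
      have tp: "t powr (- e) = 2 powr e * (2 powr e) ^ j" for e
      proof -
        have "t powr (- e) = ((1/2) powr (- e)) ^ Suc j" unfolding t_def by (rule power_powr_swap) simp
        also have "(1/2 :: real) powr (- e) = 2 powr e" by (simp add: powr_divide powr_minus)
        finally show ?thesis by simp
      qed
      have rj: "r j - r (Suc j) = h * t" by (simp add: r_def t_def field_simps)
      have kj: "k (Suc j) - k j = \<kappa> * t" by (simp add: k_def t_def field_simps)
      have klt: "k j < k (Suc j)" using \<kappa> t kj by (smt (verit) mult_pos_pos)
      have "\<kappa> * (1 - t) \<ge> 0" using \<kappa> t by simp
      then have k0: "k0 \<le> k (Suc j)" unfolding k_def t_def by linarith
      have rpos: "0 < r (Suc j)" "r (Suc j) < r j" "r j \<le> \<rho>2" "\<rho>1 \<le> r j"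
      proof -
        show "0 < r (Suc j)" using \<rho> h by (simp add: r_def add_pos_pos)
        show "r (Suc j) < r j" using rj h t by (smt (verit) mult_pos_pos)
        have "h * (1/2) ^ j \<le> h * 1" using h by (intro mult_left_mono) (auto simp: power_le_one)
        then show "r j \<le> \<rho>2" by (simp add: r_def h_def)
        show "\<rho>1 \<le> r j" using h by (simp add: r_def)
      qed
      define d where "d = h * u powr a * \<delta>0 * \<delta> ^ j"
      have d: "d > 0" using h u \<delta>0 \<delta> by (simp add: d_def)
      have d_le: "d \<le> r j - r (Suc j)"
      proof -
        have "u powr a \<le> 1" using u a by (intro powr_le1) auto
        moreover have "\<delta> ^ j \<le> (1/2) ^ j" using \<delta> by (intro power_mono) auto
        ultimately have "h * u powr a * \<delta>0 * \<delta> ^ j \<le> h * 1 * (1/2) * (1/2) ^ j"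
          using h \<delta>0 \<delta> by (intro mult_mono) auto
        then show ?thesis unfolding rj d_def t_def by simp
      qed
      have \<kappa>t: "(\<kappa> * t) powr e = \<kappa> powr e * t powr e" for e using \<kappa> t by (simp add: powr_mult)
      have tinv: "t powr e * t powr (- e) = 1" for e using t by (simp add: powr_minus)
      have Am: "measure lborel {x \<in> ball x0 (r j). k (Suc j) < v x} \<le> measure lborel (ball x0 d) / 2"
      proof -
        let ?A = "measure lborel {x \<in> ball x0 (r j). k (Suc j) < v x}"
        have "?A * (\<kappa> powr p * t powr p) \<le> M0 * \<mu> ^ j"
          using level_chebyshev[OF v v_meas p klt, of x0 "r j"] IH unfolding kj \<kappa>t Y_def by linarith
        then have "?A * (\<kappa> powr p * t powr p) * (\<kappa> powr (- p) * t powr (- p)) \<le>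
            M0 * \<mu> ^ j * (\<kappa> powr (- p) * t powr (- p))" by (intro mult_right_mono) auto
        moreover have "?A * (\<kappa> powr p * t powr p) * (\<kappa> powr (- p) * t powr (- p)) = ?A"
          using \<kappa> t by (simp add: powr_minus field_simps)
        moreover have "M0 * \<mu> ^ j * (\<kappa> powr (- p) * t powr (- p)) = measure lborel (ball x0 d) / 2"
        proof -
          have "M0 * \<mu> ^ j * (\<kappa> powr (- p) * t powr (- p)) =
             \<nu> * 2 powr p * u powr \<gamma> * \<rho>2 powr n * (\<mu> * 2 powr p) ^ j * (\<kappa> powr p * \<kappa> powr (- p))"
            unfolding M0_def tp by (simp add: power_mult_distrib mult_ac)
          also have "\<kappa> powr p * \<kappa> powr (- p) = 1" using \<kappa> by (simp add: powr_minus)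
          also have "\<nu> * 2 powr p = w / 2 * \<delta>0 powr n" by (simp add: \<nu>_def powr_minus)
          also have "\<mu> * 2 powr p = \<delta> powr n" by (simp add: \<mu>_def powr_minus)
          also have "w / 2 * \<delta>0 powr n * u powr \<gamma> * \<rho>2 powr n * (\<delta> powr n) ^ j * 1 = w / 2 * d powr n"
          proof -
            have "d powr n = h powr n * u powr (a * n) * \<delta>0 powr n * (\<delta> powr n) ^ j"
              using h u \<delta>0 \<delta> by (simp add: d_def powr_mult powr_powr power_powr_swap)
            also have "h powr n = u powr n * \<rho>2 powr n" using u \<rho>2 by (simp add: hu powr_mult)
            also have "u powr n * \<rho>2 powr n * u powr (a * n) * \<delta>0 powr n * (\<delta> powr n) ^ j =
                (u powr n * u powr (a * n)) * \<rho>2 powr n * \<delta>0 powr n * (\<delta> powr n) ^ j" by simp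
            also have "u powr n * u powr (a * n) = u powr \<gamma>"
              by (simp add: powr_add[symmetric] \<gamma>_def algebra_simps)
            finally show ?thesis by (simp add: mult_ac)
          qed
          also have "w / 2 * d powr n = measure lborel (ball x0 d) / 2"
            using d by (simp add: measure_lborel_ball w_def n_def powr_realpow)
          finally show ?thesis .
        qed
        ultimately show ?thesis by metis
      qed
      have DG: "Y (Suc j) \<le> C * d powr \<beta> * dg_energy p \<beta> v x0 (k (Suc j)) (r (Suc j)) (r j)"
        using dg rpos \<rho> d d_le Am unfolding de_giorgi_def Y_def by (meson order_trans)
      have E: "dg_energy p \<beta> v x0 (k (Suc j)) (r (Suc j)) (r j) \<le>
          (u powr (- N) * t powr (- N)) * (\<rho>2 powr (- \<beta>) * (2 powr \<beta> + T) * t powr (- (p - 1)) * Y j)"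
      proof -
        have lp: "level_moment v x0 (k (Suc j)) p (r j) \<le> Y j"
          unfolding Y_def using klt p by (intro level_moment_mono[OF v v_meas p]) auto
        have l1: "level_moment v x0 (k (Suc j)) 1 (r j) \<le> Y j * (\<kappa> powr (- (p - 1)) * t powr (- (p - 1)))"
        proof -
          let ?l = "level_moment v x0 (k (Suc j)) 1 (r j)"
          have "?l * (\<kappa> powr (p - 1) * t powr (p - 1)) \<le> Y j"
            using level_moment_1_le[OF v v_meas p klt, of x0 "r j"] unfolding kj \<kappa>t Y_def .
          then have "?l * (\<kappa> powr (p - 1) * t powr (p - 1)) * (\<kappa> powr (- (p - 1)) * t powr (- (p - 1))) \<le>
              Y j * (\<kappa> powr (- (p - 1)) * t powr (- (p - 1)))" by (intro mult_right_mono) auto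
          moreover have "?l * (\<kappa> powr (p - 1) * t powr (p - 1)) * (\<kappa> powr (- (p - 1)) * t powr (- (p - 1))) =
              ?l * ((\<kappa> powr (p - 1) * \<kappa> powr (- (p - 1))) * (t powr (p - 1) * t powr (- (p - 1))))" by (simp only: mult_ac)
          moreover have "\<kappa> powr (p - 1) * \<kappa> powr (- (p - 1)) = 1" using \<kappa> by (simp only: powr_minus) simp
          ultimately show ?thesis by (simp only: tinv mult_1_right)
        qed
        have tl: "level_tail p \<beta> v x0 (k (Suc j)) (r j) \<le> T * \<kappa> powr (p - 1) * \<rho>2 powr (- \<beta>)"
          using level_tail_mono[OF v v_meas p \<beta> k0 \<rho>(1) rpos(4), of x0] tail by linarith
        have rb: "r j powr (- \<beta>) \<le> 2 powr \<beta> * \<rho>2 powr (- \<beta>)"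
        proof -
          have "r j powr (- \<beta>) \<le> (\<rho>2 / 2) powr (- \<beta>)" using rpos \<rho> \<beta> by (intro powr_mono2') auto
          also have "\<dots> = 2 powr \<beta> * \<rho>2 powr (- \<beta>)" using \<rho>2 by (simp add: powr_divide powr_minus field_simps)
          finally show ?thesis .
        qed
        have pre: "(r j / (r j - r (Suc j))) powr N \<le> u powr (- N) * t powr (- N)"
        proof -
          have "r j / (h * t) \<le> \<rho>2 / (h * t)" using rpos h t by (intro divide_right_mono) auto
          also have "\<rho>2 / (h * t) = inverse (u * t)" using \<rho>2 by (simp add: hu field_simps)
          finally have "(r j / (h * t)) powr N \<le> (inverse (u * t)) powr N"
            using rpos h t N \<rho> by (intro powr_mono2) auto
          also have "\<dots> = (u * t) powr (- N)" unfolding powr_minus using u t by (subst inverse_powr) auto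
          also have "\<dots> = u powr (- N) * t powr (- N)" using u t by (simp add: powr_mult)
          finally show ?thesis unfolding rj .
        qed
        have t1: "1 \<le> t powr (- (p - 1))"
          using powr_mono'[of "- (p - 1)" 0 t] p t by simp
        have "r j powr (- \<beta>) * level_moment v x0 (k (Suc j)) p (r j) +
            level_tail p \<beta> v x0 (k (Suc j)) (r j) * level_moment v x0 (k (Suc j)) 1 (r j) \<le>
            (2 powr \<beta> * \<rho>2 powr (- \<beta>)) * (Y j * t powr (- (p - 1))) +
            (T * \<kappa> powr (p - 1) * \<rho>2 powr (- \<beta>)) * (Y j * (\<kappa> powr (- (p - 1)) * t powr (- (p - 1))))"
        proof (intro add_mono mult_mono rb tl l1)
          have "Y j * 1 \<le> Y j * t powr (- (p - 1))" using t1 Ynn by (intro mult_left_mono) auto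
          then show "level_moment v x0 (k (Suc j)) p (r j) \<le> Y j * t powr (- (p - 1))" using lp by simp
        qed (use T in auto)
        also have "\<dots> = \<rho>2 powr (- \<beta>) * (2 powr \<beta> + T * (\<kappa> powr (p - 1) * \<kappa> powr (- (p - 1)))) * t powr (- (p - 1)) * Y j"
          by (simp add: algebra_simps)
        also have "\<kappa> powr (p - 1) * \<kappa> powr (- (p - 1)) = 1" using \<kappa> by (simp only: powr_minus) simp
        finally have in2: "r j powr (- \<beta>) * level_moment v x0 (k (Suc j)) p (r j) +
            level_tail p \<beta> v x0 (k (Suc j)) (r j) * level_moment v x0 (k (Suc j)) 1 (r j) \<le>
            \<rho>2 powr (- \<beta>) * (2 powr \<beta> + T) * t powr (- (p - 1)) * Y j" by simp
        have N': "real DIM('a) + p = N" by (simp add: N_def n_def)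
        show ?thesis unfolding dg_energy_def N'
          by (intro mult_mono pre in2) (auto intro!: add_nonneg_nonneg)
      qed
      have "Y (Suc j) \<le> C * d powr \<beta> * ((u powr (- N) * t powr (- N)) * (\<rho>2 powr (- \<beta>) * (2 powr \<beta> + T) * t powr (- (p - 1)) * Y j))"
        using C by (intro order_trans[OF DG mult_left_mono[OF E]]) auto
      also have "\<dots> = C' * (d powr \<beta> * u powr (- N) * \<rho>2 powr (- \<beta>)) * (t powr (- N) * t powr (- (p - 1))) * Y j"
        by (simp add: C'_def mult_ac)
      also have "d powr \<beta> * u powr (- N) * \<rho>2 powr (- \<beta>) = u powr \<beta> * \<delta>0 powr \<beta> * (\<delta> powr \<beta>) ^ j"
      proof -
        have "d powr \<beta> = h powr \<beta> * u powr (a * \<beta>) * \<delta>0 powr \<beta> * (\<delta> powr \<beta>) ^ j"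
          using h u \<delta>0 \<delta> by (simp add: d_def powr_mult powr_powr power_powr_swap)
        also have "a * \<beta> = N" using \<beta> by (simp add: a_def)
        also have "h powr \<beta> = u powr \<beta> * \<rho>2 powr \<beta>" using u \<rho>2 by (simp add: hu powr_mult)
        finally have "d powr \<beta> * u powr (- N) * \<rho>2 powr (- \<beta>) =
            u powr \<beta> * \<delta>0 powr \<beta> * (\<delta> powr \<beta>) ^ j * (u powr N * u powr (- N)) * (\<rho>2 powr \<beta> * \<rho>2 powr (- \<beta>))"
          by (simp only: mult_ac)
        moreover have "u powr N * u powr (- N) = 1" "\<rho>2 powr \<beta> * \<rho>2 powr (- \<beta>) = 1"
          using u \<rho>2 by (simp_all add: powr_minus)
        ultimately show ?thesis by simp
      qed
      also have "C' * (u powr \<beta> * \<delta>0 powr \<beta> * (\<delta> powr \<beta>) ^ j) * (t powr (- N) * t powr (- (p - 1))) * Y j \<le>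
          C' * (1 * \<delta>0 powr \<beta> * (\<delta> powr \<beta>) ^ j) * (2 powr (N + p) * (2 powr (N + p)) ^ j) * Y j"
      proof -
        have "t powr (- N) * t powr (- (p - 1)) = t powr (- (N + p - 1))" by (simp add: powr_add[symmetric] algebra_simps)
        also have "\<dots> \<le> t powr (- (N + p))" using t by (intro powr_mono') auto
        also have "\<dots> = 2 powr (N + p) * (2 powr (N + p)) ^ j" by (rule tp)
        finally have tt: "t powr (- N) * t powr (- (p - 1)) \<le> 2 powr (N + p) * (2 powr (N + p)) ^ j" .
        have "u powr \<beta> \<le> 1" using u \<beta> by (intro powr_le1) auto
        then have uu: "C' * (u powr \<beta> * \<delta>0 powr \<beta> * (\<delta> powr \<beta>) ^ j) \<le> C' * (1 * \<delta>0 powr \<beta> * (\<delta> powr \<beta>) ^ j)"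
          using C' by (intro mult_left_mono mult_right_mono) auto
        show ?thesis using C' Ynn by (intro mult_right_mono[OF mult_mono[OF uu tt]]) auto
      qed
      \<comment> \<open>The first factor is at most \<mu> by the choice of \<delta>0, the j-th power
        at most 1 by the choice of \<delta>.\<close>
      also have "\<dots> = (C' * \<delta>0 powr \<beta> * 2 powr (N + p)) * (\<delta> powr \<beta> * 2 powr (N + p)) ^ j * Y j"
        by (simp add: power_mult_distrib)
      also have "\<dots> \<le> \<mu> * 1 * Y j"
      proof -
        have "(\<delta> powr \<beta> * 2 powr (N + p)) ^ j \<le> 1" using \<delta>\<beta> by (intro power_le_one) auto
        then show ?thesis using \<delta>0\<beta> \<mu> Ynn by (intro mult_right_mono mult_mono) auto
      qed
      also have "\<dots> \<le> \<mu> * (M0 * \<mu> ^ j)" using IH \<mu> by simp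
      finally show ?thesis by (simp add: mult_ac)
    qed
    have Yb: "Y j \<le> M0 * \<mu> ^ j" for j
    proof (induction j)
      case 0
      have "r 0 = \<rho>2" "k 0 = k0" by (auto simp: r_def h_def k_def)
      then show ?case using Y0 by (simp add: Y_def M0_def u_def h_def n_def)
    qed (rule step)
    have "level_moment v x0 (k0 + \<kappa>) p \<rho>1 \<le> M0 * \<mu> ^ j" for j
    proof -
      have "level_moment v x0 (k0 + \<kappa>) p \<rho>1 \<le> Y j"
        unfolding Y_def using p \<kappa> h
        by (intro level_moment_mono[OF v v_meas p]) (auto simp: k_def r_def)
      then show ?thesis using Yb[of j] by linarith
    qed
    moreover have "(\<lambda>j. M0 * \<mu> ^ j) \<longlonglongrightarrow> M0 * 0" using \<mu> by (intro tendsto_intros LIMSEQ_power_zero) auto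
    ultimately have "level_moment v x0 (k0 + \<kappa>) p \<rho>1 \<le> 0"
      by (intro LIMSEQ_le_const[where X = "\<lambda>j. M0 * \<mu> ^ j"]) auto
    then show "AE x in lborel. x \<in> ball x0 \<rho>1 \<longrightarrow> v x \<le> k0 + \<kappa>"
      by (rule level_moment_0_imp_AE[OF v v_meas p])
  qed
qed

text \<open>Here m need not be the average of v, which makes the notion stable under changing the ball.\<close>

definition excess_bound :: "real \<Rightarrow> real \<Rightarrow> ('a::euclidean_space \<Rightarrow> real) \<Rightarrow> 'a \<Rightarrow> real \<Rightarrow> real \<Rightarrow> real \<Rightarrow> bool" where
  "excess_bound p \<beta> v x0 m A r \<longleftrightarrow>
    (\<integral>x. indicator (ball x0 r) x * \<bar>v x - m\<bar> powr q_star p \<partial>lborel) \<le> A powr q_star p * measure lborel (ball x0 r) \<and>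
    (\<integral>x. indicator (- ball x0 r) x * \<bar>v x - m\<bar> powr (p - 1) * sing_kernel \<beta> (x - x0) \<partial>lborel)
      \<le> A powr (p - 1) * r powr (- \<beta>)"

section \<open>Moments and tails under an excess bound\<close>

lemma q_star_bounds: "p > 1 \<Longrightarrow> 1 \<le> q_star p \<and> p - 1 \<le> q_star p \<and> q_star p < p"
  by (auto simp: q_star_def)

context
  fixes v :: "'a::euclidean_space \<Rightarrow> real" and p :: real
  assumes v_Lp: "integrable lborel (\<lambda>x. \<bar>v x\<bar> powr p)"
    and v_meas [measurable]: "v \<in> borel_measurable borel" and p: "p > 1"
begin

lemma osc_integrable:
  assumes "0 \<le> e" "e \<le> p"
  shows "integrable lborel (\<lambda>x. indicator (ball x0 r) x * \<bar>v x - m\<bar> powr e)"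
  using assms emeasure_bounded_finite[OF bounded_ball]
  by (intro integrable_moment[OF v_Lp, where K = "\<bar>m\<bar>"]) auto

lemma osc_tail_integrable:
  assumes "0 \<le> e" "e \<le> p" "\<beta> > 0" "r > 0"
  shows "integrable lborel (\<lambda>x. indicator (- ball x0 r) x * \<bar>v x - m\<bar> powr e * sing_kernel \<beta> (x - x0))"
  using assms by (intro integrable_tail[OF v_Lp, where K = "\<bar>m\<bar>"]) auto

lemma ball_indicator_integrable: "integrable lborel (indicator (ball x0 r) :: 'a \<Rightarrow> real)"
  using emeasure_bounded_finite[OF bounded_ball] by (intro integrable_real_indicator) auto

text \<open>A substitute for Jensen's inequality at the price of a factor 2: comparing t with A
  gives t^e \<le> A^e + A^(e-q) t^q. It is applied with e = p - 1 and with e = 1, both at most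
  \<open>q_star p\<close>; this is what the maximum in \<open>q_star\<close> is for.\<close>

lemma excess_bound_power_mean:
  assumes eb: "excess_bound p \<beta> v x0 m A r" and A: "A > 0" and e: "0 \<le> e" "e \<le> q_star p"
  shows "(\<integral>x. indicator (ball x0 r) x * \<bar>v x - m\<bar> powr e \<partial>lborel) \<le> 2 * A powr e * measure lborel (ball x0 r)"
proof -
  note q = q_star_bounds[OF p]
  have pt: "t powr e \<le> A powr e + A powr (e - q_star p) * t powr q_star p" if "t \<ge> 0" for t :: real
  proof (cases "t \<le> A")
    case True
    then have "t powr e \<le> A powr e" using that e by (intro powr_mono2) auto
    then show ?thesis by (smt (verit) mult_nonneg_nonneg powr_ge_zero)
  next
    case False
    then have "t powr e = t powr (e - q_star p) * t powr q_star p" by (simp add: powr_add[symmetric])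
    also have "\<dots> \<le> A powr (e - q_star p) * t powr q_star p"
      using False A e by (intro mult_right_mono powr_mono2') auto
    finally show ?thesis by (smt (verit) powr_ge_zero)
  qed
  have i1: "integrable lborel (\<lambda>x. indicator (ball x0 r) x * \<bar>v x - m\<bar> powr q_star p)"
    using q by (intro osc_integrable) auto
  have "(\<integral>x. indicator (ball x0 r) x * \<bar>v x - m\<bar> powr e \<partial>lborel) \<le>
    (\<integral>x. A powr e * indicator (ball x0 r) x + A powr (e - q_star p) * (indicator (ball x0 r) x * \<bar>v x - m\<bar> powr q_star p) \<partial>lborel)"
  proof (rule integral_mono)
    show "integrable lborel (\<lambda>x. indicator (ball x0 r) x * \<bar>v x - m\<bar> powr e)"
      using e q by (intro osc_integrable) auto
    show "integrable lborel (\<lambda>x. A powr e * indicator (ball x0 r) x +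
        A powr (e - q_star p) * (indicator (ball x0 r) x * \<bar>v x - m\<bar> powr q_star p))"
      using i1 ball_indicator_integrable by (intro Bochner_Integration.integrable_add integrable_mult_right)
    fix x
    show "indicator (ball x0 r) x * \<bar>v x - m\<bar> powr e \<le> A powr e * indicator (ball x0 r) x +
        A powr (e - q_star p) * (indicator (ball x0 r) x * \<bar>v x - m\<bar> powr q_star p)"
      using pt[of "\<bar>v x - m\<bar>"] by (simp add: indicator_def)
  qed
  also have "\<dots> = A powr e * measure lborel (ball x0 r) +
      A powr (e - q_star p) * (\<integral>x. indicator (ball x0 r) x * \<bar>v x - m\<bar> powr q_star p \<partial>lborel)"
    using i1 ball_indicator_integrable by (simp add: Bochner_Integration.integral_add)
  also have "\<dots> \<le> A powr e * measure lborel (ball x0 r) +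
      A powr (e - q_star p) * (A powr q_star p * measure lborel (ball x0 r))"
    using eb unfolding excess_bound_def by (intro add_left_mono mult_left_mono) auto
  also have "\<dots> = A powr e * measure lborel (ball x0 r) + (A powr (e - q_star p) * A powr q_star p) * measure lborel (ball x0 r)"
    by (simp only: mult.assoc)
  also have "A powr (e - q_star p) * A powr q_star p = A powr e" by (simp add: powr_add[symmetric])
  finally show ?thesis by simp
qed

text \<open>Enlarging the complement from radius r to \<rho> adds an annulus on which the kernel is
  at most \<rho>^(-n-\<beta>); the moment of order p - 1 inside the r-ball pays for it.\<close>

lemma excess_bound_tail:
  assumes eb: "excess_bound p \<beta> v x0 m A r" and A: "A > 0" and \<beta>: "\<beta> > 0" and \<rho>: "0 < \<rho>" "\<rho> \<le> r"
  shows "(\<integral>x. indicator (- ball x0 \<rho>) x * \<bar>v x - m\<bar> powr (p - 1) * sing_kernel \<beta> (x - x0) \<partial>lborel) \<le>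
    A powr (p - 1) * ((2 * unit_ball_vol (real DIM('a)) + 1) * (r powr real DIM('a) * \<rho> powr (- (real DIM('a) + \<beta>))))"
proof -
  let ?n = "real DIM('a)"
  let ?w = "unit_ball_vol ?n"
  note q = q_star_bounds[OF p]
  have i1: "integrable lborel (\<lambda>x. indicator (ball x0 r) x * \<bar>v x - m\<bar> powr (p - 1))"
    using p by (intro osc_integrable) auto
  have i2: "integrable lborel (\<lambda>x. indicator (- ball x0 s) x * \<bar>v x - m\<bar> powr (p - 1) * sing_kernel \<beta> (x - x0))"
    if "s > 0" for s using p \<beta> that by (intro osc_tail_integrable) auto
  have r: "r > 0" using \<rho> by linarith
  have rb: "r powr (- \<beta>) \<le> r powr ?n * \<rho> powr (- (?n + \<beta>))"
  proof -
    have "r powr (- \<beta>) = r powr ?n * r powr (- (?n + \<beta>))" by (simp add: powr_add[symmetric])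
    also have "\<dots> \<le> r powr ?n * \<rho> powr (- (?n + \<beta>))" using \<rho> \<beta> by (intro mult_left_mono powr_mono2') auto
    finally show ?thesis .
  qed
  have "(\<integral>x. indicator (- ball x0 \<rho>) x * \<bar>v x - m\<bar> powr (p - 1) * sing_kernel \<beta> (x - x0) \<partial>lborel) \<le>
    (\<integral>x. \<rho> powr (- (?n + \<beta>)) * (indicator (ball x0 r) x * \<bar>v x - m\<bar> powr (p - 1)) +
      indicator (- ball x0 r) x * \<bar>v x - m\<bar> powr (p - 1) * sing_kernel \<beta> (x - x0) \<partial>lborel)"
  proof (rule integral_mono)
    fix x
    show "indicator (- ball x0 \<rho>) x * \<bar>v x - m\<bar> powr (p - 1) * sing_kernel \<beta> (x - x0) \<le>
      \<rho> powr (- (?n + \<beta>)) * (indicator (ball x0 r) x * \<bar>v x - m\<bar> powr (p - 1)) +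
      indicator (- ball x0 r) x * \<bar>v x - m\<bar> powr (p - 1) * sing_kernel \<beta> (x - x0)"
    proof (cases "x \<in> ball x0 \<rho>")
      case False
      then have "sing_kernel \<beta> (x - x0) \<le> \<rho> powr (- (?n + \<beta>))"
        using \<rho> \<beta> by (intro sing_kernel_le) (auto simp: dist_norm norm_minus_commute)
      from mult_left_mono[OF this, of "\<bar>v x - m\<bar> powr (p - 1)"] show ?thesis
        using False by (simp add: indicator_def mult.commute)
    qed (use \<rho> in simp)
  qed (use i1 i2 \<rho> r in \<open>auto intro!: Bochner_Integration.integrable_add integrable_mult_right\<close>)
  also have "\<dots> = \<rho> powr (- (?n + \<beta>)) * (\<integral>x. indicator (ball x0 r) x * \<bar>v x - m\<bar> powr (p - 1) \<partial>lborel) +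
      (\<integral>x. indicator (- ball x0 r) x * \<bar>v x - m\<bar> powr (p - 1) * sing_kernel \<beta> (x - x0) \<partial>lborel)"
    using i1 i2[OF r] by (simp add: Bochner_Integration.integral_add)
  also have "\<dots> \<le> \<rho> powr (- (?n + \<beta>)) * (2 * A powr (p - 1) * (?w * r powr ?n)) + A powr (p - 1) * r powr (- \<beta>)"
  proof (intro add_mono mult_left_mono)
    show "(\<integral>x. indicator (ball x0 r) x * \<bar>v x - m\<bar> powr (p - 1) \<partial>lborel) \<le> 2 * A powr (p - 1) * (?w * r powr ?n)"
      using excess_bound_power_mean[OF eb A, of "p - 1"] p q r by (simp add: measure_lborel_ball powr_realpow)
  qed (use eb in \<open>auto simp: excess_bound_def\<close>)
  also have "\<dots> \<le> \<rho> powr (- (?n + \<beta>)) * (2 * A powr (p - 1) * (?w * r powr ?n)) +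
      A powr (p - 1) * (r powr ?n * \<rho> powr (- (?n + \<beta>)))"
    by (intro add_left_mono mult_left_mono rb) auto
  also have "\<dots> = A powr (p - 1) * ((2 * ?w + 1) * (r powr ?n * \<rho> powr (- (?n + \<beta>))))"
    by (simp add: algebra_simps)
  finally show ?thesis .
qed

lemma level_tail_le:
  assumes \<beta>: "\<beta> > 0" and \<rho>: "\<rho> > 0"
  shows "level_tail p \<beta> v x0 m \<rho> \<le>
    (\<integral>x. indicator (- ball x0 \<rho>) x * \<bar>v x - m\<bar> powr (p - 1) * sing_kernel \<beta> (x - x0) \<partial>lborel)"
  unfolding level_tail_def
proof (rule integral_mono)
  show "integrable lborel (\<lambda>x. indicator (- ball x0 \<rho>) x * max 0 (v x - m) powr (p - 1) * sing_kernel \<beta> (x - x0))"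
    by (rule level_integrable(2)[OF v_Lp v_meas p \<beta> \<rho>])
  show "integrable lborel (\<lambda>x. indicator (- ball x0 \<rho>) x * \<bar>v x - m\<bar> powr (p - 1) * sing_kernel \<beta> (x - x0))"
    using p \<beta> \<rho> by (intro osc_tail_integrable) auto
  fix x
  show "indicator (- ball x0 \<rho>) x * max 0 (v x - m) powr (p - 1) * sing_kernel \<beta> (x - x0) \<le>
      indicator (- ball x0 \<rho>) x * \<bar>v x - m\<bar> powr (p - 1) * sing_kernel \<beta> (x - x0)"
    using p by (intro mult_right_mono mult_left_mono powr_mono2) auto
qed

text \<open>The exponent is split as (p - q) + q: the sup bound takes the first part, the moment of
  order q the second. Because q < p, the sup bound enters with a positive power below p, so a
  fraction of it can be absorbed.\<close>

lemma level_moment_interpolation: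
  assumes ae: "AE x in lborel. x \<in> ball x0 \<sigma> \<longrightarrow> v x \<le> m + M" and M: "M \<ge> 0" and \<sigma>: "\<sigma> \<le> r"
    and q: "0 \<le> q" "q < p"
  shows "level_moment v x0 m p \<sigma> \<le> M powr (p - q) * (\<integral>x. indicator (ball x0 r) x * \<bar>v x - m\<bar> powr q \<partial>lborel)"
proof -
  have i: "integrable lborel (\<lambda>x. indicator (ball x0 r) x * \<bar>v x - m\<bar> powr q)"
    using q by (intro osc_integrable) auto
  have "level_moment v x0 m p \<sigma> \<le> (\<integral>x. M powr (p - q) * (indicator (ball x0 r) x * \<bar>v x - m\<bar> powr q) \<partial>lborel)"
    unfolding level_moment_def
  proof (rule integral_mono_AE)
    show "integrable lborel (\<lambda>x. indicator (ball x0 \<sigma>) x * max 0 (v x - m) powr p)"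
      by (rule level_integrable(1)[OF v_Lp v_meas p]) (use p in auto)
    show "integrable lborel (\<lambda>x. M powr (p - q) * (indicator (ball x0 r) x * \<bar>v x - m\<bar> powr q))"
      using i by (rule integrable_mult_right)
    show "AE x in lborel. indicator (ball x0 \<sigma>) x * max 0 (v x - m) powr p \<le>
        M powr (p - q) * (indicator (ball x0 r) x * \<bar>v x - m\<bar> powr q)"
      using ae
    proof eventually_elim
      fix x assume x: "x \<in> ball x0 \<sigma> \<longrightarrow> v x \<le> m + M"
      show "indicator (ball x0 \<sigma>) x * max 0 (v x - m) powr p \<le>
        M powr (p - q) * (indicator (ball x0 r) x * \<bar>v x - m\<bar> powr q)"
      proof (cases "x \<in> ball x0 \<sigma>")
        case True
        have "max 0 (v x - m) powr p = max 0 (v x - m) powr (p - q) * max 0 (v x - m) powr q"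
          by (simp add: powr_add[symmetric])
        also have "\<dots> \<le> M powr (p - q) * \<bar>v x - m\<bar> powr q"
          using x True M q by (intro mult_mono powr_mono2) auto
        finally show ?thesis using True \<sigma> by (simp add: indicator_def)
      qed simp
    qed
  qed
  then show ?thesis by simp
qed

end

section \<open>Local boundedness from the excess\<close>

lemma exists_powr_ge:
  fixes X a e :: real
  assumes "a > 0" "e > 0"
  obtains \<kappa> where "\<kappa> > 0" "\<And>\<kappa>'. \<kappa> \<le> \<kappa>' \<Longrightarrow> X \<le> a * \<kappa>' powr e"
proof (rule that)
  let ?k = "(\<bar>X\<bar> / a + 1) powr (1 / e)"
  have pos: "\<bar>X\<bar> / a + 1 > 0" using assms by (simp add: add_nonneg_pos)
  then show "?k > 0" by simp
  fix \<kappa>' assume "?k \<le> \<kappa>'"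
  then have "?k powr e \<le> \<kappa>' powr e" using assms by (intro powr_mono2) auto
  moreover have "?k powr e = \<bar>X\<bar> / a + 1" using pos assms by (simp add: powr_powr)
  ultimately have "a * (\<bar>X\<bar> / a + 1) \<le> a * \<kappa>' powr e" using assms by (intro mult_left_mono) auto
  moreover have "a * (\<bar>X\<bar> / a + 1) = \<bar>X\<bar> + a" using assms by (simp add: distrib_left)
  ultimately show "X \<le> a * \<kappa>' powr e" using assms by linarith
qed

text \<open>The iteration first gives some bound in terms of the p-th moment; interpolating between this
  bound and the moment of order \<open>q_star p\<close> on a sequence of increasing balls then removes it.\<close>

lemma local_boundedness:
  fixes p \<beta> C :: real
  assumes p: "p > 1" and \<beta>: "\<beta> > 0" and C: "C > 0"
  obtains c where "c > 0"
    "\<And>v (x0::'a::euclidean_space) r m A. de_giorgi p \<beta> C v x0 r \<Longrightarrow> 0 < r \<Longrightarrow> A > 0 \<Longrightarrow> excess_bound p \<beta> v x0 m A r \<Longrightarrow>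
      AE x in lborel. x \<in> ball x0 (r / 2) \<longrightarrow> v x \<le> m + c * A"
proof -
  define n where "n = real DIM('a)"
  define w where "w = unit_ball_vol n"
  define q where "q = q_star p"
  have q: "1 \<le> q" "p - 1 \<le> q" "q < p" using q_star_bounds[OF p] by (auto simp: q_def)
  have n: "n \<ge> 1" using DIM_positive[where 'a='a] unfolding n_def by linarith
  have w: "w > 0" by (simp add: w_def n_def)
  \<comment> \<open>The constant of \<open>excess_bound_tail\<close> at half the radius, which
    bounds all tails that occur between r/2 and r.\<close>
  define T where "T = (2 * w + 1) * 2 powr (n + \<beta>)"
  have T: "T > 0" using w by (simp add: T_def)
  obtain \<nu> \<gamma> where \<nu>: "\<nu> > 0" and \<gamma>: "\<gamma> > 0" and iter:
    "\<And>v (x0::'a) R \<rho>1 \<rho>2 k0 \<kappa>. de_giorgi p \<beta> C v x0 R \<Longrightarrow> 0 < \<rho>1 \<Longrightarrow> \<rho>1 < \<rho>2 \<Longrightarrow> \<rho>2 \<le> 2 * \<rho>1 \<Longrightarrow> \<rho>2 \<le> R \<Longrightarrow> \<kappa> > 0 \<Longrightarrow>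
      level_moment v x0 k0 p \<rho>2 \<le> \<nu> * ((\<rho>2 - \<rho>1) / \<rho>2) powr \<gamma> * \<kappa> powr p * \<rho>2 powr n \<Longrightarrow>
      level_tail p \<beta> v x0 k0 \<rho>1 \<le> T * \<kappa> powr (p - 1) * \<rho>2 powr (- \<beta>) \<Longrightarrow>
      AE x in lborel. x \<in> ball x0 \<rho>1 \<longrightarrow> v x \<le> k0 + \<kappa>"
    using that by (rule de_giorgi_iteration[OF p \<beta> C less_imp_le[OF T], where 'a='a, folded n_def])
  define g where "g = 2 powr \<gamma>"
  have g: "g \<ge> 1" using \<gamma> by (simp add: g_def ge_one_powr_ge_zero)
  \<comment> \<open>One step replaces a bound M' on ball i + 1 by \<epsilon> M' + D g^i A on ball i.
    With \<epsilon> g = 1/2 the bound 2 D g^i A reproduces itself.\<close>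
  define \<epsilon> where "\<epsilon> = 1 / (2 * g)"
  have \<epsilon>: "\<epsilon> > 0" "\<epsilon> * g = 1/2" "\<epsilon> < 1" using g by (auto simp: \<epsilon>_def field_simps)
  \<comment> \<open>Chosen so that \<kappa> = \<epsilon> M' + D g^i A meets the smallness condition
    of the iteration: 2^n comes from comparing r with radii above r/2, and g^3 from the factor 1/8
    in the gap between consecutive radii.\<close>
  define D where "D = max 1 (w * 2 powr n * g ^ 3 / (\<nu> * \<epsilon> powr (p - q)))"
  have D: "D \<ge> 1" "w * 2 powr n * g ^ 3 \<le> \<nu> * \<epsilon> powr (p - q) * D"
  proof -
    have "w * 2 powr n * g ^ 3 / (\<nu> * \<epsilon> powr (p - q)) \<le> D" by (simp add: D_def)
    then show "w * 2 powr n * g ^ 3 \<le> \<nu> * \<epsilon> powr (p - q) * D"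
      using \<nu> \<epsilon> by (simp add: divide_le_eq mult_ac)
  qed (simp add: D_def)
  show ?thesis
  proof (rule that)
    show "2 * D > 0" using D by simp
    fix v and x0 :: 'a and r m A :: real
    assume dg: "de_giorgi p \<beta> C v x0 r" and r: "0 < r" and A: "A > 0" and eb: "excess_bound p \<beta> v x0 m A r"
    have v_meas [measurable]: "v \<in> borel_measurable borel" and v: "integrable lborel (\<lambda>x. \<bar>v x\<bar> powr p)"
      using dg by (auto simp: de_giorgi_def)
    have tail: "level_tail p \<beta> v x0 m \<rho> \<le> T * A powr (p - 1) * r powr (- \<beta>)" if "r / 2 \<le> \<rho>" "\<rho> \<le> r" for \<rho>
    proof -
      have "level_tail p \<beta> v x0 m \<rho> \<le> level_tail p \<beta> v x0 m (r / 2)"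
        using that r by (intro level_tail_mono[OF v v_meas p \<beta>]) auto
      also have "\<dots> \<le> (\<integral>x. indicator (- ball x0 (r / 2)) x * \<bar>v x - m\<bar> powr (p - 1) * sing_kernel \<beta> (x - x0) \<partial>lborel)"
        using r by (intro level_tail_le[OF v v_meas p \<beta>]) auto
      also have "\<dots> \<le> A powr (p - 1) * ((2 * w + 1) * (r powr n * (r / 2) powr (- (n + \<beta>))))"
        using excess_bound_tail[OF v v_meas p eb A \<beta>, of "r / 2"] r by (simp add: n_def w_def)
      also have "r powr n * (r / 2) powr (- (n + \<beta>)) = 2 powr (n + \<beta>) * r powr (- \<beta>)"
      proof -
        have "(r / 2) powr (- (n + \<beta>)) = 2 powr (n + \<beta>) * r powr (- (n + \<beta>))"
          using r by (simp add: powr_divide powr_minus_divide del: minus_add_distrib)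
        moreover have "r powr n * r powr (- (n + \<beta>)) = r powr (- \<beta>)" by (simp add: powr_add[symmetric])
        ultimately show ?thesis by (simp only: mult.left_commute[of "r powr n"])
      qed
      finally show ?thesis by (simp add: T_def mult_ac)
    qed
    \<comment> \<open>A qualitative bound: since the p-th moment is finite, some \<kappa> is large
      enough to start the iteration. No control of M is claimed here, and none is kept at the
      end.\<close>
    have "\<exists>M\<ge>0. AE x in lborel. x \<in> ball x0 (3 / 4 * r) \<longrightarrow> v x \<le> m + M"
    proof -
      obtain \<kappa>1 where \<kappa>1: "\<kappa>1 > 0" "\<And>\<kappa>'. \<kappa>1 \<le> \<kappa>' \<Longrightarrow>
          level_moment v x0 m p r \<le> (\<nu> * ((r - 3 / 4 * r) / r) powr \<gamma> * r powr n) * \<kappa>' powr p"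
        using exists_powr_ge[of "\<nu> * ((r - 3 / 4 * r) / r) powr \<gamma> * r powr n" p] \<nu> r p by auto
      define \<kappa> where "\<kappa> = max \<kappa>1 A"
      have \<kappa>: "\<kappa> > 0" "\<kappa> \<ge> A" using \<kappa>1 A by (auto simp: \<kappa>_def)
      have "AE x in lborel. x \<in> ball x0 (3 / 4 * r) \<longrightarrow> v x \<le> m + \<kappa>"
      proof (rule iter[OF dg])
        show "level_moment v x0 m p r \<le> \<nu> * ((r - 3 / 4 * r) / r) powr \<gamma> * \<kappa> powr p * r powr n"
          using \<kappa>1(2)[of \<kappa>] by (simp add: \<kappa>_def mult_ac)
        have "T * A powr (p - 1) * r powr (- \<beta>) \<le> T * \<kappa> powr (p - 1) * r powr (- \<beta>)"
          using \<kappa> A T p by (intro mult_right_mono mult_left_mono powr_mono2) auto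
        then show "level_tail p \<beta> v x0 m (3 / 4 * r) \<le> T * \<kappa> powr (p - 1) * r powr (- \<beta>)"
          using tail[of "3 / 4 * r"] r by simp
      qed (use r \<kappa> in auto)
      then show ?thesis using \<kappa> by (intro exI[of _ \<kappa>]) auto
    qed
    then obtain M where M: "M \<ge> 0" "AE x in lborel. x \<in> ball x0 (3 / 4 * r) \<longrightarrow> v x \<le> m + M" by blast
    \<comment> \<open>The radii increase from r/2 towards 3/4 r, the ball on which the crude bound
      is known.\<close>
    define \<sigma> where "\<sigma> i = r * (3 / 4 - (1/2) ^ i / 4)" for i :: nat
    have \<sigma>: "r / 2 \<le> \<sigma> i" "\<sigma> i \<le> 3 / 4 * r" for i
    proof -
      have "(1/2 :: real) ^ i \<le> 1" by (intro power_le_one) auto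
      then have "r * (1 / 2) \<le> r * (3 / 4 - (1/2) ^ i / 4)" "r * (3 / 4 - (1/2) ^ i / 4) \<le> r * (3 / 4)"
        using r by (intro mult_left_mono; simp)+
      then show "r / 2 \<le> \<sigma> i" "\<sigma> i \<le> 3 / 4 * r" by (auto simp: \<sigma>_def)
    qed
    have step: "AE x in lborel. x \<in> ball x0 (\<sigma> i) \<longrightarrow> v x \<le> m + (\<epsilon> * M' + D * g ^ i * A)"
      if ae: "AE x in lborel. x \<in> ball x0 (\<sigma> (Suc i)) \<longrightarrow> v x \<le> m + M'" and M': "M' \<ge> 0" for i M'
    proof -
      define \<kappa> where "\<kappa> = \<epsilon> * M' + D * g ^ i * A"
      have gi: "g ^ i \<ge> 1" using g by simp
      have DgA: "D * g ^ i * A \<ge> A" "D * g ^ i * A > 0"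
      proof -
        have "1 * 1 * A \<le> D * g ^ i * A" using D gi A by (intro mult_mono) auto
        then show "D * g ^ i * A \<ge> A" by simp
        then show "D * g ^ i * A > 0" using A by linarith
      qed
      have eM: "\<epsilon> * M' \<ge> 0" using \<epsilon> M' by simp
      have \<kappa>: "\<kappa> > 0" "\<kappa> \<ge> A" "\<kappa> \<ge> \<epsilon> * M'" "\<kappa> \<ge> D * g ^ i * A"
        unfolding \<kappa>_def using DgA eM by linarith+
      have s2: "\<sigma> (Suc i) \<le> r" "\<sigma> (Suc i) > 0" using \<sigma>[of "Suc i"] r by linarith+
      have ds: "\<sigma> (Suc i) - \<sigma> i = r * (1/2) ^ i / 8" by (simp add: \<sigma>_def field_simps)
      have "AE x in lborel. x \<in> ball x0 (\<sigma> i) \<longrightarrow> v x \<le> m + \<kappa>"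
      proof (rule iter[OF dg])
        show "0 < \<sigma> i" using \<sigma>[of i] r by linarith
        show "\<sigma> i < \<sigma> (Suc i)" using ds zero_less_power[of "1/2::real" i] mult_pos_pos[OF r, of "(1/2) ^ i"] by linarith
        show "\<sigma> (Suc i) \<le> 2 * \<sigma> i" using \<sigma>[of i] \<sigma>[of "Suc i"] r by linarith
        show "\<sigma> (Suc i) \<le> r" by (rule s2)
        show "\<kappa> > 0" by (rule \<kappa>)
        have "level_tail p \<beta> v x0 m (\<sigma> i) \<le> T * A powr (p - 1) * r powr (- \<beta>)"
          using \<sigma>[of i] r by (intro tail) auto
        also have "\<dots> \<le> T * \<kappa> powr (p - 1) * \<sigma> (Suc i) powr (- \<beta>)"
          using T \<kappa> A p s2 \<beta> by (intro mult_mono mult_left_mono powr_mono2 powr_mono2') auto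
        finally show "level_tail p \<beta> v x0 m (\<sigma> i) \<le> T * \<kappa> powr (p - 1) * \<sigma> (Suc i) powr (- \<beta>)" .
        have "level_moment v x0 m p (\<sigma> (Suc i)) \<le>
            M' powr (p - q) * (\<integral>x. indicator (ball x0 r) x * \<bar>v x - m\<bar> powr q \<partial>lborel)"
          using q by (intro level_moment_interpolation[OF v v_meas p ae M' s2(1)]) auto
        also have "\<dots> \<le> M' powr (p - q) * (A powr q * (w * r powr n))"
          using eb r unfolding excess_bound_def
          by (intro mult_left_mono) (auto simp: q_def measure_lborel_ball n_def w_def powr_realpow)
        also have "\<dots> \<le> \<nu> * ((\<sigma> (Suc i) - \<sigma> i) / \<sigma> (Suc i)) powr \<gamma> * \<kappa> powr p * \<sigma> (Suc i) powr n"
        proof -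
          have u: "1 / (g ^ i * g ^ 3) \<le> ((\<sigma> (Suc i) - \<sigma> i) / \<sigma> (Suc i)) powr \<gamma>"
          proof -
            have "(1/2) ^ (i + 3) \<le> (\<sigma> (Suc i) - \<sigma> i) / \<sigma> (Suc i)"
            proof -
              have "(1/2) ^ (i + 3) = (r * (1/2) ^ i / 8) / r" using r by (simp add: power_add power3_eq_cube)
              also have "\<dots> \<le> (r * (1/2) ^ i / 8) / \<sigma> (Suc i)" using s2 r by (intro divide_left_mono) auto
              finally show ?thesis unfolding ds .
            qed
            then have "((1/2) ^ (i + 3)) powr \<gamma> \<le> ((\<sigma> (Suc i) - \<sigma> i) / \<sigma> (Suc i)) powr \<gamma>"
              using \<gamma> by (intro powr_mono2) auto
            moreover have "((1/2 :: real) ^ (i + 3)) powr \<gamma> = 1 / (g ^ i * g ^ 3)"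
            proof -
              have "((1/2 :: real) ^ (i + 3)) powr \<gamma> = ((1/2) powr \<gamma>) ^ (i + 3)" by (rule power_powr_swap) simp
              also have "(1/2 :: real) powr \<gamma> = 1 / g" by (simp add: g_def powr_divide)
              finally show ?thesis by (simp add: power_add power_divide)
            qed
            ultimately show ?thesis by simp
          qed
          have k1: "\<epsilon> powr (p - q) * M' powr (p - q) \<le> \<kappa> powr (p - q)"
          proof -
            have "(\<epsilon> * M') powr (p - q) \<le> \<kappa> powr (p - q)" using \<kappa> eM q by (intro powr_mono2) auto
            then show ?thesis using \<epsilon> M' by (simp add: powr_mult)
          qed
          have k2: "D * g ^ i * A powr q \<le> \<kappa> powr q"
          proof -
            have "D * g ^ i \<ge> 1" using mult_mono[of 1 D 1 "g ^ i"] D gi by simp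
            then have "(D * g ^ i) powr 1 \<le> (D * g ^ i) powr q" using q by (intro powr_mono) auto
            then have "D * g ^ i * A powr q \<le> (D * g ^ i) powr q * A powr q"
              using \<open>D * g ^ i \<ge> 1\<close> by (intro mult_right_mono) auto
            also have "\<dots> = (D * g ^ i * A) powr q" using D g A by (simp add: powr_mult)
            also have "\<dots> \<le> \<kappa> powr q" using \<kappa> DgA q by (intro powr_mono2) auto
            finally show ?thesis .
          qed
          \<comment> \<open>Here \<kappa> dominates both of its summands; p - q of its factors are
            estimated by \<epsilon> M' and q of them by D g^i A, where D g^i \<ge> 1 is at most its
            own q-th power.\<close>
          have kp: "(\<epsilon> powr (p - q) * M' powr (p - q)) * (D * g ^ i * A powr q) \<le> \<kappa> powr p"
          proof -
            have "(\<epsilon> powr (p - q) * M' powr (p - q)) * (D * g ^ i * A powr q) \<le> \<kappa> powr (p - q) * \<kappa> powr q"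
              using D g by (intro mult_mono k1 k2) auto
            also have "\<dots> = \<kappa> powr p" by (simp add: powr_add[symmetric])
            finally show ?thesis .
          qed
          have s: "r powr n \<le> 2 powr n * \<sigma> (Suc i) powr n"
          proof -
            have "r powr n \<le> (2 * \<sigma> (Suc i)) powr n" using \<sigma>[of "Suc i"] r n by (intro powr_mono2) auto
            then show ?thesis using s2 by (simp add: powr_mult)
          qed
          have "M' powr (p - q) * (A powr q * (w * r powr n)) \<le>
              M' powr (p - q) * (A powr q * (w * (2 powr n * \<sigma> (Suc i) powr n)))"
            using s w by (intro mult_left_mono) auto
          also have "\<dots> = (w * 2 powr n * g ^ 3) * (1 / g ^ 3) * (M' powr (p - q) * A powr q * \<sigma> (Suc i) powr n)"
            using g by simp
          also have "\<dots> \<le> (\<nu> * \<epsilon> powr (p - q) * D) * (1 / g ^ 3) * (M' powr (p - q) * A powr q * \<sigma> (Suc i) powr n)"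
            using D g by (intro mult_right_mono) auto
          also have "\<dots> = \<nu> * (1 / (g ^ i * g ^ 3)) * ((\<epsilon> powr (p - q) * M' powr (p - q)) * (D * g ^ i * A powr q)) * \<sigma> (Suc i) powr n"
            using g by (simp add: field_simps)
          also have "\<dots> \<le> \<nu> * ((\<sigma> (Suc i) - \<sigma> i) / \<sigma> (Suc i)) powr \<gamma> * \<kappa> powr p * \<sigma> (Suc i) powr n"
            using u kp \<nu> D g by (intro mult_right_mono mult_mono mult_left_mono) auto
          finally show ?thesis .
        qed
        finally show "level_moment v x0 m p (\<sigma> (Suc i)) \<le>
          \<nu> * ((\<sigma> (Suc i) - \<sigma> i) / \<sigma> (Suc i)) powr \<gamma> * \<kappa> powr p * \<sigma> (Suc i) powr n" .
      qed
      then show ?thesis by (simp add: \<kappa>_def)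
    qed
    \<comment> \<open>K counts the interpolation steps, which in effect begin with the crude bound
      on ball i + K. Each step multiplies M by \<epsilon>, so letting K tend to infinity with i = 0
      removes it.\<close>
    have all: "AE x in lborel. x \<in> ball x0 (\<sigma> i) \<longrightarrow> v x \<le> m + (\<epsilon> ^ K * M + 2 * D * g ^ i * A)" for K i
    proof (induction K arbitrary: i)
      case 0
      have pos: "2 * D * g ^ i * A \<ge> 0" using D g A by simp
      show ?case using M(2)
      proof eventually_elim
        fix x assume x: "x \<in> ball x0 (3 / 4 * r) \<longrightarrow> v x \<le> m + M"
        show "x \<in> ball x0 (\<sigma> i) \<longrightarrow> v x \<le> m + (\<epsilon> ^ 0 * M + 2 * D * g ^ i * A)"
        proof
          assume "x \<in> ball x0 (\<sigma> i)"
          then have "x \<in> ball x0 (3 / 4 * r)" using \<sigma>(2)[of i] by simp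
          then have "v x \<le> m + M" using x by blast
          then have "v x \<le> m + (1 * M + 2 * D * g ^ i * A)" using pos by linarith
          then show "v x \<le> m + (\<epsilon> ^ 0 * M + 2 * D * g ^ i * A)" by (simp only: power_0)
        qed
      qed
    next
      case (Suc K)
      have nn: "\<epsilon> ^ K * M + 2 * D * g ^ Suc i * A \<ge> 0" using \<epsilon> M D g A by (intro add_nonneg_nonneg) auto
      have "\<epsilon> * (\<epsilon> ^ K * M + 2 * D * g ^ Suc i * A) + D * g ^ i * A =
          \<epsilon> ^ Suc K * M + (\<epsilon> * g) * (2 * D * g ^ i * A) + D * g ^ i * A" by (simp add: algebra_simps)
      also have "\<dots> = \<epsilon> ^ Suc K * M + 2 * D * g ^ i * A" by (simp add: \<epsilon>(2))
      finally have eq: "\<epsilon> * (\<epsilon> ^ K * M + 2 * D * g ^ Suc i * A) + D * g ^ i * A =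
          \<epsilon> ^ Suc K * M + 2 * D * g ^ i * A" .
      show ?case using step[OF Suc.IH[of "Suc i"] nn] unfolding eq .
    qed
    have "AE x in lborel. \<forall>K. x \<in> ball x0 (\<sigma> 0) \<longrightarrow> v x \<le> m + (\<epsilon> ^ K * M + 2 * D * g ^ 0 * A)"
      unfolding AE_all_countable using all[of 0] by blast
    then show "AE x in lborel. x \<in> ball x0 (r / 2) \<longrightarrow> v x \<le> m + 2 * D * A"
    proof eventually_elim
      fix x assume *: "\<forall>K. x \<in> ball x0 (\<sigma> 0) \<longrightarrow> v x \<le> m + (\<epsilon> ^ K * M + 2 * D * g ^ 0 * A)"
      show "x \<in> ball x0 (r / 2) \<longrightarrow> v x \<le> m + 2 * D * A"
      proof
        assume "x \<in> ball x0 (r / 2)"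
        moreover have "\<sigma> 0 = r / 2" by (simp add: \<sigma>_def)
        ultimately have le: "v x \<le> m + (\<epsilon> ^ K * M + 2 * D * A)" for K using * by simp
        have "(\<lambda>K. m + (\<epsilon> ^ K * M + 2 * D * A)) \<longlonglongrightarrow> m + (0 * M + 2 * D * A)"
          using \<epsilon> by (intro tendsto_intros LIMSEQ_power_zero) auto
        then have "v x \<le> m + (0 * M + 2 * D * A)" using le by (intro LIMSEQ_le_const) auto
        then show "v x \<le> m + 2 * D * A" by simp
      qed
    qed
  qed
qed

section \<open>Reduction of the oscillation\<close>

text \<open>Only the part of |v - m| exceeding M enters the tail, so this state reproduces itself, with m
  shifted by \<theta>M, on a ball that is smaller by a factor independent of \<theta>.\<close>

definition osc_state :: "real \<Rightarrow> real \<Rightarrow> real \<Rightarrow> ('a::euclidean_space \<Rightarrow> real) \<Rightarrow> 'a \<Rightarrow> real \<Rightarrow> real \<Rightarrow> real \<Rightarrow> bool" where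
  "osc_state p \<beta> \<kappa> v x0 m M \<rho> \<longleftrightarrow>
    (AE x in lborel. x \<in> ball x0 \<rho> \<longrightarrow> \<bar>v x - m\<bar> \<le> M) \<and>
    (\<integral>x. indicator (- ball x0 \<rho>) x * max 0 (\<bar>v x - m\<bar> - M) powr (p - 1) * sing_kernel \<beta> (x - x0) \<partial>lborel)
      \<le> \<kappa> * M powr (p - 1) * \<rho> powr (- \<beta>)"

lemma osc_state_uminus: "osc_state p \<beta> \<kappa> v x0 m M \<rho> \<Longrightarrow> osc_state p \<beta> \<kappa> (\<lambda>x. - v x) x0 (- m) M \<rho>"
proof -
  have "\<bar>- v x - - m\<bar> = \<bar>v x - m\<bar>" for x by simp
  then show "osc_state p \<beta> \<kappa> v x0 m M \<rho> \<Longrightarrow> osc_state p \<beta> \<kappa> (\<lambda>x. - v x) x0 (- m) M \<rho>"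
    unfolding osc_state_def by simp
qed

text \<open>On the \<rho>-ball the excess of |v - m| over M vanishes, so between the radii s and
  \<rho> only the constant t is integrated. The function u is left general because the estimate is
  applied to level tails, to the next state, and to |v - m| itself when a state is turned back into
  an excess bound.\<close>

lemma osc_state_tail_le:
  fixes v u :: "'a::euclidean_space \<Rightarrow> real"
  assumes v_Lp: "integrable lborel (\<lambda>x. \<bar>v x\<bar> powr p)" and [measurable]: "v \<in> borel_measurable borel"
    and p: "p > 1" and \<beta>: "\<beta> > 0"
    and st: "osc_state p \<beta> \<kappa> v x0 m M \<rho>" and M: "M \<ge> 0" and \<rho>: "\<rho> > 0" and s: "0 < s" "s \<le> \<rho>" and t: "t \<ge> 0"
    and u: "\<And>x. 0 \<le> u x" "\<And>x. u x \<le> max 0 (\<bar>v x - m\<bar> - M) + t"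
    and c0: "(\<integral>x. indicator (- ball x0 s) x * sing_kernel \<beta> (x - x0) \<partial>lborel) \<le> c0 * s powr (- \<beta>)"
  shows "(\<integral>x. indicator (- ball x0 s) x * u x powr (p - 1) * sing_kernel \<beta> (x - x0) \<partial>lborel) \<le>
    2 powr (p - 1) * (\<kappa> * M powr (p - 1) * \<rho> powr (- \<beta>) + t powr (p - 1) * (c0 * s powr (- \<beta>)))"
proof -
  define w where "w x = max 0 (\<bar>v x - m\<bar> - M)" for x
  have w0: "w x \<ge> 0" for x by (simp add: w_def)
  have i1: "integrable lborel (\<lambda>x. indicator (- ball x0 \<rho>) x * w x powr (p - 1) * sing_kernel \<beta> (x - x0))"
  proof -
    have "integrable lborel (\<lambda>x. indicator (- ball x0 \<rho>) x * \<bar>w x\<bar> powr (p - 1) * sing_kernel \<beta> (x - x0))"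
      using p \<beta> \<rho> M by (intro integrable_tail[OF v_Lp, where K = "\<bar>m\<bar>"]) (auto simp: w_def)
    then show ?thesis using w0 by simp
  qed
  have i2: "integrable lborel (\<lambda>x. indicator (- ball x0 s) x * sing_kernel \<beta> (x - x0))"
    by (rule integrable_sing_kernel_far(1)[OF \<beta> s(1)])
  let ?g = "\<lambda>x. 2 powr (p - 1) * (indicator (- ball x0 \<rho>) x * w x powr (p - 1) * sing_kernel \<beta> (x - x0)) +
      2 powr (p - 1) * t powr (p - 1) * (indicator (- ball x0 s) x * sing_kernel \<beta> (x - x0))"
  have "(\<integral>x. indicator (- ball x0 s) x * u x powr (p - 1) * sing_kernel \<beta> (x - x0) \<partial>lborel) \<le> (\<integral>x. ?g x \<partial>lborel)"
  proof (rule integral_mono_AE')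
    show "integrable lborel ?g" using i1 i2 by (intro Bochner_Integration.integrable_add integrable_mult_right)
    show "AE x in lborel. 0 \<le> ?g x" by (intro AE_I2) auto
    have "AE x in lborel. x \<in> ball x0 \<rho> \<longrightarrow> \<bar>v x - m\<bar> \<le> M" using st by (simp add: osc_state_def)
    then show "AE x in lborel. indicator (- ball x0 s) x * u x powr (p - 1) * sing_kernel \<beta> (x - x0) \<le> ?g x"
    proof eventually_elim
      fix x assume x: "x \<in> ball x0 \<rho> \<longrightarrow> \<bar>v x - m\<bar> \<le> M"
      show "indicator (- ball x0 s) x * u x powr (p - 1) * sing_kernel \<beta> (x - x0) \<le> ?g x"
      proof (cases "x \<in> ball x0 s")
        case False
        have "u x powr (p - 1) \<le> (w x + t) powr (p - 1)" using u p by (intro powr_mono2) (auto simp: w_def)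
        also have "\<dots> \<le> 2 powr (p - 1) * (w x powr (p - 1) + t powr (p - 1))"
          using w0 t p by (intro powr_add_le) auto
        also have "w x powr (p - 1) = indicator (- ball x0 \<rho>) x * w x powr (p - 1)"
          using x by (auto simp: w_def indicator_def)
        finally have "u x powr (p - 1) * sing_kernel \<beta> (x - x0) \<le>
          2 powr (p - 1) * (indicator (- ball x0 \<rho>) x * w x powr (p - 1) + t powr (p - 1)) * sing_kernel \<beta> (x - x0)"
          by (intro mult_right_mono) auto
        also have "\<dots> = ?g x" using False by (simp add: algebra_simps)
        finally show ?thesis using False by simp
      qed (use s in simp)
    qed
  qed
  also have "\<dots> = 2 powr (p - 1) * (\<integral>x. indicator (- ball x0 \<rho>) x * w x powr (p - 1) * sing_kernel \<beta> (x - x0) \<partial>lborel) +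
      2 powr (p - 1) * t powr (p - 1) * (\<integral>x. indicator (- ball x0 s) x * sing_kernel \<beta> (x - x0) \<partial>lborel)"
    using i1 i2 by (simp add: Bochner_Integration.integral_add)
  also have "\<dots> \<le> 2 powr (p - 1) * (\<kappa> * M powr (p - 1) * \<rho> powr (- \<beta>)) + 2 powr (p - 1) * t powr (p - 1) * (c0 * s powr (- \<beta>))"
    using st c0 unfolding osc_state_def w_def by (intro add_mono mult_left_mono) auto
  finally show ?thesis by (simp add: algebra_simps)
qed

lemma sing_kernel_far_const:
  fixes \<beta> :: real
  assumes "\<beta> > 0"
  obtains c where "c > 0" "\<And>\<rho> (x0::'a::euclidean_space). \<rho> > 0 \<Longrightarrow>
    (\<integral>x. indicator (- ball x0 \<rho>) x * sing_kernel \<beta> (x - x0) \<partial>lborel) \<le> c * \<rho> powr (- \<beta>)"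
  using integrable_sing_kernel_far(2)[OF assms zero_less_one, where 'a='a] by blast

text \<open>Take the level k = m + M - \<epsilon> M close to the top. On the ball v exceeds k by at
  most \<epsilon> M, and the tail parameter \<epsilon>^(p-1) makes the tail at level k of size
  (\<epsilon> M)^(p-1) as well, so the energy at k is of order (\<epsilon> M)^p. On the other hand v
  \<le> m on half of the half ball, which lies lower than k by at least M / 2. The second De Giorgi
  inequality then makes the first moment above k small compared with its trivial bound, and for
  small \<epsilon> this starts the iteration just above k.\<close>

lemma one_sided_reduction:
  fixes p \<beta> C c0 :: real
  assumes p: "p > 1" and \<beta>: "\<beta> > 0" and C: "C > 0" and c0: "c0 > 0"
    and c0_le: "\<And>\<rho> (x0::'a::euclidean_space). \<rho> > 0 \<Longrightarrow>
      (\<integral>x. indicator (- ball x0 \<rho>) x * sing_kernel \<beta> (x - x0) \<partial>lborel) \<le> c0 * \<rho> powr (- \<beta>)"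
  obtains \<epsilon> where "0 < \<epsilon>" "\<epsilon> \<le> 1/2"
    "\<And>v (x0::'a) R m M \<rho>. de_giorgi p \<beta> C v x0 R \<Longrightarrow> 0 < \<rho> \<Longrightarrow> \<rho> \<le> R \<Longrightarrow> M > 0 \<Longrightarrow>
      osc_state p \<beta> (\<epsilon> powr (p - 1)) v x0 m M \<rho> \<Longrightarrow>
      measure lborel (ball x0 (\<rho> / 2)) / 2 \<le> measure lborel {x \<in> ball x0 (\<rho> / 2). v x \<le> m} \<Longrightarrow>
      AE x in lborel. x \<in> ball x0 (\<rho> / 4) \<longrightarrow> v x \<le> m + (1 - \<epsilon> / 4) * M"
proof -
  define n where "n = real DIM('a)"
  define w where "w = unit_ball_vol n"
  have n: "n \<ge> 1" using DIM_positive[where 'a='a] unfolding n_def by linarith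
  have w: "w > 0" by (simp add: w_def n_def)
  define N where "N = n + p"
  \<comment> \<open>The tail constant relative to the increment \<open>\<kappa>'\<close> =
    \<epsilon> M / 4 used in the iteration: \<epsilon> M is 4 times and \<epsilon> M / 2 is 2 times
    this increment, and 2^\<beta> compares the radii \<rho>/4 and \<rho>/2.\<close>
  define T where "T = 2 powr (p - 1) * (4 powr (p - 1) + 2 powr (p - 1) * (2 powr \<beta> * c0))"
  have T: "T \<ge> 0" using c0 by (simp add: T_def)
  obtain \<nu> \<gamma> where \<nu>: "\<nu> > 0" and \<gamma>: "\<gamma> > 0" and iter:
    "\<And>v (x0::'a) R \<rho>1 \<rho>2 k0 \<kappa>. de_giorgi p \<beta> C v x0 R \<Longrightarrow> 0 < \<rho>1 \<Longrightarrow> \<rho>1 < \<rho>2 \<Longrightarrow> \<rho>2 \<le> 2 * \<rho>1 \<Longrightarrow> \<rho>2 \<le> R \<Longrightarrow> \<kappa> > 0 \<Longrightarrow>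
      level_moment v x0 k0 p \<rho>2 \<le> \<nu> * ((\<rho>2 - \<rho>1) / \<rho>2) powr \<gamma> * \<kappa> powr p * \<rho>2 powr n \<Longrightarrow>
      level_tail p \<beta> v x0 k0 \<rho>1 \<le> T * \<kappa> powr (p - 1) * \<rho>2 powr (- \<beta>) \<Longrightarrow>
      AE x in lborel. x \<in> ball x0 \<rho>1 \<longrightarrow> v x \<le> k0 + \<kappa>"
    using that by (rule de_giorgi_iteration[OF p \<beta> C T, where 'a='a, folded n_def])
  define K0 where "K0 = 2 powr N * (w + 2 powr (p - 1) * (1 + c0) * w)"
  have K0: "K0 > 0" using w c0 by (simp add: K0_def add_pos_pos)
  define K1 where "K1 = C * K0 * 2 powr (p - 1) * 2 powr n"
  have K1: "K1 > 0" using C K0 by (simp add: K1_def)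
  define B where "B = \<nu> * (1/2) powr \<gamma> * (1/4) powr p * (1/2) powr n"
  have B: "B > 0" using \<nu> by (simp add: B_def)
  \<comment> \<open>K1 \<epsilon>^(p-1) is the relative size of the moment with which the iteration
    starts, and B is its threshold for the radii \<rho>/2 and \<rho>/4 and an increment of
    \<epsilon> M / 4. The bound 1/2 ensures k - m \<ge> M / 2.\<close>
  define \<epsilon> where "\<epsilon> = min (1/2) ((B / K1) powr (1 / (p - 1)))"
  have \<epsilon>: "0 < \<epsilon>" "\<epsilon> \<le> 1/2" using B K1 by (auto simp: \<epsilon>_def)
  have \<epsilon>B: "K1 * \<epsilon> powr (p - 1) \<le> B"
  proof -
    have "\<epsilon> powr (p - 1) \<le> ((B / K1) powr (1 / (p - 1))) powr (p - 1)"
      using p \<epsilon> by (intro powr_mono2) (auto simp: \<epsilon>_def)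
    also have "\<dots> = B / K1" using p B K1 by (simp add: powr_powr)
    finally show ?thesis using K1 by (simp add: field_simps)
  qed
  show ?thesis
  proof (rule that[OF \<epsilon>])
    fix v and x0 :: 'a and R m M \<rho> :: real
    assume dg: "de_giorgi p \<beta> C v x0 R" and \<rho>: "0 < \<rho>" "\<rho> \<le> R" and M: "M > 0"
      and st: "osc_state p \<beta> (\<epsilon> powr (p - 1)) v x0 m M \<rho>"
      and half: "measure lborel (ball x0 (\<rho> / 2)) / 2 \<le> measure lborel {x \<in> ball x0 (\<rho> / 2). v x \<le> m}"
    have v_meas [measurable]: "v \<in> borel_measurable borel" and v: "integrable lborel (\<lambda>x. \<bar>v x\<bar> powr p)"
      using dg by (auto simp: de_giorgi_def)
    have ae: "AE x in lborel. x \<in> ball x0 \<rho> \<longrightarrow> \<bar>v x - m\<bar> \<le> M" using st by (simp add: osc_state_def)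
    have eM: "\<epsilon> * M > 0" using \<epsilon> M by simp
    have ball_int: "integrable lborel (\<lambda>x. c * indicator (ball x0 s) x :: real)" for c s
      using ball_indicator_integrable[OF v v_meas p] by (rule integrable_mult_right)
    have tail: "level_tail p \<beta> v x0 (m + M - t) s \<le>
        2 powr (p - 1) * (\<epsilon> powr (p - 1) * M powr (p - 1) * \<rho> powr (- \<beta>) + t powr (p - 1) * (c0 * s powr (- \<beta>)))"
      if "0 < s" "s \<le> \<rho>" "t \<ge> 0" for s t
      unfolding level_tail_def
      using that M by (intro osc_state_tail_le[OF v v_meas p \<beta> st _ \<rho>(1)] c0_le) auto
    define k where "k = m + M - \<epsilon> * M"
    have mom: "level_moment v x0 k e \<rho> \<le> (\<epsilon> * M) powr e * (w * \<rho> powr n)" if e: "0 < e" "e \<le> p" for e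
    proof -
      have "level_moment v x0 k e \<rho> \<le> (\<integral>x. (\<epsilon> * M) powr e * indicator (ball x0 \<rho>) x \<partial>lborel)"
        unfolding level_moment_def
      proof (rule integral_mono_AE)
        show "AE x in lborel. indicator (ball x0 \<rho>) x * max 0 (v x - k) powr e \<le> (\<epsilon> * M) powr e * indicator (ball x0 \<rho>) x"
          using ae
        proof eventually_elim
          fix x assume x: "x \<in> ball x0 \<rho> \<longrightarrow> \<bar>v x - m\<bar> \<le> M"
          show "indicator (ball x0 \<rho>) x * max 0 (v x - k) powr e \<le> (\<epsilon> * M) powr e * indicator (ball x0 \<rho>) x"
          proof (cases "x \<in> ball x0 \<rho>")
            case True
            then have "max 0 (v x - k) \<le> \<epsilon> * M" using x eM by (auto simp: k_def)
            then show ?thesis using True e by (simp add: powr_mono2)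
          qed simp
        qed
      qed (use level_integrable(1)[OF v v_meas p] e ball_int in auto)
      also have "\<dots> = (\<epsilon> * M) powr e * (w * \<rho> powr n)"
        using \<rho> by (simp add: measure_lborel_ball w_def n_def powr_realpow)
      finally show ?thesis .
    qed
    have eMp: "(\<epsilon> * M) powr e = \<epsilon> powr e * M powr e" for e using \<epsilon> M by (simp add: powr_mult)
    have tk: "level_tail p \<beta> v x0 k \<rho> \<le> 2 powr (p - 1) * (1 + c0) * ((\<epsilon> * M) powr (p - 1) * \<rho> powr (- \<beta>))"
      using tail[of \<rho> "\<epsilon> * M"] \<rho> eM unfolding k_def eMp by (simp add: algebra_simps)
    have pe: "(\<epsilon> * M) powr (p - 1) * ((\<epsilon> * M) powr 1) = (\<epsilon> * M) powr p" by (simp only: powr_add[symmetric]) simp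
    have E: "dg_energy p \<beta> v x0 k (\<rho> / 2) \<rho> \<le> K0 * ((\<epsilon> * M) powr p * \<rho> powr (- \<beta>) * \<rho> powr n)"
    proof -
      have N': "real DIM('a) + p = N" by (simp add: N_def n_def)
      have two: "\<rho> / (\<rho> - \<rho> / 2) = 2" using \<rho> by simp
      have "\<rho> powr (- \<beta>) * level_moment v x0 k p \<rho> + level_tail p \<beta> v x0 k \<rho> * level_moment v x0 k 1 \<rho> \<le>
         \<rho> powr (- \<beta>) * ((\<epsilon> * M) powr p * (w * \<rho> powr n)) +
         (2 powr (p - 1) * (1 + c0) * ((\<epsilon> * M) powr (p - 1) * \<rho> powr (- \<beta>))) * ((\<epsilon> * M) powr 1 * (w * \<rho> powr n))"
        using p c0 by (intro add_mono mult_left_mono[OF mom] mult_mono[OF tk mom]) auto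
      also have "\<dots> = \<rho> powr (- \<beta>) * ((\<epsilon> * M) powr p * (w * \<rho> powr n)) +
         2 powr (p - 1) * (1 + c0) * (((\<epsilon> * M) powr (p - 1) * (\<epsilon> * M) powr 1) * \<rho> powr (- \<beta>)) * (w * \<rho> powr n)"
        by (simp only: mult_ac)
      also have "\<dots> = (w + 2 powr (p - 1) * (1 + c0) * w) * ((\<epsilon> * M) powr p * \<rho> powr (- \<beta>) * \<rho> powr n)"
        unfolding pe by (simp add: algebra_simps)
      finally have "\<rho> powr (- \<beta>) * level_moment v x0 k p \<rho> + level_tail p \<beta> v x0 k \<rho> * level_moment v x0 k 1 \<rho> \<le>
        (w + 2 powr (p - 1) * (1 + c0) * w) * ((\<epsilon> * M) powr p * \<rho> powr (- \<beta>) * \<rho> powr n)" .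
      from mult_left_mono[OF this, of "2 powr N"] show ?thesis
        unfolding dg_energy_def N' two K0_def by (simp add: mult.assoc)
    qed
    define I where "I = level_moment v x0 k 1 (\<rho> / 2)"
    \<comment> \<open>The gain: the height \<epsilon> M above k alone would give only a multiple of
      \<epsilon> M \<rho>^n; this is better by a factor of order \<epsilon>^(p-1).\<close>
    have I: "I \<le> K1 * (\<epsilon> powr p * M * \<rho> powr n)"
    proof -
      have mk: "m \<le> k"
      proof -
        have "\<epsilon> * M \<le> 1 * M" using \<epsilon> M by (intro mult_right_mono) auto
        then show ?thesis by (simp add: k_def)
      qed
      have "(k - m) powr (p - 1) * (\<rho> / 2) powr n * \<rho> powr (- (n + \<beta>)) * I \<le> C * dg_energy p \<beta> v x0 k (\<rho> / 2) \<rho>"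
        using dg \<rho> mk half unfolding de_giorgi_def I_def n_def by auto
      also have "\<dots> \<le> C * (K0 * ((\<epsilon> * M) powr p * \<rho> powr (- \<beta>) * \<rho> powr n))" using E C by (intro mult_left_mono) auto
      finally have 1: "(k - m) powr (p - 1) * (\<rho> / 2) powr n * \<rho> powr (- (n + \<beta>)) * I \<le>
        C * (K0 * ((\<epsilon> * M) powr p * \<rho> powr (- \<beta>) * \<rho> powr n))" .
      have "M / 2 \<le> k - m"
      proof -
        have "\<epsilon> * M \<le> (1/2) * M" using \<epsilon> M by (intro mult_right_mono) auto
        then show ?thesis by (simp add: k_def)
      qed
      then have "(M / 2) powr (p - 1) \<le> (k - m) powr (p - 1)" using M p by (intro powr_mono2) auto
      then have "(M / 2) powr (p - 1) * ((\<rho> / 2) powr n * \<rho> powr (- (n + \<beta>)) * I) \<le>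
          (k - m) powr (p - 1) * ((\<rho> / 2) powr n * \<rho> powr (- (n + \<beta>)) * I)"
        by (intro mult_right_mono) (auto simp: I_def)
      with 1 have 2: "(M / 2) powr (p - 1) * ((\<rho> / 2) powr n * \<rho> powr (- (n + \<beta>)) * I) \<le>
        C * (K0 * ((\<epsilon> * M) powr p * \<rho> powr (- \<beta>) * \<rho> powr n))" by (simp only: mult.assoc)
      define Z where "Z = M powr (p - 1) * \<rho> powr (- \<beta>)"
      have Z: "Z > 0" using M \<rho> by (simp add: Z_def)
      have e1: "(M / 2) powr (p - 1) * ((\<rho> / 2) powr n * \<rho> powr (- (n + \<beta>)) * I) * (2 powr (p - 1) * 2 powr n) = Z * I"
      proof -
        have a: "(M / 2) powr (p - 1) * 2 powr (p - 1) = M powr (p - 1)" using M by (simp add: powr_divide)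
        have b: "(\<rho> / 2) powr n * 2 powr n = \<rho> powr n" using \<rho> by (simp add: powr_divide)
        have c: "\<rho> powr n * \<rho> powr (- (n + \<beta>)) = \<rho> powr (- \<beta>)" by (simp add: powr_add[symmetric])
        have "(M / 2) powr (p - 1) * ((\<rho> / 2) powr n * \<rho> powr (- (n + \<beta>)) * I) * (2 powr (p - 1) * 2 powr n) =
          ((M / 2) powr (p - 1) * 2 powr (p - 1)) * (((\<rho> / 2) powr n * 2 powr n) * \<rho> powr (- (n + \<beta>))) * I" by (simp only: mult_ac)
        then show ?thesis unfolding a b c Z_def .
      qed
      have e2: "C * (K0 * ((\<epsilon> * M) powr p * \<rho> powr (- \<beta>) * \<rho> powr n)) * (2 powr (p - 1) * 2 powr n) =
          Z * (K1 * (\<epsilon> powr p * M * \<rho> powr n))"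
      proof -
        have "M powr p = M powr (p - 1) * M" using M by (simp add: powr_diff)
        then show ?thesis unfolding eMp K1_def Z_def by (simp only: mult_ac)
      qed
      have "Z * I \<le> Z * (K1 * (\<epsilon> powr p * M * \<rho> powr n))"
        using mult_right_mono[OF 2, of "2 powr (p - 1) * 2 powr n"] unfolding e1 e2 by simp
      then show ?thesis using Z by simp
    qed
    \<comment> \<open>Halfway between k and the top. The iteration rises from here by a quarter of
      \<epsilon> M and thus stops \<epsilon> M / 4 below m + M.\<close>
    define k' where "k' = m + M - \<epsilon> * M / 2"
    define \<kappa>' where "\<kappa>' = \<epsilon> * M / 4"
    have \<kappa>': "\<kappa>' > 0" using eM by (simp add: \<kappa>'_def)
    have "AE x in lborel. x \<in> ball x0 (\<rho> / 4) \<longrightarrow> v x \<le> k' + \<kappa>'"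
    proof (rule iter[OF dg])
      have "level_moment v x0 k' p (\<rho> / 2) \<le> (\<epsilon> * M) powr (p - 1) * I"
      proof -
        have i: "integrable lborel (\<lambda>x. indicator (ball x0 (\<rho> / 2)) x * max 0 (v x - k) powr 1)"
          by (rule level_integrable(1)[OF v v_meas p]) (use p in auto)
        have "level_moment v x0 k' p (\<rho> / 2) \<le>
          (\<integral>x. (\<epsilon> * M) powr (p - 1) * (indicator (ball x0 (\<rho> / 2)) x * max 0 (v x - k) powr 1) \<partial>lborel)"
          unfolding level_moment_def
        proof (rule integral_mono_AE)
          show "integrable lborel (\<lambda>x. (\<epsilon> * M) powr (p - 1) * (indicator (ball x0 (\<rho> / 2)) x * max 0 (v x - k) powr 1))"
            using i by (rule integrable_mult_right)
          show "integrable lborel (\<lambda>x. indicator (ball x0 (\<rho> / 2)) x * max 0 (v x - k') powr p)"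
            by (rule level_integrable(1)[OF v v_meas p]) (use p in auto)
          show "AE x in lborel. indicator (ball x0 (\<rho> / 2)) x * max 0 (v x - k') powr p \<le>
            (\<epsilon> * M) powr (p - 1) * (indicator (ball x0 (\<rho> / 2)) x * max 0 (v x - k) powr 1)"
            using ae
          proof eventually_elim
            fix x assume x: "x \<in> ball x0 \<rho> \<longrightarrow> \<bar>v x - m\<bar> \<le> M"
            show "indicator (ball x0 (\<rho> / 2)) x * max 0 (v x - k') powr p \<le>
              (\<epsilon> * M) powr (p - 1) * (indicator (ball x0 (\<rho> / 2)) x * max 0 (v x - k) powr 1)"
            proof (cases "x \<in> ball x0 (\<rho> / 2)")
              case True
              then have "x \<in> ball x0 \<rho>" using \<rho> by auto
              then have b: "max 0 (v x - k') \<le> \<epsilon> * M" "max 0 (v x - k') \<le> max 0 (v x - k)"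
                using x eM by (auto simp: k'_def k_def)
              have "max 0 (v x - k') powr p = max 0 (v x - k') powr (p - 1) * max 0 (v x - k') powr 1"
                by (simp only: powr_add[symmetric]) simp
              also have "\<dots> \<le> (\<epsilon> * M) powr (p - 1) * max 0 (v x - k) powr 1"
                using b p by (intro mult_mono powr_mono2) auto
              finally show ?thesis using True by simp
            qed simp
          qed
        qed
        then show ?thesis by (simp add: I_def level_moment_def)
      qed
      also have "\<dots> \<le> (\<epsilon> * M) powr (p - 1) * (K1 * (\<epsilon> powr p * M * \<rho> powr n))"
        using I by (intro mult_left_mono) auto
      also have "\<dots> = (K1 * \<epsilon> powr (p - 1)) * ((\<epsilon> * M) powr p * \<rho> powr n)"
      proof -
        have "M powr p = M powr (p - 1) * M" using M by (simp add: powr_diff)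
        then show ?thesis unfolding eMp by (simp only: mult_ac)
      qed
      also have "\<dots> \<le> B * ((\<epsilon> * M) powr p * \<rho> powr n)" using \<epsilon>B by (intro mult_right_mono) auto
      also have "\<dots> = \<nu> * ((\<rho> / 2 - \<rho> / 4) / (\<rho> / 2)) powr \<gamma> * \<kappa>' powr p * (\<rho> / 2) powr n"
      proof -
        have h: "(\<rho> / 2 - \<rho> / 4) / (\<rho> / 2) = 1/2" using \<rho> by (simp add: field_simps)
        have a: "\<kappa>' powr p = (1/4) powr p * (\<epsilon> * M) powr p" using \<epsilon> M by (simp add: \<kappa>'_def powr_mult powr_divide)
        have b: "(\<rho> / 2) powr n = (1/2) powr n * \<rho> powr n" using \<rho> by (simp add: powr_divide)
        show ?thesis unfolding h a b B_def by (simp only: mult_ac)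
      qed
      finally show "level_moment v x0 k' p (\<rho> / 2) \<le> \<nu> * ((\<rho> / 2 - \<rho> / 4) / (\<rho> / 2)) powr \<gamma> * \<kappa>' powr p * (\<rho> / 2) powr n" .
      have "level_tail p \<beta> v x0 k' (\<rho> / 4) \<le> 2 powr (p - 1) *
         ((\<epsilon> * M) powr (p - 1) * \<rho> powr (- \<beta>) + (\<epsilon> * M / 2) powr (p - 1) * (c0 * (\<rho> / 4) powr (- \<beta>)))"
        using tail[of "\<rho> / 4" "\<epsilon> * M / 2"] \<rho> eM unfolding k'_def eMp by simp
      also have "\<dots> \<le> T * \<kappa>' powr (p - 1) * (\<rho> / 2) powr (- \<beta>)"
      proof -
        have a: "(\<epsilon> * M) powr (p - 1) = 4 powr (p - 1) * \<kappa>' powr (p - 1)"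
        proof -
          have "\<epsilon> * M = 4 * \<kappa>'" by (simp add: \<kappa>'_def)
          then show ?thesis using \<kappa>' by (simp only: powr_mult)
        qed
        have b: "(\<epsilon> * M / 2) powr (p - 1) = 2 powr (p - 1) * \<kappa>' powr (p - 1)"
        proof -
          have "\<epsilon> * M / 2 = 2 * \<kappa>'" by (simp add: \<kappa>'_def)
          then show ?thesis using \<kappa>' by (simp only: powr_mult)
        qed
        have c: "(\<rho> / 4) powr (- \<beta>) = 2 powr \<beta> * (\<rho> / 2) powr (- \<beta>)"
        proof -
          have "(\<rho> / 4) powr (- \<beta>) = ((1/2) * (\<rho> / 2)) powr (- \<beta>)" by simp
          also have "\<dots> = (1/2) powr (- \<beta>) * (\<rho> / 2) powr (- \<beta>)" using \<rho> by (simp only: powr_mult)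
          also have "(1/2 :: real) powr (- \<beta>) = 2 powr \<beta>" by (simp add: powr_divide powr_minus)
          finally show ?thesis .
        qed
        have d: "\<rho> powr (- \<beta>) \<le> (\<rho> / 2) powr (- \<beta>)" using \<rho> \<beta> by (intro powr_mono2') auto
        have "2 powr (p - 1) * ((\<epsilon> * M) powr (p - 1) * \<rho> powr (- \<beta>) + (\<epsilon> * M / 2) powr (p - 1) * (c0 * (\<rho> / 4) powr (- \<beta>))) \<le>
           2 powr (p - 1) * ((\<epsilon> * M) powr (p - 1) * (\<rho> / 2) powr (- \<beta>) + (\<epsilon> * M / 2) powr (p - 1) * (c0 * (\<rho> / 4) powr (- \<beta>)))"
          using d by (intro mult_left_mono add_right_mono) auto
        also have "\<dots> = T * \<kappa>' powr (p - 1) * (\<rho> / 2) powr (- \<beta>)"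
          unfolding a b c T_def by (simp add: algebra_simps)
        finally show ?thesis .
      qed
      finally show "level_tail p \<beta> v x0 k' (\<rho> / 4) \<le> T * \<kappa>' powr (p - 1) * (\<rho> / 2) powr (- \<beta>)" .
    qed (use \<rho> \<kappa>' in auto)
    moreover have "k' + \<kappa>' = m + (1 - \<epsilon> / 4) * M" by (simp add: k'_def \<kappa>'_def algebra_simps)
    ultimately show "AE x in lborel. x \<in> ball x0 (\<rho> / 4) \<longrightarrow> v x \<le> m + (1 - \<epsilon> / 4) * M" by simp
  qed
qed

text \<open>One of the sets {v \<le> m} and {v \<ge> m} fills half of the half ball, so the
  one-sided reduction applies to v or to -v and removes a slice at the top or at the bottom. Moving
  the centre m away from that slice by \<theta> M makes the bound symmetric again. The two
  contributions to the new tail are made small separately, each at most \<kappa> / 2 after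
  normalisation.\<close>

lemma oscillation_step:
  fixes p \<beta> C :: real
  assumes p: "p > 1" and \<beta>: "\<beta> > 0" and C: "C > 0"
  obtains \<kappa> \<sigma> \<theta> where "\<kappa> > 0" "0 < \<sigma>" "\<sigma> \<le> 1/4" "0 < \<theta>" "\<theta> \<le> 1/2"
    "\<And>v (x0::'a::euclidean_space) R m M \<rho>. de_giorgi p \<beta> C v x0 R \<Longrightarrow> de_giorgi p \<beta> C (\<lambda>x. - v x) x0 R \<Longrightarrow>
      0 < \<rho> \<Longrightarrow> \<rho> \<le> R \<Longrightarrow> M > 0 \<Longrightarrow> osc_state p \<beta> \<kappa> v x0 m M \<rho> \<Longrightarrow>
      \<exists>m'. osc_state p \<beta> \<kappa> v x0 m' ((1 - \<theta>) * M) (\<sigma> * \<rho>)"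
proof -
  obtain c0 where c0: "c0 > 0" and c0_le: "\<And>\<rho> (x0::'a). \<rho> > 0 \<Longrightarrow>
    (\<integral>x. indicator (- ball x0 \<rho>) x * sing_kernel \<beta> (x - x0) \<partial>lborel) \<le> c0 * \<rho> powr (- \<beta>)"
    using that by (rule sing_kernel_far_const[OF \<beta>])
  obtain \<epsilon> where \<epsilon>: "0 < \<epsilon>" "\<epsilon> \<le> 1/2" and red:
    "\<And>v (x0::'a) R m M \<rho>. de_giorgi p \<beta> C v x0 R \<Longrightarrow> 0 < \<rho> \<Longrightarrow> \<rho> \<le> R \<Longrightarrow> M > 0 \<Longrightarrow>
      osc_state p \<beta> (\<epsilon> powr (p - 1)) v x0 m M \<rho> \<Longrightarrow>
      measure lborel (ball x0 (\<rho> / 2)) / 2 \<le> measure lborel {x \<in> ball x0 (\<rho> / 2). v x \<le> m} \<Longrightarrow>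
      AE x in lborel. x \<in> ball x0 (\<rho> / 4) \<longrightarrow> v x \<le> m + (1 - \<epsilon> / 4) * M"
    using c0_le that by (rule one_sided_reduction[OF p \<beta> C c0])
  define \<kappa> where "\<kappa> = \<epsilon> powr (p - 1)"
  have \<kappa>: "\<kappa> > 0" using \<epsilon> by (simp add: \<kappa>_def)
  \<comment> \<open>A factor 2^(p-1) from splitting the power of a sum and another from replacing M
    by (1 - \<theta>) M \<ge> M / 2. The choice of \<sigma> below lets the old tail, scaled by
    \<sigma>^\<beta>, take up at most half of \<kappa>.\<close>
  define F :: real where "F = 4 powr (p - 1)"
  have F: "F > 0" by (simp add: F_def)
  define \<sigma> where "\<sigma> = min (1/4) ((1 / (2 * F)) powr (1 / \<beta>))"
  have \<sigma>: "0 < \<sigma>" "\<sigma> \<le> 1/4" using F by (auto simp: \<sigma>_def)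
  have \<sigma>F: "F * \<sigma> powr \<beta> \<le> 1/2"
  proof -
    have "\<sigma> powr \<beta> \<le> ((1 / (2 * F)) powr (1 / \<beta>)) powr \<beta>" using \<sigma> \<beta> by (intro powr_mono2) (auto simp: \<sigma>_def)
    also have "\<dots> = 1 / (2 * F)" using F \<beta> by (simp add: powr_powr)
    finally show ?thesis using F by (simp add: field_simps)
  qed
  \<comment> \<open>Recentring and lowering M raise the integrand of the tail by at most 2 \<theta>
    M, which has to take up at most the other half of \<kappa>. The bound 2 \<theta> \<le>
    \<epsilon> / 4 makes the interval from m - M to m + (1 - \<epsilon>/4) M fit into one of half
    length (1 - \<theta>) M around m - \<theta> M.\<close>
  define \<theta> where "\<theta> = min (\<epsilon> / 8) ((\<kappa> / (2 * F * c0)) powr (1 / (p - 1)) / 2)"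
  have \<theta>: "0 < \<theta>" "\<theta> \<le> 1/2" "2 * \<theta> \<le> \<epsilon> / 4" using \<epsilon> \<kappa> F c0 by (auto simp: \<theta>_def)
  have \<theta>F: "F * ((2 * \<theta>) powr (p - 1) * c0) \<le> \<kappa> / 2"
  proof -
    have "(2 * \<theta>) powr (p - 1) \<le> ((\<kappa> / (2 * F * c0)) powr (1 / (p - 1))) powr (p - 1)"
      using \<theta> p by (intro powr_mono2) (auto simp: \<theta>_def)
    also have "\<dots> = \<kappa> / (2 * F * c0)" using F c0 \<kappa> p by (simp add: powr_powr)
    finally show ?thesis using F c0 by (simp add: field_simps)
  qed
  show ?thesis
  proof (rule that[OF \<kappa> \<sigma> \<theta>(1,2)])
    fix v and x0 :: 'a and R m M \<rho> :: real
    assume dg: "de_giorgi p \<beta> C v x0 R" "de_giorgi p \<beta> C (\<lambda>x. - v x) x0 R"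
      and \<rho>: "0 < \<rho>" "\<rho> \<le> R" and M: "M > 0" and st: "osc_state p \<beta> \<kappa> v x0 m M \<rho>"
    have v_meas [measurable]: "v \<in> borel_measurable borel" and v: "integrable lborel (\<lambda>x. \<bar>v x\<bar> powr p)"
      using dg by (auto simp: de_giorgi_def)
    have ae: "AE x in lborel. x \<in> ball x0 \<rho> \<longrightarrow> \<bar>v x - m\<bar> \<le> M" using st by (simp add: osc_state_def)
    have \<theta>M: "0 < \<theta> * M" using \<theta> M by simp
    have e\<theta>: "(1 - \<epsilon> / 4) * M \<le> (1 - 2 * \<theta>) * M" using \<theta> M by (intro mult_right_mono) auto
    have "\<exists>m'. \<bar>m - m'\<bar> \<le> \<theta> * M \<and> (AE x in lborel. x \<in> ball x0 (\<rho> / 4) \<longrightarrow> \<bar>v x - m'\<bar> \<le> (1 - \<theta>) * M)"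
    proof (cases "measure lborel (ball x0 (\<rho> / 2)) / 2 \<le> measure lborel {x \<in> ball x0 (\<rho> / 2). v x \<le> m}")
      case True
      have "AE x in lborel. x \<in> ball x0 (\<rho> / 4) \<longrightarrow> v x \<le> m + (1 - \<epsilon> / 4) * M"
        using True st unfolding \<kappa>_def by (intro red[OF dg(1) \<rho> M])
      then have "AE x in lborel. x \<in> ball x0 (\<rho> / 4) \<longrightarrow> \<bar>v x - (m - \<theta> * M)\<bar> \<le> (1 - \<theta>) * M"
        using ae
      proof eventually_elim
        fix x assume x: "x \<in> ball x0 (\<rho> / 4) \<longrightarrow> v x \<le> m + (1 - \<epsilon> / 4) * M" "x \<in> ball x0 \<rho> \<longrightarrow> \<bar>v x - m\<bar> \<le> M"
        show "x \<in> ball x0 (\<rho> / 4) \<longrightarrow> \<bar>v x - (m - \<theta> * M)\<bar> \<le> (1 - \<theta>) * M"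
        proof
          assume "x \<in> ball x0 (\<rho> / 4)"
          then have "v x \<le> m + (1 - 2 * \<theta>) * M" "m - M \<le> v x" using x \<rho> e\<theta> by (auto simp: abs_le_iff)
          then show "\<bar>v x - (m - \<theta> * M)\<bar> \<le> (1 - \<theta>) * M" by (simp add: abs_le_iff algebra_simps)
        qed
      qed
      then show ?thesis using \<theta>M by (intro exI[of _ "m - \<theta> * M"]) auto
    next
      case False
      let ?B = "ball x0 (\<rho> / 2)"
      have "{x \<in> ?B. v x \<le> m} \<union> {x \<in> ?B. - v x \<le> - m} = ?B" by auto
      moreover have "measure lborel ({x \<in> ?B. v x \<le> m} \<union> {x \<in> ?B. - v x \<le> - m}) \<le>
          measure lborel {x \<in> ?B. v x \<le> m} + measure lborel {x \<in> ?B. - v x \<le> - m}"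
        by (intro measure_Un_le) auto
      ultimately have h: "measure lborel ?B / 2 \<le> measure lborel {x \<in> ?B. - v x \<le> - m}" using False by simp
      have "AE x in lborel. x \<in> ball x0 (\<rho> / 4) \<longrightarrow> - v x \<le> - m + (1 - \<epsilon> / 4) * M"
        using h osc_state_uminus[OF st] unfolding \<kappa>_def by (intro red[OF dg(2) \<rho> M])
      then have "AE x in lborel. x \<in> ball x0 (\<rho> / 4) \<longrightarrow> \<bar>v x - (m + \<theta> * M)\<bar> \<le> (1 - \<theta>) * M"
        using ae
      proof eventually_elim
        fix x assume x: "x \<in> ball x0 (\<rho> / 4) \<longrightarrow> - v x \<le> - m + (1 - \<epsilon> / 4) * M" "x \<in> ball x0 \<rho> \<longrightarrow> \<bar>v x - m\<bar> \<le> M"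
        show "x \<in> ball x0 (\<rho> / 4) \<longrightarrow> \<bar>v x - (m + \<theta> * M)\<bar> \<le> (1 - \<theta>) * M"
        proof
          assume "x \<in> ball x0 (\<rho> / 4)"
          then have "- v x \<le> - m + (1 - 2 * \<theta>) * M" "v x \<le> m + M" using x \<rho> e\<theta> by (auto simp: abs_le_iff)
          then show "\<bar>v x - (m + \<theta> * M)\<bar> \<le> (1 - \<theta>) * M" by (simp add: abs_le_iff algebra_simps)
        qed
      qed
      then show ?thesis using \<theta>M by (intro exI[of _ "m + \<theta> * M"]) auto
    qed
    then obtain m' where m': "\<bar>m - m'\<bar> \<le> \<theta> * M"
      and ae': "AE x in lborel. x \<in> ball x0 (\<rho> / 4) \<longrightarrow> \<bar>v x - m'\<bar> \<le> (1 - \<theta>) * M" by blast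
    have sub: "ball x0 (\<sigma> * \<rho>) \<subseteq> ball x0 (\<rho> / 4)"
    proof -
      have "\<sigma> * \<rho> \<le> 1/4 * \<rho>" using \<sigma> \<rho> by (intro mult_right_mono) auto
      then show ?thesis by (intro subset_ball) simp
    qed
    have s: "0 < \<sigma> * \<rho>" "\<sigma> * \<rho> \<le> \<rho>" using \<sigma> \<rho> by auto
    have "osc_state p \<beta> \<kappa> v x0 m' ((1 - \<theta>) * M) (\<sigma> * \<rho>)"
      unfolding osc_state_def
    proof
      show "AE x in lborel. x \<in> ball x0 (\<sigma> * \<rho>) \<longrightarrow> \<bar>v x - m'\<bar> \<le> (1 - \<theta>) * M"
        using ae' sub by (auto elim!: eventually_mono)
      have "(\<integral>x. indicator (- ball x0 (\<sigma> * \<rho>)) x * max 0 (\<bar>v x - m'\<bar> - (1 - \<theta>) * M) powr (p - 1) * sing_kernel \<beta> (x - x0) \<partial>lborel) \<le>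
        2 powr (p - 1) * (\<kappa> * M powr (p - 1) * \<rho> powr (- \<beta>) + (2 * \<theta> * M) powr (p - 1) * (c0 * (\<sigma> * \<rho>) powr (- \<beta>)))"
      proof (rule osc_state_tail_le[OF v v_meas p \<beta> st less_imp_le[OF M] \<rho>(1) s])
        fix x
        have "\<bar>v x - m'\<bar> \<le> \<bar>v x - m\<bar> + \<bar>m - m'\<bar>" by simp
        then have "\<bar>v x - m'\<bar> - (1 - \<theta>) * M \<le> (\<bar>v x - m\<bar> - M) + 2 * \<theta> * M" using m' by (simp add: algebra_simps)
        then show "max 0 (\<bar>v x - m'\<bar> - (1 - \<theta>) * M) \<le> max 0 (\<bar>v x - m\<bar> - M) + 2 * \<theta> * M" using \<theta>M by linarith
      qed (use \<theta> M c0_le[OF s(1)] in auto)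
      also have "\<dots> = 2 powr (p - 1) * (M powr (p - 1) * (\<sigma> * \<rho>) powr (- \<beta>)) * (\<kappa> * \<sigma> powr \<beta> + (2 * \<theta>) powr (p - 1) * c0)"
      proof -
        have a: "(2 * \<theta> * M) powr (p - 1) = (2 * \<theta>) powr (p - 1) * M powr (p - 1)" using \<theta> M by (simp only: powr_mult)
        have b: "\<rho> powr (- \<beta>) = \<sigma> powr \<beta> * (\<sigma> * \<rho>) powr (- \<beta>)"
        proof -
          have "(\<sigma> * \<rho>) powr (- \<beta>) = \<sigma> powr (- \<beta>) * \<rho> powr (- \<beta>)" using \<sigma> \<rho> by (simp only: powr_mult)
          moreover have "\<sigma> powr \<beta> * \<sigma> powr (- \<beta>) = 1" using \<sigma> by (simp add: powr_minus)
          ultimately show ?thesis by (metis mult.assoc mult_1)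
        qed
        show ?thesis unfolding a by (subst b) (simp add: algebra_simps)
      qed
      also have "\<dots> = (M powr (p - 1) * (\<sigma> * \<rho>) powr (- \<beta>)) / 2 powr (p - 1) * (F * (\<kappa> * \<sigma> powr \<beta> + (2 * \<theta>) powr (p - 1) * c0))"
      proof -
        have "F = 2 powr (p - 1) * 2 powr (p - 1)" unfolding F_def by (simp add: powr_mult[symmetric])
        then show ?thesis by (simp add: field_simps)
      qed
      also have "\<dots> \<le> (M powr (p - 1) * (\<sigma> * \<rho>) powr (- \<beta>)) / 2 powr (p - 1) * \<kappa>"
      proof (intro mult_left_mono)
        have "F * \<sigma> powr \<beta> * \<kappa> \<le> 1/2 * \<kappa>" using \<sigma>F \<kappa> by (intro mult_right_mono) auto
        then show "F * (\<kappa> * \<sigma> powr \<beta> + (2 * \<theta>) powr (p - 1) * c0) \<le> \<kappa>" using \<theta>F by (simp add: algebra_simps)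
      qed auto
      also have "\<dots> = \<kappa> * (M / 2) powr (p - 1) * (\<sigma> * \<rho>) powr (- \<beta>)" using M by (simp add: powr_divide)
      also have "\<dots> \<le> \<kappa> * ((1 - \<theta>) * M) powr (p - 1) * (\<sigma> * \<rho>) powr (- \<beta>)"
      proof -
        have "1/2 * M \<le> (1 - \<theta>) * M" using \<theta> M by (intro mult_right_mono) auto
        then show ?thesis using M p \<kappa> by (intro mult_right_mono mult_left_mono powr_mono2) auto
      qed
      finally show "(\<integral>x. indicator (- ball x0 (\<sigma> * \<rho>)) x * max 0 (\<bar>v x - m'\<bar> - (1 - \<theta>) * M) powr (p - 1) * sing_kernel \<beta> (x - x0) \<partial>lborel) \<le>
        \<kappa> * ((1 - \<theta>) * M) powr (p - 1) * (\<sigma> * \<rho>) powr (- \<beta>)" .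
    qed
    then show "\<exists>m'. osc_state p \<beta> \<kappa> v x0 m' ((1 - \<theta>) * M) (\<sigma> * \<rho>)" by blast
  qed
qed

section \<open>From oscillation back to the excess\<close>

lemma excess_bound_uminus: "excess_bound p \<beta> v x0 m A r \<Longrightarrow> excess_bound p \<beta> (\<lambda>x. - v x) x0 (- m) A r"
proof -
  have "\<bar>- v x - - m\<bar> = \<bar>v x - m\<bar>" for x by simp
  then show "excess_bound p \<beta> v x0 m A r \<Longrightarrow> excess_bound p \<beta> (\<lambda>x. - v x) x0 (- m) A r"
    unfolding excess_bound_def by simp
qed

lemma excess_bound_mono:
  assumes "p > 1" "excess_bound p \<beta> v x0 m A r" "0 \<le> A" "A \<le> A'"
  shows "excess_bound p \<beta> v x0 m A' r"
proof -
  have 1: "A powr q_star p \<le> A' powr q_star p" "A powr (p - 1) \<le> A' powr (p - 1)"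
    using assms q_star_bounds[of p] by (auto intro!: powr_mono2)
  then have "A powr q_star p * measure lborel (ball x0 r) \<le> A' powr q_star p * measure lborel (ball x0 r)"
    "A powr (p - 1) * r powr (- \<beta>) \<le> A' powr (p - 1) * r powr (- \<beta>)"
    by (auto intro!: mult_right_mono)
  then show ?thesis using assms(2) unfolding excess_bound_def by linarith
qed

lemma exists_powr_ge_1:
  fixes X e :: real
  assumes "e > 0"
  obtains c where "c \<ge> 1" "\<And>c'. c \<le> c' \<Longrightarrow> X \<le> c' powr e"
proof -
  obtain \<kappa> where "\<kappa> > 0" "\<And>\<kappa>'. \<kappa> \<le> \<kappa>' \<Longrightarrow> X \<le> 1 * \<kappa>' powr e" using exists_powr_ge[of 1 e X] assms by auto
  then show ?thesis by (intro that[of "max 1 \<kappa>"]) auto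
qed

lemma excess_bound_shrink:
  fixes p \<beta> :: real
  assumes p: "p > 1" and \<beta>: "\<beta> > 0"
  obtains c N where "c \<ge> 1" "N \<ge> 0"
    "\<And>v (x0::'a::euclidean_space) m A t \<rho>. integrable lborel (\<lambda>x. \<bar>v x\<bar> powr p) \<Longrightarrow> v \<in> borel_measurable borel \<Longrightarrow>
      excess_bound p \<beta> v x0 m A t \<Longrightarrow> A > 0 \<Longrightarrow> 0 < \<rho> \<Longrightarrow> \<rho> \<le> t \<Longrightarrow> excess_bound p \<beta> v x0 m (c * (t / \<rho>) powr N * A) \<rho>"
proof -
  define n where "n = real DIM('a)"
  define w where "w = unit_ball_vol n"
  have n: "n \<ge> 1" using DIM_positive[where 'a='a] unfolding n_def by linarith
  have w: "w > 0" by (simp add: w_def n_def)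
  note q = q_star_bounds[OF p]
  \<comment> \<open>The ratio of volumes costs (t/\<rho>)^n in both parts. Since A enters the local
    part with power \<open>q_star p\<close> \<ge> 1, an exponent n is enough there; in the tail it
    enters with power p - 1, which asks for n / (p - 1).\<close>
  define N where "N = n + n / (p - 1)"
  have N: "N \<ge> n" "N * (p - 1) \<ge> n" "N \<ge> 0"
  proof -
    show "N \<ge> n" "N \<ge> 0" using n p by (auto simp: N_def)
    have "N * (p - 1) = n * (p - 1) + n" using p by (simp add: N_def field_simps)
    then show "N * (p - 1) \<ge> n" using n p by simp
  qed
  obtain c where c: "c \<ge> 1" "2 * w + 1 \<le> c powr (p - 1)"
    using exists_powr_ge_1[of "p - 1" "2 * w + 1"] p by (metis diff_gt_0_iff_gt order_refl)
  show ?thesis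
  proof (rule that[OF c(1) N(3)])
    fix v and x0 :: 'a and m A t \<rho> :: real
    assume v: "integrable lborel (\<lambda>x. \<bar>v x\<bar> powr p)" and v_meas [measurable]: "v \<in> borel_measurable borel"
      and eb: "excess_bound p \<beta> v x0 m A t" and A: "A > 0" and \<rho>: "0 < \<rho>" "\<rho> \<le> t"
    have t: "t > 0" using \<rho> by linarith
    define z where "z = t / \<rho>"
    have z: "z \<ge> 1" using \<rho> by (simp add: z_def)
    have cz: "c * z powr N \<ge> z powr N" "z powr N \<ge> 1" "c * z powr N \<ge> 1"
    proof -
      show a: "z powr N \<ge> 1" using z N by (intro ge_one_powr_ge_zero) auto
      show b: "c * z powr N \<ge> z powr N" using mult_right_mono[OF c(1), of "z powr N"] by simp
      show "c * z powr N \<ge> 1" using a b by linarith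
    qed
    show "excess_bound p \<beta> v x0 m (c * (t / \<rho>) powr N * A) \<rho>"
      unfolding excess_bound_def z_def[symmetric]
    proof
      have "(\<integral>x. indicator (ball x0 \<rho>) x * \<bar>v x - m\<bar> powr q_star p \<partial>lborel) \<le>
        (\<integral>x. indicator (ball x0 t) x * \<bar>v x - m\<bar> powr q_star p \<partial>lborel)"
      proof (rule integral_mono)
        fix x show "indicator (ball x0 \<rho>) x * \<bar>v x - m\<bar> powr q_star p \<le> indicator (ball x0 t) x * \<bar>v x - m\<bar> powr q_star p"
          using \<rho> by (auto simp: indicator_def)
      qed (use q osc_integrable[OF v v_meas p] in auto)
      also have "\<dots> \<le> A powr q_star p * measure lborel (ball x0 t)" using eb by (simp add: excess_bound_def)
      also have "measure lborel (ball x0 t) = z powr n * measure lborel (ball x0 \<rho>)"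
        using \<rho> t by (simp add: measure_lborel_ball z_def n_def powr_realpow power_divide)
      also have "A powr q_star p * (z powr n * measure lborel (ball x0 \<rho>)) \<le>
          (c * z powr N * A) powr q_star p * measure lborel (ball x0 \<rho>)"
      proof -
        have "z powr n \<le> z powr N" using z N by (intro powr_mono) auto
        also have "\<dots> \<le> (c * z powr N) powr 1" using cz by simp
        also have "\<dots> \<le> (c * z powr N) powr q_star p" using cz q by (intro powr_mono) auto
        finally have "z powr n * A powr q_star p \<le> (c * z powr N) powr q_star p * A powr q_star p" by (intro mult_right_mono) auto
        also have "\<dots> = (c * z powr N * A) powr q_star p" using cz A c by (simp add: powr_mult)
        finally have "z powr n * A powr q_star p * measure lborel (ball x0 \<rho>) \<le>
          (c * z powr N * A) powr q_star p * measure lborel (ball x0 \<rho>)" by (intro mult_right_mono) auto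
        then show ?thesis by (simp add: mult_ac)
      qed
      finally show "(\<integral>x. indicator (ball x0 \<rho>) x * \<bar>v x - m\<bar> powr q_star p \<partial>lborel) \<le>
        (c * z powr N * A) powr q_star p * measure lborel (ball x0 \<rho>)" .
      have "(\<integral>x. indicator (- ball x0 \<rho>) x * \<bar>v x - m\<bar> powr (p - 1) * sing_kernel \<beta> (x - x0) \<partial>lborel) \<le>
         A powr (p - 1) * ((2 * w + 1) * (t powr n * \<rho> powr (- (n + \<beta>))))"
        using excess_bound_tail[OF v v_meas p eb A \<beta> \<rho>] by (simp add: n_def w_def)
      also have "t powr n * \<rho> powr (- (n + \<beta>)) = z powr n * \<rho> powr (- \<beta>)"
      proof -
        have "t powr n = z powr n * \<rho> powr n" using \<rho> t by (simp add: z_def powr_divide)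
        moreover have "\<rho> powr n * \<rho> powr (- (n + \<beta>)) = \<rho> powr (- \<beta>)" by (simp add: powr_add[symmetric])
        ultimately show ?thesis by (simp only: mult.assoc)
      qed
      also have "A powr (p - 1) * ((2 * w + 1) * (z powr n * \<rho> powr (- \<beta>))) \<le> (c * z powr N * A) powr (p - 1) * \<rho> powr (- \<beta>)"
      proof -
        have "z powr n \<le> z powr (N * (p - 1))" using z N by (intro powr_mono) auto
        then have "(2 * w + 1) * z powr n \<le> c powr (p - 1) * z powr (N * (p - 1))"
          using c w by (intro mult_mono) auto
        then have "(2 * w + 1) * z powr n * (A powr (p - 1) * \<rho> powr (- \<beta>)) \<le>
          c powr (p - 1) * z powr (N * (p - 1)) * (A powr (p - 1) * \<rho> powr (- \<beta>))" by (intro mult_right_mono) auto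
        moreover have "(c * z powr N * A) powr (p - 1) = c powr (p - 1) * z powr (N * (p - 1)) * A powr (p - 1)"
          using c z A by (simp add: powr_mult powr_powr)
        ultimately show ?thesis by (simp add: mult_ac)
      qed
      finally show "(\<integral>x. indicator (- ball x0 \<rho>) x * \<bar>v x - m\<bar> powr (p - 1) * sing_kernel \<beta> (x - x0) \<partial>lborel) \<le>
        (c * z powr N * A) powr (p - 1) * \<rho> powr (- \<beta>)" .
    qed
  qed
qed

text \<open>Local boundedness of v and -v turns the excess bound into an initial
  \<open>osc_state\<close> on the half ball. The oscillation step, repeated, gives decay along the
  radii \<sigma>^i r/2, and \<open>excess_bound_shrink\<close> covers the radii in between, as well
  as those above r/2 where no state is available.\<close>

lemma excess_decay:
  fixes p \<beta> C :: real
  assumes p: "p > 1" and \<beta>: "\<beta> > 0" and C: "C > 0"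
  obtains \<alpha> c where "\<alpha> > 0" "c \<ge> 1"
    "\<And>v (x0::'a::euclidean_space) r m A \<rho>. de_giorgi p \<beta> C v x0 r \<Longrightarrow> de_giorgi p \<beta> C (\<lambda>x. - v x) x0 r \<Longrightarrow>
      excess_bound p \<beta> v x0 m A r \<Longrightarrow> A > 0 \<Longrightarrow> 0 < \<rho> \<Longrightarrow> \<rho> \<le> r \<Longrightarrow>
      \<exists>m'. excess_bound p \<beta> v x0 m' (c * (\<rho> / r) powr \<alpha> * A) \<rho>"
proof -
  define n where "n = real DIM('a)"
  define w where "w = unit_ball_vol n"
  have w: "w > 0" by (simp add: w_def n_def)
  note q = q_star_bounds[OF p]
  obtain c0 where c0: "c0 > 0" and c0_le: "\<And>\<rho> (x0::'a). \<rho> > 0 \<Longrightarrow>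
    (\<integral>x. indicator (- ball x0 \<rho>) x * sing_kernel \<beta> (x - x0) \<partial>lborel) \<le> c0 * \<rho> powr (- \<beta>)"
    using that by (rule sing_kernel_far_const[OF \<beta>])
  obtain \<kappa> \<sigma> \<theta> where \<kappa>: "\<kappa> > 0" and \<sigma>: "0 < \<sigma>" "\<sigma> \<le> 1/4" and \<theta>: "0 < \<theta>" "\<theta> \<le> 1/2" and step:
    "\<And>v (x0::'a) R m M \<rho>. de_giorgi p \<beta> C v x0 R \<Longrightarrow> de_giorgi p \<beta> C (\<lambda>x. - v x) x0 R \<Longrightarrow>
      0 < \<rho> \<Longrightarrow> \<rho> \<le> R \<Longrightarrow> M > 0 \<Longrightarrow> osc_state p \<beta> \<kappa> v x0 m M \<rho> \<Longrightarrow>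
      \<exists>m'. osc_state p \<beta> \<kappa> v x0 m' ((1 - \<theta>) * M) (\<sigma> * \<rho>)"
    using that by (rule oscillation_step[OF p \<beta> C])
  obtain cb where cb: "cb > 0" and bd:
    "\<And>v (x0::'a) r m A. de_giorgi p \<beta> C v x0 r \<Longrightarrow> 0 < r \<Longrightarrow> A > 0 \<Longrightarrow> excess_bound p \<beta> v x0 m A r \<Longrightarrow>
      AE x in lborel. x \<in> ball x0 (r / 2) \<longrightarrow> v x \<le> m + cb * A"
    using that by (rule local_boundedness[OF p \<beta> C])
  obtain cz N where cz: "cz \<ge> 1" and N: "N \<ge> 0" and shrink:
    "\<And>v (x0::'a) m A t \<rho>. integrable lborel (\<lambda>x. \<bar>v x\<bar> powr p) \<Longrightarrow> v \<in> borel_measurable borel \<Longrightarrow>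
      excess_bound p \<beta> v x0 m A t \<Longrightarrow> A > 0 \<Longrightarrow> 0 < \<rho> \<Longrightarrow> \<rho> \<le> t \<Longrightarrow> excess_bound p \<beta> v x0 m (cz * (t / \<rho>) powr N * A) \<rho>"
    using that by (rule excess_bound_shrink[OF p \<beta>])
  \<comment> \<open>A multiple of A this large makes the tail on the half ball at most \<kappa>
    M^(p-1), the smallness that the initial state requires; \<open>cb\<close> below is for its sup
    bound.\<close>
  obtain c1 where c1: "c1 \<ge> 1" "\<And>c'. c1 \<le> c' \<Longrightarrow> (2 * w + 1) * 2 powr n / \<kappa> \<le> c' powr (p - 1)"
    using exists_powr_ge_1[of "p - 1" "(2 * w + 1) * 2 powr n / \<kappa>"] p by auto
  define c2 where "c2 = max c1 cb"
  have c2: "c2 \<ge> 1" "cb \<le> c2" "c1 \<le> c2" using c1(1) by (auto simp: c2_def)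
  \<comment> \<open>For the way back: |v - m'| is at most its part above Mi plus Mi, so the full
    tail costs \<kappa> + c0 up to the factor for splitting powers.\<close>
  obtain c3 where c3: "c3 \<ge> 1" "2 powr (p - 1) * (\<kappa> + c0) \<le> c3 powr (p - 1)"
    using exists_powr_ge_1[of "p - 1" "2 powr (p - 1) * (\<kappa> + c0)"] p by (metis diff_gt_0_iff_gt order_refl)
  \<comment> \<open>The exponent with \<sigma>^\<alpha> = 1 - \<theta>, so that the loss of radius
    and the gain in oscillation match.\<close>
  define \<alpha> where "\<alpha> = ln (1 - \<theta>) / ln \<sigma>"
  have \<alpha>: "\<alpha> > 0" unfolding \<alpha>_def using \<theta> \<sigma> by (intro divide_neg_neg) auto
  have \<sigma>\<alpha>: "\<sigma> powr \<alpha> = 1 - \<theta>"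
  proof -
    have "ln \<sigma> \<noteq> 0" using \<sigma> by auto
    then have "\<alpha> * ln \<sigma> = ln (1 - \<theta>)" by (simp add: \<alpha>_def)
    then show ?thesis using \<sigma> \<theta> by (simp add: powr_def)
  qed
  \<comment> \<open>From left to right: shrinking from the radius si to \<rho> (ratio at most
    1/\<sigma>), return from state to excess bound, passage to the initial state, and
    (2/\<sigma>)^\<alpha> for starting at r/2 and rounding \<rho> up to the grid of radii.\<close>
  define c where "c = cz * (1 / \<sigma>) powr N * c3 * c2 * (2 / \<sigma>) powr \<alpha>"
  have big: "(1 / \<sigma>) powr N \<ge> 1" "(2 / \<sigma>) powr \<alpha> \<ge> 2 powr \<alpha>" "(2::real) powr \<alpha> \<ge> 1"
  proof -
    show "(1 / \<sigma>) powr N \<ge> 1" using \<sigma> N by (intro ge_one_powr_ge_zero) auto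
    show "(2 / \<sigma>) powr \<alpha> \<ge> 2 powr \<alpha>" using \<sigma> \<alpha> by (intro powr_mono2) (auto simp: field_simps)
    show "(2::real) powr \<alpha> \<ge> 1" using \<alpha> by (intro ge_one_powr_ge_zero) auto
  qed
  have c_ge: "c \<ge> cz * (1 / \<sigma>) powr N * 1 * 1 * 2 powr \<alpha>"
    unfolding c_def using cz c3 c2 big by (intro mult_mono) auto
  have "cz * (1 / \<sigma>) powr N * 1 * 1 * 2 powr \<alpha> \<ge> 1 * 1 * 1 * 1 * 1"
    using cz big by (intro mult_mono) auto
  then have c_1: "c \<ge> 1" using c_ge by linarith
  show ?thesis
  proof (rule that[OF \<alpha> c_1])
    fix v and x0 :: 'a and r m A \<rho> :: real
    assume dg: "de_giorgi p \<beta> C v x0 r" "de_giorgi p \<beta> C (\<lambda>x. - v x) x0 r"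
      and eb: "excess_bound p \<beta> v x0 m A r" and A: "A > 0" and \<rho>: "0 < \<rho>" "\<rho> \<le> r"
    have v_meas [measurable]: "v \<in> borel_measurable borel" and v: "integrable lborel (\<lambda>x. \<bar>v x\<bar> powr p)"
      using dg by (auto simp: de_giorgi_def)
    have r: "r > 0" using \<rho> by linarith
    show "\<exists>m'. excess_bound p \<beta> v x0 m' (c * (\<rho> / r) powr \<alpha> * A) \<rho>"
    proof (cases "\<rho> \<le> r / 2")
      case False
      have "excess_bound p \<beta> v x0 m (cz * (r / \<rho>) powr N * A) \<rho>" by (rule shrink[OF v v_meas eb A \<rho>])
      moreover have "cz * (r / \<rho>) powr N * A \<le> c * (\<rho> / r) powr \<alpha> * A"
      proof -
        have "r / \<rho> \<le> 1 / \<sigma>"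
        proof -
          have "r / \<rho> \<le> 2" using False \<rho> by (simp add: field_simps)
          also have "2 \<le> 1 / \<sigma>" using \<sigma> by (simp add: field_simps)
          finally show ?thesis .
        qed
        then have 1: "cz * (r / \<rho>) powr N \<le> cz * (1 / \<sigma>) powr N" using cz N r \<rho> by (intro mult_left_mono powr_mono2) auto
        have "(1/2) powr \<alpha> \<le> (\<rho> / r) powr \<alpha>" using False r \<alpha> by (intro powr_mono2) (auto simp: field_simps)
        then have "2 powr \<alpha> * (1/2) powr \<alpha> \<le> 2 powr \<alpha> * (\<rho> / r) powr \<alpha>" by (intro mult_left_mono) auto
        moreover have "2 powr \<alpha> * (1/2 :: real) powr \<alpha> = 1" by (simp add: powr_mult[symmetric])
        ultimately have 2: "1 \<le> 2 powr \<alpha> * (\<rho> / r) powr \<alpha>" by simp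
        have "cz * (1 / \<sigma>) powr N * 1 \<le> cz * (1 / \<sigma>) powr N * (2 powr \<alpha> * (\<rho> / r) powr \<alpha>)"
          using 2 cz by (intro mult_left_mono) auto
        also have "\<dots> = (cz * (1 / \<sigma>) powr N * 1 * 1 * 2 powr \<alpha>) * (\<rho> / r) powr \<alpha>" by simp
        also have "\<dots> \<le> c * (\<rho> / r) powr \<alpha>" using c_ge by (intro mult_right_mono) auto
        finally have "cz * (r / \<rho>) powr N \<le> c * (\<rho> / r) powr \<alpha>" using 1 by linarith
        then show ?thesis using A by (intro mult_right_mono) auto
      qed
      moreover have "0 \<le> cz * (r / \<rho>) powr N * A" using cz A by simp
      ultimately show ?thesis using excess_bound_mono[OF p] by blast
    next
      case True
      define s where "s = r / 2"
      have s: "0 < s" "s \<le> r" "\<rho> \<le> s" using r True by (auto simp: s_def)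
      define M where "M = c2 * A"
      have M: "M > 0" using c2 A by (simp add: M_def)
      have st0: "osc_state p \<beta> \<kappa> v x0 m M s"
        unfolding osc_state_def
      proof
        have "cb * A \<le> M" using c2 A by (simp add: M_def)
        moreover have "AE x in lborel. x \<in> ball x0 s \<longrightarrow> v x \<le> m + cb * A"
          unfolding s_def by (rule bd[OF dg(1) r A eb])
        moreover have "AE x in lborel. x \<in> ball x0 s \<longrightarrow> - v x \<le> - m + cb * A"
          unfolding s_def by (rule bd[OF dg(2) r A excess_bound_uminus[OF eb]])
        ultimately show "AE x in lborel. x \<in> ball x0 s \<longrightarrow> \<bar>v x - m\<bar> \<le> M"
          by (auto elim!: eventually_elim2 simp: abs_le_iff)
        have "(\<integral>x. indicator (- ball x0 s) x * max 0 (\<bar>v x - m\<bar> - M) powr (p - 1) * sing_kernel \<beta> (x - x0) \<partial>lborel) \<le>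
          (\<integral>x. indicator (- ball x0 s) x * \<bar>v x - m\<bar> powr (p - 1) * sing_kernel \<beta> (x - x0) \<partial>lborel)"
        proof (rule integral_mono')
          show "integrable lborel (\<lambda>x. indicator (- ball x0 s) x * \<bar>v x - m\<bar> powr (p - 1) * sing_kernel \<beta> (x - x0))"
            using p \<beta> s by (intro osc_tail_integrable[OF v v_meas p]) auto
          fix x
          show "indicator (- ball x0 s) x * max 0 (\<bar>v x - m\<bar> - M) powr (p - 1) * sing_kernel \<beta> (x - x0) \<le>
            indicator (- ball x0 s) x * \<bar>v x - m\<bar> powr (p - 1) * sing_kernel \<beta> (x - x0)"
            using p M by (intro mult_right_mono mult_left_mono powr_mono2) auto
        qed auto
        also have "\<dots> \<le> A powr (p - 1) * ((2 * w + 1) * (r powr n * s powr (- (n + \<beta>))))"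
          using excess_bound_tail[OF v v_meas p eb A \<beta> s(1,2)] by (simp add: n_def w_def)
        also have "r powr n * s powr (- (n + \<beta>)) = 2 powr n * s powr (- \<beta>)"
        proof -
          have "r powr n = 2 powr n * s powr n" using r by (simp add: s_def powr_divide)
          moreover have "s powr n * s powr (- (n + \<beta>)) = s powr (- \<beta>)" by (simp add: powr_add[symmetric])
          ultimately show ?thesis by (simp only: mult.assoc)
        qed
        also have "A powr (p - 1) * ((2 * w + 1) * (2 powr n * s powr (- \<beta>))) =
            \<kappa> * ((2 * w + 1) * 2 powr n / \<kappa> * A powr (p - 1)) * s powr (- \<beta>)" using \<kappa> by simp
        also have "\<dots> \<le> \<kappa> * (c2 powr (p - 1) * A powr (p - 1)) * s powr (- \<beta>)"
          using c1(2)[OF c2(3)] \<kappa> by (intro mult_right_mono mult_left_mono) auto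
        also have "c2 powr (p - 1) * A powr (p - 1) = M powr (p - 1)" using c2 A by (simp add: M_def powr_mult)
        finally show "(\<integral>x. indicator (- ball x0 s) x * max 0 (\<bar>v x - m\<bar> - M) powr (p - 1) * sing_kernel \<beta> (x - x0) \<partial>lborel)
            \<le> \<kappa> * M powr (p - 1) * s powr (- \<beta>)" .
      qed
      have iter: "\<exists>m'. osc_state p \<beta> \<kappa> v x0 m' ((1 - \<theta>) ^ i * M) (\<sigma> ^ i * s)" for i
      proof (induction i)
        case 0 then show ?case using st0 by auto
      next
        case (Suc i)
        then obtain m' where m': "osc_state p \<beta> \<kappa> v x0 m' ((1 - \<theta>) ^ i * M) (\<sigma> ^ i * s)" by blast
        have "\<sigma> ^ i * s \<le> 1 * r" using s \<sigma> by (intro mult_mono power_le_one) auto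
        then have "\<exists>m''. osc_state p \<beta> \<kappa> v x0 m'' ((1 - \<theta>) * ((1 - \<theta>) ^ i * M)) (\<sigma> * (\<sigma> ^ i * s))"
          using \<sigma> s \<theta> M by (intro step[OF dg _ _ _ m']) auto
        then show ?case by (simp add: mult.assoc)
      qed
      define t where "t = \<rho> / s"
      have t: "0 < t" "t \<le> 1" using \<rho> s by (auto simp: t_def)
      \<comment> \<open>Locates \<rho> between two consecutive radii of the iteration; the least
        index with \<sigma>^(i+1) < t works, and for i = 0 the upper bound is t \<le> 1.\<close>
      have "\<exists>i. \<sigma> ^ Suc i < t \<and> t \<le> \<sigma> ^ i"
      proof -
        obtain k where k: "\<sigma> ^ k < t" using real_arch_pow_inv[of t \<sigma>] t \<sigma> by auto
        have "\<sigma> ^ Suc k < t"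
        proof -
          have "\<sigma> * \<sigma> ^ k \<le> 1 * \<sigma> ^ k" using \<sigma> by (intro mult_right_mono) auto
          then show ?thesis using k by simp
        qed
        define i where "i = (LEAST i. \<sigma> ^ Suc i < t)"
        have i: "\<sigma> ^ Suc i < t" unfolding i_def by (rule LeastI) fact
        have "t \<le> \<sigma> ^ i"
        proof (cases i)
          case (Suc j)
          then have "\<not> \<sigma> ^ Suc j < t" using not_less_Least[of j "\<lambda>i. \<sigma> ^ Suc i < t"] by (simp add: i_def)
          then show ?thesis using Suc by simp
        qed (use t in simp)
        with i show ?thesis by blast
      qed
      then obtain i where i: "\<sigma> ^ Suc i < t" "t \<le> \<sigma> ^ i" by blast
      obtain m' where m': "osc_state p \<beta> \<kappa> v x0 m' ((1 - \<theta>) ^ i * M) (\<sigma> ^ i * s)" using iter by blast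
      define Mi where "Mi = (1 - \<theta>) ^ i * M"
      define si where "si = \<sigma> ^ i * s"
      have Mi: "Mi > 0" using \<theta> M by (simp add: Mi_def)
      have si: "si > 0" "\<rho> \<le> si" "si / \<rho> \<le> 1 / \<sigma>"
      proof -
        show "si > 0" using \<sigma> s by (simp add: si_def)
        show "\<rho> \<le> si" using i s by (simp add: t_def si_def field_simps)
        have "\<sigma> * si \<le> \<rho>" using i(1) s by (simp add: t_def si_def field_simps)
        then show "si / \<rho> \<le> 1 / \<sigma>" using \<rho> \<sigma> by (simp add: field_simps)
      qed
      have st: "osc_state p \<beta> \<kappa> v x0 m' Mi si" using m' by (simp add: Mi_def si_def)
      have ebi: "excess_bound p \<beta> v x0 m' (c3 * Mi) si"
        unfolding excess_bound_def
      proof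
        have ae: "AE x in lborel. x \<in> ball x0 si \<longrightarrow> \<bar>v x - m'\<bar> \<le> Mi" using st by (simp add: osc_state_def)
        have "(\<integral>x. indicator (ball x0 si) x * \<bar>v x - m'\<bar> powr q_star p \<partial>lborel) \<le>
          (\<integral>x. (c3 * Mi) powr q_star p * indicator (ball x0 si) x \<partial>lborel)"
        proof (rule integral_mono_AE)
          show "AE x in lborel. indicator (ball x0 si) x * \<bar>v x - m'\<bar> powr q_star p \<le> (c3 * Mi) powr q_star p * indicator (ball x0 si) x"
            using ae
          proof eventually_elim
            fix x assume x: "x \<in> ball x0 si \<longrightarrow> \<bar>v x - m'\<bar> \<le> Mi"
            have "1 * Mi \<le> c3 * Mi" using c3 Mi by (intro mult_right_mono) auto
            then show "indicator (ball x0 si) x * \<bar>v x - m'\<bar> powr q_star p \<le> (c3 * Mi) powr q_star p * indicator (ball x0 si) x"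
              using x q by (cases "x \<in> ball x0 si") (auto intro!: powr_mono2)
          qed
        qed (use q osc_integrable[OF v v_meas p] ball_indicator_integrable[OF v v_meas p] in auto)
        then show "(\<integral>x. indicator (ball x0 si) x * \<bar>v x - m'\<bar> powr q_star p \<partial>lborel) \<le>
          (c3 * Mi) powr q_star p * measure lborel (ball x0 si)" by simp
        have "(\<integral>x. indicator (- ball x0 si) x * \<bar>v x - m'\<bar> powr (p - 1) * sing_kernel \<beta> (x - x0) \<partial>lborel) \<le>
          2 powr (p - 1) * (\<kappa> * Mi powr (p - 1) * si powr (- \<beta>) + Mi powr (p - 1) * (c0 * si powr (- \<beta>)))"
          using Mi si by (intro osc_state_tail_le[OF v v_meas p \<beta> st] c0_le) auto
        also have "\<dots> = 2 powr (p - 1) * (\<kappa> + c0) * (Mi powr (p - 1) * si powr (- \<beta>))" by (simp add: algebra_simps)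
        also have "\<dots> \<le> c3 powr (p - 1) * (Mi powr (p - 1) * si powr (- \<beta>))" using c3 by (intro mult_right_mono) auto
        also have "\<dots> = (c3 * Mi) powr (p - 1) * si powr (- \<beta>)" using c3 Mi by (simp add: powr_mult)
        finally show "(\<integral>x. indicator (- ball x0 si) x * \<bar>v x - m'\<bar> powr (p - 1) * sing_kernel \<beta> (x - x0) \<partial>lborel) \<le>
          (c3 * Mi) powr (p - 1) * si powr (- \<beta>)" .
      qed
      have c3Mi: "c3 * Mi > 0" using c3 Mi by simp
      have "excess_bound p \<beta> v x0 m' (cz * (si / \<rho>) powr N * (c3 * Mi)) \<rho>"
        by (rule shrink[OF v v_meas ebi c3Mi \<rho>(1) si(2)])
      moreover have "cz * (si / \<rho>) powr N * (c3 * Mi) \<le> c * (\<rho> / r) powr \<alpha> * A"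
      proof -
        have "(1 - \<theta>) ^ i = (\<sigma> ^ i) powr \<alpha>" using \<sigma> by (simp add: power_powr_swap \<sigma>\<alpha>)
        also have "\<dots> \<le> ((2 / \<sigma>) * (\<rho> / r)) powr \<alpha>"
        proof (intro powr_mono2)
          have "\<sigma> * \<sigma> ^ i \<le> 2 * \<rho> / r" using i(1) by (simp add: t_def s_def mult.commute)
          then have "\<sigma> * \<sigma> ^ i / \<sigma> \<le> 2 * \<rho> / r / \<sigma>" using \<sigma> by (intro divide_right_mono) auto
          then show "\<sigma> ^ i \<le> (2 / \<sigma>) * (\<rho> / r)" using \<sigma> by (simp add: mult.commute)
        qed (use \<alpha> \<sigma> in auto)
        also have "\<dots> = (2 / \<sigma>) powr \<alpha> * (\<rho> / r) powr \<alpha>" using \<sigma> \<rho> r by (simp only: powr_mult)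
        finally have "c3 * ((1 - \<theta>) ^ i * (c2 * A)) \<le> c3 * ((2 / \<sigma>) powr \<alpha> * (\<rho> / r) powr \<alpha> * (c2 * A))"
          using c3 c2 A by (intro mult_left_mono mult_right_mono) auto
        then have x: "c3 * Mi \<le> c3 * ((2 / \<sigma>) powr \<alpha> * (\<rho> / r) powr \<alpha> * (c2 * A))" by (simp add: Mi_def M_def)
        have "(si / \<rho>) powr N \<le> (1 / \<sigma>) powr N" using si N \<rho> by (intro powr_mono2) auto
        then have y: "cz * (si / \<rho>) powr N \<le> cz * (1 / \<sigma>) powr N" using cz by (intro mult_left_mono) auto
        have "cz * (si / \<rho>) powr N * (c3 * Mi) \<le> cz * (1 / \<sigma>) powr N * (c3 * ((2 / \<sigma>) powr \<alpha> * (\<rho> / r) powr \<alpha> * (c2 * A)))"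
          using cz c3Mi by (intro mult_mono[OF y x]) auto
        also have "\<dots> = c * (\<rho> / r) powr \<alpha> * A" by (simp add: c_def mult_ac)
        finally show ?thesis .
      qed
      moreover have "0 \<le> cz * (si / \<rho>) powr N * (c3 * Mi)" using cz c3Mi by simp
      ultimately show ?thesis using excess_bound_mono[OF p] by blast
    qed
  qed
qed

section \<open>Decay of the excess\<close>

lemma borel_measurable_lebesgue_cong_AE:
  fixes f g :: "'a::euclidean_space \<Rightarrow> real"
  assumes f: "f \<in> borel_measurable lebesgue" and ae: "AE x in lborel. f x = g x"
  shows "g \<in> borel_measurable lebesgue"
proof (rule measurableI)
  fix S :: "real set" assume S: "S \<in> sets borel"
  show "g -` S \<inter> space lebesgue \<in> sets lebesgue"
  proof (rule completion.in_sets_AE)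
    show "f -` S \<inter> space lebesgue \<in> sets lebesgue" using f S by (rule measurable_sets)
    have "AE x in lebesgue. f x = g x" using ae by (rule AE_completion)
    then show "AE x in lebesgue. (x \<in> f -` S \<inter> space lebesgue) = (x \<in> g -` S \<inter> space lebesgue)"
      by eventually_elim auto
  qed auto
qed auto

text \<open>Completeness of \<open>lebesgue\<close> makes f measurable as soon as it agrees almost
  everywhere with a Borel function. This is how the statement, phrased with Lebesgue measure, is
  moved to \<open>lborel\<close>, where Fubini and the measurability automation work.\<close>

lemma lebesgue_integral_eq_lborel:
  fixes f g :: "'a::euclidean_space \<Rightarrow> real"
  assumes g: "g \<in> borel_measurable borel" and ae: "AE x in lborel. f x = g x"
  shows "integral\<^sup>L lebesgue f = integral\<^sup>L lborel g" "integrable lebesgue f \<longleftrightarrow> integrable lborel g"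
proof -
  have g': "g \<in> borel_measurable lebesgue" using g by (intro measurable_completion) auto
  have "AE x in lborel. g x = f x" using ae by eventually_elim simp
  then have f: "f \<in> borel_measurable lebesgue" using g' by (rule borel_measurable_lebesgue_cong_AE[rotated])
  have ae': "AE x in lebesgue. f x = g x" using ae by (rule AE_completion)
  show "integral\<^sup>L lebesgue f = integral\<^sup>L lborel g"
    using integral_cong_AE[OF f g' ae'] g by (simp add: integral_completion)
  show "integrable lebesgue f \<longleftrightarrow> integrable lborel g"
    using integrable_cong_AE[OF f g' ae'] g by (simp add: integrable_completion)
qed

lemma AE_lborel_prod:
  fixes P :: "'a::euclidean_space \<Rightarrow> bool"
  assumes "AE x in lborel. P x"
  shows "AE z in lborel. P (fst z :: 'a) \<and> P (snd z :: 'a)"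
proof -
  obtain N where N: "{x. \<not> P x} \<subseteq> N" "N \<in> sets lborel" "emeasure lborel N = 0"
    using AE_E[OF assms] by auto
  have "emeasure (lborel \<Otimes>\<^sub>M lborel) (N \<times> (UNIV :: 'a set)) = emeasure lborel N * emeasure lborel (UNIV :: 'a set)"
    using N by (intro lborel.emeasure_pair_measure_Times) auto
  then have 1: "emeasure lborel (N \<times> (UNIV :: 'a set)) = 0" using N by (simp add: lborel_prod)
  have "emeasure (lborel \<Otimes>\<^sub>M lborel) ((UNIV :: 'a set) \<times> N) = emeasure lborel (UNIV :: 'a set) * emeasure lborel N"
    using N by (intro lborel.emeasure_pair_measure_Times) auto
  then have 2: "emeasure lborel ((UNIV :: 'a set) \<times> N) = 0" using N by (simp add: lborel_prod)
  have m: "N \<times> (UNIV :: 'a set) \<in> sets lborel" "(UNIV :: 'a set) \<times> N \<in> sets lborel"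
    using N by (auto simp: borel_prod[symmetric] intro!: pair_measureI)
  have "AE z in lborel. z \<notin> N \<times> (UNIV :: 'a set)" "AE z in lborel. z \<notin> (UNIV :: 'a set) \<times> N"
    using 1 2 m by (auto intro!: AE_not_in simp: null_sets_def)
  then show ?thesis by eventually_elim (use N in auto)
qed

text \<open>The excess of a Borel representative, with set integrals written as indicators and
  \<open>lebesgue\<close> replaced by \<open>lborel\<close>, so that its measurability in r becomes
  accessible.\<close>

definition borel_excess :: "real \<Rightarrow> real \<Rightarrow> ('a::euclidean_space \<Rightarrow> real) \<Rightarrow> 'a \<Rightarrow> real \<Rightarrow> real" where
  "borel_excess p \<beta> v x0 r =
    (let m = (\<integral>x. indicator (ball x0 r) x * v x \<partial>lborel) / measure lborel (ball x0 r) in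
      ((\<integral>x. indicator (ball x0 r) x * \<bar>v x - m\<bar> powr q_star p \<partial>lborel) / measure lborel (ball x0 r)) powr (1 / q_star p) +
      (r powr \<beta> * (\<integral>x. indicator (- ball x0 r) x * \<bar>v x - m\<bar> powr (p - 1) * sing_kernel \<beta> (x - x0) \<partial>lborel)) powr (1 / (p - 1)))"

lemma borel_excess_nonneg: "borel_excess p \<beta> v x0 r \<ge> 0"
  by (simp add: borel_excess_def Let_def)

lemma excess_eq_borel_excess:
  fixes v v' :: "real^'n \<Rightarrow> real"
  assumes [measurable]: "v' \<in> borel_measurable borel" and ae: "AE x in lborel. v x = v' x"
  shows "excess s p v x0 r = borel_excess p (s * p) v' x0 r"
proof -
  have B: "measure lebesgue (ball x0 r) = measure lborel (ball x0 r)" by simp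
  have a: "average v (ball x0 r) = (\<integral>x. indicator (ball x0 r) x * v' x \<partial>lborel) / measure lborel (ball x0 r)"
    unfolding average_def set_lebesgue_integral_def B
    by (subst lebesgue_integral_eq_lborel(1)[where g = "\<lambda>x. indicator (ball x0 r) x * v' x"])
       (use ae in \<open>auto elim!: eventually_mono\<close>)
  have b: "average (\<lambda>x. \<bar>v x - m\<bar> powr e) (ball x0 r) =
      (\<integral>x. indicator (ball x0 r) x * \<bar>v' x - m\<bar> powr e \<partial>lborel) / measure lborel (ball x0 r)" for m e
    unfolding average_def set_lebesgue_integral_def B
    by (subst lebesgue_integral_eq_lborel(1)[where g = "\<lambda>x. indicator (ball x0 r) x * \<bar>v' x - m\<bar> powr e"])
       (use ae in \<open>auto elim!: eventually_mono\<close>)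
  have k: "t / norm z powr (real CARD('n) + s * p) = t * sing_kernel (s * p) z" for t and z :: "real^'n"
    by (simp add: sing_kernel_def powr_minus divide_inverse del: minus_add_distrib)
  have c: "Tail s p (\<lambda>x. v x - m) x0 r =
      (r powr (s * p) * (\<integral>x. indicator (- ball x0 r) x * \<bar>v' x - m\<bar> powr (p - 1) * sing_kernel (s * p) (x - x0) \<partial>lborel)) powr (1 / (p - 1))" for m
    unfolding Tail_def set_lebesgue_integral_def k
    by (subst lebesgue_integral_eq_lborel(1)[where g = "\<lambda>x. indicator (- ball x0 r) x * \<bar>v' x - m\<bar> powr (p - 1) * sing_kernel (s * p) (x - x0)"])
       (use ae in \<open>auto elim!: eventually_mono\<close>)
  show ?thesis unfolding excess_def borel_excess_def Let_def a b c ..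
qed

lemma excess_bound_of_borel_excess:
  fixes v :: "'a::euclidean_space \<Rightarrow> real"
  assumes p: "p > 1" and r: "r > 0" and A: "borel_excess p \<beta> v x0 r \<le> A"
  obtains m where "excess_bound p \<beta> v x0 m A r"
proof -
  note q = q_star_bounds[OF p]
  define V where "V = measure lborel (ball x0 r)"
  have V: "V > 0" using r by (simp add: V_def content_ball_pos)
  define m where "m = (\<integral>x. indicator (ball x0 r) x * v x \<partial>lborel) / V"
  define X where "X = (\<integral>x. indicator (ball x0 r) x * \<bar>v x - m\<bar> powr q_star p \<partial>lborel)"
  define Y where "Y = (\<integral>x. indicator (- ball x0 r) x * \<bar>v x - m\<bar> powr (p - 1) * sing_kernel \<beta> (x - x0) \<partial>lborel)"
  have X0: "X \<ge> 0" and Y0: "Y \<ge> 0" unfolding X_def Y_def by (auto intro!: integral_nonneg_AE)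
  have "(X / V) powr (1 / q_star p) + (r powr \<beta> * Y) powr (1 / (p - 1)) \<le> A"
    using A by (simp add: borel_excess_def Let_def V_def m_def X_def Y_def)
  then have 1: "(X / V) powr (1 / q_star p) \<le> A" "(r powr \<beta> * Y) powr (1 / (p - 1)) \<le> A"
    by (smt (verit) powr_ge_zero)+
  have "X / V = ((X / V) powr (1 / q_star p)) powr q_star p" using q X0 V by (simp add: powr_powr)
  also have "\<dots> \<le> A powr q_star p" using 1 q by (intro powr_mono2) auto
  finally have "X \<le> A powr q_star p * V" using V by (simp add: divide_le_eq)
  moreover have "Y \<le> A powr (p - 1) * r powr (- \<beta>)"
  proof -
    have "r powr \<beta> * Y = ((r powr \<beta> * Y) powr (1 / (p - 1))) powr (p - 1)" using p Y0 by (simp add: powr_powr)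
    also have "\<dots> \<le> A powr (p - 1)" using 1 p by (intro powr_mono2) auto
    finally have "r powr \<beta> * Y * r powr (- \<beta>) \<le> A powr (p - 1) * r powr (- \<beta>)" by (intro mult_right_mono) auto
    then show ?thesis using r by (simp add: powr_minus field_simps)
  qed
  ultimately show ?thesis using that[of m] by (simp add: excess_bound_def X_def Y_def V_def)
qed

text \<open>Replacing an arbitrary centre m' by the average costs only a constant: the average
  differs from m' by at most the mean of |v - m'|, hence by at most 2 A, and constants have tail of
  order r^(-\<beta>).\<close>

lemma borel_excess_le:
  fixes p \<beta> :: real
  assumes p: "p > 1" and \<beta>: "\<beta> > 0"
  obtains c where "c > 0"
    "\<And>v (x0::'a::euclidean_space) m A r. integrable lborel (\<lambda>x. \<bar>v x\<bar> powr p) \<Longrightarrow> v \<in> borel_measurable borel \<Longrightarrow>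
      excess_bound p \<beta> v x0 m A r \<Longrightarrow> A > 0 \<Longrightarrow> r > 0 \<Longrightarrow> borel_excess p \<beta> v x0 r \<le> c * A"
proof -
  note q = q_star_bounds[OF p]
  obtain c0 where c0: "c0 > 0" and c0_le: "\<And>\<rho> (x0::'a). \<rho> > 0 \<Longrightarrow>
    (\<integral>x. indicator (- ball x0 \<rho>) x * sing_kernel \<beta> (x - x0) \<partial>lborel) \<le> c0 * \<rho> powr (- \<beta>)"
    using that by (rule sing_kernel_far_const[OF \<beta>])
  define c1 where "c1 = 2 powr q_star p * (1 + 2 powr q_star p)"
  define c2 where "c2 = 2 powr (p - 1) * (1 + 2 powr (p - 1) * c0)"
  have c12: "c1 > 0" "c2 > 0" using c0 by (auto simp: c1_def c2_def add_pos_pos)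
  show ?thesis
  proof (rule that)
    show "c1 powr (1 / q_star p) + c2 powr (1 / (p - 1)) > 0" using c12 by (simp add: add_pos_pos)
    fix v and x0 :: 'a and m' A r :: real
    assume v: "integrable lborel (\<lambda>x. \<bar>v x\<bar> powr p)" and v_meas [measurable]: "v \<in> borel_measurable borel"
      and eb: "excess_bound p \<beta> v x0 m' A r" and A: "A > 0" and r: "r > 0"
    define V where "V = measure lborel (ball x0 r)"
    have V: "V > 0" using r by (simp add: V_def content_ball_pos)
    define m where "m = (\<integral>x. indicator (ball x0 r) x * v x \<partial>lborel) / V"
    have B: "integrable lborel (indicator (ball x0 r) :: 'a \<Rightarrow> real)" by (rule ball_indicator_integrable[OF v v_meas p])
    have vI: "integrable lborel (\<lambda>x. indicator (ball x0 r) x * v x)"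
    proof -
      have "integrable lborel (\<lambda>x. \<bar>indicator (ball x0 r) x * v x\<bar>)"
        using osc_integrable[OF v v_meas p, of 1 x0 r 0] p by (simp add: abs_mult)
      then show ?thesis by (subst (asm) integrable_abs_iff) auto
    qed
    have mm: "\<bar>m - m'\<bar> \<le> 2 * A"
    proof -
      have "m - m' = (\<integral>x. indicator (ball x0 r) x * (v x - m') \<partial>lborel) / V"
        using vI B V by (simp add: m_def right_diff_distrib V_def field_simps)
      then have "\<bar>m - m'\<bar> = \<bar>\<integral>x. indicator (ball x0 r) x * (v x - m') \<partial>lborel\<bar> / V" using V by (simp add: abs_divide)
      also have "\<dots> \<le> (\<integral>x. \<bar>indicator (ball x0 r) x * (v x - m')\<bar> \<partial>lborel) / V"
        using V by (intro divide_right_mono integral_abs_bound) auto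
      also have "(\<integral>x. \<bar>indicator (ball x0 r) x * (v x - m')\<bar> \<partial>lborel) = (\<integral>x. indicator (ball x0 r) x * \<bar>v x - m'\<bar> powr 1 \<partial>lborel)"
        by (simp add: abs_mult)
      also have "\<dots> \<le> 2 * A powr 1 * V"
        unfolding V_def using q by (intro excess_bound_power_mean[OF v v_meas p eb A]) auto
      finally show ?thesis using V A by (simp add: divide_right_mono)
    qed
    have sum: "\<bar>v x - m\<bar> powr e \<le> 2 powr e * (\<bar>v x - m'\<bar> powr e + (2 * A) powr e)" if "e \<ge> 0" for x e
    proof -
      have "\<bar>v x - m\<bar> \<le> \<bar>v x - m'\<bar> + 2 * A" using mm by linarith
      then have "\<bar>v x - m\<bar> powr e \<le> (\<bar>v x - m'\<bar> + 2 * A) powr e" using that by (intro powr_mono2) auto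
      also have "\<dots> \<le> 2 powr e * (\<bar>v x - m'\<bar> powr e + (2 * A) powr e)" using that A by (intro powr_add_le) auto
      finally show ?thesis .
    qed
    have t1: "((\<integral>x. indicator (ball x0 r) x * \<bar>v x - m\<bar> powr q_star p \<partial>lborel) / V) powr (1 / q_star p) \<le> c1 powr (1 / q_star p) * A"
    proof -
      have i: "integrable lborel (\<lambda>x. indicator (ball x0 r) x * \<bar>v x - m'\<bar> powr q_star p)"
        using q by (intro osc_integrable[OF v v_meas p]) auto
      have "(\<integral>x. indicator (ball x0 r) x * \<bar>v x - m\<bar> powr q_star p \<partial>lborel) \<le>
        (\<integral>x. 2 powr q_star p * (indicator (ball x0 r) x * \<bar>v x - m'\<bar> powr q_star p) +
          2 powr q_star p * (2 * A) powr q_star p * indicator (ball x0 r) x \<partial>lborel)"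
      proof (rule integral_mono')
        show "integrable lborel (\<lambda>x. 2 powr q_star p * (indicator (ball x0 r) x * \<bar>v x - m'\<bar> powr q_star p) +
          2 powr q_star p * (2 * A) powr q_star p * indicator (ball x0 r) x)"
          using i B by (intro Bochner_Integration.integrable_add integrable_mult_right)
        fix x
        show "indicator (ball x0 r) x * \<bar>v x - m\<bar> powr q_star p \<le> 2 powr q_star p * (indicator (ball x0 r) x * \<bar>v x - m'\<bar> powr q_star p) +
          2 powr q_star p * (2 * A) powr q_star p * indicator (ball x0 r) x"
          using sum[of "q_star p" x] q by (simp add: indicator_def algebra_simps)
      qed auto
      also have "\<dots> = 2 powr q_star p * (\<integral>x. indicator (ball x0 r) x * \<bar>v x - m'\<bar> powr q_star p \<partial>lborel) +
          2 powr q_star p * (2 * A) powr q_star p * V"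
        using i B by (simp add: Bochner_Integration.integral_add V_def)
      also have "\<dots> \<le> 2 powr q_star p * (A powr q_star p * V) + 2 powr q_star p * (2 * A) powr q_star p * V"
        using eb unfolding excess_bound_def V_def by (intro add_right_mono mult_left_mono) auto
      also have "\<dots> = c1 * A powr q_star p * V" using A by (simp add: c1_def powr_mult algebra_simps)
      finally have "(\<integral>x. indicator (ball x0 r) x * \<bar>v x - m\<bar> powr q_star p \<partial>lborel) / V \<le> c1 * A powr q_star p"
        using V by (simp add: divide_le_eq)
      then have "((\<integral>x. indicator (ball x0 r) x * \<bar>v x - m\<bar> powr q_star p \<partial>lborel) / V) powr (1 / q_star p) \<le>
          (c1 * A powr q_star p) powr (1 / q_star p)"
        using q V by (intro powr_mono2) (auto intro!: divide_nonneg_nonneg integral_nonneg_AE)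
      also have "\<dots> = c1 powr (1 / q_star p) * A" using c12 A q by (simp add: powr_mult powr_powr)
      finally show ?thesis .
    qed
    have t2: "(r powr \<beta> * (\<integral>x. indicator (- ball x0 r) x * \<bar>v x - m\<bar> powr (p - 1) * sing_kernel \<beta> (x - x0) \<partial>lborel)) powr (1 / (p - 1)) \<le> c2 powr (1 / (p - 1)) * A"
    proof -
      have i: "integrable lborel (\<lambda>x. indicator (- ball x0 r) x * \<bar>v x - m'\<bar> powr (p - 1) * sing_kernel \<beta> (x - x0))"
        using p \<beta> r by (intro osc_tail_integrable[OF v v_meas p]) auto
      have j: "integrable lborel (\<lambda>x. indicator (- ball x0 r) x * sing_kernel \<beta> (x - x0))"
        by (rule integrable_sing_kernel_far(1)[OF \<beta> r])
      have "(\<integral>x. indicator (- ball x0 r) x * \<bar>v x - m\<bar> powr (p - 1) * sing_kernel \<beta> (x - x0) \<partial>lborel) \<le>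
        (\<integral>x. 2 powr (p - 1) * (indicator (- ball x0 r) x * \<bar>v x - m'\<bar> powr (p - 1) * sing_kernel \<beta> (x - x0)) +
          2 powr (p - 1) * (2 * A) powr (p - 1) * (indicator (- ball x0 r) x * sing_kernel \<beta> (x - x0)) \<partial>lborel)"
      proof (rule integral_mono')
        show "integrable lborel (\<lambda>x. 2 powr (p - 1) * (indicator (- ball x0 r) x * \<bar>v x - m'\<bar> powr (p - 1) * sing_kernel \<beta> (x - x0)) +
          2 powr (p - 1) * (2 * A) powr (p - 1) * (indicator (- ball x0 r) x * sing_kernel \<beta> (x - x0)))"
          using i j by (intro Bochner_Integration.integrable_add integrable_mult_right)
        fix x
        have "indicator (- ball x0 r) x * \<bar>v x - m\<bar> powr (p - 1) * sing_kernel \<beta> (x - x0) \<le>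
          indicator (- ball x0 r) x * (2 powr (p - 1) * (\<bar>v x - m'\<bar> powr (p - 1) + (2 * A) powr (p - 1))) * sing_kernel \<beta> (x - x0)"
          using p by (intro mult_right_mono mult_left_mono sum) auto
        then show "indicator (- ball x0 r) x * \<bar>v x - m\<bar> powr (p - 1) * sing_kernel \<beta> (x - x0) \<le>
          2 powr (p - 1) * (indicator (- ball x0 r) x * \<bar>v x - m'\<bar> powr (p - 1) * sing_kernel \<beta> (x - x0)) +
          2 powr (p - 1) * (2 * A) powr (p - 1) * (indicator (- ball x0 r) x * sing_kernel \<beta> (x - x0))"
          by (simp add: algebra_simps)
      qed auto
      also have "\<dots> = 2 powr (p - 1) * (\<integral>x. indicator (- ball x0 r) x * \<bar>v x - m'\<bar> powr (p - 1) * sing_kernel \<beta> (x - x0) \<partial>lborel) +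
          2 powr (p - 1) * (2 * A) powr (p - 1) * (\<integral>x. indicator (- ball x0 r) x * sing_kernel \<beta> (x - x0) \<partial>lborel)"
        using i j by (simp add: Bochner_Integration.integral_add)
      also have "\<dots> \<le> 2 powr (p - 1) * (A powr (p - 1) * r powr (- \<beta>)) + 2 powr (p - 1) * (2 * A) powr (p - 1) * (c0 * r powr (- \<beta>))"
        using eb c0_le[OF r] unfolding excess_bound_def by (intro add_mono mult_left_mono) auto
      also have "\<dots> = c2 * A powr (p - 1) * r powr (- \<beta>)" using A by (simp add: c2_def powr_mult algebra_simps)
      finally have "r powr \<beta> * (\<integral>x. indicator (- ball x0 r) x * \<bar>v x - m\<bar> powr (p - 1) * sing_kernel \<beta> (x - x0) \<partial>lborel) \<le>
          r powr \<beta> * (c2 * A powr (p - 1) * r powr (- \<beta>))" by (intro mult_left_mono) auto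
      also have "\<dots> = c2 * A powr (p - 1)" using r by (simp add: powr_minus)
      finally have "(r powr \<beta> * (\<integral>x. indicator (- ball x0 r) x * \<bar>v x - m\<bar> powr (p - 1) * sing_kernel \<beta> (x - x0) \<partial>lborel)) powr (1 / (p - 1)) \<le>
          (c2 * A powr (p - 1)) powr (1 / (p - 1))"
        using p by (intro powr_mono2) (auto intro!: mult_nonneg_nonneg integral_nonneg_AE)
      also have "\<dots> = c2 powr (1 / (p - 1)) * A" using c12 A p by (simp add: powr_mult powr_powr)
      finally show ?thesis .
    qed
    show "borel_excess p \<beta> v x0 r \<le> (c1 powr (1 / q_star p) + c2 powr (1 / (p - 1))) * A"
      using add_mono[OF t1 t2] by (simp add: borel_excess_def Let_def m_def V_def distrib_right)
  qed
qed

text \<open>The radius appears in the domain of integration. Writing the indicators as conditions on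
  \<open>dist x0 x < r\<close> makes the integrands jointly measurable in (r, x). The measurability
  is wanted for the integral over t in the final estimate.\<close>

lemma borel_measurable_borel_excess [measurable]:
  fixes v :: "'a::euclidean_space \<Rightarrow> real"
  assumes [measurable]: "v \<in> borel_measurable borel"
  shows "borel_excess p \<beta> v x0 \<in> borel_measurable borel"
proof -
  have i: "indicator (ball x0 r) x = (if dist x0 x < r then 1 else 0 :: real)"
    "indicator (- ball x0 r) x = (if dist x0 x < r then 0 else 1 :: real)" for r x
    by (auto simp: indicator_def)
  define V where "V r = (\<integral>x. indicator (ball x0 r) x \<partial>lborel :: real)" for r
  have V: "measure lborel (ball x0 r) = V r" for r by (simp add: V_def)
  have [measurable]: "V \<in> borel_measurable borel" unfolding V_def[abs_def] i by measurable
  define m where "m r = (\<integral>x. indicator (ball x0 r) x * v x \<partial>lborel) / V r" for r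
  have [measurable]: "m \<in> borel_measurable borel" unfolding m_def[abs_def] i by measurable
  have "(\<lambda>r. ((\<integral>x. indicator (ball x0 r) x * \<bar>v x - m r\<bar> powr q_star p \<partial>lborel) / V r) powr (1 / q_star p) +
      (r powr \<beta> * (\<integral>x. indicator (- ball x0 r) x * \<bar>v x - m r\<bar> powr (p - 1) * sing_kernel \<beta> (x - x0) \<partial>lborel)) powr (1 / (p - 1)))
      \<in> borel_measurable borel"
    unfolding i by measurable
  moreover have "borel_excess p \<beta> v x0 = (\<lambda>r. ((\<integral>x. indicator (ball x0 r) x * \<bar>v x - m r\<bar> powr q_star p \<partial>lborel) / V r) powr (1 / q_star p) +
      (r powr \<beta> * (\<integral>x. indicator (- ball x0 r) x * \<bar>v x - m r\<bar> powr (p - 1) * sing_kernel \<beta> (x - x0) \<partial>lborel)) powr (1 / (p - 1)))"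
    by (rule ext) (simp only: borel_excess_def Let_def V m_def)
  ultimately show ?thesis by (simp only:)
qed

text \<open>The decay lemmas ask for A > 0, while the excess may vanish. So they are applied with
  every A above the excess, and A is then lowered to it.\<close>

lemma le_mult_of_le_mult_greater:
  fixes x y K :: real
  assumes "K \<ge> 0" "\<And>A. y < A \<Longrightarrow> x \<le> K * A"
  shows "x \<le> K * y"
proof (rule field_le_epsilon)
  fix e :: real assume e: "e > 0"
  have "x \<le> K * (y + e / (K + 1))" using assms e by (intro assms) auto
  also have "K * (y + e / (K + 1)) = K * y + e * (K / (K + 1))" using assms by (simp add: distrib_left)
  also have "e * (K / (K + 1)) \<le> e * 1" using e assms by (intro mult_left_mono) auto
  finally show "x \<le> K * y + e" by simp
qed

section \<open>Decay and comparability of the excess\<close>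

lemma borel_excess_decay:
  fixes p \<beta> C :: real
  assumes p: "p > 1" and \<beta>: "\<beta> > 0" and C: "C > 0"
  obtains \<alpha> c where "\<alpha> > 0" "c \<ge> 1"
    "\<And>v (x0::'a::euclidean_space) r \<rho>. de_giorgi p \<beta> C v x0 r \<Longrightarrow> de_giorgi p \<beta> C (\<lambda>x. - v x) x0 r \<Longrightarrow>
      0 < \<rho> \<Longrightarrow> \<rho> \<le> r \<Longrightarrow> borel_excess p \<beta> v x0 \<rho> \<le> c * (\<rho> / r) powr \<alpha> * borel_excess p \<beta> v x0 r"
proof -
  obtain \<alpha> c where \<alpha>: "\<alpha> > 0" and c: "c \<ge> 1" and dec:
    "\<And>v (x0::'a) r m A \<rho>. de_giorgi p \<beta> C v x0 r \<Longrightarrow> de_giorgi p \<beta> C (\<lambda>x. - v x) x0 r \<Longrightarrow>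
      excess_bound p \<beta> v x0 m A r \<Longrightarrow> A > 0 \<Longrightarrow> 0 < \<rho> \<Longrightarrow> \<rho> \<le> r \<Longrightarrow>
      \<exists>m'. excess_bound p \<beta> v x0 m' (c * (\<rho> / r) powr \<alpha> * A) \<rho>"
    using that by (rule excess_decay[OF p \<beta> C])
  obtain c' where c': "c' > 0" and le:
    "\<And>v (x0::'a) m A r. integrable lborel (\<lambda>x. \<bar>v x\<bar> powr p) \<Longrightarrow> v \<in> borel_measurable borel \<Longrightarrow>
      excess_bound p \<beta> v x0 m A r \<Longrightarrow> A > 0 \<Longrightarrow> r > 0 \<Longrightarrow> borel_excess p \<beta> v x0 r \<le> c' * A"
    using that by (rule borel_excess_le[OF p \<beta>])
  show ?thesis
  proof (rule that[OF \<alpha>])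
    show "max 1 (c' * c) \<ge> 1" by simp
    fix v and x0 :: 'a and r \<rho> :: real
    assume dg: "de_giorgi p \<beta> C v x0 r" "de_giorgi p \<beta> C (\<lambda>x. - v x) x0 r" and \<rho>: "0 < \<rho>" "\<rho> \<le> r"
    have v_meas: "v \<in> borel_measurable borel" and v: "integrable lborel (\<lambda>x. \<bar>v x\<bar> powr p)"
      using dg by (auto simp: de_giorgi_def)
    show "borel_excess p \<beta> v x0 \<rho> \<le> max 1 (c' * c) * (\<rho> / r) powr \<alpha> * borel_excess p \<beta> v x0 r"
    proof (rule le_mult_of_le_mult_greater)
      fix A assume A: "borel_excess p \<beta> v x0 r < A"
      then have A0: "A > 0" using borel_excess_nonneg[of p \<beta> v x0 r] by linarith
      have r0: "r > 0" using \<rho> by linarith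
      obtain m where m: "excess_bound p \<beta> v x0 m A r"
        using that by (rule excess_bound_of_borel_excess[OF p r0 less_imp_le[OF A]])
      from dec[OF dg m A0 \<rho>] obtain m' where m': "excess_bound p \<beta> v x0 m' (c * (\<rho> / r) powr \<alpha> * A) \<rho>" by blast
      have "borel_excess p \<beta> v x0 \<rho> \<le> c' * (c * (\<rho> / r) powr \<alpha> * A)"
        using c A0 \<rho> by (intro le[OF v v_meas m']) auto
      also have "\<dots> = (c' * c) * ((\<rho> / r) powr \<alpha> * A)" by simp
      also have "\<dots> \<le> max 1 (c' * c) * ((\<rho> / r) powr \<alpha> * A)" using A0 by (intro mult_right_mono) auto
      finally show "borel_excess p \<beta> v x0 \<rho> \<le> max 1 (c' * c) * (\<rho> / r) powr \<alpha> * A" by (simp add: mult.assoc)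
    qed auto
  qed
qed

lemma borel_excess_shrink:
  fixes p \<beta> :: real
  assumes p: "p > 1" and \<beta>: "\<beta> > 0"
  obtains c N where "c \<ge> 1" "N \<ge> 0"
    "\<And>v (x0::'a::euclidean_space) t \<rho>. integrable lborel (\<lambda>x. \<bar>v x\<bar> powr p) \<Longrightarrow> v \<in> borel_measurable borel \<Longrightarrow>
      0 < \<rho> \<Longrightarrow> \<rho> \<le> t \<Longrightarrow> borel_excess p \<beta> v x0 \<rho> \<le> c * (t / \<rho>) powr N * borel_excess p \<beta> v x0 t"
proof -
  obtain c N where c: "c \<ge> 1" and N: "N \<ge> 0" and shrink:
    "\<And>v (x0::'a) m A t \<rho>. integrable lborel (\<lambda>x. \<bar>v x\<bar> powr p) \<Longrightarrow> v \<in> borel_measurable borel \<Longrightarrow>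
      excess_bound p \<beta> v x0 m A t \<Longrightarrow> A > 0 \<Longrightarrow> 0 < \<rho> \<Longrightarrow> \<rho> \<le> t \<Longrightarrow> excess_bound p \<beta> v x0 m (c * (t / \<rho>) powr N * A) \<rho>"
    using that by (rule excess_bound_shrink[OF p \<beta>])
  obtain c' where c': "c' > 0" and le:
    "\<And>v (x0::'a) m A r. integrable lborel (\<lambda>x. \<bar>v x\<bar> powr p) \<Longrightarrow> v \<in> borel_measurable borel \<Longrightarrow>
      excess_bound p \<beta> v x0 m A r \<Longrightarrow> A > 0 \<Longrightarrow> r > 0 \<Longrightarrow> borel_excess p \<beta> v x0 r \<le> c' * A"
    using that by (rule borel_excess_le[OF p \<beta>])
  show ?thesis
  proof (rule that[OF _ N])
    show "max 1 (c' * c) \<ge> 1" by simp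
    fix v :: "'a \<Rightarrow> real" and x0 :: 'a and t \<rho> :: real
    assume v: "integrable lborel (\<lambda>x. \<bar>v x\<bar> powr p)" and v_meas: "v \<in> borel_measurable borel" and \<rho>: "0 < \<rho>" "\<rho> \<le> t"
    show "borel_excess p \<beta> v x0 \<rho> \<le> max 1 (c' * c) * (t / \<rho>) powr N * borel_excess p \<beta> v x0 t"
    proof (rule le_mult_of_le_mult_greater)
      fix A assume A: "borel_excess p \<beta> v x0 t < A"
      then have A0: "A > 0" using borel_excess_nonneg[of p \<beta> v x0 t] by linarith
      have t0: "t > 0" using \<rho> by linarith
      obtain m where m: "excess_bound p \<beta> v x0 m A t"
        using that by (rule excess_bound_of_borel_excess[OF p t0 less_imp_le[OF A]])
      note m' = shrink[OF v v_meas m A0 \<rho>]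
      have "borel_excess p \<beta> v x0 \<rho> \<le> c' * (c * (t / \<rho>) powr N * A)"
        using c A0 \<rho> by (intro le[OF v v_meas m']) auto
      also have "\<dots> = (c' * c) * ((t / \<rho>) powr N * A)" by simp
      also have "\<dots> \<le> max 1 (c' * c) * ((t / \<rho>) powr N * A)" using A0 by (intro mult_right_mono) auto
      finally show "borel_excess p \<beta> v x0 \<rho> \<le> max 1 (c' * c) * (t / \<rho>) powr N * A" by (simp add: mult.assoc)
    qed auto
  qed
qed

text \<open>The density \<Phi>(v(x) - v(y)) K(x,y) is only Lebesgue measurable on the product, so
  both v and the density are exchanged for Borel functions that agree almost everywhere; product
  null sets keep the integrals in the weak form unchanged. The constant is the square of \<Lambda>
  because \<Phi> and K contribute one factor each.\<close>

lemma weak_solution_nonlocal_solution: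
  fixes K :: "real^'n \<Rightarrow> real^'n \<Rightarrow> real" and v :: "real^'n \<Rightarrow> real"
  assumes p: "1 < p" and s: "0 < s" "s < 1" and \<Lambda>: "\<Lambda> \<ge> 1"
    and \<Phi>: "structure_nonlinearity p \<Lambda> \<Phi>" and K: "structure_kernel s p \<Lambda> K"
    and sol: "weak_solution s p \<Phi> K \<Omega> g v"
  obtains b v' where "nonlocal_solution p (s * p) (\<Lambda>\<^sup>2) \<Omega> b v'" "AE x in lborel. v x = v' x"
proof -
  define \<beta> where "\<beta> = s * p"
  have \<beta>: "0 < \<beta>" "\<beta> < p" using p s by (auto simp: \<beta>_def)
  have kern: "t / norm z powr (real CARD('n) + s * p) = t * sing_kernel \<beta> z" for t and z :: "real^'n"
    by (simp add: \<beta>_def sing_kernel_def powr_minus divide_inverse del: minus_add_distrib)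
  have kern': "norm z powr (- real CARD('n) - s * p) = sing_kernel \<beta> z" for z :: "real^'n"
    by (simp add: \<beta>_def sing_kernel_def)
  have fs: "v \<in> frac_sobolev s p" using sol by (simp add: weak_solution_def)
  have "v \<in> borel_measurable (completion lborel)" using fs by (simp add: frac_sobolev_def)
  then obtain v' where v'[measurable]: "v' \<in> borel_measurable lborel" and vv': "AE x in lborel. v x = v' x"
    using completion_ex_borel_measurable_real by blast
  have [measurable]: "v' \<in> borel_measurable borel" using v' by simp
  have vz: "AE z in lborel. v (fst z) = v' (fst z) \<and> v (snd z) = v' (snd z)"
    using AE_lborel_prod[OF vv'] .
  have vLp: "integrable lborel (\<lambda>x. \<bar>v' x\<bar> powr p)"
  proof -
    have "integrable lebesgue (\<lambda>x. \<bar>v x\<bar> powr p)" using fs by (simp add: frac_sobolev_def)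
    then show ?thesis
      by (subst (asm) lebesgue_integral_eq_lborel(2)[where g = "\<lambda>x. \<bar>v' x\<bar> powr p"])
         (use vv' in \<open>auto elim!: eventually_mono\<close>)
  qed
  have vS: "integrable lborel (\<lambda>z. \<bar>v' (fst z) - v' (snd z)\<bar> powr p * sing_kernel \<beta> (fst z - snd z))"
  proof -
    have I: "integrable lebesgue (\<lambda>z. \<bar>v (fst z) - v (snd z)\<bar> powr p * sing_kernel \<beta> (fst z - snd z))"
      using fs by (simp add: frac_sobolev_def kern case_prod_beta')
    have e: "AE z in lborel. \<bar>v (fst z) - v (snd z)\<bar> powr p * sing_kernel \<beta> (fst z - snd z) =
        \<bar>v' (fst z) - v' (snd z)\<bar> powr p * sing_kernel \<beta> (fst z - snd z)"
      using vz by eventually_elim simp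
    have m: "(\<lambda>z. \<bar>v' (fst z) - v' (snd z)\<bar> powr p * sing_kernel \<beta> (fst z - snd z)) \<in> borel_measurable borel"
      by measurable
    show ?thesis using I by (simp only: lebesgue_integral_eq_lborel(2)[OF m e])
  qed
  have "continuous_on UNIV \<Phi>" using \<Phi> by (simp add: structure_nonlinearity_def)
  then have [measurable]: "\<Phi> \<in> borel_measurable borel" by (rule borel_measurable_continuous_onI)
  define f where "f z = \<Phi> (v' (fst z) - v' (snd z)) * K (fst z) (snd z)" for z
  have f: "f \<in> borel_measurable (completion lborel)"
  proof -
    have "(\<lambda>z. \<Phi> (v' (fst z) - v' (snd z))) \<in> borel_measurable lebesgue"
      by (intro measurable_completion) auto
    moreover have "(\<lambda>z. K (fst z) (snd z)) \<in> borel_measurable lebesgue"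
      using K by (simp add: structure_kernel_def case_prod_beta')
    ultimately show ?thesis unfolding f_def by (rule borel_measurable_times)
  qed
  then obtain b where b: "b \<in> borel_measurable lborel" and fb: "AE z in lborel. f z = b z"
    using completion_ex_borel_measurable_real by blast
  have [measurable]: "b \<in> borel_measurable borel" using b by simp
  have \<Phi>0: "\<Phi> 0 = 0" and \<Phi>1: "inverse \<Lambda> * \<bar>t\<bar> powr p \<le> \<Phi> t * t" and \<Phi>2: "\<Phi> t * t \<le> \<Lambda> * \<bar>t\<bar> powr p" for t
    using \<Phi> by (auto simp: structure_nonlinearity_def)
  have \<Phi>abs: "\<bar>\<Phi> t\<bar> \<le> \<Lambda> * \<bar>t\<bar> powr (p - 1)" for t
  proof (cases "t = 0")
    case False
    have "0 \<le> inverse \<Lambda> * \<bar>t\<bar> powr p" using \<Lambda> by simp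
    then have "\<Phi> t * t \<ge> 0" using \<Phi>1[of t] by linarith
    then have "\<bar>\<Phi> t * t\<bar> = \<Phi> t * t" by (rule abs_of_nonneg)
    then have "\<bar>\<Phi> t\<bar> * \<bar>t\<bar> = \<Phi> t * t" by (simp only: abs_mult)
    also have "\<dots> \<le> \<Lambda> * \<bar>t\<bar> powr p" by (rule \<Phi>2)
    also have "\<dots> = \<Lambda> * \<bar>t\<bar> powr (p - 1) * \<bar>t\<bar>" using False by (simp add: powr_diff)
    finally show ?thesis by (rule mult_right_le_imp_le) (use False in simp)
  qed (simp add: \<Phi>0)
  have K1: "inverse \<Lambda> * sing_kernel \<beta> (x - y) \<le> K x y" and K2: "K x y \<le> \<Lambda> * sing_kernel \<beta> (x - y)" if "x \<noteq> y" for x y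
    using K that unfolding structure_kernel_def kern' by auto
  have flo: "\<bar>v' (fst z) - v' (snd z)\<bar> powr p * sing_kernel \<beta> (fst z - snd z) / \<Lambda>\<^sup>2 \<le> f z * (v' (fst z) - v' (snd z))"
    and fup: "\<bar>f z\<bar> \<le> \<Lambda>\<^sup>2 * \<bar>v' (fst z) - v' (snd z)\<bar> powr (p - 1) * sing_kernel \<beta> (fst z - snd z)" for z
  proof -
    obtain x y where z: "z = (x, y)" by (cases z)
    define a where "a = v' x - v' y"
    define k where "k = sing_kernel \<beta> (x - y)"
    have k: "k \<ge> 0" by (simp add: k_def)
    have "\<bar>a\<bar> powr p * k / \<Lambda>\<^sup>2 \<le> \<Phi> a * K x y * a \<and> \<bar>\<Phi> a * K x y\<bar> \<le> \<Lambda>\<^sup>2 * \<bar>a\<bar> powr (p - 1) * k"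
    \<comment> \<open>On the diagonal K is unrestricted; there \<Phi> 0 = 0 makes both sides
      vanish.\<close>
    proof (cases "x = y")
      case True
      then have "a = 0" by (simp add: a_def)
      then show ?thesis by (simp add: \<Phi>0)
    next
      case False
      have k1: "inverse \<Lambda> * k \<le> K x y" and k2: "K x y \<le> \<Lambda> * k" using K1[OF False] K2[OF False] by (auto simp: k_def)
      have ik: "inverse \<Lambda> * k \<ge> 0" using \<Lambda> k by simp
      then have K0: "K x y \<ge> 0" using k1 by linarith
      have "(inverse \<Lambda> * \<bar>a\<bar> powr p) * (inverse \<Lambda> * k) \<le> (\<Phi> a * a) * K x y"
      proof (rule mult_mono[OF \<Phi>1 k1 _ ik])
        have "0 \<le> inverse \<Lambda> * \<bar>a\<bar> powr p" using \<Lambda> by simp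
        then show "0 \<le> \<Phi> a * a" using \<Phi>1[of a] by linarith
      qed
      moreover have "(inverse \<Lambda> * \<bar>a\<bar> powr p) * (inverse \<Lambda> * k) = \<bar>a\<bar> powr p * k / \<Lambda>\<^sup>2"
        by (simp add: power2_eq_square divide_inverse)
      moreover have "\<bar>\<Phi> a\<bar> * K x y \<le> (\<Lambda> * \<bar>a\<bar> powr (p - 1)) * (\<Lambda> * k)"
        by (rule mult_mono[OF \<Phi>abs k2 _ K0]) (use \<Lambda> in simp)
      ultimately show ?thesis using K0 by (simp add: abs_mult power2_eq_square mult_ac)
    qed
    then show "\<bar>v' (fst z) - v' (snd z)\<bar> powr p * sing_kernel \<beta> (fst z - snd z) / \<Lambda>\<^sup>2 \<le> f z * (v' (fst z) - v' (snd z))"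
      "\<bar>f z\<bar> \<le> \<Lambda>\<^sup>2 * \<bar>v' (fst z) - v' (snd z)\<bar> powr (p - 1) * sing_kernel \<beta> (fst z - snd z)"
      by (simp_all add: f_def z a_def k_def)
  qed
  have "nonlocal_solution p \<beta> (\<Lambda>\<^sup>2) \<Omega> b v'"
  proof
    show "AE z in lborel. \<bar>v' (fst z) - v' (snd z)\<bar> powr p * sing_kernel \<beta> (fst z - snd z) / \<Lambda>\<^sup>2 \<le> b z * (v' (fst z) - v' (snd z))"
      using fb by eventually_elim (use flo in metis)
    show "AE z in lborel. \<bar>b z\<bar> \<le> \<Lambda>\<^sup>2 * \<bar>v' (fst z) - v' (snd z)\<bar> powr (p - 1) * sing_kernel \<beta> (fst z - snd z)"
      using fb by eventually_elim (use fup in metis)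
    fix \<psi> :: "real^'n \<Rightarrow> real" assume \<psi>: "\<psi> \<in> test_functions \<Omega>"
    then have "C_k 0 \<psi>" unfolding test_functions_def by blast
    then have [measurable]: "\<psi> \<in> borel_measurable borel" by (simp add: borel_measurable_continuous_onI)
    have "(LINT (x, y)|lebesgue. \<Phi> (v x - v y) * (\<psi> x - \<psi> y) * K x y) = 0"
      using sol \<psi> by (simp add: weak_solution_def)
    then have I: "(\<integral>z. \<Phi> (v (fst z) - v (snd z)) * (\<psi> (fst z) - \<psi> (snd z)) * K (fst z) (snd z) \<partial>lebesgue) = 0"
      by (simp add: case_prod_beta')
    have e: "AE z in lborel. \<Phi> (v (fst z) - v (snd z)) * (\<psi> (fst z) - \<psi> (snd z)) * K (fst z) (snd z) = b z * (\<psi> (fst z) - \<psi> (snd z))"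
      using fb vz by eventually_elim (auto simp: f_def)
    have m: "(\<lambda>z. b z * (\<psi> (fst z) - \<psi> (snd z))) \<in> borel_measurable borel" by measurable
    show "(\<integral>z. b z * (\<psi> (fst z) - \<psi> (snd z)) \<partial>lborel) = 0"
      using I by (simp only: lebesgue_integral_eq_lborel(1)[OF m e])
  qed (use p \<beta> \<Lambda> vLp vS in auto)
  then show ?thesis using vv' by (intro that) (auto simp: \<beta>_def)
qed

text \<open>Only the part of the integral over [r, 2 r] is used. There E t is at least E r / (c
  2^N), the weight is at least 2^(-\<kappa>), and 1/t is at least 1 / (2 r) on an interval of length
  r; this explains the constant.\<close>

lemma le_integral_of_le_near:
  fixes E :: "real \<Rightarrow> real" and r R \<kappa> c N x :: real
  assumes E_meas [measurable]: "E \<in> borel_measurable borel" and E0: "\<And>t. E t \<ge> 0"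
    and r: "0 < r" "2 * r \<le> R" and \<kappa>: "\<kappa> \<ge> 0" and c: "c > 0" and N: "N \<ge> 0"
    and near: "\<And>t t'. r \<le> t \<Longrightarrow> t \<le> t' \<Longrightarrow> t' \<le> R \<Longrightarrow> E t \<le> c * (t' / t) powr N * E t'"
  shows "E r \<le> c * 2 powr (N + \<kappa> + 1) * (LINT t:{r..R}|lebesgue. (r / t) powr \<kappa> * E t / t)"
proof -
  define f where "f t = indicator {r..R} t * ((r / t) powr \<kappa> * E t / t)" for t
  have [measurable]: "f \<in> borel_measurable borel" unfolding f_def by measurable
  have f0: "f t \<ge> 0" for t using r E0 by (auto simp: f_def indicator_def)
  have eq: "(LINT t:{r..R}|lebesgue. (r / t) powr \<kappa> * E t / t) = (\<integral>t. f t \<partial>lborel)"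
    unfolding set_lebesgue_integral_def by (rule lebesgue_integral_eq_lborel(1)) (auto simp: f_def)
  define B where "B = c * (R / r) powr N * E R / r"
  \<comment> \<open>Needed before anything can be bounded by the integral, which would have the
    default value 0 for a function that is not integrable. The majorant comes from comparing each E
    t with E R.\<close>
  have fI: "integrable lborel f"
  proof (rule Bochner_Integration.integrable_bound)
    show "integrable lborel (\<lambda>t. B * indicator {r..R} t)"
      by (intro integrable_mult_right integrable_real_indicator) (auto simp: emeasure_lborel_Icc_eq)
    show "AE t in lborel. norm (f t) \<le> norm (B * indicator {r..R} t)"
    proof (intro AE_I2)
      fix t
      show "norm (f t) \<le> norm (B * indicator {r..R} t)"
      proof (cases "t \<in> {r..R}")
        case True
        then have t: "r \<le> t" "t \<le> R" "t > 0" using r by auto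
        have "(r / t) powr \<kappa> \<le> 1" using t r \<kappa> by (intro powr_le1) auto
        moreover have "E t \<le> c * (R / r) powr N * E R"
        proof -
          have "E t \<le> c * (R / t) powr N * E R" using t by (intro near) auto
          also have "\<dots> \<le> c * (R / r) powr N * E R"
            using c N t r E0 by (intro mult_right_mono mult_left_mono powr_mono2) (auto intro: divide_left_mono)
          finally show ?thesis .
        qed
        ultimately have "(r / t) powr \<kappa> * E t \<le> 1 * (c * (R / r) powr N * E R)" using E0 by (intro mult_mono) auto
        then have "(r / t) powr \<kappa> * E t / t \<le> B"
          unfolding B_def using t r c E0 by (intro frac_le) auto
        moreover have "0 \<le> (r / t) powr \<kappa> * E t / t" using E0 t by simp
        ultimately show ?thesis using True by (simp add: f_def)
      qed (simp add: f_def)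
    qed
  qed measurable
  define y where "y = E r / (c * 2 powr (N + \<kappa> + 1))"
  have y0: "y \<ge> 0" using E0 c by (simp add: y_def)
  have "y = (\<integral>t. y / r * indicator {r..2 * r} t \<partial>lborel)"
    using r by simp
  also have "\<dots> \<le> (\<integral>t. f t \<partial>lborel)"
  proof (rule integral_mono')
    fix t
    show "y / r * indicator {r..2 * r} t \<le> f t"
    proof (cases "t \<in> {r..2 * r}")
      case True
      then have t: "r \<le> t" "t \<le> 2 * r" "t > 0" "t \<le> R" using r by auto
      have "E r \<le> c * (t / r) powr N * E t" using t by (intro near) auto
      also have "\<dots> \<le> c * 2 powr N * E t"
        using c N t r E0 by (intro mult_right_mono mult_left_mono powr_mono2) (auto simp: field_simps)
      finally have 1: "E r \<le> c * 2 powr N * E t" .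
      have "(1/2) powr \<kappa> \<le> (r / t) powr \<kappa>" using t r \<kappa> by (intro powr_mono2) (auto simp: field_simps)
      then have 2: "1 \<le> 2 powr \<kappa> * (r / t) powr \<kappa>" by (simp add: powr_divide field_simps)
      have 3: "1 / r \<le> 2 / t" using t r by (simp add: field_simps)
      have "y / r = E r / (c * 2 powr (N + \<kappa> + 1)) * (1 / r)" by (simp add: y_def)
      also have "\<dots> \<le> (c * 2 powr N * E t) / (c * 2 powr (N + \<kappa> + 1)) * (2 / t)"
        using 1 3 c E0 r by (intro mult_mono divide_right_mono) auto
      also have "\<dots> = 1 * E t / (2 powr \<kappa> * t)" using c t by (simp add: powr_add)
      also have "\<dots> \<le> (2 powr \<kappa> * (r / t) powr \<kappa>) * E t / (2 powr \<kappa> * t)"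
        using 2 E0 t by (intro divide_right_mono mult_right_mono) auto
      also have "\<dots> = (r / t) powr \<kappa> * E t / t" by simp
      finally show ?thesis using True t by (simp add: f_def)
    qed (use f0 in simp)
  qed (use fI f0 in auto)
  finally have "y \<le> (\<integral>t. f t \<partial>lborel)" .
  then have "c * 2 powr (N + \<kappa> + 1) * y \<le> c * 2 powr (N + \<kappa> + 1) * (\<integral>t. f t \<partial>lborel)"
    using c by (intro mult_left_mono) auto
  then show ?thesis using c unfolding eq by (simp add: y_def)
qed

theorem theorem1p6:
  fixes s p \<Lambda> :: real
  assumes "CARD('n::finite) \<ge> 2"
    and "1 < p" and "0 < s" and "s < 1" and "\<Lambda> \<ge> 1"
  shows "\<exists>\<alpha> c :: real. 0 < \<alpha> \<and> \<alpha> < s * p / q_star p \<and> c \<ge> 1 \<and>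
    (\<forall>(\<Phi> :: real \<Rightarrow> real) (K :: real ^ 'n \<Rightarrow> real ^ 'n \<Rightarrow> real) (\<Omega> :: (real ^ 'n) set)
      (v :: real ^ 'n \<Rightarrow> real) (g :: real ^ 'n \<Rightarrow> real) (x0 :: real ^ 'n) (R :: real).
      structure_nonlinearity p \<Lambda> \<Phi> \<longrightarrow> structure_kernel s p \<Lambda> K \<longrightarrow> open \<Omega> \<longrightarrow>
      g \<in> frac_sobolev s p \<longrightarrow> weak_solution s p \<Phi> K \<Omega> g v \<longrightarrow> ball x0 R \<subseteq> \<Omega> \<longrightarrow>
      (\<forall>\<rho> r. 0 < \<rho> \<longrightarrow> \<rho> \<le> r \<longrightarrow> r \<le> R \<longrightarrow>
        excess s p v x0 \<rho> \<le>
          c * (\<rho> / r) powr \<alpha> * (r / R) powr (s * p / q_star p) * excess s p v x0 R +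
          c * (\<rho> / r) powr \<alpha> *
            (LINT t:{r..R}|lebesgue. (r / t) powr (s * p / q_star p) * excess s p v x0 t / t)))"
proof -
  note p = \<open>1 < p\<close> and s = \<open>0 < s\<close> \<open>s < 1\<close> and \<Lambda> = \<open>\<Lambda> \<ge> 1\<close>
  define \<beta> where "\<beta> = s * p"
  define \<kappa> where "\<kappa> = \<beta> / q_star p"
  have \<beta>: "0 < \<beta>" "\<beta> < p" using p s by (auto simp: \<beta>_def)
  have \<kappa>: "\<kappa> > 0" using \<beta> q_star_bounds[OF p] by (simp add: \<kappa>_def)
  have L: "\<Lambda>\<^sup>2 \<ge> 1" using \<Lambda> by simp
  obtain C where C: "C > 0" and dg:
    "\<And>\<Omega> b (v :: real^'n \<Rightarrow> real) x0 R. nonlocal_solution p \<beta> (\<Lambda>\<^sup>2) \<Omega> b v \<Longrightarrow> ball x0 R \<subseteq> \<Omega> \<Longrightarrow> de_giorgi p \<beta> C v x0 R"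
    using that by (rule nonlocal_solution_de_giorgi[OF p \<beta> L])
  obtain \<alpha>0 c1 where \<alpha>0: "\<alpha>0 > 0" and c1: "c1 \<ge> 1" and decay:
    "\<And>v (x0::real^'n) r \<rho>. de_giorgi p \<beta> C v x0 r \<Longrightarrow> de_giorgi p \<beta> C (\<lambda>x. - v x) x0 r \<Longrightarrow>
      0 < \<rho> \<Longrightarrow> \<rho> \<le> r \<Longrightarrow> borel_excess p \<beta> v x0 \<rho> \<le> c1 * (\<rho> / r) powr \<alpha>0 * borel_excess p \<beta> v x0 r"
    using that by (rule borel_excess_decay[OF p \<beta>(1) C])
  obtain c2 N where c2: "c2 \<ge> 1" and N: "N \<ge> 0" and shrink:
    "\<And>v (x0::real^'n) t \<rho>. integrable lborel (\<lambda>x. \<bar>v x\<bar> powr p) \<Longrightarrow> v \<in> borel_measurable borel \<Longrightarrow>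
      0 < \<rho> \<Longrightarrow> \<rho> \<le> t \<Longrightarrow> borel_excess p \<beta> v x0 \<rho> \<le> c2 * (t / \<rho>) powr N * borel_excess p \<beta> v x0 t"
    using that by (rule borel_excess_shrink[OF p \<beta>(1)])
  \<comment> \<open>Lowering the exponent is harmless because \<rho> \<le> r; \<kappa> / 2 secures
    the strict upper bound on \<alpha>.\<close>
  define \<alpha> where "\<alpha> = min \<alpha>0 (\<kappa> / 2)"
  have \<alpha>: "0 < \<alpha>" "\<alpha> < \<kappa>" "\<alpha> \<le> \<alpha>0" using \<alpha>0 \<kappa> by (auto simp: \<alpha>_def)
  \<comment> \<open>The constant of \<open>le_integral_of_le_near\<close>; it is also large enough
    for the case in which r and R are comparable.\<close>
  define D where "D = c2 * 2 powr (N + \<kappa> + 1)"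
  have D: "D \<ge> 1" "D > 0"
  proof -
    have "1 * 1 \<le> c2 * 2 powr (N + \<kappa> + 1)" using c2 N \<kappa> by (intro mult_mono ge_one_powr_ge_zero) auto
    then show "D \<ge> 1" "D > 0" by (auto simp: D_def)
  qed
  define c where "c = c1 * D"
  have c: "c \<ge> 1" using mult_mono[OF c1 D(1)] c1 by (simp add: c_def)
  show ?thesis
  proof (intro exI conjI allI impI)
    show "0 < \<alpha>" "\<alpha> < s * p / q_star p" "c \<ge> 1" using \<alpha> c by (auto simp: \<kappa>_def \<beta>_def)
    fix \<Phi> :: "real \<Rightarrow> real" and K :: "real ^ 'n \<Rightarrow> real ^ 'n \<Rightarrow> real" and \<Omega> :: "(real ^ 'n) set"
      and v g :: "real ^ 'n \<Rightarrow> real" and x0 :: "real ^ 'n" and R \<rho> r :: real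
    assume \<Phi>: "structure_nonlinearity p \<Lambda> \<Phi>" and K: "structure_kernel s p \<Lambda> K"
      and sol: "weak_solution s p \<Phi> K \<Omega> g v" and ball: "ball x0 R \<subseteq> \<Omega>"
      and \<rho>: "0 < \<rho>" "\<rho> \<le> r" "r \<le> R"
    obtain b v' where ns: "nonlocal_solution p \<beta> (\<Lambda>\<^sup>2) \<Omega> b v'" and vv': "AE x in lborel. v x = v' x"
      using that unfolding \<beta>_def by (rule weak_solution_nonlocal_solution[OF p s \<Lambda> \<Phi> K sol])
    interpret nonlocal_solution p \<beta> "\<Lambda>\<^sup>2" \<Omega> b v' by (rule ns)
    define E where "E = borel_excess p \<beta> v' x0"
    have ex: "excess s p v x0 t = E t" for t
      unfolding E_def \<beta>_def by (rule excess_eq_borel_excess[OF v_meas vv'])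
    have E0: "E t \<ge> 0" for t unfolding E_def by (rule borel_excess_nonneg)
    have E_meas: "E \<in> borel_measurable borel" unfolding E_def by measurable
    have ball_r: "ball x0 r \<subseteq> \<Omega>" using ball \<rho> by auto
    have "E \<rho> \<le> c1 * (\<rho> / r) powr \<alpha>0 * E r"
      unfolding E_def by (rule decay[OF dg[OF ns ball_r] dg[OF nonlocal_solution_uminus[OF ns] ball_r] \<rho>(1,2)])
    also have "\<dots> \<le> c1 * (\<rho> / r) powr \<alpha> * E r"
      using c1 \<rho> \<alpha> E0 by (intro mult_right_mono mult_left_mono powr_mono') auto
    finally have dec: "E \<rho> \<le> c1 * (\<rho> / r) powr \<alpha> * E r" .
    have shr: "E t \<le> c2 * (t' / t) powr N * E t'" if "r \<le> t" "t \<le> t'" for t t'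
      unfolding E_def using that \<rho> by (intro shrink[OF v_Lp v_meas]) auto
    let ?I = "LINT t:{r..R}|lebesgue. (r / t) powr \<kappa> * E t / t"
    let ?X = "(r / R) powr \<kappa> * E R"
    have I0: "?I \<ge> 0" unfolding set_lebesgue_integral_def
      using E0 \<rho> by (intro integral_nonneg_AE AE_I2) (auto simp: indicator_def)
    have X0: "?X \<ge> 0" using E0 by simp
    have "E r \<le> D * ?X + D * ?I"
    \<comment> \<open>If 2 r > R, the interval [r, R] may be too short for the integral to control
      anything, but then r / R > 1/2 and the weight of the term with E R is bounded below.\<close>
    proof (cases "2 * r \<le> R")
      case True
      have "E r \<le> D * ?I"
        unfolding D_def using \<rho> True \<kappa> c2 N E0 E_meas shr by (intro le_integral_of_le_near) auto
      moreover have "0 \<le> D * ?X" using D X0 by simp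
      ultimately show ?thesis by linarith
    next
      case False
      have R: "R > 0" using \<rho> by linarith
      have "E r \<le> c2 * (R / r) powr N * E R" using \<rho> by (intro shr) auto
      also have "\<dots> \<le> c2 * 2 powr N * E R"
        using c2 N \<rho> False E0 by (intro mult_right_mono mult_left_mono powr_mono2) (auto simp: field_simps)
      also have "\<dots> \<le> c2 * 2 powr N * (2 powr (\<kappa> + 1) * (r / R) powr \<kappa>) * E R"
      proof -
        have "(1/2) powr \<kappa> \<le> (r / R) powr \<kappa>" using False R \<kappa> by (intro powr_mono2) (auto simp: field_simps)
        then have "1 \<le> 2 powr \<kappa> * (r / R) powr \<kappa>" by (simp add: powr_divide field_simps)
        moreover have "2 powr \<kappa> * (r / R) powr \<kappa> \<le> 2 powr (\<kappa> + 1) * (r / R) powr \<kappa>"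
          by (intro mult_right_mono powr_mono) auto
        ultimately have "1 \<le> 2 powr (\<kappa> + 1) * (r / R) powr \<kappa>" by linarith
        then have "c2 * 2 powr N * 1 * E R \<le> c2 * 2 powr N * (2 powr (\<kappa> + 1) * (r / R) powr \<kappa>) * E R"
          using c2 E0 by (intro mult_right_mono mult_left_mono) auto
        then show ?thesis by simp
      qed
      also have "\<dots> = D * ?X" by (simp add: D_def powr_add)
      finally have "E r \<le> D * ?X" .
      moreover have "0 \<le> D * ?I" using D I0 by simp
      ultimately show ?thesis by linarith
    qed
    then have "c1 * (\<rho> / r) powr \<alpha> * E r \<le> c1 * (\<rho> / r) powr \<alpha> * (D * ?X + D * ?I)"
      using c1 by (intro mult_left_mono) auto
    with dec have "E \<rho> \<le> c1 * (\<rho> / r) powr \<alpha> * (D * ?X + D * ?I)" by linarith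
    also have "\<dots> = c * (\<rho> / r) powr \<alpha> * (r / R) powr \<kappa> * E R + c * (\<rho> / r) powr \<alpha> * ?I"
      by (simp add: c_def algebra_simps)
    finally show "excess s p v x0 \<rho> \<le>
          c * (\<rho> / r) powr \<alpha> * (r / R) powr (s * p / q_star p) * excess s p v x0 R +
          c * (\<rho> / r) powr \<alpha> *
            (LINT t:{r..R}|lebesgue. (r / t) powr (s * p / q_star p) * excess s p v x0 t / t)"
      unfolding ex \<kappa>_def \<beta>_def .
  qed
qed

end
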